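(* Consider the boundary value problem $$-u''=\lambda u'+u+(\lambda-u^2)u^2\ \text{ in }(0,\pi),\qquad u(0)=u(\pi)=0,$$ with $\lambda\in\mathbb{R}$ and $u\in U:=H^2(0,\pi)\cap H_0^1(0,\pi)$. Let $\gamma_1,\gamma_2:(0,\varepsilon)\to\mathbb{R}\times U$ be the two analytic arcs of positive solutions emanating from $(0,0)$, and let $\mathscr{C}_1^+$, $\mathscr{C}_2^+$ be the connected components of the set of positive solutions $\mathscr{S}$ containing, locally at $(0,0)$, the curves $\gamma_1$ and $\gamma_2$, respectively. Then $\mathscr{C}_1^+=\mathscr{C}_2^+$. Moreover, each of the local curves $\gamma_i$, $i\in\{1,2\}$, can be continued to a global locally injective continuous curve $\Gamma_i:(0,T)\to\mathscr{C}_i^+$ such that, up to a reparametrization, $\Gamma_i|_{[T-\delta,T)}=\gamma_j$ for some $\delta>0$, where $j\in\{1,2\}\setminus\{i\}$. Thus, there is a loop of positive solutions of the problem with vertex at $(0,0)$.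
   Context: $\mathfrak{F}:\mathbb{R}\times U\to L^2(0,\pi)$, $\mathfrak{F}(\lambda,u)=u''+\lambda u'+u+(\lambda-u^2)u^2$, so that the solutions are $\mathfrak{F}^{-1}(0)$. For $u\in\mathcal{C}_0^1[0,\pi]$, $u\gg0$ (strongly positive) means $u(x)>0$ for $x\in(0,\pi)$, $u'(0)>0$ and $u'(\pi)<0$; every nonnegative nonzero solution is strongly positive. $\mathscr{S}:=\{(\lambda,u)\in\mathfrak{F}^{-1}(0):u\gg0\}\subset\mathbb{R}\times U$. Local picture at $(0,0)$: for some $\varepsilon>0$ there are exactly two analytic arcs of positive solutions emanating from $(0,0)$, $\gamma_i(\lambda)=(\lambda,u_i(\lambda))$, $\lambda\in(0,\varepsilon)$, with $\lim_{\lambda\downarrow0}u_i(\lambda)=0$, $i\in\{1,2\}$, and in a neighbourhood of $(0,0)$ the set of positive solutions consists of these two arcs. With $\varphi_0(x)=\sqrt{2/\pi}\sin x$ they are distinguished by $\int_0^\pi u_1(\lambda)\varphi_0\,dx=\frac{3\pi}{32}\sqrt{\frac{\pi}{2}}\,\lambda+o(\lambda)$ and $\int_0^\pi u_2(\lambda)\varphi_0\,dx=\sqrt{\frac{5\pi}{8}}\sqrt{\lambda}+o(\sqrt\lambda)$ as $\lambda\downarrow0$. *)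

theory Defs
  imports "HOL-Analysis.Analysis" "HOL-Library.Landau_Symbols"
begin

section \<open>Sobolev spaces on \<open>(0,\<pi>)\<close>\<close>

abbreviation dom_measure :: "real measure" where
  "dom_measure \<equiv> restrict_space lborel {0<..<pi}"

definition L2 :: "(real \<Rightarrow> real) set" where
  "L2 = {f \<in> borel_measurable dom_measure. integrable dom_measure (\<lambda>x. (f x)\<^sup>2)}"

text \<open>The test functions are those of class \<open>C\<^sup>1\<close> with compact support in \<open>(0,\<pi>)\<close>,
  extended by zero to the real line.\<close>

definition test_fun :: "(real \<Rightarrow> real) \<Rightarrow> bool" where
  "test_fun \<phi> \<longleftrightarrow>
     (\<forall>x. \<phi> differentiable (at x)) \<and> continuous_on UNIV (deriv \<phi>) \<and>
     (\<exists>a b. 0 < a \<and> b < pi \<and> (\<forall>x. x \<notin> {a..b} \<longrightarrow> \<phi> x = 0))"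

definition has_weak_deriv :: "(real \<Rightarrow> real) \<Rightarrow> (real \<Rightarrow> real) \<Rightarrow> bool" where
  "has_weak_deriv u v \<longleftrightarrow>
     (\<forall>\<phi>. test_fun \<phi> \<longrightarrow>
        (LINT x|dom_measure. u x * deriv \<phi> x) = - (LINT x|dom_measure. v x * \<phi> x))"

definition H1 :: "(real \<Rightarrow> real) set" where
  "H1 = {u \<in> L2. \<exists>v\<in>L2. has_weak_deriv u v}"

text \<open>The choice is determined up to null sets, see \<open>weak_deriv_unique\<close> below.\<close>

definition wderiv :: "(real \<Rightarrow> real) \<Rightarrow> real \<Rightarrow> real" where
  "wderiv u = (SOME v. v \<in> L2 \<and> has_weak_deriv u v)"

definition H2 :: "(real \<Rightarrow> real) set" where
  "H2 = {u \<in> H1. wderiv u \<in> H1}"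

lemma space_dom [simp]: "space dom_measure = {0<..<pi}"
  by (simp add: space_restrict_space)

lemma finite_measure_dom: "finite_measure dom_measure"
  by (rule finite_measureI) (simp add: emeasure_restrict_space)

lemma borel_measurable_dom: "f \<in> borel_measurable borel \<Longrightarrow> f \<in> borel_measurable dom_measure"
  by (rule measurable_restrict_space1) simp

lemma L2_mult_integrable:
  assumes "f \<in> L2" "g \<in> L2"
  shows "integrable dom_measure (\<lambda>x. f x * g x)"
proof (rule Bochner_Integration.integrable_bound)
  show "integrable dom_measure (\<lambda>x. (f x)\<^sup>2 + (g x)\<^sup>2)"
    using assms by (auto simp: L2_def)
  show "(\<lambda>x. f x * g x) \<in> borel_measurable dom_measure"
    using assms by (auto simp: L2_def)
  have "\<bar>a * b\<bar> \<le> a\<^sup>2 + b\<^sup>2" for a b :: real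
  proof -
    have "0 \<le> (\<bar>a\<bar> - \<bar>b\<bar>)\<^sup>2" "0 \<le> a\<^sup>2" "0 \<le> b\<^sup>2" by simp_all
    moreover have "0 \<le> \<bar>a\<bar> * \<bar>b\<bar>" by simp
    ultimately show ?thesis unfolding power2_diff abs_mult power2_abs by linarith
  qed
  then show "AE x in dom_measure. norm (f x * g x) \<le> norm ((f x)\<^sup>2 + (g x)\<^sup>2)"
    by simp
qed

lemma L2_add:
  assumes "f \<in> L2" "g \<in> L2" shows "(\<lambda>x. f x + g x) \<in> L2"
proof -
  have "integrable dom_measure (\<lambda>x. (f x)\<^sup>2 + (g x)\<^sup>2 + 2 * (f x * g x))"
    using assms L2_mult_integrable[OF assms] by (auto simp: L2_def)
  then show ?thesis using assms
    by (auto simp: L2_def power2_sum mult.assoc)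
qed

lemma L2_scale: "f \<in> L2 \<Longrightarrow> (\<lambda>x. c * f x) \<in> L2"
  by (auto simp: L2_def power_mult_distrib)

lemma L2_zero: "(\<lambda>x. 0) \<in> L2"
  by (auto simp: L2_def)

lemma L2_bounded:
  assumes "f \<in> borel_measurable borel" "\<And>x. \<bar>f x\<bar> \<le> B"
  shows "f \<in> L2"
proof -
  interpret finite_measure dom_measure by (rule finite_measure_dom)
  have m: "f \<in> borel_measurable dom_measure"
    by (rule borel_measurable_dom[OF assms(1)])
  have "\<bar>(f x)\<^sup>2\<bar> \<le> B\<^sup>2" for x
    using assms(2)[of x] by (metis abs_ge_zero abs_power2 power2_abs power_mono)
  then have "integrable dom_measure (\<lambda>x. (f x)\<^sup>2)"
    using m by (intro integrable_const_bound[where B = "B\<^sup>2"]) auto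
  with m show ?thesis by (simp add: L2_def)
qed

lemma L2_continuous_vanishing:
  assumes "continuous_on UNIV f" "\<And>x. x \<notin> {a..b} \<Longrightarrow> f x = 0"
  shows "f \<in> L2"
proof -
  have "compact (f ` {a..b})"
    by (intro compact_continuous_image compact_Icc continuous_on_subset[OF assms(1)]) auto
  then have "bounded (f ` {a..b})" by (rule compact_imp_bounded)
  then obtain B where B: "\<And>x. x \<in> {a..b} \<Longrightarrow> \<bar>f x\<bar> \<le> B"
    unfolding bounded_iff by fastforce
  have "\<bar>f x\<bar> \<le> max B 0" for x
    using B[of x] assms(2)[of x] by (cases "x \<in> {a..b}") auto
  then show ?thesis
    using assms(1) by (intro L2_bounded[where B = "max B 0"] borel_measurable_continuous_onI)
qed

lemma test_fun_L2:
  assumes "test_fun \<phi>" shows "\<phi> \<in> L2" "deriv \<phi> \<in> L2"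
proof -
  obtain a b where ab: "\<And>x. x \<notin> {a..b} \<Longrightarrow> \<phi> x = 0"
    using assms unfolding test_fun_def by blast
  have "continuous_on UNIV \<phi>"
    using assms unfolding test_fun_def
    by (meson continuous_at_imp_continuous_on differentiable_imp_continuous_within)
  then show "\<phi> \<in> L2" using ab by (rule L2_continuous_vanishing)
  have "deriv \<phi> x = 0" if "x \<notin> {a..b}" for x
  proof -
    have "open (- {a..b})" by (simp add: open_Compl)
    then have "eventually (\<lambda>y. y \<in> - {a..b}) (nhds x)"
      using that by (intro eventually_nhds_in_open) auto
    then have "eventually (\<lambda>y. \<phi> y = 0) (nhds x)"
      by eventually_elim (use ab in auto)
    then have "deriv \<phi> x = deriv (\<lambda>_. 0) x" by (rule deriv_cong_ev) simp
    then show ?thesis by simp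
  qed
  then show "deriv \<phi> \<in> L2"
    using assms unfolding test_fun_def by (intro L2_continuous_vanishing) auto
qed

lemma has_weak_deriv_add:
  assumes "u \<in> L2" "v \<in> L2" "u' \<in> L2" "v' \<in> L2"
    "has_weak_deriv u v" "has_weak_deriv u' v'"
  shows "has_weak_deriv (\<lambda>x. u x + u' x) (\<lambda>x. v x + v' x)"
  unfolding has_weak_deriv_def
proof (intro allI impI)
  fix \<phi> assume t: "test_fun \<phi>"
  show "(LINT x|dom_measure. (u x + u' x) * deriv \<phi> x)
      = - (LINT x|dom_measure. (v x + v' x) * \<phi> x)"
    using assms(5,6) t test_fun_L2[OF t] assms(1-4)
    by (simp add: has_weak_deriv_def distrib_right L2_mult_integrable)
qed

lemma has_weak_deriv_scale:
  assumes "has_weak_deriv u v"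
  shows "has_weak_deriv (\<lambda>x. c * u x) (\<lambda>x. c * v x)"
  using assms unfolding has_weak_deriv_def by (auto simp: mult.assoc)

lemma has_weak_deriv_zero: "has_weak_deriv (\<lambda>x. 0) (\<lambda>x. 0)"
  by (simp add: has_weak_deriv_def)

lemma DERIV_max0_square:
  "((\<lambda>t::real. (max 0 t)\<^sup>2) has_real_derivative 2 * max 0 t) (at t)"
proof -
  consider "t > 0" | "t < 0" | "t = 0" by linarith
  then show ?thesis
  proof cases
    case 1
    have "((\<lambda>t::real. t\<^sup>2) has_real_derivative 2 * t) (at t)"
      by (auto intro!: derivative_eq_intros)
    then have "((\<lambda>t::real. (max 0 t)\<^sup>2) has_real_derivative 2 * t) (at t)"
      by (rule has_field_derivative_transform_within_open[where S = "{0<..}"]) (use 1 in auto)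
    then show ?thesis using 1 by simp
  next
    case 2
    have "((\<lambda>t::real. 0) has_real_derivative 0) (at t)" by simp
    then have "((\<lambda>t::real. (max 0 t)\<^sup>2) has_real_derivative 0) (at t)"
      by (rule has_field_derivative_transform_within_open[where S = "{..<0}"]) (use 2 in auto)
    then show ?thesis using 2 by simp
  next
    case 3
    have "(\<lambda>h::real. (max 0 h)\<^sup>2 / h) \<midarrow>0\<rightarrow> 0"
    proof (rule Lim_null_comparison[where g = "\<lambda>h. \<bar>h\<bar>"])
      show "\<forall>\<^sub>F h::real in at 0. norm ((max 0 h)\<^sup>2 / h) \<le> \<bar>h\<bar>"
        by (rule always_eventually) (auto simp: max_def power2_eq_square)
      show "((\<lambda>h::real. \<bar>h\<bar>) \<longlongrightarrow> 0) (at 0)"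
        by (rule tendsto_rabs_zero) (rule tendsto_ident_at)
    qed
    then show ?thesis using 3 by (simp add: DERIV_def)
  qed
qed

definition bump :: "real \<Rightarrow> real \<Rightarrow> real \<Rightarrow> real \<Rightarrow> real" where
  "bump k c d x =
     k * ((max 0 (x - c))\<^sup>2 * (max 0 (d - x))\<^sup>2) /
     (1 + k * ((max 0 (x - c))\<^sup>2 * (max 0 (d - x))\<^sup>2))"

lemma bump_bounds: "k \<ge> 0 \<Longrightarrow> 0 \<le> bump k c d x \<and> bump k c d x \<le> 1"
  by (auto simp: bump_def intro!: divide_nonneg_nonneg divide_le_eq_1_pos[THEN iffD2] add_pos_nonneg
      mult_nonneg_nonneg)

lemma bump_zero: "x \<notin> {c..d} \<Longrightarrow> bump k c d x = 0"
  by (auto simp: bump_def max_def)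

lemma test_fun_bump:
  assumes "k \<ge> 0" "0 < c" "d < pi"
  shows "test_fun (bump k c d)"
proof -
  define p where "p x = (max 0 (x - c))\<^sup>2 * (max 0 (d - x))\<^sup>2" for x
  define p' where "p' x = 2 * max 0 (x - c) * (max 0 (d - x))\<^sup>2
      - (max 0 (x - c))\<^sup>2 * (2 * max 0 (d - x))" for x
  have p: "(p has_real_derivative p' x) (at x)" for x
  proof -
    have 1: "((\<lambda>x. (max 0 (x - c))\<^sup>2) has_real_derivative 2 * max 0 (x - c)) (at x)"
    proof -
      have "((\<lambda>x. x - c) has_real_derivative 1) (at x)"
        by (auto intro!: derivative_eq_intros)
      from DERIV_chain2[OF DERIV_max0_square this] show ?thesis by simp
    qed
    have 2: "((\<lambda>x. (max 0 (d - x))\<^sup>2) has_real_derivative - (2 * max 0 (d - x))) (at x)"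
    proof -
      have "((\<lambda>x. d - x) has_real_derivative - 1) (at x)"
        by (auto intro!: derivative_eq_intros)
      from DERIV_chain2[OF DERIV_max0_square this] show ?thesis by simp
    qed
    show ?thesis unfolding p_def p'_def
      using DERIV_mult[OF 1 2] by (simp add: algebra_simps)
  qed
  have pos: "1 + k * p x > 0" for x
    using assms(1) by (auto simp: p_def intro!: add_pos_nonneg mult_nonneg_nonneg)
  have b: "bump k c d = (\<lambda>x. k * p x / (1 + k * p x))"
    by (simp add: bump_def p_def fun_eq_iff)
  have D: "(bump k c d has_real_derivative k * p' x / (1 + k * p x)\<^sup>2) (at x)" for x
    unfolding b using pos[of x]
    by (auto intro!: derivative_eq_intros p simp: field_simps power2_eq_square)
  then have der: "deriv (bump k c d) = (\<lambda>x. k * p' x / (1 + k * p x)\<^sup>2)"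
    by (auto intro!: DERIV_imp_deriv)
  have "continuous_on UNIV (deriv (bump k c d))"
    unfolding der p'_def
    using pos less_imp_neq[OF pos]
    by (intro continuous_intros) (auto simp: p_def intro!: continuous_intros)
  moreover have "bump k c d differentiable (at x)" for x
    using D real_differentiable_def by blast
  ultimately show ?thesis
    unfolding test_fun_def using assms bump_zero by blast
qed

lemma L2_integrable: "v \<in> L2 \<Longrightarrow> integrable dom_measure v"
  using L2_mult_integrable[of v "\<lambda>_. 1"] L2_bounded[of "\<lambda>_. 1" 1] by simp

lemma fundamental_lemma:
  assumes v: "v \<in> L2" and 0: "\<And>\<phi>. test_fun \<phi> \<Longrightarrow> (LINT x|dom_measure. v x * \<phi> x) = 0"
  shows "AE x in dom_measure. v x = 0"
proof -
  define w where "w x = indicator {0<..<pi} x * v x" for x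
  have iv: "integrable dom_measure v" by (rule L2_integrable[OF v])
  then have iw: "integrable lborel w"
    unfolding w_def by (subst (asm) integrable_restrict_space) auto
  have mv: "v \<in> borel_measurable dom_measure" using v by (simp add: L2_def)
  have interval: "(LINT x|dom_measure. v x * indicator {a<..<b} x) = 0" for a b
  proof -
    define c where "c n = max 0 a + 1 / Suc n" for n
    define d where "d n = min pi b - 1 / Suc n" for n
    define \<phi> where "\<phi> n = bump (Suc n) (c n) (d n)" for n
    have "test_fun (\<phi> n)" for n
      unfolding \<phi>_def
    proof (rule test_fun_bump)
      have "0 < 1 / real (Suc n)" by simp
      then show "0 < c n" "d n < pi" unfolding c_def d_def by linarith+
    qed simp
    then have "(LINT x|dom_measure. v x * \<phi> n x) = 0" for n
      using 0 by blast
    moreover have "(\<lambda>n. LINT x|dom_measure. v x * \<phi> n x)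
        \<longlonglongrightarrow> (LINT x|dom_measure. v x * indicator {a<..<b} x)"
    proof (rule integral_dominated_convergence[where w = "\<lambda>x. norm (v x)"])
      show "(\<lambda>x. v x * indicator {a<..<b} x) \<in> borel_measurable dom_measure"
        by (intro borel_measurable_times mv borel_measurable_dom) simp
      show "(\<lambda>x. v x * \<phi> n x) \<in> borel_measurable dom_measure" for n
        using test_fun_L2(1)[OF \<open>test_fun (\<phi> n)\<close>] mv
        by (intro borel_measurable_times) (auto simp: L2_def)
      show "integrable dom_measure (\<lambda>x. norm (v x))"
        using iv by (rule integrable_norm)
      show "AE x in dom_measure. norm (v x * \<phi> n x) \<le> norm (v x)" for n
      proof (rule AE_I2)
        fix x
        have "0 \<le> \<phi> n x" "\<phi> n x \<le> 1" unfolding \<phi>_def using bump_bounds by simp_all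
        then show "norm (v x * \<phi> n x) \<le> norm (v x)"
          by (simp add: abs_mult mult_left_le)
      qed
      show "AE x in dom_measure. (\<lambda>n. v x * \<phi> n x) \<longlonglongrightarrow> v x * indicator {a<..<b} x"
      proof (rule AE_I2)
        fix x assume "x \<in> space dom_measure"
        then have x: "0 < x" "x < pi" by auto
        have "(\<lambda>n. \<phi> n x) \<longlonglongrightarrow> indicator {a<..<b} x"
        proof (cases "x \<in> {a<..<b}")
          case True
          define q where "q n = (max 0 (x - c n))\<^sup>2 * (max 0 (d n - x))\<^sup>2" for n
          define q0 where "q0 = (x - max 0 a)\<^sup>2 * (min pi b - x)\<^sup>2"
          have inv: "(\<lambda>n. 1 / real (Suc n)) \<longlonglongrightarrow> 0"
            by (rule LIMSEQ_Suc[OF lim_1_over_n])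
          have "q \<longlonglongrightarrow> (max 0 (x - (max 0 a + 0)))\<^sup>2 * (max 0 ((min pi b - 0) - x))\<^sup>2"
            unfolding q_def c_def d_def by (intro tendsto_intros inv)
          moreover have "max 0 (x - (max 0 a + 0)) = x - max 0 a"
            "max 0 ((min pi b - 0) - x) = min pi b - x" using x True by auto
          ultimately have q: "q \<longlonglongrightarrow> q0" unfolding q0_def by simp
          have q0: "q0 > 0" unfolding q0_def using x True by auto
          have "(\<lambda>n. q n / (1 / real (Suc n) + q n)) \<longlonglongrightarrow> q0 / (0 + q0)"
            using q0 by (intro tendsto_intros inv q) auto
          moreover have "\<phi> n x = q n / (1 / real (Suc n) + q n)" for n
          proof -
            have "1 + real (Suc n) * q n = real (Suc n) * (1 / real (Suc n) + q n)"
              by (simp add: distrib_left del: of_nat_Suc)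
            then show ?thesis
              unfolding \<phi>_def bump_def q_def[symmetric] by (simp del: of_nat_Suc)
          qed
          ultimately show ?thesis using True q0 by simp
        next
          case False
          have "x \<notin> {c n..d n}" for n
          proof -
            have "0 < 1 / real (Suc n)" by simp
            then show ?thesis
              using False x unfolding c_def d_def atLeastAtMost_iff greaterThanLessThan_iff
              by linarith
          qed
          then have "\<phi> n x = 0" for n unfolding \<phi>_def by (rule bump_zero)
          then show ?thesis using False by simp
        qed
        then show "(\<lambda>n. v x * \<phi> n x) \<longlonglongrightarrow> v x * indicator {a<..<b} x"
          by (rule tendsto_mult_left)
      qed
    qed
    ultimately show ?thesis by (simp add: LIMSEQ_const_iff)
  qed
  have int_w: "(LINT x:A|lborel. w x) = (LINT x|dom_measure. v x * indicator A x)"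
    if "A \<in> sets borel" for A
    unfolding set_lebesgue_integral_def w_def
    by (subst integral_restrict_space) (auto simp: mult_ac)
  let ?G = "range (\<lambda>(a, b). {a<..<b::real})"
  have sets: "sets (borel :: real measure) = sigma_sets UNIV ?G"
  proof -
    have "range (\<lambda>(a, b). box a b) = ?G" by (intro image_cong) auto
    moreover have "sets (borel :: real measure) = sigma_sets UNIV (range (\<lambda>(a, b). box a b))"
      by (subst borel_eq_box) (rule sets_measure_of, simp)
    ultimately show ?thesis by simp
  qed
  have all: "(LINT x:A|lborel. w x) = 0" if "A \<in> sigma_sets UNIV ?G" for A
    using that
  proof (rule sigma_sets_induct_disjoint[rotated 2])
    show "Int_stable ?G"
      by (auto simp: Int_stable_def)
    show "?G \<subseteq> Pow UNIV" by simp
    show "(LINT x:A|lborel. w x) = 0" if "A \<in> ?G" for A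
      using that interval by (auto simp: int_w)
    show "(LINT x:{}|lborel. w x) = 0" by (simp add: set_lebesgue_integral_def)
    show "(LINT x:(UNIV - A)|lborel. w x) = 0"
      if A: "A \<in> sigma_sets UNIV ?G" and z: "(LINT x:A|lborel. w x) = 0" for A
    proof -
      have Ab: "A \<in> sets lborel" using A sets by simp
      have si: "set_integrable lborel B w" if "B \<in> sets lborel" for B
        using iw that unfolding set_integrable_def
        by (intro integrable_mult_indicator) auto
      have "(LINT x:(A \<union> (UNIV - A))|lborel. w x)
          = (LINT x:A|lborel. w x) + (LINT x:(UNIV - A)|lborel. w x)"
        by (rule set_integral_Un) (use si Ab in auto)
      moreover have "(LINT x:(A \<union> (UNIV - A))|lborel. w x) = (LINT x:{0<..<pi}|lborel. w x)"
        unfolding set_lebesgue_integral_def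
        by (rule Bochner_Integration.integral_cong) (auto simp: w_def indicator_def)
      moreover have "(LINT x:{0<..<pi}|lborel. w x) = 0"
        using interval by (simp add: int_w)
      ultimately show ?thesis using z by simp
    qed
    show "(LINT x:(\<Union>i. A i)|lborel. w x) = 0"
      if dis: "disjoint_family A" and A: "range A \<subseteq> sigma_sets UNIV ?G"
        and z: "\<And>i. (LINT x:A i|lborel. w x) = 0" for A :: "nat \<Rightarrow> real set"
    proof -
      have Ab: "A i \<in> sets lborel" for i using A sets by auto
      have "set_integrable lborel (\<Union>i. A i) w"
        using iw Ab unfolding set_integrable_def
        by (intro integrable_mult_indicator) auto
      then have "(LINT x:(\<Union>i. A i)|lborel. w x) = (\<Sum>i. LINT x:A i|lborel. w x)"
        using dis Ab by (intro lebesgue_integral_countable_add) (auto simp: disjoint_family_on_def)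
      then show ?thesis using z by simp
    qed
  qed
  have "AE x in lborel. w x = 0"
    using iw all sets
    by (intro density_unique_real) (auto simp: set_lebesgue_integral_def)
  then have "AE x in lborel. x \<in> {0<..<pi} \<longrightarrow> v x = 0"
    by eventually_elim (auto simp: w_def)
  then show ?thesis by (subst AE_restrict_space_iff) auto
qed

lemma weak_deriv_unique:
  assumes "v \<in> L2" "v' \<in> L2" "has_weak_deriv u v" "has_weak_deriv u v'"
  shows "AE x in dom_measure. v x = v' x"
proof -
  have d: "(\<lambda>x. v x + (-1) * v' x) \<in> L2"
    by (intro L2_add L2_scale assms)
  have "AE x in dom_measure. v x + (-1) * v' x = 0"
  proof (rule fundamental_lemma[OF d])
    fix \<phi> assume t: "test_fun \<phi>"
    have "(LINT x|dom_measure. (v x + (-1) * v' x) * \<phi> x)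
        = (LINT x|dom_measure. v x * \<phi> x) - (LINT x|dom_measure. v' x * \<phi> x)"
      using assms test_fun_L2(1)[OF t] by (simp add: left_diff_distrib L2_mult_integrable)
    then show "(LINT x|dom_measure. (v x + (-1) * v' x) * \<phi> x) = 0"
      using assms t unfolding has_weak_deriv_def by fastforce
  qed
  then show ?thesis by eventually_elim simp
qed

lemma has_weak_deriv_cong_AE:
  assumes "AE x in dom_measure. u x = u' x" "u \<in> L2" "u' \<in> L2" "has_weak_deriv u v"
  shows "has_weak_deriv u' v"
  unfolding has_weak_deriv_def
proof (intro allI impI)
  fix \<phi> assume t: "test_fun \<phi>"
  have "(LINT x|dom_measure. u' x * deriv \<phi> x) = (LINT x|dom_measure. u x * deriv \<phi> x)"
  proof (rule integral_cong_AE)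
    show "(\<lambda>x. u' x * deriv \<phi> x) \<in> borel_measurable dom_measure"
      "(\<lambda>x. u x * deriv \<phi> x) \<in> borel_measurable dom_measure"
      using assms test_fun_L2[OF t] by (auto simp: L2_def)
    show "AE x in dom_measure. u' x * deriv \<phi> x = u x * deriv \<phi> x"
      using assms(1) by eventually_elim simp
  qed
  then show "(LINT x|dom_measure. u' x * deriv \<phi> x) = - (LINT x|dom_measure. v x * \<phi> x)"
    using assms(4) t unfolding has_weak_deriv_def by simp
qed

lemma wderiv_H1:
  assumes "u \<in> H1" shows "wderiv u \<in> L2" "has_weak_deriv u (wderiv u)"
proof -
  have "\<exists>v. v \<in> L2 \<and> has_weak_deriv u v" using assms by (auto simp: H1_def)
  then have "wderiv u \<in> L2 \<and> has_weak_deriv u (wderiv u)"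
    unfolding wderiv_def by (rule someI_ex)
  then show "wderiv u \<in> L2" "has_weak_deriv u (wderiv u)" by auto
qed

lemma H1_wderivI:
  assumes "u \<in> L2" "v \<in> L2" "has_weak_deriv u v"
  shows "u \<in> H1" "AE x in dom_measure. wderiv u x = v x"
proof -
  show "u \<in> H1" using assms by (auto simp: H1_def)
  then show "AE x in dom_measure. wderiv u x = v x"
    using wderiv_H1 assms weak_deriv_unique by blast
qed

lemma H2_wderivI:
  assumes "u \<in> L2" "v \<in> L2" "w \<in> L2" "has_weak_deriv u v" "has_weak_deriv v w"
  shows "u \<in> H2" "AE x in dom_measure. wderiv u x = v x"
    "AE x in dom_measure. wderiv (wderiv u) x = w x"
proof -
  have u: "u \<in> H1" and uv: "AE x in dom_measure. wderiv u x = v x"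
    using H1_wderivI[of u v] assms by auto
  have "AE x in dom_measure. v x = wderiv u x" using uv by eventually_elim simp
  then have *: "has_weak_deriv (wderiv u) w"
    using has_weak_deriv_cong_AE assms wderiv_H1(1)[OF u] by blast
  have "wderiv u \<in> H1" "AE x in dom_measure. wderiv (wderiv u) x = w x"
    using H1_wderivI[OF wderiv_H1(1)[OF u] assms(3) *] by auto
  then show "u \<in> H2" "AE x in dom_measure. wderiv u x = v x"
    "AE x in dom_measure. wderiv (wderiv u) x = w x"
    using u uv by (auto simp: H2_def)
qed

lemma H2_L2:
  assumes "u \<in> H2"
  shows "u \<in> L2" "wderiv u \<in> L2" "wderiv (wderiv u) \<in> L2"
    "has_weak_deriv u (wderiv u)" "has_weak_deriv (wderiv u) (wderiv (wderiv u))"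
  using assms wderiv_H1 by (auto simp: H2_def H1_def)

lemma H2_add:
  assumes "u \<in> H2" "v \<in> H2"
  shows "(\<lambda>x. u x + v x) \<in> H2"
    "AE x in dom_measure. wderiv (\<lambda>x. u x + v x) x = wderiv u x + wderiv v x"
    "AE x in dom_measure. wderiv (wderiv (\<lambda>x. u x + v x)) x
       = wderiv (wderiv u) x + wderiv (wderiv v) x"
proof -
  note u = H2_L2[OF assms(1)] and v = H2_L2[OF assms(2)]
  note * = H2_wderivI[OF L2_add[OF u(1) v(1)] L2_add[OF u(2) v(2)] L2_add[OF u(3) v(3)]
      has_weak_deriv_add[OF u(1,2) v(1,2) u(4) v(4)]
      has_weak_deriv_add[OF u(2,3) v(2,3) u(5) v(5)]]
  show "(\<lambda>x. u x + v x) \<in> H2"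
    "AE x in dom_measure. wderiv (\<lambda>x. u x + v x) x = wderiv u x + wderiv v x"
    "AE x in dom_measure. wderiv (wderiv (\<lambda>x. u x + v x)) x
       = wderiv (wderiv u) x + wderiv (wderiv v) x"
    by (rule *)+
qed

lemma H2_scale:
  assumes "u \<in> H2"
  shows "(\<lambda>x. c * u x) \<in> H2"
    "AE x in dom_measure. wderiv (\<lambda>x. c * u x) x = c * wderiv u x"
    "AE x in dom_measure. wderiv (wderiv (\<lambda>x. c * u x)) x = c * wderiv (wderiv u) x"
proof -
  note u = H2_L2[OF assms]
  note * = H2_wderivI[OF L2_scale[OF u(1)] L2_scale[OF u(2)] L2_scale[OF u(3)]
      has_weak_deriv_scale[OF u(4)] has_weak_deriv_scale[OF u(5)], of c]
  show "(\<lambda>x. c * u x) \<in> H2"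
    "AE x in dom_measure. wderiv (\<lambda>x. c * u x) x = c * wderiv u x"
    "AE x in dom_measure. wderiv (wderiv (\<lambda>x. c * u x)) x = c * wderiv (wderiv u) x"
    by (rule *)+
qed

lemma H2_zero: "(\<lambda>x. 0) \<in> H2"
  using H2_wderivI(1)[OF L2_zero L2_zero L2_zero has_weak_deriv_zero has_weak_deriv_zero] .

text \<open>Each class in \<open>H\<^sup>2(0,\<pi>) \<inter> H\<^sub>0\<^sup>1(0,\<pi>)\<close> is represented by its
  continuous representative on \<open>[0,\<pi>]\<close>, extended by zero. As the continuous
  representative belongs to \<open>H\<^sub>0\<^sup>1\<close> if and only if it vanishes at \<open>0\<close> and \<open>\<pi>\<close>,
  this extension is continuous on the real line.\<close>

typedef sobU = "{u \<in> H2. continuous_on UNIV u \<and> (\<forall>x. x \<notin> {0<..<pi} \<longrightarrow> u x = 0)}"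
  morphisms fun_of Abs_sobU
  using H2_zero by (intro exI[of _ "\<lambda>x. 0"]) auto

setup_lifting type_definition_sobU

instantiation sobU :: real_vector
begin

lift_definition zero_sobU :: sobU is "\<lambda>x. 0"
  using H2_zero by auto

lift_definition plus_sobU :: "sobU \<Rightarrow> sobU \<Rightarrow> sobU" is "\<lambda>u v x. u x + v x"
  using H2_add(1) by (auto intro: continuous_on_add)

lift_definition scaleR_sobU :: "real \<Rightarrow> sobU \<Rightarrow> sobU" is "\<lambda>c u x. c * u x"
  using H2_scale(1) by (auto intro: continuous_on_mult_left)

lift_definition uminus_sobU :: "sobU \<Rightarrow> sobU" is "\<lambda>u x. - u x"
  using H2_scale(1)[of _ "-1"] by (auto intro: continuous_on_minus)

lift_definition minus_sobU :: "sobU \<Rightarrow> sobU \<Rightarrow> sobU" is "\<lambda>u v x. u x - v x"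
  using H2_add(1)[OF _ H2_scale(1)[of _ "-1"]] by (auto intro: continuous_on_diff)

instance
  by standard (transfer; auto simp: algebra_simps)+

end

text \<open>\<open>U\<close> carries the topology of \<open>H\<^sup>2(0,\<pi>)\<close>, given by its usual inner product.\<close>

instantiation sobU :: real_inner
begin

definition inner_sobU :: "sobU \<Rightarrow> sobU \<Rightarrow> real" where
  "inner_sobU u v =
     (LINT x|dom_measure. fun_of u x * fun_of v x)
   + (LINT x|dom_measure. wderiv (fun_of u) x * wderiv (fun_of v) x)
   + (LINT x|dom_measure. wderiv (wderiv (fun_of u)) x * wderiv (wderiv (fun_of v)) x)"

definition norm_sobU :: "sobU \<Rightarrow> real" where
  "norm_sobU u = sqrt (inner u u)"

definition sgn_sobU :: "sobU \<Rightarrow> sobU" where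
  "sgn_sobU u = inverse (norm u) *\<^sub>R u"

definition dist_sobU :: "sobU \<Rightarrow> sobU \<Rightarrow> real" where
  "dist_sobU u v = norm (u - v)"

definition uniformity_sobU :: "(sobU \<times> sobU) filter" where
  "uniformity_sobU = (INF e\<in>{0<..}. principal {(x, y). dist x y < e})"

definition open_sobU :: "sobU set \<Rightarrow> bool" where
  "open_sobU S \<longleftrightarrow> (\<forall>x\<in>S. \<forall>\<^sub>F (x', y) in uniformity. x' = x \<longrightarrow> y \<in> S)"

instance
proof
  fix u v w :: sobU and r :: real and S :: "sobU set"
  have H2: "fun_of a \<in> H2" for a using fun_of[of a] by auto
  note L = H2_L2(1-3)[OF H2]
  have cong: "(LINT x|dom_measure. f x * h x) = (LINT x|dom_measure. g x * h x)"
    if "AE x in dom_measure. f x = g x" "f \<in> L2" "g \<in> L2" "h \<in> L2" for f g h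
  proof (rule integral_cong_AE)
    show "AE x in dom_measure. f x * h x = g x * h x" using that(1) by eventually_elim simp
  qed (use that in \<open>auto simp: L2_def\<close>)
  show "dist u v = norm (u - v)" by (rule dist_sobU_def)
  show "sgn u = u /\<^sub>R norm u" by (simp add: sgn_sobU_def)
  show "uniformity = (INF e\<in>{0<..}. principal {(x, y::sobU). dist x y < e})"
    by (rule uniformity_sobU_def)
  show "open S = (\<forall>x\<in>S. \<forall>\<^sub>F (x', y) in uniformity. x' = x \<longrightarrow> y \<in> S)"
    by (rule open_sobU_def)
  show "norm u = sqrt (inner u u)" by (rule norm_sobU_def)
  show "inner u v = inner v u" by (simp add: inner_sobU_def mult.commute)
  have add: "fun_of (u + v) = (\<lambda>x. fun_of u x + fun_of v x)"
    by (simp add: plus_sobU.rep_eq)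
  show "inner (u + v) w = inner u w + inner v w"
    unfolding inner_sobU_def add
    using cong[OF H2_add(2)[OF H2[of u] H2[of v]] _ _ L(2)[of w]]
      cong[OF H2_add(3)[OF H2[of u] H2[of v]] _ _ L(3)[of w]]
      H2_L2[OF H2_add(1)[OF H2[of u] H2[of v]]]
    by (simp add: L L2_add distrib_right L2_mult_integrable)
  have scale: "fun_of (r *\<^sub>R u) = (\<lambda>x. r * fun_of u x)" for r u
    by (simp add: scaleR_sobU.rep_eq)
  show inner_scale: "inner (r *\<^sub>R u) v = r * inner u v" for r and u v :: sobU
    unfolding inner_sobU_def scale
    using cong[OF H2_scale(2)[OF H2[of u], of r] _ _ L(2)[of v]]
      cong[OF H2_scale(3)[OF H2[of u], of r] _ _ L(3)[of v]]
      H2_L2[OF H2_scale(1)[OF H2[of u], of r]]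
    by (simp add: L L2_scale distrib_left mult.assoc)
  show ge: "0 \<le> inner u u"
    unfolding inner_sobU_def by (intro add_nonneg_nonneg integral_nonneg) auto
  show "inner u u = 0 \<longleftrightarrow> u = 0"
  proof
    assume "inner u u = 0"
    moreover have "0 \<le> (LINT x|dom_measure. fun_of u x * fun_of u x)"
      "0 \<le> (LINT x|dom_measure. wderiv (fun_of u) x * wderiv (fun_of u) x)"
      "0 \<le> (LINT x|dom_measure. wderiv (wderiv (fun_of u)) x * wderiv (wderiv (fun_of u)) x)"
      by simp_all
    ultimately have "(LINT x|dom_measure. fun_of u x * fun_of u x) = 0"
      unfolding inner_sobU_def by linarith
    then have "AE x in dom_measure. fun_of u x * fun_of u x = 0"
      by (subst (asm) integral_nonneg_eq_0_iff_AE) (auto intro: L2_mult_integrable L)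
    then have "AE x in lborel. x \<in> {0<..<pi} \<longrightarrow> fun_of u x = 0"
      by (subst (asm) AE_restrict_space_iff) auto
    then have ae: "AE x in lborel. fun_of u x = 0"
      by eventually_elim (use fun_of[of u] in auto)
    have "fun_of u x = 0" for x
    proof (rule ccontr)
      assume nz: "fun_of u x \<noteq> 0"
      have "open (fun_of u -` (- {0}))"
        using fun_of[of u] by (intro open_vimage) auto
      moreover have "x \<in> fun_of u -` (- {0})" using nz by simp
      ultimately obtain e where e: "e > 0" "ball x e \<subseteq> fun_of u -` (- {0})"
        by (meson open_contains_ball)
      have "AE y in lborel. y \<notin> ball x e"
        using ae by eventually_elim (use e in auto)
      then have "emeasure lborel (ball x e) = 0"
        by (subst (asm) AE_iff_measurable[OF _ refl]) (auto simp: ball_def)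
      then show False using e(1) by (simp add: ball_eq_greaterThanLessThan)
    qed
    then show "u = 0" by transfer auto
  next
    assume "u = 0"
    then show "inner u u = 0" using inner_scale[of 0 u u] by simp
  qed
qed

end

section \<open>The boundary value problem\<close>

text \<open>The values of the operator are \<open>L\<^sup>2\<close> functions, taken up to null sets.\<close>

definition bvp_op :: "real \<Rightarrow> sobU \<Rightarrow> real \<Rightarrow> real" where
  "bvp_op l u x =
     wderiv (wderiv (fun_of u)) x + l * wderiv (fun_of u) x + fun_of u x
     + (l - (fun_of u x)\<^sup>2) * (fun_of u x)\<^sup>2"

definition bvp_solutions :: "(real \<times> sobU) set" where
  "bvp_solutions = {(l, u). AE x in dom_measure. bvp_op l u x = 0}"

text \<open>The derivatives at \<open>0\<close> and \<open>\<pi>\<close> are one-sided.\<close>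

definition strongly_positive :: "(real \<Rightarrow> real) \<Rightarrow> bool" where
  "strongly_positive u \<longleftrightarrow>
     (\<forall>x\<in>{0<..<pi}. u x > 0) \<and>
     (\<exists>d>0. (u has_real_derivative d) (at 0 within {0..pi})) \<and>
     (\<exists>d<0. (u has_real_derivative d) (at pi within {0..pi}))"

definition positive_solutions :: "(real \<times> sobU) set" where
  "positive_solutions = {(l, u) \<in> bvp_solutions. strongly_positive (fun_of u)}"

definition phi0 :: "real \<Rightarrow> real" where
  "phi0 x = sqrt (2 / pi) * sin x"

section \<open>Curves\<close>

definition arc_of :: "(real \<Rightarrow> sobU) \<Rightarrow> real \<Rightarrow> real \<times> sobU" where
  "arc_of w l = (l, w l)"

text \<open>To be used on open sets only.\<close>

definition real_analytic_on :: "(real \<Rightarrow> 'a::real_normed_vector) \<Rightarrow> real set \<Rightarrow> bool" where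
  "real_analytic_on f S \<longleftrightarrow>
     (\<forall>t0\<in>S. \<exists>r>0. \<exists>a. \<forall>t. \<bar>t - t0\<bar> < r \<longrightarrow> (\<lambda>n. (t - t0) ^ n *\<^sub>R a n) sums f t)"

definition locally_inj_on :: "(real \<Rightarrow> 'a) \<Rightarrow> real set \<Rightarrow> bool" where
  "locally_inj_on f S \<longleftrightarrow> (\<forall>t\<in>S. \<exists>r>0. inj_on f (S \<inter> ball t r))"

text \<open>A locally injective curve in \<open>C\<close> on \<open>(0,T)\<close> that starts as the arc of \<open>w\<close> on \<open>(0,\<epsilon>)\<close>
  and ends as a reparametrization of the arc of \<open>w'\<close>. Since \<open>[T-\<delta>,T)\<close> is half-open while the arc
  of \<open>w'\<close> lives on \<open>(0,\<epsilon>)\<close>, the latter is exhausted by its restrictions to \<open>(0,\<eta>]\<close>,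
  \<open>0 < \<eta> < \<epsilon>\<close>, each of which is a terminal piece of the curve.\<close>

definition global_continuation ::
  "real \<Rightarrow> (real \<Rightarrow> sobU) \<Rightarrow> (real \<Rightarrow> sobU) \<Rightarrow> (real \<times> sobU) set \<Rightarrow> real
     \<Rightarrow> (real \<Rightarrow> real \<times> sobU) \<Rightarrow> bool" where
  "global_continuation \<epsilon> w w' C T \<Gamma> \<longleftrightarrow>
     \<epsilon> < T \<and>
     continuous_on {0<..<T} \<Gamma> \<and> \<Gamma> ` {0<..<T} \<subseteq> C \<and> locally_inj_on \<Gamma> {0<..<T} \<and>
     (\<forall>t\<in>{0<..<\<epsilon>}. \<Gamma> t = arc_of w t) \<and>
     (\<forall>\<eta>\<in>{0<..<\<epsilon>}. \<exists>\<delta>\<in>{0<..<T}. \<exists>\<theta> \<theta>'.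
        homeomorphism {T - \<delta>..<T} {0<..\<eta>} \<theta> \<theta>' \<and>
        (\<forall>t\<in>{T - \<delta>..<T}. \<Gamma> t = arc_of w' (\<theta> t)))"

end

theory Submission
  imports Defs "HOL-Complex_Analysis.Complex_Analysis" "Jordan_Normal_Form.Determinant"
begin

text \<open>A positive solution is determined by \<open>\<lambda>\<close> and its initial slope \<open>p = u'(0)\<close>, so that the set of positive
  solutions is homeomorphic to the planar set \<open>Z\<close> of zeros \<open>(\<lambda>, p)\<close>, \<open>p > 0\<close>, of a shooting function \<open>G\<close>.
  A priori bounds show that \<open>Z\<close> together with the origin is compact. The complexified shooting function is
  holomorphic, hence \<open>Z\<close> is near each of its points a finite union of graphs of continuous functions of \<open>\<lambda>\<close> to
  the left and to the right of that point. In particular what is left of \<open>Z\<close> after removing the two local arcs is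
  compact and locally path connected.

  Close to the origin \<open>G\<close> changes sign across both arcs, and by analyticity it does so at points arbitrarily close
  to their far ends. If the far ends could not be joined outside the arcs, then cutting the first arc at such a
  point would exhibit \<open>Z \<union> {0}\<close> as the union of two compact sets with exactly one common point. By Janiszewski's
  theorem \<open>Z \<union> {0}\<close> would not separate the two sides of the cut, where \<open>G\<close> has opposite signs. Hence the far
  ends coincide or are joined by an arc, which closes the loop.\<close>

section \<open>Volterra equations\<close>

text \<open>Two shooting functions are in play because neither serves alone. The truncated flow
  exists on all of [0, pi] with global Lipschitz bounds, but truncation destroys analyticity; the
  polynomial equation is analytic in its data, but its solutions may blow up before pi. The bridge
  is that the truncated solution, once it has reached zero, stays negative. An end value \<ge> 0
  therefore forces positivity on (0, pi), and there, near a zero, both equations coincide. So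
  \<open>shoot\<close> and \<open>cshoot\<close> share zeros and signs near every zero, which is all
  that the topology uses. Volterra equations over an arbitrary normed field treat both versions at
  once. The first arc has to be cut near its far end: the two arcs may meet in between, but distinct
  far ends keep them apart there. The sign change, visible near the origin, is carried to that place
  by the parity of the order of vanishing in p, which is generically constant along an analytic arc.
  Since the arcs may cross each other, the loop is only locally injective.\<close>

lemma gronwall_sup:
  fixes e :: "real \<Rightarrow> real"
  assumes ce: "continuous_on {0..b} e" and k: "k \<ge> 0" and b: "b \<ge> 0"
    and nn: "\<And>x. x \<in> {0..b} \<Longrightarrow> 0 \<le> e x"
    and le: "\<And>x. x \<in> {0..b} \<Longrightarrow> e x \<le> c + integral {0..x} (\<lambda>t. k * e t)"
    and x: "x \<in> {0..b}"
  shows "e x \<le> 2 * c * exp ((2 * k + 1) * x)"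
proof -
  \<comment> \<open>At the maximum of e x * exp (- K * x) the integral term is at most k / K \<le>
    1/2 of the left side and can be absorbed, whence the factor 2 in the result. The summand 1 keeps
    K positive for k = 0.\<close>
  define K where "K = 2 * k + 1"
  have K: "K > 0" using k by (simp add: K_def)
  obtain x0 where x0: "x0 \<in> {0..b}" "\<And>y. y \<in> {0..b} \<Longrightarrow> e y * exp (- K * y) \<le> e x0 * exp (- K * x0)"
  proof -
    have "continuous_on {0..b} (\<lambda>x. e x * exp (- K * x))" by (intro continuous_intros ce)
    then show ?thesis
      using continuous_attains_sup[of "{0..b}" "\<lambda>x. e x * exp (- K * x)"] b that by auto
  qed
  define m where "m = e x0 * exp (- K * x0)"
  have m0: "m \<ge> 0" using nn[OF x0(1)] by (simp add: m_def)
  have em: "e y \<le> m * exp (K * y)" if "y \<in> {0..b}" for y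
  proof -
    have "e y * exp (- K * y) * exp (K * y) \<le> m * exp (K * y)"
      using x0(2)[OF that] unfolding m_def by (intro mult_right_mono) auto
    then show ?thesis by (simp add: mult.assoc flip: exp_add)
  qed
  have int: "((\<lambda>t. k * (m * exp (K * t))) has_integral k * m / K * exp (K * x0) - k * m / K * exp (K * 0)) {0..x0}"
  proof (rule fundamental_theorem_of_calculus)
    show "((\<lambda>t. k * m / K * exp (K * t)) has_vector_derivative k * (m * exp (K * t))) (at t within {0..x0})" for t
      unfolding has_real_derivative_iff_has_vector_derivative[symmetric]
      using K by (auto intro!: derivative_eq_intros)
  qed (use x0 in auto)
  have "integral {0..x0} (\<lambda>t. k * e t) \<le> integral {0..x0} (\<lambda>t. k * (m * exp (K * t)))"
  proof (rule integral_le)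
    have "continuous_on {0..x0} e" by (rule continuous_on_subset[OF ce]) (use x0 in auto)
    then show "(\<lambda>t. k * e t) integrable_on {0..x0}"
      by (intro integrable_continuous_interval continuous_intros)
    show "k * e t \<le> k * (m * exp (K * t))" if "t \<in> {0..x0}" for t
      by (rule mult_left_mono[OF em k]) (use that x0 in auto)
  qed (use int in blast)
  also have "\<dots> \<le> k * m / K * exp (K * x0)"
    using integral_unique[OF int] k m0 K by simp
  also have "\<dots> \<le> m * exp (K * x0) / 2"
  proof -
    have "k / K \<le> 1 / 2" using k by (simp add: K_def field_simps)
    then have "k / K * (m * exp (K * x0)) \<le> 1 / 2 * (m * exp (K * x0))"
      using m0 by (intro mult_right_mono) auto
    then show ?thesis by (simp add: field_simps)
  qed
  finally have "e x0 \<le> c + m * exp (K * x0) / 2" using le[OF x0(1)] by linarith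
  moreover have "e x0 = m * exp (K * x0)" by (simp add: m_def exp_minus)
  ultimately have "m * exp (K * x0) \<le> 2 * c" by linarith
  moreover have "m \<le> m * exp (K * x0)"
    using m0 K x0 by (simp add: mult_le_cancel_left1)
  ultimately have "m \<le> 2 * c" by linarith
  then show ?thesis using em[OF x] mult_right_mono[of m "2 * c" "exp (K * x)"] by (simp only: K_def exp_ge_zero) (meson order_trans)
qed

text \<open>The initial value problem \<open>u'' + a u' + g(u) = 0\<close>, \<open>u(0) = 0\<close>, \<open>u'(0) = p\<close>, integrated twice.\<close>

definition volterra ::
  "('a::{real_normed_field,banach} \<Rightarrow> 'a) \<Rightarrow> 'a \<Rightarrow> 'a \<Rightarrow> (real \<Rightarrow> 'a) \<Rightarrow> real \<Rightarrow> 'a" where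
  "volterra g a p u x = p * of_real x - integral {0..x} (\<lambda>t. a * u t + of_real (x - t) * g (u t))"

definition volterra_sol ::
  "real \<Rightarrow> ('a::{real_normed_field,banach} \<Rightarrow> 'a) \<Rightarrow> 'a \<Rightarrow> 'a \<Rightarrow> (real \<Rightarrow> 'a) \<Rightarrow> bool" where
  "volterra_sol b g a p u \<longleftrightarrow> continuous_on {0..b} u \<and> (\<forall>x\<in>{0..b}. u x = volterra g a p u x)"

lemma continuous_volterra_integrand:
  fixes u :: "real \<Rightarrow> 'a::{real_normed_field,banach}"
  assumes "continuous_on {0..b} u" "continuous_on UNIV g" "x \<le> b"
  shows "continuous_on {0..x} (\<lambda>t. a * u t + of_real (y - t) * g (u t))"
proof -
  have u: "continuous_on {0..x} u" by (rule continuous_on_subset[OF assms(1)]) (use assms(3) in auto)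
  have gu: "continuous_on {0..x} (\<lambda>t. g (u t))"
    by (intro continuous_on_compose2[OF assms(2) u]) auto
  show ?thesis
    by (intro continuous_on_add continuous_on_mult continuous_on_of_real continuous_on_diff
        continuous_on_const continuous_on_id u gu)
qed

lemma volterra_diff_le:
  fixes u w :: "real \<Rightarrow> 'a::{real_normed_field,banach}"
  assumes cu: "continuous_on {0..b} u" and cw: "continuous_on {0..b} w"
    and cg: "continuous_on UNIV g" and cg': "continuous_on UNIV g'"
    and L: "\<And>t. t \<in> {0..b} \<Longrightarrow> norm (g (u t) - g (w t)) \<le> L * norm (u t - w t)" "L \<ge> 0"
    and d: "\<And>t. t \<in> {0..b} \<Longrightarrow> norm (g (w t) - g' (w t)) \<le> d"
    and M: "\<And>t. t \<in> {0..b} \<Longrightarrow> norm (w t) \<le> M"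
    and x: "x \<in> {0..b}"
  shows "norm (volterra g a p u x - volterra g' a' p' w x)
     \<le> (norm (p - p') * b + norm (a - a') * M * b + b\<^sup>2 * d)
       + integral {0..x} (\<lambda>t. (norm a + b * L) * norm (u t - w t))"
proof -
  let ?f = "\<lambda>t. (a * u t + of_real (x - t) * g (u t)) - (a' * w t + of_real (x - t) * g' (w t))"
  have b: "b \<ge> 0" using x by auto
  have d0: "d \<ge> 0" using order_trans[OF norm_ge_zero d[of 0]] b by simp
  have M0: "M \<ge> 0" using order_trans[OF norm_ge_zero M[of 0]] b by simp
  have i1: "(\<lambda>t. a * u t + of_real (x - t) * g (u t)) integrable_on {0..x}"
    using x by (intro integrable_continuous_interval continuous_volterra_integrand[OF cu cg]) auto
  have i2: "(\<lambda>t. a' * w t + of_real (x - t) * g' (w t)) integrable_on {0..x}"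
    using x by (intro integrable_continuous_interval continuous_volterra_integrand[OF cw cg']) auto
  have sub: "continuous_on {0..x} u" "continuous_on {0..x} w"
    using x by (auto intro: continuous_on_subset[OF cu] continuous_on_subset[OF cw])
  have "norm (integral {0..x} ?f)
     \<le> integral {0..x} (\<lambda>t. (norm (a - a') * M + b * d) + (norm a + b * L) * norm (u t - w t))"
  proof (rule integral_norm_bound_integral)
    show "?f integrable_on {0..x}" by (rule integrable_diff[OF i1 i2])
    show "(\<lambda>t. norm (a - a') * M + b * d + (norm a + b * L) * norm (u t - w t)) integrable_on {0..x}"
      by (intro integrable_continuous_interval continuous_intros sub)
    fix t assume "t \<in> {0..x}"
    then have t: "t \<in> {0..b}" and xt: "0 \<le> x - t" "x - t \<le> b" using x by auto
    \<comment> \<open>The change of data is evaluated along w, where bounds are known; the old data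
      act on u - w only and produce the term for Gronwall's lemma.\<close>
    have eq: "?f t = (a - a') * w t + of_real (x - t) * (g (w t) - g' (w t))
        + (a * (u t - w t) + of_real (x - t) * (g (u t) - g (w t)))" by (simp add: algebra_simps)
    have n1: "norm ((a - a') * w t) \<le> norm (a - a') * M"
      using M[OF t] by (simp add: norm_mult mult_left_mono)
    have n2: "norm (of_real (x - t) * (g (w t) - g' (w t))) \<le> b * d"
      unfolding norm_mult norm_of_real using d[OF t] xt b by (intro mult_mono) auto
    have n3: "norm (a * (u t - w t)) = norm a * norm (u t - w t)" by (rule norm_mult)
    have n4: "norm (of_real (x - t) * (g (u t) - g (w t))) \<le> b * (L * norm (u t - w t))"
      unfolding norm_mult norm_of_real using L(1)[OF t] xt b by (intro mult_mono) auto
    have "norm (?f t) \<le> norm ((a - a') * w t) + norm (of_real (x - t) * (g (w t) - g' (w t)))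
        + (norm (a * (u t - w t)) + norm (of_real (x - t) * (g (u t) - g (w t))))"
      unfolding eq by (intro norm_triangle_le add_mono order_refl norm_triangle_ineq)
    then show "norm (?f t) \<le> norm (a - a') * M + b * d + (norm a + b * L) * norm (u t - w t)"
      using n1 n2 n3 n4 by (simp add: algebra_simps)
  qed
  also have "\<dots> = (norm (a - a') * M + b * d) * x
      + integral {0..x} (\<lambda>t. (norm a + b * L) * norm (u t - w t))"
    using x by (subst integral_add) (auto intro!: integrable_continuous_interval continuous_intros sub)
  also have "(norm (a - a') * M + b * d) * x \<le> (norm (a - a') * M + b * d) * b"
    using x b d0 M0 by (intro mult_left_mono) auto
  finally have 1: "norm (integral {0..x} ?f) \<le> (norm (a - a') * M + b * d) * b
      + integral {0..x} (\<lambda>t. (norm a + b * L) * norm (u t - w t))" by simp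
  have "volterra g a p u x - volterra g' a' p' w x = (p - p') * of_real x - integral {0..x} ?f"
    unfolding volterra_def integral_diff[OF i1 i2] by (simp add: algebra_simps)
  then have "norm (volterra g a p u x - volterra g' a' p' w x)
      \<le> norm (p - p') * norm (of_real x :: 'a) + norm (integral {0..x} ?f)"
    using norm_triangle_ineq4[of "(p - p') * of_real x" "integral {0..x} ?f"] by (simp only: norm_mult)
  also have "norm (p - p') * norm (of_real x :: 'a) \<le> norm (p - p') * b"
    using x by (intro mult_left_mono) auto
  finally show ?thesis using 1 by (simp add: power2_eq_square algebra_simps)
qed

lemma volterra_sol_dist:
  fixes u w :: "real \<Rightarrow> 'a::{real_normed_field,banach}"
  assumes u: "volterra_sol b g a p u" and w: "volterra_sol b g' a' p' w"
    and cg: "continuous_on UNIV g" and cg': "continuous_on UNIV g'"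
    and L: "\<And>t. t \<in> {0..b} \<Longrightarrow> norm (g (u t) - g (w t)) \<le> L * norm (u t - w t)" "L \<ge> 0"
    and d: "\<And>t. t \<in> {0..b} \<Longrightarrow> norm (g (w t) - g' (w t)) \<le> d"
    and M: "\<And>t. t \<in> {0..b} \<Longrightarrow> norm (w t) \<le> M"
    and x: "x \<in> {0..b}"
  shows "norm (u x - w x)
     \<le> 2 * (norm (p - p') * b + norm (a - a') * M * b + b\<^sup>2 * d)
       * exp ((2 * (norm a + b * L) + 1) * x)"
proof (rule gronwall_sup[where e = "\<lambda>x. norm (u x - w x)" and b = b])
  have cu: "continuous_on {0..b} u" and cw: "continuous_on {0..b} w"
    using u w by (auto simp: volterra_sol_def)
  then show "continuous_on {0..b} (\<lambda>x. norm (u x - w x))" by (intro continuous_intros)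
  show "norm (u y - w y) \<le> norm (p - p') * b + norm (a - a') * M * b + b\<^sup>2 * d
      + integral {0..y} (\<lambda>t. (norm a + b * L) * norm (u t - w t))" if "y \<in> {0..b}" for y
    using volterra_diff_le[OF cu cw cg cg' L d M that, of a p a' p'] u w that
    by (simp add: volterra_sol_def)
qed (use x L in auto)

lemma volterra_sol_unique:
  fixes u w :: "real \<Rightarrow> 'a::{real_normed_field,banach}"
  assumes u: "volterra_sol b g a p u" and w: "volterra_sol b g a p w"
    and cg: "continuous_on UNIV g"
    and L: "\<And>t. t \<in> {0..b} \<Longrightarrow> norm (g (u t) - g (w t)) \<le> L * norm (u t - w t)" "L \<ge> 0"
    and x: "x \<in> {0..b}"
  shows "u x = w x"
proof -
  have "compact (w ` {0..b})"
    using w by (intro compact_continuous_image) (auto simp: volterra_sol_def)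
  then obtain M where "\<forall>y\<in>w ` {0..b}. norm y \<le> M" by (auto dest!: compact_imp_bounded simp: bounded_iff)
  then have M: "norm (w t) \<le> M" if "t \<in> {0..b}" for t using that by blast
  have "norm (u x - w x) \<le> 2 * (norm (p - p) * b + norm (a - a) * M * b + b\<^sup>2 * 0)
       * exp ((2 * (norm a + b * L) + 1) * x)"
    by (rule volterra_sol_dist[OF u w cg cg L _ M x]) auto
  then show ?thesis by simp
qed

text \<open>Splitting the kernel x - t leaves x only as a factor and as an upper limit of
  integration, so that continuity and derivatives can be read off.\<close>

lemma volterra_eq:
  assumes cu: "continuous_on {0..b} u" and cg: "continuous_on UNIV g" and x: "x \<in> {0..b}"
  shows "volterra g a p u x = p * of_real x - a * integral {0..x} u
      - of_real x * integral {0..x} (\<lambda>t. g (u t)) + integral {0..x} (\<lambda>t. of_real t * g (u t))"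
proof -
  have cgu: "continuous_on {0..b} (\<lambda>t. g (u t))"
    by (intro continuous_on_compose2[OF cg cu]) auto
  have s: "continuous_on {0..x} u" "continuous_on {0..x} (\<lambda>t. g (u t))"
    using x by (auto intro: continuous_on_subset[OF cu] continuous_on_subset[OF cgu])
  have i1: "(\<lambda>t. a * u t) integrable_on {0..x}" "(\<lambda>t. of_real x * g (u t)) integrable_on {0..x}"
    by (intro integrable_continuous_interval continuous_intros s)+
  have i2: "(\<lambda>t. of_real t * g (u t)) integrable_on {0..x}"
    by (intro integrable_continuous_interval continuous_on_mult continuous_on_of_real continuous_on_id s)
  have "integral {0..x} (\<lambda>t. a * u t + of_real (x - t) * g (u t))
     = integral {0..x} (\<lambda>t. a * u t + (of_real x * g (u t) - of_real t * g (u t)))"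
    by (simp add: algebra_simps)
  also have "\<dots> = integral {0..x} (\<lambda>t. a * u t) + (integral {0..x} (\<lambda>t. of_real x * g (u t))
      - integral {0..x} (\<lambda>t. of_real t * g (u t)))"
    by (simp only: integral_add[OF i1(1) integrable_diff[OF i1(2) i2]] integral_diff[OF i1(2) i2])
  finally show ?thesis by (simp add: volterra_def)
qed

lemma continuous_on_volterra:
  assumes cu: "continuous_on {0..b} u" and cg: "continuous_on UNIV g"
  shows "continuous_on {0..b} (volterra g a p u)"
proof -
  have cgu: "continuous_on {0..b} (\<lambda>t. g (u t))"
    by (intro continuous_on_compose2[OF cg cu]) auto
  have I: "continuous_on {0..b} (\<lambda>x. integral {0..x} u)"
    "continuous_on {0..b} (\<lambda>x. integral {0..x} (\<lambda>t. g (u t)))"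
    by (intro indefinite_integral_continuous_1 integrable_continuous_interval cu cgu)+
  have J: "continuous_on {0..b} (\<lambda>x. integral {0..x} (\<lambda>t. of_real t * g (u t)))"
    by (intro indefinite_integral_continuous_1 integrable_continuous_interval cgu
        continuous_on_mult continuous_on_of_real continuous_on_id)
  have "continuous_on {0..b} (\<lambda>x. p * of_real x - a * integral {0..x} u
      - of_real x * integral {0..x} (\<lambda>t. g (u t)) + integral {0..x} (\<lambda>t. of_real t * g (u t)))"
    by (intro continuous_on_add continuous_on_diff continuous_on_mult continuous_on_const
        continuous_on_of_real continuous_on_id I J)
  then show ?thesis
    by (rule continuous_on_eq) (use volterra_eq[OF cu cg] in auto)
qed

lemma volterra_derivative:
  assumes u: "volterra_sol b g a p u" and cg: "continuous_on UNIV g" and x: "x \<in> {0..b}"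
  shows "(u has_vector_derivative p - a * u x - integral {0..x} (\<lambda>t. g (u t))) (at x within {0..b})"
    and "u 0 = 0"
proof -
  have cu: "continuous_on {0..b} u" using u by (simp add: volterra_sol_def)
  have cgu: "continuous_on {0..b} (\<lambda>t. g (u t))"
    by (intro continuous_on_compose2[OF cg cu]) auto
  have ctgu: "continuous_on {0..b} (\<lambda>t. of_real t * g (u t))"
    by (intro continuous_on_mult continuous_on_of_real continuous_on_id cgu)
  have eq: "u y = p * of_real y - a * integral {0..y} u
      - of_real y * integral {0..y} (\<lambda>t. g (u t)) + integral {0..y} (\<lambda>t. of_real t * g (u t))"
    if y: "y \<in> {0..b}" for y
    using volterra_eq[OF cu cg y, of a p] u y by (simp add: volterra_sol_def)
  have D: "((\<lambda>y. integral {0..y} f) has_vector_derivative f x) (at x within {0..b})"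
    if "continuous_on {0..b} f" for f :: "real \<Rightarrow> 'a"
    by (rule integral_has_vector_derivative[OF that x])
  have R: "(of_real has_vector_derivative (1::'a)) (at x within {0..b})"
    using has_vector_derivative_scaleR[OF DERIV_ident has_vector_derivative_const[of "1::'a"], of x "{0..b}"]
    by (simp add: of_real_def[abs_def])
  have "((\<lambda>y. p * of_real y - a * integral {0..y} u
      - of_real y * integral {0..y} (\<lambda>t. g (u t)) + integral {0..y} (\<lambda>t. of_real t * g (u t)))
    has_vector_derivative p * 1 - a * u x - (of_real x * g (u x) + 1 * integral {0..x} (\<lambda>t. g (u t)))
       + of_real x * g (u x)) (at x within {0..b})"
    by (intro has_vector_derivative_add has_vector_derivative_diff has_vector_derivative_mult
        has_vector_derivative_mult_right D cu cgu ctgu R)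
  then have "((\<lambda>y. p * of_real y - a * integral {0..y} u
      - of_real y * integral {0..y} (\<lambda>t. g (u t)) + integral {0..y} (\<lambda>t. of_real t * g (u t)))
    has_vector_derivative p - a * u x - integral {0..x} (\<lambda>t. g (u t))) (at x within {0..b})"
    by (simp only: mult_1_left mult_1_right) (simp add: algebra_simps)
  then show "(u has_vector_derivative p - a * u x - integral {0..x} (\<lambda>t. g (u t))) (at x within {0..b})"
    by (rule has_vector_derivative_transform[OF x, rotated]) (use eq in auto)
  show "u 0 = 0" using eq[of 0] x by auto
qed

section \<open>Picard iteration in a tube around an approximate solution\<close>

primrec picard ::
  "('a::{real_normed_field,banach} \<Rightarrow> 'a) \<Rightarrow> 'a \<Rightarrow> 'a \<Rightarrow> (real \<Rightarrow> 'a) \<Rightarrow> nat \<Rightarrow> real \<Rightarrow> 'a" where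
  "picard g a p w 0 = w"
| "picard g a p w (Suc n) = volterra g a p (picard g a p w n)"

text \<open>The centre w need not be a solution: d bounds its defect, and the last assumption keeps
  all iterates in the tube of radius \<rho> on which g is Lipschitz. With w = 0 this yields the
  truncated flow, with a known solution w of the polynomial equation it yields the solutions for
  nearby data.\<close>

locale picard_tube =
  fixes g :: "'a::{real_normed_field,banach} \<Rightarrow> 'a" and a p :: 'a and w :: "real \<Rightarrow> 'a" and b L d \<rho> :: real
  assumes cw: "continuous_on {0..b} w" and cg: "continuous_on UNIV g" and b: "b \<ge> 0" and L0: "L \<ge> 0"
    and L: "\<And>x y z. x \<in> {0..b} \<Longrightarrow> norm (y - w x) \<le> \<rho> \<Longrightarrow> norm (z - w x) \<le> \<rho> \<Longrightarrow> norm (g y - g z) \<le> L * norm (y - z)"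
    and d: "\<And>x. x \<in> {0..b} \<Longrightarrow> norm (volterra g a p w x - w x) \<le> d"
    and small: "2 * d * exp ((2 * (norm a + b * L) + 1) * b) \<le> \<rho>"
begin

abbreviation "K \<equiv> 2 * (norm a + b * L) + 1"

lemma d0: "d \<ge> 0"
  using order_trans[OF norm_ge_zero d[of 0]] b by simp

lemma K0: "K > 0" using L0 b by (simp add: add_nonneg_pos)

lemma picard_continuous: "continuous_on {0..b} (picard g a p w n)"
  by (induction n) (auto intro: cw continuous_on_volterra cg)

text \<open>The two claims need each other: iterates contract only while they stay in the tube, and
  their distance to w is the geometric sum of the steps. Thanks to the weight exp (K * x) each
  integration costs a factor (norm a + b * L) / K \<le> 1/2, however long the interval is.\<close>

lemma picard_bounds:
  "(\<forall>x\<in>{0..b}. norm (picard g a p w n x - w x) \<le> 2 * d * (1 - (1/2)^n) * exp (K * x)) \<and>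
   (\<forall>x\<in>{0..b}. norm (picard g a p w (Suc n) x - picard g a p w n x) \<le> d * (1/2)^n * exp (K * x))"
proof (induction n)
  case 0
  have "norm (volterra g a p w x - w x) \<le> d * exp (K * x)" if "x \<in> {0..b}" for x
  proof -
    have "d * 1 \<le> d * exp (K * x)" using d0 K0 that by (intro mult_left_mono) auto
    then show ?thesis using d[OF that] by linarith
  qed
  then show ?case by auto
next
  case (Suc n)
  let ?u = "picard g a p w"
  have 1: "norm (?u (Suc n) x - w x) \<le> 2 * d * (1 - (1/2)^Suc n) * exp (K * x)" if x: "x \<in> {0..b}" for x
  proof -
    have "norm (?u (Suc n) x - w x) \<le> norm (?u (Suc n) x - ?u n x) + norm (?u n x - w x)"
      using norm_triangle_ineq[of "?u (Suc n) x - ?u n x" "?u n x - w x"] by simp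
    also have "\<dots> \<le> d * (1/2)^n * exp (K * x) + 2 * d * (1 - (1/2)^n) * exp (K * x)"
      using Suc x by (intro add_mono) blast+
    finally show ?thesis by (simp add: algebra_simps)
  qed
  have tube: "norm (?u m x - w x) \<le> \<rho>" if x: "x \<in> {0..b}" and m: "m = n \<or> m = Suc n" for x m
  proof -
    have "norm (?u m x - w x) \<le> 2 * d * (1 - (1/2)^m) * exp (K * x)" using m Suc 1 x by blast
    also have "\<dots> \<le> 2 * d * 1 * exp (K * b)"
      using d0 x K0 by (intro mult_mono) (auto simp: power_le_one)
    finally show ?thesis using small by simp
  qed
  have 2: "norm (?u (Suc (Suc n)) x - ?u (Suc n) x) \<le> d * (1/2)^Suc n * exp (K * x)" if x: "x \<in> {0..b}" for x
  proof -
    define M where "M = Sup ((\<lambda>x. norm (?u n x)) ` {0..b})"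
    have "compact ((\<lambda>x. norm (?u n x)) ` {0..b})"
      by (intro compact_continuous_image continuous_intros picard_continuous) auto
    then have M: "norm (?u n t) \<le> M" if "t \<in> {0..b}" for t
      unfolding M_def using that by (intro cSup_upper) (auto simp: compact_imp_bounded bounded_imp_bdd_above)
    have "norm (volterra g a p (?u (Suc n)) x - volterra g a p (?u n) x)
      \<le> (norm (p - p) * b + norm (a - a) * M * b + b\<^sup>2 * 0)
       + integral {0..x} (\<lambda>t. (norm a + b * L) * norm (?u (Suc n) t - ?u n t))"
      by (rule volterra_diff_le[OF picard_continuous picard_continuous cg cg L[OF _ tube tube] L0 _ M x]) auto
    also have "\<dots> = integral {0..x} (\<lambda>t. (norm a + b * L) * norm (?u (Suc n) t - ?u n t))" by simp
    also have "\<dots> \<le> integral {0..x} (\<lambda>t. (norm a + b * L) * (d * (1/2)^n * exp (K * t)))"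
    proof (rule integral_le)
      have s: "continuous_on {0..x} (?u m)" for m
        using x by (intro continuous_on_subset[OF picard_continuous]) auto
      show "(\<lambda>t. (norm a + b * L) * norm (?u (Suc n) t - ?u n t)) integrable_on {0..x}"
        by (intro integrable_continuous_interval continuous_intros s)
      show "(\<lambda>t. (norm a + b * L) * (d * (1/2)^n * exp (K * t))) integrable_on {0..x}"
        by (intro integrable_continuous_interval continuous_intros)
      fix t assume "t \<in> {0..x}"
      then have "t \<in> {0..b}" using x by auto
      then show "(norm a + b * L) * norm (?u (Suc n) t - ?u n t) \<le> (norm a + b * L) * (d * (1/2)^n * exp (K * t))"
        using Suc b L0 by (intro mult_left_mono) auto
    qed
    also have "\<dots> = (norm a + b * L) * (d * (1/2)^n) / K * (exp (K * x) - 1)"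
    proof (rule integral_unique)
      have "((\<lambda>t. (norm a + b * L) * (d * (1/2)^n * exp (K * t))) has_integral
          (norm a + b * L) * (d * (1/2)^n) / K * exp (K * x) - (norm a + b * L) * (d * (1/2)^n) / K * exp (K * 0)) {0..x}"
      proof (rule fundamental_theorem_of_calculus)
        show "((\<lambda>t. (norm a + b * L) * (d * (1/2)^n) / K * exp (K * t)) has_vector_derivative
            (norm a + b * L) * (d * (1/2)^n * exp (K * t))) (at t within {0..x})" for t
          unfolding has_real_derivative_iff_has_vector_derivative[symmetric]
          by (rule derivative_eq_intros refl)+ (use K0 in simp)
      qed (use x in auto)
      then show "((\<lambda>t. (norm a + b * L) * (d * (1/2)^n * exp (K * t))) has_integral
          (norm a + b * L) * (d * (1/2)^n) / K * (exp (K * x) - 1)) {0..x}"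
        by (simp add: right_diff_distrib)
    qed
    also have "\<dots> \<le> (d * (1/2)^n) * (1/2) * exp (K * x)"
    proof -
      have "(norm a + b * L) / K \<le> 1/2" using K0 by (simp add: field_simps)
      then have "(norm a + b * L) / K * (d * (1/2)^n) * (exp (K * x) - 1) \<le> 1/2 * (d * (1/2)^n) * exp (K * x)"
        using d0 K0 x b L0 by (intro mult_mono) auto
      then show ?thesis by (simp add: mult_ac)
    qed
    finally show ?thesis by simp
  qed
  show ?case using 1 2 by blast
qed

lemma picard_tube: "x \<in> {0..b} \<Longrightarrow> norm (picard g a p w n x - w x) \<le> \<rho>"
proof -
  assume x: "x \<in> {0..b}"
  have "norm (picard g a p w n x - w x) \<le> 2 * d * (1 - (1/2)^n) * exp (K * x)" using picard_bounds x by blast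
  also have "\<dots> \<le> 2 * d * 1 * exp (K * b)"
    using d0 x K0 by (intro mult_mono) (auto simp: power_le_one)
  finally show ?thesis using small by simp
qed

lemma picard_step: "x \<in> {0..b} \<Longrightarrow> norm (picard g a p w (Suc n) x - picard g a p w n x) \<le> \<rho> * (1/2)^Suc n"
proof -
  assume x: "x \<in> {0..b}"
  have "norm (picard g a p w (Suc n) x - picard g a p w n x) \<le> d * (1/2)^n * exp (K * x)" using picard_bounds x by blast
  also have "\<dots> \<le> d * (1/2)^n * exp (K * b)" using d0 x K0 by (intro mult_left_mono) auto
  also have "\<dots> = (2 * d * exp (K * b)) * (1/2)^Suc n" by simp
  also have "\<dots> \<le> \<rho> * (1/2)^Suc n" using small by (intro mult_right_mono) auto
  finally show ?thesis .
qed

text \<open>The geometric error bound is recorded because it depends on a and p through \<rho> only: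
  for a common tube radius the iterates converge uniformly in the parameters, and holomorphy
  survives the limit.\<close>

lemma picard_limit:
  obtains u where "volterra_sol b g a p u" "\<And>x. x \<in> {0..b} \<Longrightarrow> norm (u x - w x) \<le> \<rho>"
    "\<And>x n. x \<in> {0..b} \<Longrightarrow> norm (u x - picard g a p w n x) \<le> \<rho> * (1/2)^n"
proof -
  let ?u = "picard g a p w"
  have \<rho>: "\<rho> \<ge> 0" using picard_tube[of 0 0] b by simp
  have far: "norm (?u (n + k) x - ?u n x) \<le> \<rho> * (1/2)^n * (1 - (1/2)^k)" if x: "x \<in> {0..b}" for x n k
  proof (induction k)
    case (Suc k)
    have "norm (?u (n + Suc k) x - ?u n x) \<le> norm (?u (Suc (n + k)) x - ?u (n + k) x) + norm (?u (n + k) x - ?u n x)"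
      using norm_triangle_ineq[of "?u (Suc (n + k)) x - ?u (n + k) x" "?u (n + k) x - ?u n x"]
      by (simp del: picard.simps)
    also have "\<dots> \<le> \<rho> * (1/2)^Suc (n + k) + \<rho> * (1/2)^n * (1 - (1/2)^k)"
      using picard_step[OF x] Suc by (intro add_mono)
    finally show ?case by (simp add: algebra_simps power_add)
  qed simp
  have far': "norm (?u m x - ?u n x) \<le> \<rho> * (1/2)^n" if x: "x \<in> {0..b}" and "m \<ge> n" for x n m
  proof -
    obtain k where k: "m = n + k" using \<open>m \<ge> n\<close> le_Suc_ex by blast
    have "\<rho> * (1/2)^n * (1 - (1/2)^k) \<le> \<rho> * (1/2)^n * 1" using \<rho> by (intro mult_left_mono) auto
    then show ?thesis using far[OF x, of n k] k by simp
  qed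
  have lim0: "(\<lambda>n. \<rho> * (1/2)^n) \<longlonglongrightarrow> 0"
    by (intro tendsto_mult_right_zero LIMSEQ_power_zero) simp
  have conv: "convergent (\<lambda>n. ?u n x)" if x: "x \<in> {0..b}" for x
  proof (rule Cauchy_convergent, rule metric_CauchyI)
    fix e :: real assume "e > 0"
    then obtain N where N: "\<rho> * (1/2)^N < e / 2"
      using order_tendstoD(2)[OF lim0, of "e/2"] by (auto simp: eventually_sequentially)
    show "\<exists>M. \<forall>m\<ge>M. \<forall>n\<ge>M. dist (?u m x) (?u n x) < e"
    proof (intro exI[of _ N] allI impI)
      fix m n assume "m \<ge> N" "n \<ge> N"
      then have "dist (?u m x) (?u N x) < e / 2" "dist (?u n x) (?u N x) < e / 2"
        using far'[OF x] N by (force simp: dist_norm)+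
      then show "dist (?u m x) (?u n x) < e" by (rule dist_triangle_half_l)
    qed
  qed
  define u where "u x = lim (\<lambda>n. ?u n x)" for x
  have lim: "(\<lambda>n. ?u n x) \<longlonglongrightarrow> u x" if "x \<in> {0..b}" for x
    using conv[OF that] by (simp add: u_def convergent_LIMSEQ_iff)
  have est: "norm (u x - ?u n x) \<le> \<rho> * (1/2)^n" if x: "x \<in> {0..b}" for x n
  proof (rule Lim_bounded)
    show "(\<lambda>m. norm (?u m x - ?u n x)) \<longlonglongrightarrow> norm (u x - ?u n x)"
      by (intro tendsto_intros lim x)
    show "\<forall>m\<ge>n. norm (?u m x - ?u n x) \<le> \<rho> * (1/2)^n" using far'[OF x] by blast
  qed
  have tube: "norm (u x - w x) \<le> \<rho>" if x: "x \<in> {0..b}" for x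
    using est[OF x, of 0] by simp
  have unif: "uniform_limit {0..b} ?u u sequentially"
  proof (rule uniform_limitI)
    fix e :: real assume "e > 0"
    have "\<forall>\<^sub>F n in sequentially. \<rho> * (1/2)^n < e" by (rule order_tendstoD(2)[OF lim0 \<open>e > 0\<close>])
    then show "\<forall>\<^sub>F n in sequentially. \<forall>x\<in>{0..b}. dist (?u n x) (u x) < e"
    proof eventually_elim
      case (elim n)
      show ?case
      proof
        fix x assume "x \<in> {0..b}"
        from est[OF this, of n] elim show "dist (?u n x) (u x) < e"
          unfolding dist_norm norm_minus_commute[of "?u n x"] by linarith
      qed
    qed
  qed
  have cu: "continuous_on {0..b} u"
  proof (rule uniform_limit_theorem[OF _ unif])
    show "\<forall>\<^sub>F n in sequentially. continuous_on {0..b} (?u n)"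
      by (rule always_eventually) (simp add: picard_continuous)
  qed simp
  have "u x = volterra g a p u x" if x: "x \<in> {0..b}" for x
  proof -
    have "(\<lambda>n. volterra g a p (?u n) x) \<longlonglongrightarrow> volterra g a p u x"
    proof (rule LIM_zero_cancel, rule Lim_null_comparison)
      define M where "M = Sup ((\<lambda>x. norm (u x)) ` {0..b})"
      have "compact ((\<lambda>x. norm (u x)) ` {0..b})"
        by (intro compact_continuous_image continuous_intros cu) auto
      then have M: "norm (u t) \<le> M" if "t \<in> {0..b}" for t
        unfolding M_def using that by (intro cSup_upper) (auto simp: compact_imp_bounded bounded_imp_bdd_above)
      show "\<forall>\<^sub>F n in sequentially. norm (volterra g a p (?u n) x - volterra g a p u x)
          \<le> x * ((norm a + b * L) * (\<rho> * (1/2)^n))"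
      proof (rule always_eventually, rule allI)
        fix n
        have "norm (volterra g a p (?u n) x - volterra g a p u x)
          \<le> (norm (p - p) * b + norm (a - a) * M * b + b\<^sup>2 * 0)
           + integral {0..x} (\<lambda>t. (norm a + b * L) * norm (?u n t - u t))"
        proof (rule volterra_diff_le[where g = g and g' = g and d = 0 and M = M and b = b and L = L])
          fix t assume t: "t \<in> {0..b}"
          show "norm (g (?u n t) - g (u t)) \<le> L * norm (?u n t - u t)"
            using L[OF t picard_tube[OF t] tube[OF t]] .
        qed (use picard_continuous cu cg L0 M x in auto)
        also have "\<dots> = integral {0..x} (\<lambda>t. (norm a + b * L) * norm (?u n t - u t))" by simp
        also have "\<dots> \<le> integral {0..x} (\<lambda>t. (norm a + b * L) * (\<rho> * (1/2)^n))"
        proof (rule integral_le)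
          have sub: "{0..x} \<subseteq> {0..b}" using x by simp
          show "(\<lambda>t. (norm a + b * L) * norm (?u n t - u t)) integrable_on {0..x}"
            by (intro integrable_continuous_interval continuous_on_mult continuous_on_norm continuous_on_diff
                continuous_on_const continuous_on_subset[OF picard_continuous sub] continuous_on_subset[OF cu sub])
          fix t assume "t \<in> {0..x}"
          then have "t \<in> {0..b}" using x by auto
          then have "norm (?u n t - u t) \<le> \<rho> * (1/2)^n"
            using est[of t n] by (simp only: norm_minus_commute)
          then show "(norm a + b * L) * norm (?u n t - u t) \<le> (norm a + b * L) * (\<rho> * (1/2)^n)"
            by (rule mult_left_mono) (simp add: b L0)
        qed (rule integrable_const_ivl)
        also have "\<dots> = x * ((norm a + b * L) * (\<rho> * (1/2)^n))"
          using x unfolding integral_const_real by (simp only: measure_lborel_Icc atLeastAtMost_iff diff_0_right real_scaleR_def)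
        finally show "norm (volterra g a p (?u n) x - volterra g a p u x)
          \<le> x * ((norm a + b * L) * (\<rho> * (1/2)^n))" .
      qed
      show "(\<lambda>n. x * ((norm a + b * L) * (\<rho> * (1/2)^n))) \<longlonglongrightarrow> 0"
        by (rule tendsto_mult_right_zero, rule tendsto_mult_right_zero, rule lim0)
    qed
    moreover have "(\<lambda>n. volterra g a p (?u n) x) \<longlonglongrightarrow> u x"
      using LIMSEQ_Suc[OF lim[OF x]] by simp
    ultimately show ?thesis by (rule LIMSEQ_unique[rotated])
  qed
  then have "volterra_sol b g a p u" using cu by (simp add: volterra_sol_def)
  then show ?thesis by (rule that[OF _ tube est])
qed

lemma picard_ex:
  "\<exists>u. volterra_sol b g a p u \<and> (\<forall>x\<in>{0..b}. norm (u x - w x) \<le> \<rho>) \<and>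
     (\<forall>x\<in>{0..b}. \<forall>n. norm (u x - picard g a p w n x) \<le> \<rho> * (1/2)^n)"
proof (rule picard_limit)
  fix u assume "volterra_sol b g a p u" "\<And>x. x \<in> {0..b} \<Longrightarrow> norm (u x - w x) \<le> \<rho>"
    "\<And>x n. x \<in> {0..b} \<Longrightarrow> norm (u x - picard g a p w n x) \<le> \<rho> * (1/2)^n"
  then show ?thesis by blast
qed

end

section \<open>From the Volterra equation to the differential equation and back\<close>

definition vdot :: "(real \<Rightarrow> real) \<Rightarrow> real \<Rightarrow> real \<Rightarrow> (real \<Rightarrow> real) \<Rightarrow> real \<Rightarrow> real" where
  "vdot g a p u x = p - a * u x - integral {0..x} (\<lambda>t. g (u t))"

lemma volterra_ode:
  fixes g :: "real \<Rightarrow> real"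
  assumes u: "volterra_sol b g a p u" and cg: "continuous_on UNIV g" and x: "x \<in> {0..b}"
  shows "(u has_real_derivative vdot g a p u x) (at x within {0..b})"
    "(vdot g a p u has_real_derivative - a * vdot g a p u x - g (u x)) (at x within {0..b})"
    "u 0 = 0" "vdot g a p u 0 = p"
proof -
  have cu: "continuous_on {0..b} u" using u by (simp add: volterra_sol_def)
  have cgu: "continuous_on {0..b} (\<lambda>t. g (u t))"
    by (intro continuous_on_compose2[OF cg cu]) auto
  show 1: "(u has_real_derivative vdot g a p u x) (at x within {0..b})"
    using volterra_derivative(1)[OF u cg x]
    by (simp add: vdot_def has_real_derivative_iff_has_vector_derivative)
  have 2: "((\<lambda>y. integral {0..y} (\<lambda>t. g (u t))) has_real_derivative g (u x)) (at x within {0..b})"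
    using integral_has_vector_derivative[OF cgu x]
    by (simp add: has_real_derivative_iff_has_vector_derivative)
  have "((\<lambda>y. p - a * u y - integral {0..y} (\<lambda>t. g (u t))) has_real_derivative
      0 - a * vdot g a p u x - g (u x)) (at x within {0..b})"
    by (intro DERIV_diff DERIV_cmult 1 2 DERIV_const)
  then show "(vdot g a p u has_real_derivative - a * vdot g a p u x - g (u x)) (at x within {0..b})"
    by (simp add: vdot_def[abs_def])
  show "u 0 = 0" by (rule volterra_derivative(2)[OF u cg x])
  then show "vdot g a p u 0 = p" by (simp add: vdot_def)
qed

text \<open>By the equation, v + a u plus the integral of g(u) is constant; one more integration
  gives the Volterra form. This is how reversed, shifted, rescaled or explicit functions are
  recognised as solutions, to which uniqueness then applies.\<close>

lemma ode_volterra: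
  fixes g :: "real \<Rightarrow> real"
  assumes b: "b \<ge> 0" and cg: "continuous_on UNIV g"
    and du: "\<And>x. x \<in> {0..b} \<Longrightarrow> (u has_real_derivative v x) (at x within {0..b})"
    and dv: "\<And>x. x \<in> {0..b} \<Longrightarrow> (v has_real_derivative - a * v x - g (u x)) (at x within {0..b})"
    and u0: "u 0 = 0"
  shows "volterra_sol b g a (v 0) u" "\<And>x. x \<in> {0..b} \<Longrightarrow> v x = vdot g a (v 0) u x"
proof -
  have cu: "continuous_on {0..b} u" by (rule DERIV_continuous_on[OF du])
  have cgu: "continuous_on {0..b} (\<lambda>t. g (u t))"
    by (intro continuous_on_compose2[OF cg cu]) auto
  have ctgu: "continuous_on {0..b} (\<lambda>t. t * g (u t))" by (intro continuous_intros cgu)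
  have D: "((\<lambda>y. integral {0..y} f) has_real_derivative f x) (at x within {0..b})"
    if "continuous_on {0..b} f" "x \<in> {0..b}" for f x
    using integral_has_vector_derivative[OF that]
    by (simp add: has_real_derivative_iff_has_vector_derivative)
  have "\<exists>c. \<forall>x\<in>{0..b}. v x + a * u x + integral {0..x} (\<lambda>t. g (u t)) = c"
  proof (rule has_field_derivative_zero_constant)
    fix x assume x: "x \<in> {0..b}"
    have "((\<lambda>x. v x + a * u x + integral {0..x} (\<lambda>t. g (u t))) has_real_derivative
      (- a * v x - g (u x)) + a * v x + g (u x)) (at x within {0..b})"
      by (intro DERIV_add DERIV_cmult D du dv x cgu)
    then show "((\<lambda>x. v x + a * u x + integral {0..x} (\<lambda>t. g (u t))) has_real_derivative 0) (at x within {0..b})"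
      by simp
  qed simp
  then obtain c where c: "\<And>x. x \<in> {0..b} \<Longrightarrow> v x + a * u x + integral {0..x} (\<lambda>t. g (u t)) = c" by blast
  have "c = v 0" using c[of 0] b u0 by simp
  then show v: "v x = vdot g a (v 0) u x" if "x \<in> {0..b}" for x
    using c[OF that] by (simp add: vdot_def)
  let ?V = "\<lambda>x. v 0 * x - a * integral {0..x} u - x * integral {0..x} (\<lambda>t. g (u t)) + integral {0..x} (\<lambda>t. t * g (u t))"
  have "\<exists>c. \<forall>x\<in>{0..b}. u x - ?V x = c"
  proof (rule has_field_derivative_zero_constant)
    fix x assume x: "x \<in> {0..b}"
    have "((\<lambda>x. u x - ?V x) has_real_derivative
      v x - (v 0 * 1 - a * u x - (1 * integral {0..x} (\<lambda>t. g (u t)) + g (u x) * x) + x * g (u x))) (at x within {0..b})"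
      by (intro DERIV_diff DERIV_add DERIV_cmult DERIV_mult D du x cgu ctgu cu DERIV_ident)
    then show "((\<lambda>x. u x - ?V x) has_real_derivative 0) (at x within {0..b})"
      using v[OF x] by (simp add: vdot_def)
  qed simp
  then obtain c' where c': "\<And>x. x \<in> {0..b} \<Longrightarrow> u x - ?V x = c'" by blast
  moreover have "c' = 0" using c'[of 0] b u0 by simp
  ultimately show "volterra_sol b g a (v 0) u"
    using cu volterra_eq[OF cu cg] by (simp add: volterra_sol_def)
qed

lemma volterra_sol_subset:
  assumes "volterra_sol b g a p u" "b' \<le> b"
  shows "volterra_sol b' g a p u"
proof -
  have "{0..b'} \<subseteq> {0..b}" using assms(2) by auto
  then show ?thesis using assms(1) continuous_on_subset unfolding volterra_sol_def by blast
qed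

text \<open>The substitution w = exp (a x / 2) u removes the damping: w'' = exp (a x / 2) (a^2 u / 4
  - g(u)). The function differentiated here is the Wronskian w' sin - w cos of w and sin.\<close>

lemma volterra_sin_deriv:
  fixes g :: "real \<Rightarrow> real"
  assumes u: "volterra_sol b g a p u" and cg: "continuous_on UNIV g" and x: "x \<in> {0..b}"
  shows "((\<lambda>x. exp (a * x / 2) * ((vdot g a p u x + a / 2 * u x) * sin x - u x * cos x)) has_real_derivative
    exp (a * x / 2) * sin x * (a\<^sup>2 / 4 * u x + u x - g (u x))) (at x within {0..b})"
proof -
  note d = volterra_ode(1,2)[OF u cg x]
  have e: "((\<lambda>x. exp (a * x / 2)) has_real_derivative exp (a * x / 2) * (a / 2)) (at x within {0..b})"
    by (auto intro!: derivative_eq_intros)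
  have sc: "(sin has_real_derivative cos x) (at x within {0..b})" "(cos has_real_derivative - sin x) (at x within {0..b})"
    by (auto intro!: derivative_eq_intros)
  show ?thesis
    by (rule DERIV_cong[OF DERIV_mult[OF e DERIV_diff[OF DERIV_mult[OF DERIV_add[OF d(2) DERIV_cmult[OF d(1), of "a / 2"]] sc(1)]
          DERIV_mult[OF d(1) sc(2)]]]])
      (simp add: algebra_simps power2_eq_square)
qed

text \<open>The Wronskian with sin vanishes at 0 and would increase strictly up to T, although it is
  nonpositive at T because u vanishes there with nonpositive slope.\<close>

lemma volterra_no_early_zero:
  fixes g :: "real \<Rightarrow> real"
  assumes u: "volterra_sol b g a p u" and cg: "continuous_on UNIV g" and T: "0 < T" "T \<le> b" "T \<le> pi"
    and pos: "\<And>x. x \<in> {0<..<T} \<Longrightarrow> u x > 0" and uT: "u T = 0" and vT: "vdot g a p u T \<le> 0"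
    and q: "\<And>x. x \<in> {0<..<T} \<Longrightarrow> a\<^sup>2 / 4 * u x + u x - g (u x) > 0"
  shows False
proof -
  let ?v = "vdot g a p u"
  define \<Phi> where "\<Phi> x = exp (a * x / 2) * ((?v x + a / 2 * u x) * sin x - u x * cos x)" for x
  have D: "(\<Phi> has_real_derivative exp (a * x / 2) * sin x * (a\<^sup>2 / 4 * u x + u x - g (u x))) (at x within {0..b})"
    if x: "x \<in> {0..b}" for x
    unfolding \<Phi>_def by (rule volterra_sin_deriv[OF u cg x])
  have "\<Phi> 0 < \<Phi> T"
  proof (rule DERIV_pos_imp_increasing_open[OF T(1)])
    fix x assume x: "0 < x" "x < T"
    have "(\<Phi> has_real_derivative exp (a * x / 2) * sin x * (a\<^sup>2 / 4 * u x + u x - g (u x))) (at x)"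
      using D[of x] x T by (simp add: at_within_Icc_at)
    moreover have "exp (a * x / 2) * sin x * (a\<^sup>2 / 4 * u x + u x - g (u x)) > 0"
      using x T q[of x] by (intro mult_pos_pos sin_gt_zero) auto
    ultimately show "\<exists>y. (\<Phi> has_real_derivative y) (at x) \<and> 0 < y" by blast
  next
    have "continuous_on {0..b} \<Phi>" by (rule DERIV_continuous_on[OF D])
    then show "continuous_on {0..T} \<Phi>" by (rule continuous_on_subset) (use T in auto)
  qed
  moreover have "\<Phi> 0 = 0" using volterra_ode(3)[OF u cg, of 0] T by (simp add: \<Phi>_def)
  moreover have "\<Phi> T \<le> 0" unfolding \<Phi>_def uT
    using vT T by (simp add: mult_nonneg_nonpos mult_nonpos_nonneg sin_ge_zero)
  ultimately show False by simp
qed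

text \<open>At an interior maximum u' = 0, hence u'' = - g(u), which would be positive if the
  maximum exceeded R.\<close>

lemma volterra_max_le:
  fixes g :: "real \<Rightarrow> real"
  assumes u: "volterra_sol b g a p u" and cg: "continuous_on UNIV g" and T: "0 < T" "T \<le> b"
    and pos: "\<And>x. x \<in> {0<..<T} \<Longrightarrow> u x > 0" and uT: "u T = 0"
    and R: "\<And>y. y > R \<Longrightarrow> g y < 0"
  obtains m where "m \<in> {0<..<T}" "vdot g a p u m = 0" "\<And>x. x \<in> {0..T} \<Longrightarrow> u x \<le> u m" "u m \<le> R"
proof -
  let ?v = "vdot g a p u"
  have cu: "continuous_on {0..T} u"
    using volterra_sol_subset[OF u T(2)] by (simp add: volterra_sol_def)
  obtain m where m: "m \<in> {0..T}" "\<And>y. y \<in> {0..T} \<Longrightarrow> u y \<le> u m"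
    using continuous_attains_sup[OF _ _ cu] T by auto
  have u0: "u 0 = 0" using volterra_ode(3)[OF u cg, of 0] T by auto
  have "u m > 0" using m(2)[of "T/2"] pos[of "T/2"] T by auto
  then have mT: "m \<in> {0<..<T}" using m(1) u0 uT by (cases "m = 0"; cases "m = T") auto
  have du: "(u has_real_derivative ?v x) (at x)" "(?v has_real_derivative - a * ?v x - g (u x)) (at x)"
    if "x \<in> {0<..<T}" for x
    using volterra_ode(1,2)[OF u cg, of x] that T by (auto simp: at_within_Icc_at)
  have vm: "?v m = 0"
  proof (rule DERIV_local_max[OF du(1)[OF mT]])
    show "0 < min m (T - m)" using mT by simp
    show "\<forall>y. \<bar>m - y\<bar> < min m (T - m) \<longrightarrow> u y \<le> u m" using m(2) mT by (auto simp: abs_if split: if_splits)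
  qed
  have "u m \<le> R"
  proof (rule ccontr)
    assume "\<not> u m \<le> R"
    then have "- a * ?v m - g (u m) > 0" using R[of "u m"] vm by simp
    from DERIV_pos_inc_right[OF du(2)[OF mT] this]
    obtain d where d: "d > 0" "\<And>h. 0 < h \<Longrightarrow> h < d \<Longrightarrow> ?v (m + h) > 0" using vm by auto
    define y where "y = m + min d (T - m) / 2"
    have y: "m < y" "y < T" "y - m < d" using d mT by (auto simp: y_def min_def field_simps)
    have "u m < u y"
    proof (rule DERIV_pos_imp_increasing_open[OF y(1)])
      fix x assume x: "m < x" "x < y"
      show "\<exists>z. (u has_real_derivative z) (at x) \<and> z > 0"
        using du(1)[of x] d(2)[of "x - m"] x y mT by (intro exI[of _ "?v x"]) auto
    qed (rule continuous_on_subset[OF cu], use mT y in auto)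
    then show False using m(2)[of y] y mT by auto
  qed
  then show ?thesis using that mT vm m(2) by blast
qed

section \<open>The shooting function\<close>

text \<open>Positive solutions are bounded by \<open>3\<close>, so that truncating the nonlinearity there loses none of them while
  making it globally Lipschitz.\<close>

definition trunc :: "real \<Rightarrow> real \<Rightarrow> real" where
  "trunc l y = (let c = max 0 (min 3 y) in c + l * c\<^sup>2 - c ^ 4)"

lemma trunc_eq: "0 \<le> y \<Longrightarrow> y \<le> 3 \<Longrightarrow> trunc l y = y + l * y\<^sup>2 - y ^ 4"
  by (simp add: trunc_def)

lemma trunc_nonpos: "y \<le> 0 \<Longrightarrow> trunc l y = 0"
  by (simp add: trunc_def)

lemma trunc_large: "y \<ge> 3 \<Longrightarrow> trunc l y = 9 * l - 78"
  by (simp add: trunc_def)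

lemma continuous_trunc: "continuous_on UNIV (trunc l)"
  unfolding trunc_def Let_def by (intro continuous_intros)

lemma trunc_lipschitz: "norm (trunc l y - trunc l z) \<le> (109 + 6 * \<bar>l\<bar>) * norm (y - z)"
proof -
  define c where "c = max 0 (min 3 y)"
  define d where "d = max 0 (min 3 z)"
  have cd: "0 \<le> c" "c \<le> 3" "0 \<le> d" "d \<le> 3" by (auto simp: c_def d_def)
  have le: "\<bar>c - d\<bar> \<le> \<bar>y - z\<bar>" by (auto simp: c_def d_def)
  have "trunc l y - trunc l z = (1 + l * (c + d) - (c + d) * (c\<^sup>2 + d\<^sup>2)) * (c - d)"
    by (simp add: trunc_def Let_def c_def[symmetric] d_def[symmetric] power2_eq_square power4_eq_xxxx algebra_simps)
  then have "\<bar>trunc l y - trunc l z\<bar> = \<bar>1 + l * (c + d) - (c + d) * (c\<^sup>2 + d\<^sup>2)\<bar> * \<bar>c - d\<bar>"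
    by (simp add: abs_mult)
  also have "\<dots> \<le> (109 + 6 * \<bar>l\<bar>) * \<bar>y - z\<bar>"
  \<comment> \<open>Since c and d lie in [0, 3], c + d is at most 6 and the sum of their squares at
    most 18, whence 6 |l| and 109 = 1 + 6 * 18.\<close>
  proof (intro mult_mono le)
    have "\<bar>l * (c + d)\<bar> \<le> \<bar>l\<bar> * 6" unfolding abs_mult using cd by (intro mult_mono) auto
    moreover have "(c + d) * (c\<^sup>2 + d\<^sup>2) \<le> 6 * 18"
    proof (rule mult_mono)
      have "c\<^sup>2 \<le> 3\<^sup>2" "d\<^sup>2 \<le> 3\<^sup>2" using power_mono[of c 3 2] power_mono[of d 3 2] cd by auto
      then show "c\<^sup>2 + d\<^sup>2 \<le> 18" by simp
    qed (use cd in auto)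
    moreover have "0 \<le> (c + d) * (c\<^sup>2 + d\<^sup>2)" using cd by simp
    ultimately show "\<bar>1 + l * (c + d) - (c + d) * (c\<^sup>2 + d\<^sup>2)\<bar> \<le> 109 + 6 * \<bar>l\<bar>" by linarith
  qed auto
  finally show ?thesis by simp
qed

text \<open>By the Wronskian argument this confines positive solutions to 0 < l < 4. The bound 4
  makes l / 2 - y \<ge> 1 in the critical range y \<le> 1, where the term y^2 (y - 1) is negative
  but larger than -1.\<close>

lemma nonlinearity_sub_pos:
  fixes y l :: real
  assumes "y > 0" "l \<le> 0 \<or> 4 \<le> l"
  shows "l\<^sup>2 / 4 * y + y - (y + l * y\<^sup>2 - y ^ 4) > 0"
proof -
  have "l\<^sup>2 / 4 * y + y - (y + l * y\<^sup>2 - y ^ 4) = y * ((l / 2 - y)\<^sup>2 + y\<^sup>2 * (y - 1))"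
    by (simp add: power2_eq_square power4_eq_xxxx algebra_simps)
  moreover have "(l / 2 - y)\<^sup>2 + y\<^sup>2 * (y - 1) > 0"
  proof -
    have e: "(l / 2 - y)\<^sup>2 + y\<^sup>2 * (y - 1) = l\<^sup>2 / 4 - l * y + y ^ 3"
      by (simp add: power2_eq_square power3_eq_cube algebra_simps)
    have y3: "y ^ 3 > 0" using assms by simp
    show ?thesis
    proof (cases "l \<le> 0")
      case True
      then have "l * y \<le> 0" using assms by (simp add: mult_nonpos_nonneg)
      then show ?thesis unfolding e using y3 zero_le_power2[of l] by linarith
    next
      case False
      then have l: "l \<ge> 4" using assms by simp
      show ?thesis
      proof (cases "y > 1")
        case True
        then have "y\<^sup>2 * (y - 1) > 0" by simp
        then show ?thesis by (simp add: add_nonneg_pos)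
      next
        case False
        then have "(l / 2 - y)\<^sup>2 \<ge> 1\<^sup>2" using l by (intro power_mono) auto
        moreover have "y\<^sup>2 * (1 - y) \<le> 1 * (1 - y)" using False assms
          by (intro mult_right_mono) (auto simp: power_le_one)
        ultimately show ?thesis using assms by (simp add: algebra_simps)
      qed
    qed
  qed
  ultimately show ?thesis using assms by simp
qed

text \<open>Beyond y = 3 the nonlinearity is frozen at 9 l - 78, and it remains to see that 3 l^2 /
  4 - 9 l + 78, whose minimum is 51 at l = 6, is positive.\<close>

lemma trunc_sub_pos:
  assumes "y > 0" "l \<le> 0 \<or> 4 \<le> l"
  shows "l\<^sup>2 / 4 * y + y - trunc l y > 0"
proof (cases "y \<le> 3")
  case True
  then show ?thesis using nonlinearity_sub_pos[OF assms] assms(1) by (simp add: trunc_eq)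
next
  case False
  then have y: "y > 3" by simp
  have "l\<^sup>2 / 4 * y \<ge> l\<^sup>2 / 4 * 3" using y by (intro mult_left_mono) auto
  moreover have "3 * l\<^sup>2 / 4 - 9 * l + 78 > 0"
  proof -
    have "3 * l\<^sup>2 / 4 - 9 * l + 78 = 3 / 4 * (l - 6)\<^sup>2 + 51" by (simp add: power2_eq_square algebra_simps)
    then show ?thesis using zero_le_power2[of "l - 6"] by linarith
  qed
  ultimately show ?thesis using y by (simp add: trunc_large)
qed

section \<open>The truncated flow and its dependence on the data\<close>

lemma flow_exists: "\<exists>u. volterra_sol pi (trunc l) l p u"
proof -
  let ?K = "2 * (norm l + pi * (109 + 6 * \<bar>l\<bar>)) + 1"
  \<comment> \<open>As the Lipschitz bound is global, the tube radius can be chosen as whatever the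
    smallness condition demands.\<close>
  interpret picard_tube "trunc l" l p "\<lambda>_. 0" pi "109 + 6 * \<bar>l\<bar>" "\<bar>p\<bar> * pi" "2 * (\<bar>p\<bar> * pi) * exp (?K * pi)"
  proof
    fix x assume x: "x \<in> {0..pi}"
    show "norm (volterra (trunc l) l p (\<lambda>_. 0) x - 0) \<le> \<bar>p\<bar> * pi"
      using x by (auto simp: volterra_def trunc_nonpos abs_mult intro!: mult_left_mono)
  qed (use continuous_trunc trunc_lipschitz in auto)
  obtain u where "volterra_sol pi (trunc l) l p u" by (rule picard_limit)
  then show ?thesis by blast
qed

definition flow :: "real \<Rightarrow> real \<Rightarrow> real \<Rightarrow> real" where
  "flow l p = (SOME u. volterra_sol pi (trunc l) l p u)"

lemma flow_sol: "volterra_sol pi (trunc l) l p (flow l p)"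
  unfolding flow_def by (rule someI_ex[OF flow_exists])

lemma flow_unique:
  assumes "volterra_sol b (trunc l) l p u" "b \<le> pi" "x \<in> {0..b}"
  shows "u x = flow l p x"
  by (rule volterra_sol_unique[OF assms(1) volterra_sol_subset[OF flow_sol assms(2)] continuous_trunc
        trunc_lipschitz _ assms(3)]) auto

definition dflow :: "real \<Rightarrow> real \<Rightarrow> real \<Rightarrow> real" where
  "dflow l p = vdot (trunc l) l p (flow l p)"

lemma flow_deriv:
  assumes "x \<in> {0..pi}"
  shows "(flow l p has_real_derivative dflow l p x) (at x within {0..pi})"
    "(dflow l p has_real_derivative - l * dflow l p x - trunc l (flow l p x)) (at x within {0..pi})"
  using volterra_ode(1,2)[OF flow_sol continuous_trunc assms] by (simp_all add: dflow_def[abs_def])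

lemma flow_0 [simp]: "flow l p 0 = 0" "dflow l p 0 = p"
  using volterra_ode(3,4)[OF flow_sol continuous_trunc, of 0] by (simp_all add: dflow_def)

lemma continuous_flow: "continuous_on {0..pi} (flow l p)" "continuous_on {0..pi} (dflow l p)"
  by (rule DERIV_continuous_on, erule flow_deriv)+

lemma flow_lipschitz:
  obtains C where "C \<ge> 0"
    "\<And>l p x. \<bar>l - l0\<bar> \<le> 1 \<Longrightarrow> x \<in> {0..pi} \<Longrightarrow> \<bar>flow l p x - flow l0 p0 x\<bar> \<le> C * (\<bar>l - l0\<bar> + \<bar>p - p0\<bar>)"
proof -
  obtain M where M: "\<And>t. t \<in> {0..pi} \<Longrightarrow> norm (flow l0 p0 t) \<le> M"
  proof -
    have "compact (flow l0 p0 ` {0..pi})" by (intro compact_continuous_image continuous_flow) auto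
    then obtain M where "\<forall>y\<in>flow l0 p0 ` {0..pi}. norm y \<le> M" by (auto dest!: compact_imp_bounded simp: bounded_iff)
    then show ?thesis using that by blast
  qed
  have M0: "M \<ge> 0" using order_trans[OF norm_ge_zero M[of 0]] by simp
  define A where "A = exp ((2 * ((\<bar>l0\<bar> + 1) + pi * (109 + 6 * (\<bar>l0\<bar> + 1))) + 1) * pi)"
  \<comment> \<open>The three summands account for the change of p, of the damping, and of l inside
    the nonlinearity, where the clipped value squared is at most 9.\<close>
  define B where "B = pi + M * pi + pi\<^sup>2 * 9"
  have B0: "B \<ge> 0" "A \<ge> 0" using M0 by (auto simp: B_def A_def)
  have "\<bar>flow l p x - flow l0 p0 x\<bar> \<le> 2 * B * A * (\<bar>l - l0\<bar> + \<bar>p - p0\<bar>)"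
    if l: "\<bar>l - l0\<bar> \<le> 1" and x: "x \<in> {0..pi}" for l p x
  proof -
    have "norm (flow l p x - flow l0 p0 x) \<le> 2 * (norm (p - p0) * pi + norm (l - l0) * M * pi + pi\<^sup>2 * (9 * \<bar>l - l0\<bar>))
       * exp ((2 * (norm l + pi * (109 + 6 * \<bar>l\<bar>)) + 1) * x)"
    proof (rule volterra_sol_dist[OF flow_sol flow_sol continuous_trunc continuous_trunc trunc_lipschitz _ _ M x])
      fix t
      define c where "c = max 0 (min 3 (flow l0 p0 t))"
      have "c\<^sup>2 \<le> 3\<^sup>2" by (rule power_mono) (auto simp: c_def)
      moreover have "trunc l (flow l0 p0 t) - trunc l0 (flow l0 p0 t) = (l - l0) * c\<^sup>2"
        by (simp add: trunc_def Let_def c_def algebra_simps)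
      ultimately show "norm (trunc l (flow l0 p0 t) - trunc l0 (flow l0 p0 t)) \<le> 9 * \<bar>l - l0\<bar>"
        using mult_left_mono[of "c\<^sup>2" 9 "\<bar>l - l0\<bar>"] by (simp add: abs_mult)
    qed auto
    also have "\<dots> \<le> (2 * B * (\<bar>l - l0\<bar> + \<bar>p - p0\<bar>)) * A"
    proof (rule mult_mono)
      have "\<bar>p - p0\<bar> * pi + \<bar>l - l0\<bar> * M * pi + pi\<^sup>2 * (9 * \<bar>l - l0\<bar>)
        \<le> (\<bar>p - p0\<bar> * pi + \<bar>l - l0\<bar> * M * pi + pi\<^sup>2 * (9 * \<bar>l - l0\<bar>))
          + (\<bar>l - l0\<bar> * pi + \<bar>p - p0\<bar> * (M * pi + pi\<^sup>2 * 9))" using M0 by simp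
      also have "\<dots> = B * (\<bar>l - l0\<bar> + \<bar>p - p0\<bar>)" by (simp add: B_def algebra_simps)
      finally show "2 * (norm (p - p0) * pi + norm (l - l0) * M * pi + pi\<^sup>2 * (9 * \<bar>l - l0\<bar>))
         \<le> 2 * B * (\<bar>l - l0\<bar> + \<bar>p - p0\<bar>)" by simp
      have l': "\<bar>l\<bar> \<le> \<bar>l0\<bar> + 1" using l by linarith
      have "(2 * (norm l + pi * (109 + 6 * \<bar>l\<bar>)) + 1) * x \<le> (2 * ((\<bar>l0\<bar> + 1) + pi * (109 + 6 * (\<bar>l0\<bar> + 1))) + 1) * pi"
        using l' x by (intro mult_mono add_mono) auto
      then show "exp ((2 * (norm l + pi * (109 + 6 * \<bar>l\<bar>)) + 1) * x) \<le> A" by (simp add: A_def)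
    qed (use B0 in auto)
    finally show ?thesis by (simp add: mult_ac)
  qed
  then show ?thesis using that[of "2 * B * A"] B0 by auto
qed

text \<open>The flow is compared with the zero solution. The range |l| \<le> 4 contains all l for
  which a nonpositive end value is possible, and on it the constant is uniform.\<close>

lemma flow_linear_bound:
  obtains C where "C > 0" "\<And>l p x. \<bar>l\<bar> \<le> 4 \<Longrightarrow> x \<in> {0..pi} \<Longrightarrow> \<bar>flow l p x\<bar> \<le> C * \<bar>p\<bar>"
proof -
  define A where "A = exp ((2 * (4 + pi * (109 + 24)) + 1) * pi)"
  have "\<bar>flow l p x\<bar> \<le> 2 * pi * A * \<bar>p\<bar>" if l: "\<bar>l\<bar> \<le> 4" and x: "x \<in> {0..pi}" for l p x
  proof -
    have z: "volterra_sol pi (trunc l) l 0 (\<lambda>_. 0)" by (simp add: volterra_sol_def volterra_def trunc_nonpos)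
    have "norm (flow l p x - 0) \<le> 2 * (norm (p - 0) * pi + norm (l - l) * 0 * pi + pi\<^sup>2 * 0)
       * exp ((2 * (norm l + pi * (109 + 6 * \<bar>l\<bar>)) + 1) * x)"
    proof (rule volterra_sol_dist[where w = "\<lambda>_. 0" and g = "trunc l" and g' = "trunc l" and b = pi and M = 0 and d = 0
          and L = "109 + 6 * \<bar>l\<bar>"])
      show "norm (trunc l (flow l p t) - trunc l 0) \<le> (109 + 6 * \<bar>l\<bar>) * norm (flow l p t - 0)" for t
        by (rule trunc_lipschitz)
    qed (use flow_sol z continuous_trunc x in simp_all)
    also have "\<dots> \<le> 2 * (\<bar>p\<bar> * pi) * A"
    proof -
      have "pi * (109 + 6 * \<bar>l\<bar>) \<le> pi * (109 + 24)"
        by (rule mult_left_mono) (use l in linarith, simp)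
      then have "2 * (norm l + pi * (109 + 6 * \<bar>l\<bar>)) + 1 \<le> 2 * (4 + pi * (109 + 24)) + 1"
        using l by (simp only: real_norm_def add_le_cancel_right) (intro mult_left_mono add_mono, simp_all)
      then have "(2 * (norm l + pi * (109 + 6 * \<bar>l\<bar>)) + 1) * x \<le> (2 * (4 + pi * (109 + 24)) + 1) * pi"
        using x by (rule_tac mult_mono) auto
      then have "exp ((2 * (norm l + pi * (109 + 6 * \<bar>l\<bar>)) + 1) * x) \<le> A" by (simp add: A_def)
      from mult_left_mono[OF this, of "2 * (\<bar>p\<bar> * pi)"] show ?thesis by simp
    qed
    finally show ?thesis by (simp add: mult_ac)
  qed
  moreover have "2 * pi * A > 0" by (simp add: A_def)
  ultimately show ?thesis using that by blast
qed

lemma DERIV_compose_within: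
  fixes f :: "real \<Rightarrow> real"
  assumes "(f has_real_derivative D) (at (g x) within S)" "(g has_real_derivative E) (at x within R)" "g ` R \<subseteq> S"
  shows "((\<lambda>x. f (g x)) has_real_derivative D * E) (at x within R)"
  using DERIV_image_chain[OF DERIV_subset[OF assms(1,3)] assms(2)] by (simp add: o_def)

text \<open>This is the gain from truncating at 0: below zero the equation is linear without
  restoring force, so the flow cannot return after its first zero. Positivity on (0, pi) can thus be
  read off from the end value alone.\<close>

lemma flow_first_zero:
  assumes p: "p > 0" and x0: "x0 \<in> {0<..pi}" "flow l p x0 \<le> 0"
  obtains T where "0 < T" "T \<le> x0" "flow l p T = 0" "\<And>x. x \<in> {0<..<T} \<Longrightarrow> flow l p x > 0" "dflow l p T < 0"
    "\<And>x. x \<in> {T<..pi} \<Longrightarrow> flow l p x < 0"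
proof -
  let ?u = "flow l p" and ?v = "dflow l p"
  have d0: "(?u has_real_derivative p) (at 0 within {0..pi})"
    using flow_deriv(1)[of 0 l p] by simp
  from has_real_derivative_pos_inc_right[OF d0 p]
  obtain d where d: "d > 0" "\<And>h. h > 0 \<Longrightarrow> 0 + h \<in> {0..pi} \<Longrightarrow> h < d \<Longrightarrow> ?u 0 < ?u (0 + h)" by blast
  then have pos0: "?u x > 0" if "0 < x" "x < d" "x \<le> pi" for x using that d(2)[of x] by simp
  define A where "A = {x \<in> {d..x0}. ?u x \<le> 0}"
  have x0d: "x0 \<ge> d" using pos0[of x0] x0 by force
  have cl: "continuous_on {d..x0} ?u" by (rule continuous_on_subset[OF continuous_flow(1)]) (use x0 d in auto)
  have "closed A" unfolding A_def
    by (rule continuous_on_closed_Collect_le[OF cl]) auto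
  then have "compact A" by (rule compact_Int_closed[of "{d..x0}", THEN back_subst[of compact], rotated])
      (auto simp: A_def)
  moreover have "x0 \<in> A" using x0 x0d by (simp add: A_def)
  ultimately obtain T where T: "T \<in> A" "\<And>y. y \<in> A \<Longrightarrow> T \<le> y" using compact_attains_inf[of A] by auto
  have T0: "0 < T" "T \<le> x0" "T \<le> pi" "?u T \<le> 0" using T(1) d x0 by (auto simp: A_def)
  have pos: "?u x > 0" if "x \<in> {0<..<T}" for x
  proof (cases "x < d")
    case True then show ?thesis using pos0[of x] that T0 by auto
  next
    case False
    then have "x \<in> {d..x0}" using that T0 by auto
    then show ?thesis using T(2)[of x] that unfolding A_def by (simp add: not_le[symmetric]) (metis not_le)
  qed
  have dT: "(?u has_real_derivative ?v T) (at T within {0..pi})" using flow_deriv(1)[of T l p] T0 by simp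
  have uT: "?u T = 0"
  proof (rule ccontr)
    assume "?u T \<noteq> 0"
    then have neg: "?u T < 0" using T0 by simp
    have "continuous_on {T/2..T} ?u" by (rule continuous_on_subset[OF continuous_flow(1)]) (use T0 in auto)
    moreover have "?u (T/2) > 0" using pos[of "T/2"] T0 by simp
    ultimately obtain y where y: "T/2 \<le> y" "y \<le> T" "?u y = 0"
      using IVT2'[of ?u T 0 "T/2"] neg T0 by auto
    then show False using pos[of y] T0 neg by (cases "y = T") auto
  qed
  have "?v T \<le> 0"
  proof (rule ccontr)
    assume "\<not> ?v T \<le> 0"
    from has_real_derivative_pos_inc_left[OF dT] this
    obtain e where e: "e > 0" "\<And>h. h > 0 \<Longrightarrow> T - h \<in> {0..pi} \<Longrightarrow> h < e \<Longrightarrow> ?u (T - h) < ?u T" by auto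
    define h where "h = min e T / 2"
    have "0 < h" "h < e" "h < T" using e T0 by (auto simp: h_def)
    then show False using e(2)[of h] pos[of "T - h"] uT T0 by auto
  qed
  moreover have "?v T \<noteq> 0"
  proof
    assume v0: "?v T = 0"
    \<comment> \<open>Run backwards from T, the flow solves the equation with damping - l and zero
      data, so uniqueness makes it vanish on all of [0, T].\<close>
    have "volterra_sol T (trunc l) (- l) (- ?v (T - 0)) (\<lambda>t. ?u (T - t))"
    proof (rule ode_volterra(1)[where v = "\<lambda>t. - ?v (T - t)"])
      fix t assume t: "t \<in> {0..T}"
      have im: "(-) T ` {0..T} \<subseteq> {0..pi}" using T0 by auto
      have g: "((-) T has_real_derivative - 1) (at t within {0..T})" by (auto intro!: derivative_eq_intros)
      have tT: "T - t \<in> {0..pi}" using t T0 by auto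
      show "((\<lambda>t. ?u (T - t)) has_real_derivative - ?v (T - t)) (at t within {0..T})"
        using DERIV_compose_within[OF flow_deriv(1)[OF tT, of l p] g im] by simp
      show "((\<lambda>t. - ?v (T - t)) has_real_derivative - (- l) * - ?v (T - t) - trunc l (?u (T - t))) (at t within {0..T})"
        by (rule DERIV_cong[OF DERIV_minus[OF DERIV_compose_within[OF flow_deriv(2)[OF tT, of l p] g im]]]) simp
    qed (use T0 uT continuous_trunc in auto)
    then have s: "volterra_sol T (trunc l) (- l) 0 (\<lambda>t. ?u (T - t))" using v0 by simp
    have z: "volterra_sol T (trunc l) (- l) 0 (\<lambda>_. 0)" by (simp add: volterra_sol_def volterra_def trunc_nonpos)
    have "?u (T - T/2) = 0"
      by (rule volterra_sol_unique[OF s z continuous_trunc trunc_lipschitz]) (use T0 in auto)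
    then show False using pos[of "T/2"] T0 by simp
  qed
  ultimately have vT: "?v T < 0" by simp
  have neg: "?u x < 0" if x: "x \<in> {T<..pi}" for x
  proof -
    define b where "b = pi - T"
    define E where "E t = integral {0..t} (\<lambda>s. exp (- l * s))" for t
    have E: "(E has_real_derivative exp (- l * t)) (at t within {0..b})" if "t \<in> {0..b}" for t
      unfolding E_def has_real_derivative_iff_has_vector_derivative
      by (rule integral_has_vector_derivative[OF _ that]) (intro continuous_intros)
    have E0: "E 0 = 0" by (simp add: E_def)
    have Epos: "E t > 0" if t: "t \<in> {0<..b}" for t
    proof -
      have "E 0 < E t"
      proof (rule DERIV_pos_imp_increasing_open[where f = E])
        show "0 < t" using t by simp
        fix s assume s: "0 < s" "s < t"
        then have "(E has_real_derivative exp (- l * s)) (at s)" using E[of s] t by (simp add: at_within_Icc_at)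
        then show "\<exists>y. (E has_real_derivative y) (at s) \<and> 0 < y" by (intro exI[of _ "exp (- l * s)"]) simp
      next
        show "continuous_on {0..t} E"
          by (rule continuous_on_subset[OF DERIV_continuous_on[OF E]]) (use t in auto)
      qed
      then show ?thesis using E0 by simp
    qed
    have b: "b \<ge> 0" using T0 by (simp add: b_def)
    have s1: "volterra_sol b (trunc l) l (?v (T + 0)) (\<lambda>t. ?u (T + t))"
    proof (rule ode_volterra(1)[where v = "\<lambda>t. ?v (T + t)"])
      fix t assume t: "t \<in> {0..b}"
      have im: "(+) T ` {0..b} \<subseteq> {0..pi}" using T0 by (auto simp: b_def)
      have g: "((+) T has_real_derivative 1) (at t within {0..b})" by (auto intro!: derivative_eq_intros)
      have tT: "T + t \<in> {0..pi}" using t T0 by (auto simp: b_def)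
      show "((\<lambda>t. ?u (T + t)) has_real_derivative ?v (T + t)) (at t within {0..b})"
        using DERIV_compose_within[OF flow_deriv(1)[OF tT, of l p] g im] by simp
      show "((\<lambda>t. ?v (T + t)) has_real_derivative - l * ?v (T + t) - trunc l (?u (T + t))) (at t within {0..b})"
        using DERIV_compose_within[OF flow_deriv(2)[OF tT, of l p] g im] by simp
    qed (use b uT continuous_trunc in auto)
    \<comment> \<open>For nonpositive values the equation is u'' + l u' = 0. This explicit function
      solves it and keeps the sign of the slope at T, because E is positive; by uniqueness it
      continues the flow.\<close>
    have s2: "volterra_sol b (trunc l) l (?v T * exp (- l * 0)) (\<lambda>t. ?v T * E t)"
    proof (rule ode_volterra(1)[where v = "\<lambda>t. ?v T * exp (- l * t)"])
      fix t assume t: "t \<in> {0..b}"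
      show "((\<lambda>t. ?v T * E t) has_real_derivative ?v T * exp (- l * t)) (at t within {0..b})"
        by (rule DERIV_cmult[OF E[OF t]])
      have "E t \<ge> 0" using Epos[of t] E0 t by (cases "t = 0") auto
      then have "?v T * E t \<le> 0" using vT by (simp add: mult_nonpos_nonneg)
      moreover have "((\<lambda>t. ?v T * exp (- l * t)) has_real_derivative - l * (?v T * exp (- l * t)) - 0) (at t within {0..b})"
        by (auto intro!: derivative_eq_intros)
      ultimately show "((\<lambda>t. ?v T * exp (- l * t)) has_real_derivative - l * (?v T * exp (- l * t)) - trunc l (?v T * E t)) (at t within {0..b})"
        by (simp add: trunc_nonpos)
    qed (use b E0 continuous_trunc in auto)
    have xb: "x - T \<in> {0..b}" using x by (auto simp: b_def)
    have "?u (T + (x - T)) = ?v T * E (x - T)"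
      by (rule volterra_sol_unique[OF s1 _ continuous_trunc trunc_lipschitz _ xb]) (use s2 in auto)
    moreover have "E (x - T) > 0" using Epos[of "x - T"] x by (auto simp: b_def)
    ultimately show ?thesis using vT by (simp add: mult_neg_pos)
  qed
  show ?thesis using that T0 uT pos vT neg by blast
qed

section \<open>Sign of the end value and a priori bounds\<close>

definition shoot :: "real \<Rightarrow> real \<Rightarrow> real" where
  "shoot l p = flow l p pi"

lemma continuous_shoot: "continuous_on UNIV (\<lambda>z. shoot (fst z) (snd z))"
proof (intro continuous_at_imp_continuous_on ballI)
  fix z0 :: "real \<times> real"
  obtain l0 p0 where z0: "z0 = (l0, p0)" by fastforce
  obtain C where C: "C \<ge> 0"
    "\<And>l p x. \<bar>l - l0\<bar> \<le> 1 \<Longrightarrow> x \<in> {0..pi} \<Longrightarrow> \<bar>flow l p x - flow l0 p0 x\<bar> \<le> C * (\<bar>l - l0\<bar> + \<bar>p - p0\<bar>)"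
    using flow_lipschitz[of l0 p0] by blast
  show "isCont (\<lambda>z. shoot (fst z) (snd z)) z0"
  proof (unfold isCont_def, rule LIM_zero_cancel, rule Lim_null_comparison)
    have "\<forall>\<^sub>F z in at z0. \<bar>fst z - l0\<bar> < 1"
    proof -
      have "((\<lambda>z. \<bar>fst z - l0\<bar>) \<longlongrightarrow> \<bar>fst z0 - l0\<bar>) (at z0)" by (intro tendsto_intros)
      then show ?thesis by (rule order_tendstoD(2)) (simp add: z0)
    qed
    then show "\<forall>\<^sub>F z in at z0. norm (shoot (fst z) (snd z) - shoot (fst z0) (snd z0)) \<le> C * (\<bar>fst z - l0\<bar> + \<bar>snd z - p0\<bar>)"
      by eventually_elim (use C(2) in \<open>simp add: shoot_def z0\<close>)
    have "((\<lambda>z. C * (\<bar>fst z - l0\<bar> + \<bar>snd z - p0\<bar>)) \<longlongrightarrow> C * (\<bar>fst z0 - l0\<bar> + \<bar>snd z0 - p0\<bar>)) (at z0)"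
      by (intro tendsto_intros)
    then show "((\<lambda>z. C * (\<bar>fst z - l0\<bar> + \<bar>snd z - p0\<bar>)) \<longlongrightarrow> 0) (at z0)" by (simp add: z0)
  qed
qed

text \<open>A zero inside (0, pi) would make the flow negative from there on, in particular at
  pi.\<close>

lemma shoot_nonneg_pos:
  assumes "p > 0" "shoot l p \<ge> 0" "x \<in> {0<..<pi}"
  shows "flow l p x > 0"
proof (rule ccontr)
  assume "\<not> ?thesis"
  then obtain T where "T \<le> x" "\<And>y. y \<in> {T<..pi} \<Longrightarrow> flow l p y < 0"
    using flow_first_zero[OF assms(1), of x l] assms(3) by (metis greaterThanAtMost_iff greaterThanLessThan_iff less_eq_real_def not_less)
  then have "shoot l p < 0" using assms(3) by (auto simp: shoot_def)
  then show False using assms(2) by simp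
qed

text \<open>A nonpositive end value means a first zero T \<le> pi with negative slope, and every
  bound is derived on [0, T]: the range of l from the Wronskian, the height from the maximum, p from
  the equation integrated up to the maximum. Negative end values are included because the sign of
  \<open>shoot\<close> off its zero set matters later.\<close>

lemma shoot_nonpos:
  assumes p: "p > 0" and G: "shoot l p \<le> 0"
  shows "0 < l" "l < 4" "\<And>x. x \<in> {0..pi} \<Longrightarrow> flow l p x \<le> 3" "p \<le> 200"
    "\<exists>x\<in>{0..pi}. l \<le> 4 * \<bar>flow l p x\<bar>"
proof -
  obtain T where T: "0 < T" "T \<le> pi" "flow l p T = 0" "\<And>x. x \<in> {0<..<T} \<Longrightarrow> flow l p x > 0" "dflow l p T < 0"
    "\<And>x. x \<in> {T<..pi} \<Longrightarrow> flow l p x < 0"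
    using flow_first_zero[OF p, of pi l] G by (auto simp: shoot_def)
  have ex: "\<exists>x\<in>{0<..<T}. l\<^sup>2 / 4 * flow l p x + flow l p x - trunc l (flow l p x) \<le> 0"
    using volterra_no_early_zero[OF flow_sol continuous_trunc T(1,2,2,4,3)] T(5)
    by (force simp: dflow_def not_less)
  then show l: "0 < l" "l < 4" using trunc_sub_pos T(4) by (meson not_less)+
  have neg: "trunc l y < 0" if "y > 3" for y using that l by (simp add: trunc_large)
  obtain m where m: "m \<in> {0<..<T}" "dflow l p m = 0" "\<And>x. x \<in> {0..T} \<Longrightarrow> flow l p x \<le> flow l p m" "flow l p m \<le> 3"
    using volterra_max_le[OF flow_sol continuous_trunc T(1,2,4,3) neg] unfolding dflow_def by blast
  show le3: "flow l p x \<le> 3" if "x \<in> {0..pi}" for x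
  proof (cases "x \<le> T")
    case True then show ?thesis using m(3)[of x] m(4) that by auto
  next
    case False then show ?thesis using T(6)[of x] that by auto
  qed
  have ge0: "flow l p x \<ge> 0" if "x \<in> {0..T}" for x
    using T(4)[of x] T(3) that by (cases "x = 0"; cases "x = T") auto
  \<comment> \<open>On 0 \<le> u \<le> 3 the terms u and l u^2 contribute at most 3 + 4 * 9.\<close>
  have tr: "trunc l (flow l p x) \<le> 39" if "x \<in> {0..m}" for x
  proof -
    have x: "flow l p x \<ge> 0" "flow l p x \<le> 3" using ge0[of x] le3[of x] that m(1) T by auto
    have "(flow l p x)\<^sup>2 \<le> 3\<^sup>2" using x by (intro power_mono) auto
    then have "l * (flow l p x)\<^sup>2 \<le> 4 * 9" using l by (intro mult_mono) auto
    then show ?thesis using x zero_le_power[OF x(1), of 4] unfolding trunc_eq[OF x] by linarith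
  qed
  \<comment> \<open>The slope vanishes at m, so the once integrated equation expresses p. The two
    terms are at most 4 * 3 and 39 * 4, in total 168.\<close>
  have "p = l * flow l p m + integral {0..m} (\<lambda>t. trunc l (flow l p t))"
    using m(2) by (simp add: dflow_def vdot_def)
  moreover have "l * flow l p m \<le> 4 * 3" using l m ge0[of m] by (intro mult_mono) auto
  moreover have "integral {0..m} (\<lambda>t. trunc l (flow l p t)) \<le> integral {0..m} (\<lambda>t. 39)"
  proof (rule integral_le)
    have "continuous_on {0..m} (flow l p)" by (rule continuous_on_subset[OF continuous_flow(1)]) (use m T in auto)
    then show "(\<lambda>t. trunc l (flow l p t)) integrable_on {0..m}"
      by (intro integrable_continuous_interval continuous_on_compose2[OF continuous_trunc]) auto
  qed (use tr in auto)
  moreover have "integral {0..m} (\<lambda>t. 39::real) \<le> 39 * 4"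
    using m(1) T pi_less_4 by simp
  ultimately show "p \<le> 200" by linarith
  \<comment> \<open>Where the Wronskian integrand fails to be positive, l^2 / 4 - l u + u^3 \<le> 0,
    and this is impossible for l > 4 u.\<close>
  obtain x where x: "x \<in> {0<..<T}" "l\<^sup>2 / 4 * flow l p x + flow l p x - trunc l (flow l p x) \<le> 0" using ex by blast
  have u: "0 < flow l p x" "flow l p x \<le> 3" using T(4)[OF x(1)] le3[of x] x(1) T by auto
  have "l \<le> 4 * flow l p x"
  proof (rule ccontr)
    assume "\<not> ?thesis"
    then have "l * (l / 4 - flow l p x) > 0" using l by simp
    then have "flow l p x * (l * (l / 4 - flow l p x) + (flow l p x) ^ 3) > 0"
      using u by (intro mult_pos_pos[OF u(1)] add_pos_pos) simp_all
    then show False using x(2) u by (simp add: trunc_eq power2_eq_square power3_eq_cube power4_eq_xxxx algebra_simps)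
  qed
  then show "\<exists>x\<in>{0..pi}. l \<le> 4 * \<bar>flow l p x\<bar>" using u x(1) T by (intro bexI[of _ x]) auto
qed

text \<open>Somewhere l \<le> 4 |u|, and |u| is at most a multiple of p. Nonpositive values of
  \<open>shoot\<close> thus occur only in a sector, so that the zero set approaches the axis p = 0
  at the origin only.\<close>

lemma shoot_nonpos_slope:
  obtains c where "c > 0" "\<And>l p. p > 0 \<Longrightarrow> shoot l p \<le> 0 \<Longrightarrow> l \<le> c * p"
proof -
  obtain C where C: "C > 0" "\<And>l p x. \<bar>l\<bar> \<le> 4 \<Longrightarrow> x \<in> {0..pi} \<Longrightarrow> \<bar>flow l p x\<bar> \<le> C * \<bar>p\<bar>"
    using flow_linear_bound by blast
  have "l \<le> 4 * C * p" if pG: "p > 0" "shoot l p \<le> 0" for l p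
  proof -
    obtain x where x: "x \<in> {0..pi}" "l \<le> 4 * \<bar>flow l p x\<bar>" using shoot_nonpos(5)[OF pG] by blast
    have "\<bar>l\<bar> \<le> 4" using shoot_nonpos(1,2)[OF pG] by simp
    then show ?thesis using C(2)[OF _ x(1), of l p] x(2) pG(1) by (simp add: mult.assoc)
  qed
  then show ?thesis using that[of "4 * C"] C by simp
qed

lemma shoot_zero_slope: "p > 0 \<Longrightarrow> shoot l p = 0 \<Longrightarrow> dflow l p pi < 0"
proof -
  assume a: "p > 0" "shoot l p = 0"
  obtain T where T: "0 < T" "T \<le> pi" "flow l p T = 0" "dflow l p T < 0"
  proof (rule flow_first_zero[OF a(1), of pi l])
    show "pi \<in> {0<..pi}" by simp
    show "flow l p pi \<le> 0" using a(2) by (simp add: shoot_def)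
  qed
  have "T = pi"
  proof (rule ccontr)
    assume "T \<noteq> pi"
    then show False using shoot_nonneg_pos[OF a(1), of l T] a(2) T by auto
  qed
  then show ?thesis using T by simp
qed

section \<open>The sign of the shooting function on the diagonal\<close>

lemma volterra_sol_sin: "volterra_sol pi (\<lambda>y. y) (0::real) 1 sin"
proof -
  have "volterra_sol pi (\<lambda>y. y) 0 (cos 0) (sin :: real \<Rightarrow> real)"
    by (rule ode_volterra(1)[where v = cos]) (auto intro!: derivative_eq_intros)
  then show ?thesis by simp
qed

text \<open>The rescaled solution y = u / l starts with slope 1 and, for values in [0, 3 / l], obeys
  the nonlinearity y + l^2 y^2 - l^3 y^4, which on the range of sin differs from y by at most 2 l.
  So y is a perturbation of order l of sin. The Lipschitz constant 115 is 109 + 6 l for l \<le>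
  1.\<close>

lemma flow_diag_approx:
  obtains C where "C > 0"
    "\<And>l x. 0 < l \<Longrightarrow> l \<le> 1 \<Longrightarrow> x \<in> {0..pi} \<Longrightarrow> \<bar>flow l l x / l - sin x\<bar> \<le> C * l"
proof -
  define A where "A = exp ((2 * (1 + pi * 115) + 1) * pi)"
  have "\<bar>flow l l x / l - sin x\<bar> \<le> 2 * (pi + pi\<^sup>2 * 2) * A * l" if l: "0 < l" "l \<le> 1" and x: "x \<in> {0..pi}" for l x
  proof -
    have s: "volterra_sol pi (\<lambda>y. trunc l (l * y) / l) l 1 (\<lambda>x. flow l l x / l)"
    proof -
      have "volterra_sol pi (\<lambda>y. trunc l (l * y) / l) l (dflow l l 0 / l) (\<lambda>x. flow l l x / l)"
      proof (rule ode_volterra(1)[where v = "\<lambda>x. dflow l l x / l"])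
        have "continuous_on UNIV (\<lambda>y. trunc l (l * y))"
          by (rule continuous_on_compose2[OF continuous_trunc]) (auto intro!: continuous_intros)
        then show "continuous_on UNIV (\<lambda>y. trunc l (l * y) / l)" using l by (intro continuous_intros) auto
        fix x assume x: "x \<in> {0..pi}"
        show "((\<lambda>x. flow l l x / l) has_real_derivative dflow l l x / l) (at x within {0..pi})"
          by (rule DERIV_cdivide[OF flow_deriv(1)[OF x]])
        show "((\<lambda>x. dflow l l x / l) has_real_derivative - l * (dflow l l x / l) - trunc l (l * (flow l l x / l)) / l) (at x within {0..pi})"
          using DERIV_cdivide[OF flow_deriv(2)[OF x, of l l], of l] l by (simp add: diff_divide_distrib)
      qed (use l in auto)
      then show ?thesis using l by simp
    qed
    have "norm (flow l l x / l - sin x) \<le> 2 * (norm (1 - 1 :: real) * pi + norm (l - 0) * 1 * pi + pi\<^sup>2 * (2 * l))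
       * exp ((2 * (norm l + pi * 115) + 1) * x)"
    proof (rule volterra_sol_dist[OF s volterra_sol_sin _ _ _ _ _ _ x])
      have "continuous_on UNIV (\<lambda>y. trunc l (l * y))"
        by (rule continuous_on_compose2[OF continuous_trunc]) (auto intro!: continuous_intros)
      then show "continuous_on UNIV (\<lambda>y. trunc l (l * y) / l)" using l by (intro continuous_intros) auto
      show "continuous_on UNIV (\<lambda>y::real. y)" by (intro continuous_intros)
    next
      fix t assume t: "t \<in> {0..pi}"
      let ?y = "flow l l t / l" and ?z = "sin t"
      have "norm (trunc l (l * ?y) - trunc l (l * ?z)) \<le> (109 + 6 * \<bar>l\<bar>) * norm (l * ?y - l * ?z)" by (rule trunc_lipschitz)
      also have "\<dots> \<le> 115 * norm (l * ?y - l * ?z)" using l by (intro mult_right_mono) auto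
      also have "\<dots> = l * (115 * norm (?y - ?z))"
        unfolding right_diff_distrib[symmetric] norm_mult using l by (simp only: real_norm_def abs_of_pos mult_ac)
      finally show "norm (trunc l (l * ?y) / l - trunc l (l * ?z) / l) \<le> 115 * norm (?y - ?z)"
        using l by (simp add: field_simps flip: diff_divide_distrib)
      have z: "0 \<le> ?z" "?z \<le> 1" using t by (auto intro: sin_ge_zero)
      have lz: "0 \<le> l * ?z" "l * ?z \<le> 3" using z l mult_mono[of l 1 ?z 1] by auto
      have eq: "trunc l (l * ?z) / l - ?z = l\<^sup>2 * ?z\<^sup>2 - l ^ 3 * ?z ^ 4"
        using l by (simp add: trunc_eq[OF lz] field_simps power2_eq_square power3_eq_cube power4_eq_xxxx)
      have "l\<^sup>2 * ?z\<^sup>2 \<le> l * 1" using l z unfolding power2_eq_square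
        by (metis mult.assoc mult_left_le mult_le_one mult_left_mono less_imp_le mult_nonneg_nonneg)
      moreover have "l ^ 3 * ?z ^ 4 \<le> l * 1"
      proof (rule mult_mono)
        show "l ^ 3 \<le> l" using l power_decreasing[of 1 3 l] by simp
        show "?z ^ 4 \<le> 1" using z by (simp add: power_le_one)
      qed (use l in auto)
      moreover have "0 \<le> l\<^sup>2 * ?z\<^sup>2" "0 \<le> l ^ 3 * ?z ^ 4" using l z by auto
      ultimately show "norm (trunc l (l * ?z) / l - ?z) \<le> 2 * l" unfolding eq real_norm_def by linarith
      show "norm (sin t) \<le> 1" by simp
    qed simp
    also have "\<dots> = 2 * (pi + pi\<^sup>2 * 2) * l * exp ((2 * (norm l + pi * 115) + 1) * x)" using l by (simp add: algebra_simps)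
    also have "\<dots> \<le> 2 * (pi + pi\<^sup>2 * 2) * l * A"
    proof (rule mult_left_mono)
      have "(2 * (norm l + pi * 115) + 1) * x \<le> (2 * (1 + pi * 115) + 1) * pi"
        using l x by (intro mult_mono) auto
      then show "exp ((2 * (norm l + pi * 115) + 1) * x) \<le> A" by (simp add: A_def)
    qed (use l in auto)
    finally show ?thesis by (simp add: mult_ac)
  qed
  moreover have "2 * (pi + pi\<^sup>2 * 2) * A > 0" by (simp add: A_def add_pos_pos)
  ultimately show ?thesis using that by blast
qed

lemma sin_integrals:
  "((\<lambda>x. (sin x / 4 - (sin x)\<^sup>2) * sin x) has_integral pi / 8 - 4 / 3) {0..pi}"
proof -
  define F where "F x = (x - sin x * cos x) / 8 + cos x - (cos x) ^ 3 / 3" for x :: real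
  have "((\<lambda>x. (sin x / 4 - (sin x)\<^sup>2) * sin x) has_integral F pi - F 0) {0..pi}"
  proof (rule fundamental_theorem_of_calculus)
    fix x :: real
    have "(F has_real_derivative (1 - (cos x * cos x - sin x * sin x)) / 8 - sin x + (cos x)\<^sup>2 * sin x) (at x within {0..pi})"
      unfolding F_def by (auto intro!: derivative_eq_intros simp: power2_eq_square)
    moreover have "(1 - (cos x * cos x - sin x * sin x)) / 8 - sin x + (cos x)\<^sup>2 * sin x = (sin x / 4 - (sin x)\<^sup>2) * sin x"
    proof -
      have c: "(cos x)\<^sup>2 = 1 - (sin x)\<^sup>2" by (simp add: cos_squared_eq)
      have "(1 - ((cos x)\<^sup>2 - (sin x)\<^sup>2)) / 8 - sin x + (cos x)\<^sup>2 * sin x = (sin x / 4 - (sin x)\<^sup>2) * sin x"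
        unfolding c by (simp add: algebra_simps power2_eq_square)
      then show ?thesis by (simp add: power2_eq_square)
    qed
    ultimately show "(F has_vector_derivative (sin x / 4 - (sin x)\<^sup>2) * sin x) (at x within {0..pi})"
      by (simp add: has_real_derivative_iff_has_vector_derivative)
  qed simp
  moreover have "F pi - F 0 = pi / 8 - 4 / 3" by (simp add: F_def)
  ultimately show ?thesis by simp
qed

text \<open>The Wronskian identity expresses the end value by an integral. Along p = a l, where u
  \<approx> a l sin x, its leading term is a l^3 (pi / 8 - 4 a / 3), which vanishes at a = 3 pi /
  32, the slope of the lower arc, and is negative for a = 1. As the upper arc rises like sqrt l, the
  diagonal runs between the two arcs.\<close>

lemma shoot_diag_neg: "\<exists>\<delta>>0. \<forall>l. 0 < l \<and> l < \<delta> \<longrightarrow> shoot l l < 0"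
proof -
  obtain C where C: "C > 0"
    "\<And>l x. 0 < l \<Longrightarrow> l \<le> 1 \<Longrightarrow> x \<in> {0..pi} \<Longrightarrow> \<bar>flow l l x / l - sin x\<bar> \<le> C * l"
    using flow_diag_approx by blast
  \<comment> \<open>The first two summands bound the error of replacing y by sin and of dropping l
    y^4; the third, 84 = 4 * 21, that of replacing the exponential weight by 1.\<close>
  define B where "B = 4 * C + 16 + 84"
  have B: "B > 0" using C by (simp add: B_def)
  define \<delta> where "\<delta> = min (1/2) (min (1 / C) (1 / (10 * B)))"
  have "shoot l l < 0" if l: "0 < l" "l < \<delta>" for l
  proof (rule ccontr)
    assume "\<not> shoot l l < 0"
    then have G: "shoot l l \<ge> 0" by simp
    have l1: "l \<le> 1" "l < 1/2" and lC: "C * l \<le> 1" and lB: "B * l < 1/10"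
      using l C B by (auto simp: \<delta>_def field_simps)
    define y where "y x = flow l l x / l" for x
    have uy: "flow l l x = l * y x" for x using l by (simp add: y_def)
    have yc: "\<bar>y x - sin x\<bar> \<le> C * l" if "x \<in> {0..pi}" for x using C(2)[of l x] l l1 that by (simp add: y_def)
    have y0: "y x \<ge> 0" if x: "x \<in> {0..pi}" for x
    proof -
      have "flow l l x \<ge> 0" using shoot_nonneg_pos[OF l(1) G, of x] G x by (cases "x = 0"; cases "x = pi") (auto simp: shoot_def)
      then show ?thesis using l by (simp add: y_def)
    qed
    let ?h = "\<lambda>x. exp (l * x / 2) * sin x * (l\<^sup>2 / 4 * flow l l x + flow l l x - trunc l (flow l l x))"
    have FT: "(?h has_integral exp (l * pi / 2) * ((vdot (trunc l) l l (flow l l) pi + l / 2 * flow l l pi) * sin pi - flow l l pi * cos pi)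
       - exp (l * 0 / 2) * ((vdot (trunc l) l l (flow l l) 0 + l / 2 * flow l l 0) * sin 0 - flow l l 0 * cos 0)) {0..pi}"
      by (rule fundamental_theorem_of_calculus[OF pi_ge_zero])
        (use volterra_sin_deriv[OF flow_sol continuous_trunc] in \<open>simp only: has_real_derivative_iff_has_vector_derivative\<close>)
    \<comment> \<open>At 0 everything vanishes, and at pi only - u cos survives, which is the end
      value.\<close>
    then have I: "(?h has_integral exp (l * pi / 2) * shoot l l) {0..pi}" by (simp add: shoot_def)
    have up: "?h x \<le> l ^ 3 * ((sin x / 4 - (sin x)\<^sup>2) * sin x + B * l)" if x: "x \<in> {0..pi}" for x
    proof -
      define s where "s = sin x"
      define Y where "Y = y x"
      define E where "E = exp (l * x / 2)"
      have s: "0 \<le> s" "s \<le> 1" using x by (auto simp: s_def intro: sin_ge_zero)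
      have Y: "0 \<le> Y" "Y \<le> 2" "\<bar>Y - s\<bar> \<le> C * l"
        using y0[OF x] yc[OF x] lC s unfolding Y_def s_def by linarith+
      have lY: "0 \<le> l * Y" "l * Y \<le> 3" using Y l l1 mult_mono[of l 1 Y 2] by auto
      have h: "?h x = l ^ 3 * (E * (Y / 4 - Y\<^sup>2 + l * Y ^ 4) * s)"
        unfolding uy Y_def[symmetric] trunc_eq[OF lY]
        by (simp add: E_def s_def algebra_simps power2_eq_square power3_eq_cube power4_eq_xxxx)
      define R where "R = Y / 4 - Y\<^sup>2 + l * Y ^ 4"
      have E: "1 \<le> E" "E \<le> 1 + 4 * l"
      proof -
        show "1 \<le> E" using l x by (simp add: E_def)
        have "l * x \<le> l * 4" using l x pi_less_4 by (intro mult_left_mono) auto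
        then have lx: "l * x / 2 \<le> 1" "l * x / 2 \<le> 2 * l" using l1 by auto
        then have "E \<le> 1 + l * x / 2 + (l * x / 2)\<^sup>2" unfolding E_def using l x by (intro exp_bound) auto
        also have "(l * x / 2)\<^sup>2 \<le> l * x / 2" unfolding power2_eq_square using lx l x by (intro mult_left_le) auto
        finally show "E \<le> 1 + 4 * l" using lx by linarith
      qed
      have Y4: "Y ^ 4 \<le> 16" using power_mono[of Y 2 4] Y by simp
      have Y2: "Y\<^sup>2 \<le> 4" using power_mono[of Y 2 2] Y by simp
      have lY4: "0 \<le> l * Y ^ 4" "l * Y ^ 4 \<le> 16 * l" "l * Y ^ 4 \<le> 8"
      proof -
        show "0 \<le> l * Y ^ 4" using l Y by simp
        show 1: "l * Y ^ 4 \<le> 16 * l" using mult_left_mono[OF Y4, of l] l by simp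
        then show "l * Y ^ 4 \<le> 8" using l1 by simp
      qed
      have aR: "\<bar>R\<bar> \<le> 21" using Y Y2 lY4 zero_le_power2[of Y] unfolding R_def by linarith
      have "R - (s / 4 - s\<^sup>2) = (Y - s) * (1/4 - (Y + s)) + l * Y ^ 4" by (simp add: R_def field_simps power2_eq_square)
      also have "\<dots> \<le> (C * l) * 4 + 16 * l"
      proof (rule add_mono[OF _ lY4(2)])
        have "\<bar>(Y - s) * (1/4 - (Y + s))\<bar> \<le> (C * l) * 4" unfolding abs_mult
          using Y s by (intro mult_mono) auto
        then show "(Y - s) * (1/4 - (Y + s)) \<le> (C * l) * 4" by simp
      qed
      finally have R: "R \<le> s / 4 - s\<^sup>2 + (4 * C + 16) * l" by (simp add: algebra_simps)
      have "E * R = R + (E - 1) * R" by (simp add: algebra_simps)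
      also have "(E - 1) * R \<le> \<bar>(E - 1) * R\<bar>" by simp
      also have "\<dots> \<le> (4 * l) * 21" unfolding abs_mult using E aR by (intro mult_mono) auto
      finally have "E * R \<le> s / 4 - s\<^sup>2 + B * l" using R by (simp add: B_def algebra_simps)
      then have "E * R * s \<le> (s / 4 - s\<^sup>2 + B * l) * s" using s by (intro mult_right_mono)
      also have "\<dots> \<le> (s / 4 - s\<^sup>2) * s + B * l" using s B l by (simp add: distrib_right mult_left_le)
      finally have "l ^ 3 * (E * R * s) \<le> l ^ 3 * ((s / 4 - s\<^sup>2) * s + B * l)" using l by (intro mult_left_mono) auto
      then show ?thesis unfolding h unfolding R_def s_def .
    qed
    have I2: "((\<lambda>x. l ^ 3 * ((sin x / 4 - (sin x)\<^sup>2) * sin x + B * l)) has_integral l ^ 3 * ((pi / 8 - 4 / 3) + B * l * pi)) {0..pi}"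
    proof (intro has_integral_mult_right has_integral_add sin_integrals)
      show "((\<lambda>x. B * l) has_integral B * l * pi) {0..pi}"
        using has_integral_const_real[of "B * l" 0 pi] by (simp add: mult.commute)
    qed
    have "exp (l * pi / 2) * shoot l l \<le> l ^ 3 * ((pi / 8 - 4 / 3) + B * l * pi)"
      by (rule has_integral_le[OF I I2 up])
    moreover have "exp (l * pi / 2) * shoot l l \<ge> 0" using G by simp
    moreover have "(pi / 8 - 4 / 3) + B * l * pi < 0"
    proof -
      have "B * l * pi \<le> (1/10) * 4" using lB B l pi_less_4 by (intro mult_mono) auto
      then show ?thesis using pi_less_4 by simp
    qed
    then have "l ^ 3 * ((pi / 8 - 4 / 3) + B * l * pi) < 0" using l by (simp add: mult_pos_neg)
    ultimately show False by linarith
  qed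
  moreover have "\<delta> > 0" using C B by (simp add: \<delta>_def)
  ultimately show ?thesis by blast
qed

section \<open>Zeros of holomorphic families\<close>

lemma contour_integral_continuous_param:
  assumes vg: "valid_path g" and dg: "continuous_on {0..1} (\<lambda>t. vector_derivative g (at t))"
    and ch: "continuous_on (U \<times> path_image g) (\<lambda>(x, y). h x y)"
  shows "continuous_on U (\<lambda>x. contour_integral g (h x))"
proof -
  have cg: "continuous_on {0..1} g" using valid_path_imp_path[OF vg] by (simp add: path_def)
  have "continuous_on (U \<times> cbox 0 1) (\<lambda>(x, t). h x (g t) * vector_derivative g (at t))"
    unfolding split_def
  proof (intro continuous_on_mult)
    have "continuous_on (U \<times> cbox 0 1) (\<lambda>z. (\<lambda>(x, y). h x y) (fst z, g (snd z)))"
    proof (rule continuous_on_compose2[OF ch])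
      show "continuous_on (U \<times> cbox 0 1) (\<lambda>z. (fst z, g (snd z)))"
        by (intro continuous_on_Pair continuous_on_fst continuous_on_id continuous_on_compose2[OF cg] continuous_on_snd) auto
    qed (auto simp: path_image_def)
    then show "continuous_on (U \<times> cbox 0 1) (\<lambda>z. h (fst z) (g (snd z)))" by simp
    show "continuous_on (U \<times> cbox 0 1) (\<lambda>z. vector_derivative g (at (snd z)))"
      by (rule continuous_on_compose2[OF dg]) (auto intro: continuous_on_snd continuous_on_id)
  qed
  then have "continuous_on U (\<lambda>x. integral (cbox 0 1) (\<lambda>t. h x (g t) * vector_derivative g (at t)))"
    by (rule integral_continuous_on_param)
  then show ?thesis by (simp add: contour_integral_integral)
qed

text \<open>Morera's theorem: the integral over a triangle in the parameter is exchanged with the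
  one along g, and then the inner integral vanishes by Cauchy's theorem. This only asks for joint
  continuity and holomorphy in x, not for a jointly continuous derivative.\<close>

lemma contour_integral_holomorphic_param:
  assumes U: "open U" and vg: "valid_path g" and dg: "continuous_on {0..1} (\<lambda>t. vector_derivative g (at t))"
    and ch: "continuous_on (U \<times> path_image g) (\<lambda>(x, y). h x y)"
    and hol: "\<And>y. y \<in> path_image g \<Longrightarrow> (\<lambda>x. h x y) holomorphic_on U"
  shows "(\<lambda>x. contour_integral g (h x)) holomorphic_on U"
proof -
  have "(\<lambda>x. contour_integral g (h x)) analytic_on U"
  proof (rule Morera_triangle[OF contour_integral_continuous_param[OF vg dg ch] U], intro impI)
    fix a b c assume abc: "convex hull {a, b, c} \<subseteq> U"
    have seg: "closed_segment a b \<subseteq> convex hull {a, b, c}" "closed_segment b c \<subseteq> convex hull {a, b, c}"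
      "closed_segment c a \<subseteq> convex hull {a, b, c}"
      by (rule closed_segment_subset_convex_hull; simp add: hull_inc)+
    have sw: "contour_integral (linepath u v) (\<lambda>x. contour_integral g (h x)) = contour_integral g (\<lambda>y. contour_integral (linepath u v) (\<lambda>x. h x y))"
      if uv: "closed_segment u v \<subseteq> U" for u v
    proof (rule contour_integral_swap)
      show "continuous_on (path_image (linepath u v) \<times> path_image g) (\<lambda>(y1, y2). h y1 y2)"
        by (rule continuous_on_subset[OF ch]) (use uv in auto)
    qed (use vg dg in auto)
    have ci: "(\<lambda>y. contour_integral (linepath u v) (\<lambda>x. h x y)) contour_integrable_on g" if uv: "closed_segment u v \<subseteq> U" for u v
      unfolding contour_integrable_on
    proof (intro integrable_continuous_interval continuous_on_mult dg)
      have cg: "continuous_on {0..1} g" using valid_path_imp_path[OF vg] by (simp add: path_def)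
      have "continuous_on (path_image g) (\<lambda>y. contour_integral (linepath u v) (\<lambda>x. h x y))"
      proof (rule contour_integral_continuous_param)
        have "continuous_on (path_image g \<times> path_image (linepath u v)) (\<lambda>z. (\<lambda>(x, y). h x y) (snd z, fst z))"
          by (rule continuous_on_compose2[OF ch]) (use uv in \<open>auto intro!: continuous_on_Pair continuous_on_snd continuous_on_fst continuous_on_id\<close>)
        then show "continuous_on (path_image g \<times> path_image (linepath u v)) (\<lambda>(y, x). h x y)" by (simp add: split_def)
      qed auto
      then show "continuous_on {0..1} (\<lambda>t. contour_integral (linepath u v) (\<lambda>x. h x (g t)))"
        by (rule continuous_on_compose2[OF _ cg]) (auto simp: path_image_def)
    qed
    note s = order_trans[OF seg(1) abc] order_trans[OF seg(2) abc] order_trans[OF seg(3) abc]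
    have "contour_integral (linepath a b) (\<lambda>x. contour_integral g (h x)) + contour_integral (linepath b c) (\<lambda>x. contour_integral g (h x)) +
        contour_integral (linepath c a) (\<lambda>x. contour_integral g (h x))
       = contour_integral g (\<lambda>y. contour_integral (linepath a b) (\<lambda>x. h x y) + contour_integral (linepath b c) (\<lambda>x. h x y)
           + contour_integral (linepath c a) (\<lambda>x. h x y))"
      using ci[OF s(1)] ci[OF s(2)] ci[OF s(3)]
      by (simp add: sw s contour_integral_add contour_integrable_add)
    also have "\<dots> = contour_integral g (\<lambda>y. 0)"
    proof (rule contour_integral_eq)
      fix y assume y: "y \<in> path_image g"
      have hy: "(\<lambda>x. h x y) holomorphic_on convex hull {a, b, c}" by (rule holomorphic_on_subset[OF hol[OF y] abc])
      then have cy: "continuous_on (convex hull {a, b, c}) (\<lambda>x. h x y)" by (rule holomorphic_on_imp_continuous_on)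
      have i: "(\<lambda>x. h x y) contour_integrable_on linepath a b" "(\<lambda>x. h x y) contour_integrable_on linepath b c"
        "(\<lambda>x. h x y) contour_integrable_on linepath c a"
        by (rule contour_integrable_continuous_linepath, rule continuous_on_subset[OF cy], rule seg)+
      have "contour_integral (linepath a b +++ linepath b c +++ linepath c a) (\<lambda>x. h x y) = 0"
        using Cauchy_theorem_triangle[OF hy] by (rule contour_integral_unique)
      then show "contour_integral (linepath a b) (\<lambda>x. h x y) + contour_integral (linepath b c) (\<lambda>x. h x y)
           + contour_integral (linepath c a) (\<lambda>x. h x y) = 0"
        using i by (simp add: contour_integrable_joinI add.assoc)
    qed
    finally show "contour_integral (linepath a b) (\<lambda>x. contour_integral g (h x)) + contour_integral (linepath b c) (\<lambda>x. contour_integral g (h x)) +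
        contour_integral (linepath c a) (\<lambda>x. contour_integral g (h x)) = 0" by simp
  qed
  then show ?thesis by (rule analytic_imp_holomorphic)
qed

text \<open>The number of distinct zeros is the rank of the Hankel matrix of their power sums, and the power sums depend
  holomorphically on the parameter. This makes the number of distinct zeros constant off a discrete set.\<close>

definition hankel :: "(nat \<Rightarrow> complex) \<Rightarrow> nat \<Rightarrow> complex Matrix.mat" where
  "hankel s k = Matrix.mat k k (\<lambda>(i, j). s (i + j))"

lemma hankel_carrier: "hankel s k \<in> carrier_mat k k"
  by (simp add: hankel_def)

lemma hankel_mult:
  assumes "v \<in> carrier_vec k" "i < k"
  shows "vec_index (mult_mat_vec (hankel s k) v) i = (\<Sum>j<k. s (i + j) * vec_index v j)"
  using assms by (simp add: hankel_def mult_mat_vec_def scalar_prod_def atLeast0LessThan)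

text \<open>The coefficients of the monic polynomial with root set Z, padded by zeros to length k,
  form a kernel vector: each row pairs them to a weighted sum of values of this polynomial on
  Z.\<close>

lemma det_hankel_eq_0:
  assumes fin: "finite Z" and k: "card Z < k"
  shows "Determinant.det (hankel (\<lambda>n. \<Sum>p\<in>Z. m p * p ^ n) k) = 0"
proof -
  define q :: "complex poly" where "q = (\<Prod>p\<in>Z. [:- p, 1:])"
  have deg: "degree q = card Z" unfolding q_def by (subst degree_prod_eq_sum_degree) auto
  have lc: "lead_coeff q = 1" unfolding q_def by (subst lead_coeff_prod) simp
  have root: "poly q p = 0" if "p \<in> Z" for p
    unfolding q_def poly_prod by (rule prod_zero[OF fin]) (use that in auto)
  have pq: "poly q x = (\<Sum>j<k. coeff q j * x ^ j)" for x
    unfolding poly_altdef by (rule sum.mono_neutral_left) (use deg k in \<open>auto simp: coeff_eq_0\<close>)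
  define v where "v = Matrix.vec k (coeff q)"
  have v: "v \<in> carrier_vec k" by (simp add: v_def)
  moreover have "v \<noteq> 0\<^sub>v k"
  proof
    assume "v = 0\<^sub>v k"
    then have "vec_index v (card Z) = vec_index (0\<^sub>v k) (card Z)" by simp
    then show False using k lc deg by (simp add: v_def)
  qed
  moreover have "mult_mat_vec (hankel (\<lambda>n. \<Sum>p\<in>Z. m p * p ^ n) k) v = 0\<^sub>v k"
  proof (rule eq_vecI)
    fix i assume "i < dim_vec (0\<^sub>v k :: complex Matrix.vec)"
    then have i: "i < k" by simp
    have "vec_index (mult_mat_vec (hankel (\<lambda>n. \<Sum>p\<in>Z. m p * p ^ n) k) v) i
        = (\<Sum>j<k. (\<Sum>p\<in>Z. m p * p ^ (i + j)) * coeff q j)"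
      unfolding hankel_mult[OF v i] by (rule sum.cong) (auto simp: v_def)
    also have "\<dots> = (\<Sum>j<k. \<Sum>p\<in>Z. m p * p ^ i * (coeff q j * p ^ j))"
      unfolding sum_distrib_right by (intro sum.cong refl) (simp add: power_add mult_ac)
    also have "\<dots> = (\<Sum>p\<in>Z. m p * p ^ i * (\<Sum>j<k. coeff q j * p ^ j))"
      by (subst sum.swap) (simp add: sum_distrib_left)
    also have "\<dots> = (\<Sum>p\<in>Z. m p * p ^ i * 0)"
      by (rule sum.cong) (use root pq in auto)
    finally show "vec_index (mult_mat_vec (hankel (\<lambda>n. \<Sum>p\<in>Z. m p * p ^ n) k) v) i = vec_index (0\<^sub>v k) i"
      using i by simp
  qed (simp add: hankel_def)
  ultimately show ?thesis
    using det_0_iff_vec_prod_zero_field[OF hankel_carrier] by blast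
qed

text \<open>A kernel vector is a polynomial q of degree below card Z that is orthogonal, with the
  weights m on Z, to all such polynomials. Testing with the product of X - p' over the points p'
  other than p isolates p and gives q(p) = 0, so q has more roots than its degree allows.\<close>

lemma det_hankel_neq_0:
  assumes fin: "finite Z" and m: "\<And>p. p \<in> Z \<Longrightarrow> m p \<noteq> 0"
  shows "Determinant.det (hankel (\<lambda>n. \<Sum>p\<in>Z. m p * p ^ n) (card Z)) \<noteq> 0"
proof
  let ?k = "card Z"
  assume "Determinant.det (hankel (\<lambda>n. \<Sum>p\<in>Z. m p * p ^ n) ?k) = 0"
  then obtain v where v: "v \<in> carrier_vec ?k" "v \<noteq> 0\<^sub>v ?k"
    "mult_mat_vec (hankel (\<lambda>n. \<Sum>p\<in>Z. m p * p ^ n) ?k) v = 0\<^sub>v ?k"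
    using det_0_iff_vec_prod_zero_field[OF hankel_carrier] by blast
  define q :: "complex poly" where "q = (\<Sum>j<?k. monom (vec_index v j) j)"
  have pq: "poly q x = (\<Sum>j<?k. vec_index v j * x ^ j)" for x
    by (simp add: q_def poly_sum poly_monom)
  have cq: "coeff q j = (if j < ?k then vec_index v j else 0)" for j
  proof -
    have "coeff q j = (\<Sum>i<?k. if i = j then vec_index v i else 0)"
      unfolding q_def coeff_sum by (intro sum.cong refl) simp
    then show ?thesis by (simp add: sum.delta)
  qed
  have ann: "(\<Sum>p\<in>Z. m p * poly q p * p ^ i) = 0" if i: "i < ?k" for i
  proof -
    have "(\<Sum>p\<in>Z. m p * poly q p * p ^ i) = (\<Sum>p\<in>Z. \<Sum>j<?k. m p * p ^ (i + j) * vec_index v j)"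
      unfolding pq sum_distrib_left sum_distrib_right by (intro sum.cong refl) (simp add: power_add mult_ac)
    also have "\<dots> = (\<Sum>j<?k. (\<Sum>p\<in>Z. m p * p ^ (i + j)) * vec_index v j)"
      by (subst sum.swap) (simp add: sum_distrib_right)
    also have "\<dots> = 0" using hankel_mult[OF v(1) i, of "\<lambda>n. \<Sum>p\<in>Z. m p * p ^ n"] v(3) i by simp
    finally show ?thesis .
  qed
  have annp: "(\<Sum>p\<in>Z. m p * poly q p * poly g p) = 0" if g: "degree g < ?k" for g
  proof -
    have "(\<Sum>p\<in>Z. m p * poly q p * poly g p) = (\<Sum>p\<in>Z. \<Sum>i\<le>degree g. coeff g i * (m p * poly q p * p ^ i))"
      unfolding poly_altdef[of g] by (simp add: sum_distrib_left mult_ac)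
    also have "\<dots> = (\<Sum>i\<le>degree g. coeff g i * (\<Sum>p\<in>Z. m p * poly q p * p ^ i))"
      by (subst sum.swap) (simp add: sum_distrib_left)
    also have "\<dots> = 0" by (rule sum.neutral) (use ann g in auto)
    finally show ?thesis .
  qed
  have root: "poly q p = 0" if p: "p \<in> Z" for p
  proof -
    define g :: "complex poly" where "g = (\<Prod>p'\<in>Z - {p}. [:- p', 1:])"
    have "degree g = card (Z - {p})" unfolding g_def by (subst degree_prod_eq_sum_degree) auto
    then have dg: "degree g < ?k" using card_Diff1_less[OF fin p] by simp
    have gp: "poly g p \<noteq> 0" unfolding g_def poly_prod using fin by (subst prod_zero_iff) auto
    have g0: "poly g p' = 0" if "p' \<in> Z" "p' \<noteq> p" for p'
      unfolding g_def poly_prod by (rule prod_zero) (use that fin in auto)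
    have "(\<Sum>p'\<in>Z. m p' * poly q p' * poly g p') = (\<Sum>p'\<in>Z. if p' = p then m p * poly q p * poly g p else 0)"
      by (rule sum.cong) (auto simp: g0)
    then have "m p * poly q p * poly g p = 0" using annp[OF dg] p fin by (simp add: sum.delta)
    then show ?thesis using m[OF p] gp by simp
  qed
  have "q = 0"
  proof (rule ccontr)
    assume "q \<noteq> 0"
    then have "card Z \<le> card {x. poly q x = 0}"
      by (intro card_mono poly_roots_finite) (use root in auto)
    also have "\<dots> \<le> degree q" using \<open>q \<noteq> 0\<close> by (rule card_poly_roots_bound)
    finally have "coeff q (degree q) = 0" by (simp add: cq)
    then show False using \<open>q \<noteq> 0\<close> by simp
  qed
  then have "vec_index v j = 0" if "j < ?k" for j using cq[of j] that by simp
  then have "v = 0\<^sub>v ?k" using v(1) by (intro eq_vecI) auto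
  then show False using v(2) by simp
qed

lemma det_hankel_holomorphic:
  assumes "\<And>n. s n holomorphic_on U"
  shows "(\<lambda>x. Determinant.det (hankel (\<lambda>n. s n x) k)) holomorphic_on U"
proof -
  have "Determinant.det (hankel (\<lambda>n. s n x) k)
      = (\<Sum>p | p permutes {0..<k}. of_int (sign p) * (\<Prod>i = 0..<k. s (i + p i) x))" for x
    unfolding Determinant.det_def hankel_def
    by simp
  then show ?thesis by (simp only:) (intro holomorphic_intros assms)
qed

section \<open>Counting the distinct zeros in a disc\<close>

locale zero_family =
  fixes f :: "complex \<Rightarrow> complex \<Rightarrow> complex" and x0 y0 :: complex and R r r' :: real
  assumes R: "R > 0" and r: "0 < r" "r < r'"
    and cont: "continuous_on (ball x0 R \<times> ball y0 r') (\<lambda>(x, y). f x y)"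
    and holy: "\<And>x. x \<in> ball x0 R \<Longrightarrow> f x holomorphic_on ball y0 r'"
    and holx: "\<And>y. y \<in> ball y0 r' \<Longrightarrow> (\<lambda>x. f x y) holomorphic_on ball x0 R"
    and bd: "\<And>x y. x \<in> ball x0 R \<Longrightarrow> y \<in> sphere y0 r \<Longrightarrow> f x y \<noteq> 0"
begin

definition zeros :: "complex \<Rightarrow> complex set" where
  "zeros x = {y \<in> ball y0 r. f x y = 0}"

text \<open>The power sums carry multiplicities because this is what the argument principle
  delivers; for the Hankel determinant the weights only have to be nonzero, so the zeros it counts
  are the distinct ones.\<close>

definition psum :: "nat \<Rightarrow> complex \<Rightarrow> complex" where
  "psum n x = (\<Sum>p\<in>zeros x. of_int (zorder (f x) p) * p ^ n)"

lemma bd_point: "x \<in> ball x0 R \<Longrightarrow> f x (y0 + of_real r) \<noteq> 0" "y0 + of_real r \<in> ball y0 r'"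
  using bd[of x "y0 + of_real r"] r by (auto simp: dist_norm)

text \<open>An accumulation point of zeros would make f x vanish on the whole disc, in particular at
  the boundary point y0 + r.\<close>

lemma finite_zeros_cball:
  assumes x: "x \<in> ball x0 R" and s: "s < r'"
  shows "finite {y \<in> cball y0 s. f x y = 0}"
proof (rule ccontr)
  assume inf: "infinite {y \<in> cball y0 s. f x y = 0}"
  then obtain z where z: "z \<in> cball y0 s" "z islimpt {y \<in> cball y0 s. f x y = 0}"
    using compact_cball[of y0 s] unfolding compact_eq_Bolzano_Weierstrass by (metis (no_types, lifting) mem_Collect_eq subsetI)
  have "f x (y0 + of_real r) = 0"
    by (rule analytic_continuation[OF holy[OF x] _ _ _ _ z(2)]) (use z s r bd_point(2) in \<open>auto\<close>)
  then show False using bd_point(1)[OF x] by simp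
qed

lemma finite_zeros: "x \<in> ball x0 R \<Longrightarrow> finite (zeros x)"
  by (rule finite_subset[OF _ finite_zeros_cball[of x r]]) (use r in \<open>auto simp: zeros_def\<close>)

lemma frequently_nonzero:
  assumes x: "x \<in> ball x0 R" and y: "y \<in> ball y0 r'"
  shows "\<exists>\<^sub>F z in at y. f x z \<noteq> 0"
proof (rule ccontr)
  assume "\<not> ?thesis"
  then have ev: "\<forall>\<^sub>F z in at y. f x z = 0" by (simp add: not_frequently)
  then obtain e where e: "e > 0" "\<And>z. z \<in> ball y e \<Longrightarrow> z \<noteq> y \<Longrightarrow> f x z = 0"
    unfolding eventually_at by (auto simp: dist_commute)
  obtain e' where e': "e' > 0" "ball y e' \<subseteq> ball y0 r'" using openE[OF open_ball y] by blast
  define U where "U = ball y (min e e') - {y}"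
  have lim: "y islimpt U"
  proof -
    have "y islimpt ball y (min e e')" using e e' by (simp add: islimpt_ball)
    then show ?thesis unfolding U_def by (simp add: islimpt_punctured[symmetric])
  qed
  have U: "U \<subseteq> ball y0 r'" using e'(2) by (auto simp: U_def)
  have "f x (y0 + of_real r) = 0"
  proof (rule analytic_continuation[OF holy[OF x], of U y])
    show "f x z = 0" if "z \<in> U" for z by (rule e(2)) (use that in \<open>auto simp: U_def\<close>)
  qed (use y bd_point(2) lim U in auto)
  then show False using bd_point(1)[OF x] by simp
qed

lemma zorder_pos: "x \<in> ball x0 R \<Longrightarrow> p \<in> zeros x \<Longrightarrow> zorder (f x) p > 0"
  using zorder_pos_iff[OF holy, of x p] frequently_nonzero[of x p] r by (auto simp: zeros_def)

lemma psum_integral: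
  assumes x: "x \<in> ball x0 R"
  shows "contour_integral (circlepath y0 r) (\<lambda>y. deriv (f x) y * y ^ n / f x y) = 2 * pi * \<i> * psum n x"
proof -
  \<comment> \<open>The argument principle is applied on a slightly larger disc. Its zeros outside
    the circle of radius r have winding number 0 and drop out of the sum.\<close>
  define s where "s = (r + r') / 2"
  have s: "r < s" "s < r'" using r by (auto simp: s_def)
  define pz where "pz = {w \<in> ball y0 s. f x w = 0 \<or> w \<in> {}}"
  have fin: "finite pz"
    by (rule finite_subset[OF _ finite_zeros_cball[OF x s(2)]]) (auto simp: pz_def)
  have out: "winding_number (circlepath y0 r) z = 0" if "z \<notin> cball y0 r" for z
    by (rule winding_number_zero_outside[OF _ convex_cball[of y0 r] _ that]) (use r in auto)
  have "contour_integral (circlepath y0 r) (\<lambda>y. deriv (f x) y * y ^ n / f x y)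
      = 2 * pi * \<i> * (\<Sum>p\<in>pz. winding_number (circlepath y0 r) p * p ^ n * zorder (f x) p)"
    unfolding pz_def
  proof (rule argument_principle)
    show "f x holomorphic_on ball y0 s - {}" by (rule holomorphic_on_subset[OF holy[OF x]]) (use s in auto)
    show "(\<lambda>y. y ^ n) holomorphic_on ball y0 s" by (intro holomorphic_intros)
    show "path_image (circlepath y0 r) \<subseteq> ball y0 s - {w \<in> ball y0 s. f x w = 0 \<or> w \<in> {}}"
      using bd[OF x] r s by auto
    show "\<forall>z. z \<notin> ball y0 s \<longrightarrow> winding_number (circlepath y0 r) z = 0" using out s by auto
    show "finite {w \<in> ball y0 s. f x w = 0 \<or> w \<in> {}}" using fin by (simp add: pz_def)
  qed auto
  also have "(\<Sum>p\<in>pz. winding_number (circlepath y0 r) p * p ^ n * zorder (f x) p)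
      = (\<Sum>p\<in>zeros x. winding_number (circlepath y0 r) p * p ^ n * zorder (f x) p)"
  proof (rule sum.mono_neutral_right[OF fin])
    show "zeros x \<subseteq> pz" using s by (auto simp: zeros_def pz_def)
    show "\<forall>p\<in>pz - zeros x. winding_number (circlepath y0 r) p * p ^ n * zorder (f x) p = 0"
    proof
      fix p assume p: "p \<in> pz - zeros x"
      then have "p \<notin> ball y0 r" by (auto simp: pz_def zeros_def)
      moreover have "p \<notin> sphere y0 r" using p bd[OF x, of p] by (auto simp: pz_def)
      ultimately have "p \<notin> cball y0 r" by auto
      then show "winding_number (circlepath y0 r) p * p ^ n * zorder (f x) p = 0" by (simp add: out)
    qed
  qed
  also have "\<dots> = psum n x" unfolding psum_def
    by (rule sum.cong) (auto simp: zeros_def dist_norm norm_minus_commute winding_number_circlepath)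
  finally show ?thesis .
qed

lemma psum_holomorphic: "psum n holomorphic_on ball x0 R"
proof -
  define s where "s = (r + r') / 2"
  have s: "r < s" "s < r'" "0 < s" using r by (auto simp: s_def)
  \<comment> \<open>The derivative in y is written as a Cauchy integral over a larger circle, which
    makes its joint continuity and its holomorphy in x evident.\<close>
  define D where "D x y = 1 / (2 * pi * \<i>) * contour_integral (circlepath y0 s) (\<lambda>u. f x u / (u - y)\<^sup>2)" for x y
  have D: "deriv (f x) y = D x y" if x: "x \<in> ball x0 R" and y: "y \<in> sphere y0 r" for x y
  proof -
    have "f x holomorphic_on cball y0 s" by (rule holomorphic_on_subset[OF holy[OF x]]) (use s in auto)
    then have h: "continuous_on (cball y0 s) (f x)" "f x holomorphic_on ball y0 s"
      using holomorphic_on_imp_continuous_on holomorphic_on_subset ball_subset_cball by blast+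
    have "y \<in> ball y0 s" using s y by auto
    from Cauchy_derivative_integral_circlepath(2)[OF h this]
    have "(f x has_field_derivative D x y) (at y)" by (simp add: D_def)
    then show ?thesis by (rule DERIV_imp_deriv)
  qed
  have vd: "continuous_on {0..1} (\<lambda>t. vector_derivative (circlepath y0 q) (at t))" for q
    unfolding vector_derivative_circlepath by (intro continuous_intros)
  have cf: "continuous_on S (\<lambda>z. f (g z) (h z))"
    if "continuous_on S g" "continuous_on S h" "g ` S \<subseteq> ball x0 R" "h ` S \<subseteq> ball y0 r'" for S and g h :: "'a::topological_space \<Rightarrow> complex"
  proof -
    have "continuous_on S (\<lambda>z. (\<lambda>(x, y). f x y) (g z, h z))"
      by (rule continuous_on_compose2[OF cont]) (use that in \<open>auto intro!: continuous_on_Pair\<close>)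
    then show ?thesis by simp
  qed
  have cD: "continuous_on (ball x0 R \<times> sphere y0 r) (\<lambda>(x, y). D x y)"
    unfolding D_def split_def
  proof (intro continuous_on_mult continuous_on_const contour_integral_continuous_param vd valid_path_circlepath)
    show "continuous_on ((ball x0 R \<times> sphere y0 r) \<times> path_image (circlepath y0 s)) (\<lambda>(z, u). f (fst z) u / (u - snd z)\<^sup>2)"
      unfolding split_def
    proof (intro continuous_on_divide continuous_on_power continuous_on_diff cf continuous_on_fst continuous_on_snd continuous_on_id)
      show "\<forall>z\<in>(ball x0 R \<times> sphere y0 r) \<times> path_image (circlepath y0 s). (snd z - snd (fst z))\<^sup>2 \<noteq> 0"
        using s by auto
    qed (use s in auto)
  qed
  have hD: "(\<lambda>x. D x y) holomorphic_on ball x0 R" if y: "y \<in> sphere y0 r" for y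
    unfolding D_def
  proof (intro holomorphic_on_mult holomorphic_on_const contour_integral_holomorphic_param vd valid_path_circlepath)
    show "continuous_on (ball x0 R \<times> path_image (circlepath y0 s)) (\<lambda>(x, u). f x u / (u - y)\<^sup>2)"
      unfolding split_def
      by (intro continuous_on_divide continuous_on_power continuous_on_diff cf continuous_on_fst continuous_on_snd continuous_on_id continuous_on_const)
        (use s y in auto)
    show "(\<lambda>x. f x u / (u - y)\<^sup>2) holomorphic_on ball x0 R" if "u \<in> path_image (circlepath y0 s)" for u
    proof (intro holomorphic_on_divide holomorphic_on_const holx)
      show "u \<in> ball y0 r'" using that s by auto
      show "(u - y)\<^sup>2 \<noteq> 0" using that s y by auto
    qed
  qed simp
  define h where "h x y = D x y * y ^ n / f x y" for x y
  have "(\<lambda>x. contour_integral (circlepath y0 r) (h x)) holomorphic_on ball x0 R"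
  proof (intro contour_integral_holomorphic_param vd valid_path_circlepath)
    have sp: "path_image (circlepath y0 r) = sphere y0 r" using r by simp
    show "continuous_on (ball x0 R \<times> path_image (circlepath y0 r)) (\<lambda>(x, y). h x y)"
      unfolding h_def split_def sp
    proof (intro continuous_on_divide continuous_on_mult continuous_on_power cf continuous_on_fst continuous_on_snd continuous_on_id)
      show "continuous_on (ball x0 R \<times> sphere y0 r) (\<lambda>z. D (fst z) (snd z))" using cD by (simp add: split_def)
    qed (use bd r in auto)
    show "(\<lambda>x. h x y) holomorphic_on ball x0 R" if "y \<in> path_image (circlepath y0 r)" for y
      unfolding h_def
    proof (intro holomorphic_on_divide holomorphic_on_mult holomorphic_on_const holx hD)
      show "y \<in> ball y0 r'" "y \<in> sphere y0 r" using that r by auto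
      show "f x y \<noteq> 0" if "x \<in> ball x0 R" for x using bd that \<open>y \<in> sphere y0 r\<close> by auto
    qed
  qed simp
  then have "(\<lambda>x. 1 / (2 * pi * \<i>) * contour_integral (circlepath y0 r) (h x)) holomorphic_on ball x0 R"
    by (intro holomorphic_intros)
  moreover have "1 / (2 * pi * \<i>) * contour_integral (circlepath y0 r) (h x) = psum n x" if x: "x \<in> ball x0 R" for x
  proof -
    have "contour_integral (circlepath y0 r) (h x) = contour_integral (circlepath y0 r) (\<lambda>y. deriv (f x) y * y ^ n / f x y)"
      by (rule contour_integral_eq) (use r D[OF x] in \<open>auto simp: h_def\<close>)
    then show ?thesis using psum_integral[OF x, of n] by simp
  qed
  ultimately show ?thesis by (rule holomorphic_transform)
qed

lemma card_zeros_le: "x \<in> ball x0 R \<Longrightarrow> real (card (zeros x)) \<le> norm (psum 0 x)"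
proof -
  assume x: "x \<in> ball x0 R"
  have "psum 0 x = of_int (\<Sum>p\<in>zeros x. zorder (f x) p)" by (simp add: psum_def)
  moreover have "(\<Sum>p\<in>zeros x. 1) \<le> (\<Sum>p\<in>zeros x. zorder (f x) p)"
    using zorder_pos[OF x] by (intro sum_mono) force
  then have "int (card (zeros x)) \<le> (\<Sum>p\<in>zeros x. zorder (f x) p)" by simp
  then have "real (card (zeros x)) \<le> of_int (\<Sum>p\<in>zeros x. zorder (f x) p)"
    by linarith
  ultimately show ?thesis unfolding \<open>psum 0 x = _\<close> norm_of_int by linarith
qed

text \<open>The power sum of exponent 0 counts with multiplicity and is locally bounded, so the
  number of distinct zeros attains a maximum k near x0. The k-th Hankel determinant is holomorphic
  in x and nonzero where the maximum is attained, so its zeros are isolated; wherever it is nonzero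
  there are at least, hence exactly, k zeros. Collisions can remain at x0 itself only.\<close>

lemma card_zeros_constant:
  obtains k \<delta> where "0 < \<delta>" "\<delta> < R" "\<And>x. x \<in> ball x0 \<delta> - {x0} \<Longrightarrow> card (zeros x) = k"
proof -
  define S where "S = ball x0 (R / 2)"
  have S: "S \<subseteq> ball x0 R" "x0 \<in> S" "open S" "connected S" using R by (auto simp: S_def)
  have "compact (psum 0 ` cball x0 (R / 2))"
    by (intro compact_continuous_image holomorphic_on_imp_continuous_on holomorphic_on_subset[OF psum_holomorphic]) (use R in auto)
  then obtain B where "\<forall>y\<in>psum 0 ` cball x0 (R / 2). norm y \<le> B"
    by (auto dest!: compact_imp_bounded simp: bounded_iff)
  then have B: "norm (psum 0 x) \<le> B" if "x \<in> cball x0 (R / 2)" for x using that by blast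
  have bnd: "card (zeros x) \<le> nat \<lceil>B\<rceil>" if "x \<in> S" for x
  proof -
    have "x \<in> ball x0 R" "x \<in> cball x0 (R / 2)" using that S(1) by (auto simp: S_def)
    then have "real (card (zeros x)) \<le> B" using card_zeros_le B by fastforce
    then show ?thesis by linarith
  qed
  then have fin: "finite ((\<lambda>x. card (zeros x)) ` S)" by (intro finite_subset[OF _ finite_atMost[of "nat \<lceil>B\<rceil>"]]) auto
  define k where "k = Max ((\<lambda>x. card (zeros x)) ` S)"
  have "k \<in> (\<lambda>x. card (zeros x)) ` S" unfolding k_def by (rule Max_in[OF fin]) (use S in auto)
  then obtain x1 where x1: "x1 \<in> S" "card (zeros x1) = k" by auto
  have le: "card (zeros x) \<le> k" if "x \<in> S" for x unfolding k_def by (rule Max_ge[OF fin]) (use that in auto)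
  define \<Delta> where "\<Delta> x = Determinant.det (hankel (\<lambda>n. psum n x) k)" for x
  have hol: "\<Delta> holomorphic_on S" unfolding \<Delta>_def
    by (intro det_hankel_holomorphic holomorphic_on_subset[OF psum_holomorphic] S)
  have nz: "\<Delta> x1 \<noteq> 0" unfolding \<Delta>_def psum_def x1(2)[symmetric]
    using x1 S zorder_pos[of x1] by (intro det_hankel_neq_0 finite_zeros) force+
  have ge: "card (zeros x) \<ge> k" if "x \<in> S" "\<Delta> x \<noteq> 0" for x
  proof (rule ccontr)
    assume "\<not> card (zeros x) \<ge> k"
    then have "\<Delta> x = 0" unfolding \<Delta>_def psum_def using that S by (intro det_hankel_eq_0 finite_zeros) auto
    then show False using that by simp
  qed
  obtain e where e: "e > 0" "ball x0 e \<subseteq> S" "\<And>z. z \<in> ball x0 e - {x0} \<Longrightarrow> \<Delta> z \<noteq> 0"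
  proof (cases "\<Delta> x0 = 0")
    case True
    show ?thesis by (rule isolated_zeros[OF hol S(3,4,2) True x1(1) nz]) (rule that)
  next
    case False
    have "continuous_on S \<Delta>" by (rule holomorphic_on_imp_continuous_on[OF hol])
    then obtain e where "e > 0" "\<And>z. z \<in> S \<Longrightarrow> dist z x0 < e \<Longrightarrow> dist (\<Delta> z) (\<Delta> x0) < norm (\<Delta> x0)"
      using S(2) False unfolding continuous_on_iff by (metis zero_less_norm_iff)
    then show ?thesis using that[of "min e (R / 2)"] R by (force simp: S_def dist_norm norm_minus_commute)
  qed
  show ?thesis
  proof (rule that)
    show "0 < min e (R / 2)" "min e (R / 2) < R" using e R by auto
    show "card (zeros x) = k" if "x \<in> ball x0 (min e (R / 2)) - {x0}" for x
      using that e(2,3) ge[of x] le[of x] by (auto intro!: antisym)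
  qed
qed

text \<open>Otherwise a sequence of parameters tending to x1 would have no zeros in a fixed disc
  around y1. The convergence is locally uniform in y, so Hurwitz's theorem would exclude the zero y1
  of the limit.\<close>

lemma zero_persists:
  assumes x1: "x1 \<in> ball x0 R" and y1: "y1 \<in> zeros x1" and e: "e > 0"
  obtains \<eta> where "\<eta> > 0" "\<And>x. x \<in> ball x1 \<eta> \<Longrightarrow> \<exists>y\<in>zeros x. dist y y1 < e"
proof -
  obtain e' where e': "e' > 0" "e' \<le> e" "ball y1 e' \<subseteq> ball y0 r"
  proof -
    have "y1 \<in> ball y0 r" using y1 by (simp add: zeros_def)
    then obtain q where q: "q > 0" "ball y1 q \<subseteq> ball y0 r" using openE[OF open_ball] by blast
    have "ball y1 (min q e) \<subseteq> ball y0 r" using q(2) by (auto simp: subset_iff)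
    then show ?thesis using that[of "min q e"] e q by auto
  qed
  have "\<exists>\<eta>>0. \<forall>x\<in>ball x1 \<eta>. \<exists>y\<in>ball y1 e'. f x y = 0"
  proof (rule ccontr)
    assume "\<not> ?thesis"
    then have no: "\<And>\<eta>. \<eta> > 0 \<Longrightarrow> \<exists>x\<in>ball x1 \<eta>. \<forall>y\<in>ball y1 e'. f x y \<noteq> 0" by blast
    obtain q where q: "q > 0" "ball x1 q \<subseteq> ball x0 R" using openE[OF open_ball x1] by blast
    define d where "d n = min q (1 / real (Suc n))" for n
    have "\<forall>n. \<exists>x. x \<in> ball x1 (d n) \<and> (\<forall>y\<in>ball y1 e'. f x y \<noteq> 0)" 
    proof
      fix n
      have "d n > 0" using q by (simp add: d_def)
      from no[OF this] show "\<exists>x. x \<in> ball x1 (d n) \<and> (\<forall>y\<in>ball y1 e'. f x y \<noteq> 0)" by blast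
    qed
    then obtain X where X: "\<And>n. X n \<in> ball x1 (d n)" "\<And>n y. y \<in> ball y1 e' \<Longrightarrow> f (X n) y \<noteq> 0" by metis
    have XR: "X n \<in> ball x0 R" for n using X(1)[of n] q by (auto simp: d_def)
    have Xlim: "X \<longlonglongrightarrow> x1"
    proof (rule metric_tendsto_imp_tendsto)
      show "(\<lambda>n. 1 / real (Suc n)) \<longlonglongrightarrow> 0" by (rule LIMSEQ_Suc[OF lim_1_over_n])
      have "dist (X n) x1 \<le> dist (1 / real (Suc n)) 0" for n
        using X(1)[of n] by (simp add: d_def dist_commute dist_norm)
      then show "\<forall>\<^sub>F n in sequentially. dist (X n) x1 \<le> dist (1 / real (Suc n)) 0"
        by simp
    qed
    have sub: "ball y1 e' \<subseteq> ball y0 r'" using e' r by auto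
    have "f x1 y1 \<noteq> 0"
    proof (rule Hurwitz_no_zeros[where \<F> = "\<lambda>n. f (X n)" and S = "ball y1 e'" and g = "f x1" and ?z0.0 = y1])
      show "f (X n) holomorphic_on ball y1 e'" for n by (rule holomorphic_on_subset[OF holy[OF XR] sub])
      show "f x1 holomorphic_on ball y1 e'" by (rule holomorphic_on_subset[OF holy[OF x1] sub])
      show "\<not> f x1 constant_on ball y1 e'"
      proof
        assume "f x1 constant_on ball y1 e'"
        then have z: "f x1 z = 0" if "z \<in> ball y1 e'" for z
          using that y1 e' by (auto simp: constant_on_def zeros_def)
        have "\<forall>\<^sub>F z in at y1. f x1 z = 0"
          using eventually_at_ball[OF e'(1), of y1 UNIV] by eventually_elim (use z in auto)
        then show False using frequently_nonzero[OF x1, of y1] y1 r by (auto simp: zeros_def frequently_def)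
      qed
      show "uniform_limit K (\<lambda>n. f (X n)) (f x1) sequentially" if K: "compact K" "K \<subseteq> ball y1 e'" for K
      proof -
        have cK: "continuous_on (cball x1 (q/2) \<times> K) (\<lambda>(x, y). f x y)"
          by (rule continuous_on_subset[OF cont]) (use K sub q in \<open>auto simp: subset_iff\<close>)
        have "compact (cball x1 (q/2) \<times> K)" using K by (intro compact_Times) auto
        then have uc: "uniformly_continuous_on (cball x1 (q/2) \<times> K) (\<lambda>(x, y). f x y)"
          using cK compact_uniformly_continuous by blast
        show ?thesis
        proof (rule uniform_limitI)
          fix \<epsilon> :: real assume "\<epsilon> > 0"
          with uc obtain \<delta> where \<delta>: "\<delta> > 0"
            "\<And>z z'. z \<in> cball x1 (q/2) \<times> K \<Longrightarrow> z' \<in> cball x1 (q/2) \<times> K \<Longrightarrow> dist z' z < \<delta> \<Longrightarrow> dist ((\<lambda>(x, y). f x y) z') ((\<lambda>(x, y). f x y) z) < \<epsilon>"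
            unfolding uniformly_continuous_on_def by metis
          have "\<forall>\<^sub>F n in sequentially. dist (X n) x1 < min \<delta> (q/2)"
            using Xlim \<delta> q by (intro tendstoD) auto
          then show "\<forall>\<^sub>F n in sequentially. \<forall>y\<in>K. dist (f (X n) y) (f x1 y) < \<epsilon>"
          proof eventually_elim
            case (elim n)
            show ?case
            proof
              fix y assume "y \<in> K"
              then show "dist (f (X n) y) (f x1 y) < \<epsilon>"
                using \<delta>(2)[of "(x1, y)" "(X n, y)"] elim q by (auto simp: dist_commute dist_Pair_Pair)
            qed
          qed
        qed
      qed
    qed (use X(2) e' in auto)
    then show False using y1 by (simp add: zeros_def)
  qed
  then obtain \<eta> where "\<eta> > 0" "\<forall>x\<in>ball x1 \<eta>. \<exists>y\<in>ball y1 e'. f x y = 0" by blast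
  then show ?thesis using that[of \<eta>] e' by (force simp: zeros_def dist_commute)
qed

end

section \<open>Real zeros as ordered families of continuous branches\<close>

definition zero_rank :: "real set \<Rightarrow> real \<Rightarrow> nat" where
  "zero_rank S y = card {y' \<in> S. y' < y}"

text \<open>This says that the fibres consist of finitely many continuous branches that never meet,
  without naming the branches: neighbouring fibres are matched in an order preserving way, by a map
  that may depend on x.\<close>

definition locally_ordered_on :: "real set \<Rightarrow> (real \<Rightarrow> real set) \<Rightarrow> bool" where
  "locally_ordered_on I Z \<longleftrightarrow> (\<forall>x\<in>I. finite (Z x)) \<and>
    (\<forall>x1\<in>I. \<forall>e>0. \<exists>\<eta>>0. \<forall>x\<in>I. \<bar>x - x1\<bar> < \<eta> \<longrightarrow>
       (\<exists>h. bij_betw h (Z x1) (Z x) \<and> strict_mono_on (Z x1) h \<and> (\<forall>y\<in>Z x1. \<bar>h y - y\<bar> < e)))"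

lemma zero_rank_inj:
  assumes "finite S" "y \<in> S" "y' \<in> S" "zero_rank S y = zero_rank S y'"
  shows "y = y'"
proof -
  have lt: "zero_rank S a < zero_rank S b" if "a \<in> S" "a < b" for a b
    unfolding zero_rank_def using that assms(1) by (intro psubset_card_mono) auto
  show ?thesis using lt[of y y'] lt[of y' y] assms by (cases y y' rule: linorder_cases) auto
qed

lemma zero_rank_transfer:
  assumes "bij_betw h S S'" "strict_mono_on S h" "y \<in> S"
  shows "zero_rank S' (h y) = zero_rank S y"
proof -
  have inj: "inj_on h S" and im: "h ` S = S'" using assms(1) by (auto simp: bij_betw_def)
  have "{y' \<in> S'. y' < h y} = h ` {y' \<in> S. y' < y}"
    using assms(3) strict_mono_on_less[OF assms(2)] by (auto simp flip: im)
  then show ?thesis unfolding zero_rank_def using inj by (simp add: card_image inj_on_subset)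
qed

text \<open>The rank of a point, the number of points below it in its fibre, is preserved by the
  matchings. The section follows the points with the rank of y1; the set of x whose fibre has such a
  point is open and closed in I.\<close>

lemma continuous_section_through:
  assumes I: "connected I" and lo: "locally_ordered_on I Z" and x1: "x1 \<in> I" "y1 \<in> Z x1"
  obtains q where "continuous_on I q" "q x1 = y1" "\<And>x. x \<in> I \<Longrightarrow> q x \<in> Z x"
proof -
  have fin: "finite (Z x)" if "x \<in> I" for x using lo that by (simp add: locally_ordered_on_def)
  have loc: "\<exists>\<eta>>0. \<forall>x\<in>I. \<bar>x - a\<bar> < \<eta> \<longrightarrow> (\<exists>h. bij_betw h (Z a) (Z x) \<and> strict_mono_on (Z a) h \<and> (\<forall>y\<in>Z a. \<bar>h y - y\<bar> < e))"
    if "a \<in> I" "e > 0" for a e using lo that unfolding locally_ordered_on_def by blast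
  define k where "k = zero_rank (Z x1) y1"
  define A where "A = {x \<in> I. \<exists>y\<in>Z x. zero_rank (Z x) y = k}"
  have stable: "\<exists>\<eta>>0. \<forall>x\<in>I. dist x a < \<eta> \<longrightarrow> (x \<in> A \<longleftrightarrow> a \<in> A)" if a: "a \<in> I" for a
  proof -
    obtain \<eta> where \<eta>: "\<eta> > 0" "\<And>x. x \<in> I \<Longrightarrow> \<bar>x - a\<bar> < \<eta> \<Longrightarrow> \<exists>h. bij_betw h (Z a) (Z x) \<and> strict_mono_on (Z a) h"
      using loc[OF a, of 1] by fastforce
    have "x \<in> A \<longleftrightarrow> a \<in> A" if x: "x \<in> I" "dist x a < \<eta>" for x
    proof -
      obtain h where h: "bij_betw h (Z a) (Z x)" "strict_mono_on (Z a) h" using \<eta>(2)[of x] x by (auto simp: dist_real_def)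
      then have "Z x = h ` Z a" by (simp add: bij_betw_def)
      then show ?thesis using zero_rank_transfer[OF h] a x by (auto simp: A_def)
    qed
    then show ?thesis using \<eta>(1) by blast
  qed
  have "openin (top_of_set I) A"
    unfolding openin_euclidean_subtopology_iff using stable by (auto simp: A_def) blast
  moreover have "openin (top_of_set I) (I - A)"
    unfolding openin_euclidean_subtopology_iff using stable by blast
  then have "closedin (top_of_set I) A" by (simp add: closedin_def A_def)
  moreover have "x1 \<in> A" using x1 by (auto simp: A_def k_def)
  ultimately have AI: "A = I" using I unfolding connected_clopen by blast
  define q where "q x = (THE y. y \<in> Z x \<and> zero_rank (Z x) y = k)" for x
  have uniq: "q x = y" if "x \<in> I" "y \<in> Z x" "zero_rank (Z x) y = k" for x y
    unfolding q_def using that zero_rank_inj[OF fin[OF that(1)]] by (intro the_equality) auto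
  have q: "q x \<in> Z x" "zero_rank (Z x) (q x) = k" if x: "x \<in> I" for x
  proof -
    have "x \<in> A" using x AI by simp
    then obtain y where "y \<in> Z x" "zero_rank (Z x) y = k" by (auto simp: A_def)
    then show "q x \<in> Z x" "zero_rank (Z x) (q x) = k" using uniq[OF x] by auto
  qed
  have "continuous_on I q"
    unfolding continuous_on_iff
  proof (intro ballI allI impI)
    fix a e :: real assume a: "a \<in> I" and e: "e > 0"
    obtain \<eta> where \<eta>: "\<eta> > 0" "\<forall>x\<in>I. \<bar>x - a\<bar> < \<eta> \<longrightarrow> (\<exists>h. bij_betw h (Z a) (Z x) \<and> strict_mono_on (Z a) h \<and> (\<forall>y\<in>Z a. \<bar>h y - y\<bar> < e))"
      using loc[OF a e] by blast
    show "\<exists>d>0. \<forall>x\<in>I. dist x a < d \<longrightarrow> dist (q x) (q a) < e"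
    proof (intro exI[of _ \<eta>] conjI ballI impI \<eta>(1))
      fix x assume x: "x \<in> I" "dist x a < \<eta>"
      then obtain h where h: "bij_betw h (Z a) (Z x)" "strict_mono_on (Z a) h" "\<forall>y\<in>Z a. \<bar>h y - y\<bar> < e"
        using \<eta>(2) unfolding dist_real_def by blast
      have "h (q a) \<in> Z x" using h(1) q(1)[OF a] by (auto simp: bij_betw_def)
      then have "q x = h (q a)"
        by (rule uniq[OF x(1)]) (use zero_rank_transfer[OF h(1,2) q(1)[OF a]] q(2)[OF a] in simp)
      then show "dist (q x) (q a) < e" using h(3) q(1)[OF a] by (simp add: dist_real_def)
    qed
  qed
  moreover have "q x1 = y1" by (rule uniq[OF x1]) (simp add: k_def)
  ultimately show ?thesis using that q(1) by blast
qed

text \<open>Coincidence spreads: with g the gap of the fibre around the common value, matchings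
  moving points by less than g / 2 leave a single point of the nearby fibre within g / 2 of that
  value. So the set of coincidence is open and closed.\<close>

lemma continuous_sections_unique:
  assumes I: "connected I" and lo: "locally_ordered_on I Z"
    and q: "continuous_on I q" "\<And>x. x \<in> I \<Longrightarrow> q x \<in> Z x"
    and q': "continuous_on I q'" "\<And>x. x \<in> I \<Longrightarrow> q' x \<in> Z x"
    and x1: "x1 \<in> I" "q x1 = q' x1" and x: "x \<in> I"
  shows "q x = q' x"
proof -
  define A where "A = {x \<in> I. q x = q' x}"
  have "\<exists>\<eta>>0. \<forall>x\<in>I. dist x a < \<eta> \<longrightarrow> x \<in> A" if a: "a \<in> A" for a
  proof -
    have aI: "a \<in> I" and eq: "q a = q' a" using a by (auto simp: A_def)
    have "finite (Z a - {q a})" using lo aI by (simp add: locally_ordered_on_def)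
    then obtain g where g: "g > 0" "\<And>y. y \<in> Z a - {q a} \<Longrightarrow> g \<le> dist (q a) y"
      using finite_set_avoid[of "Z a - {q a}" "q a"] by auto
    obtain \<eta> where \<eta>: "\<eta> > 0" "\<forall>x\<in>I. \<bar>x - a\<bar> < \<eta> \<longrightarrow> (\<exists>h. bij_betw h (Z a) (Z x) \<and> strict_mono_on (Z a) h \<and> (\<forall>y\<in>Z a. \<bar>h y - y\<bar> < g/2))"
      using lo aI half_gt_zero[OF g(1)] unfolding locally_ordered_on_def by blast
    have *: "\<exists>d>0. \<forall>x\<in>I. dist x a < d \<longrightarrow> dist (p x) (p a) < g/2" if "continuous_on I p" for p :: "real \<Rightarrow> real"
      using that aI half_gt_zero[OF g(1)] unfolding continuous_on_iff by blast
    obtain d d' where d: "d > 0" "\<And>x. x \<in> I \<Longrightarrow> dist x a < d \<Longrightarrow> dist (q x) (q a) < g/2"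
      "d' > 0" "\<And>x. x \<in> I \<Longrightarrow> dist x a < d' \<Longrightarrow> dist (q' x) (q' a) < g/2"
      using *[OF q(1)] *[OF q'(1)] by blast
    show ?thesis
    proof (intro exI[of _ "min \<eta> (min d d')"] conjI ballI impI)
      fix x assume x: "x \<in> I" "dist x a < min \<eta> (min d d')"
      then obtain h where h: "bij_betw h (Z a) (Z x)" "\<And>y. y \<in> Z a \<Longrightarrow> \<bar>h y - y\<bar> < g/2"
        using \<eta>(2) unfolding dist_real_def by fastforce
      have val: "z = h (q a)" if "z \<in> Z x" "dist z (q a) < g/2" for z
      proof -
        have "z \<in> h ` Z a" using h(1) that(1) by (simp add: bij_betw_def)
        then obtain y where y: "y \<in> Z a" "z = h y" by blast
        have "dist (q a) y < g" using h(2)[OF y(1)] that(2) y(2) unfolding dist_real_def by linarith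
        then have "y = q a" using g(2)[of y] y(1) by force
        then show ?thesis using y by simp
      qed
      have "q x = h (q a)" "q' x = h (q a)"
        using x d(2)[of x] d(4)[of x] eq q(2) q'(2) by (intro val; simp)+
      then show "x \<in> A" using x by (simp add: A_def)
    qed (use \<eta>(1) d in auto)
  qed
  then have "openin (top_of_set I) A"
    unfolding openin_euclidean_subtopology_iff by (auto simp: A_def)
  moreover have "closedin (top_of_set I) A"
  proof -
    have "closedin (top_of_set I) (I \<inter> (\<lambda>x. q x - q' x) -` {0})"
      by (rule continuous_closedin_preimage) (auto intro!: continuous_intros q q')
    then show ?thesis by (rule back_subst) (auto simp: A_def)
  qed
  moreover have "x1 \<in> A" using x1 by (auto simp: A_def)
  ultimately have "A = I" using I unfolding connected_clopen by blast
  then show ?thesis using x by (auto simp: A_def)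
qed

text \<open>The parameters with a zero over the compact set K form the projection of a compact set,
  hence a closed set, and x0 is not among them.\<close>

lemma nonzero_tube:
  fixes f :: "complex \<Rightarrow> complex \<Rightarrow> complex"
  assumes K: "compact K" and s: "s > 0" and c: "continuous_on (cball x0 s \<times> K) (\<lambda>(x, y). f x y)"
    and nz: "\<And>y. y \<in> K \<Longrightarrow> f x0 y \<noteq> 0"
  shows "\<exists>d>0. d \<le> s \<and> (\<forall>x\<in>ball x0 d. \<forall>y\<in>K. f x y \<noteq> 0)"
proof -
  have cc: "compact (cball x0 s \<times> K)" by (intro compact_Times compact_cball K)
  define A where "A = (cball x0 s \<times> K) \<inter> (\<lambda>(x, y). f x y) -` {0}"
  have "closed A" unfolding A_def by (rule continuous_closed_preimage[OF c compact_imp_closed[OF cc]]) simp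
  then have "compact ((cball x0 s \<times> K) \<inter> A)" using cc by (intro compact_Int_closed)
  then have "compact (fst ` ((cball x0 s \<times> K) \<inter> A))" by (intro compact_continuous_image continuous_intros)
  moreover have "(cball x0 s \<times> K) \<inter> A = A" by (auto simp: A_def)
  ultimately have op: "open (- fst ` A)" by (simp add: compact_imp_closed open_Compl)
  have "x0 \<in> - fst ` A" using nz by (auto simp: A_def)
  then obtain d where d: "d > 0" "ball x0 d \<subseteq> - fst ` A" using openE[OF op] by blast
  have "f x y \<noteq> 0" if xy: "x \<in> ball x0 (min d s)" "y \<in> K" for x y
  proof
    assume "f x y = 0"
    then have "(x, y) \<in> A" using xy by (auto simp: A_def)
    then have "x \<in> fst ` A" by (rule image_eqI[rotated]) simp
    then show False using d(2) xy by auto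
  qed
  then show ?thesis using d s by (intro exI[of _ "min d s"]) auto
qed

locale real_zero_family = zero_family f "complex_of_real a0" "complex_of_real b0" R r r'
  for f a0 b0 R r r' +
  assumes sym: "\<And>x y. x \<in> ball (of_real a0) R \<Longrightarrow> y \<in> ball (of_real b0) r' \<Longrightarrow> f (cnj x) (cnj y) = cnj (f x y)"
    and centre: "\<And>y. y \<in> cball (of_real b0) r \<Longrightarrow> f (of_real a0) y = 0 \<Longrightarrow> y = of_real b0"
begin

definition rzeros :: "real \<Rightarrow> real set" where
  "rzeros x = {y. \<bar>y - b0\<bar> < r \<and> f (of_real x) (of_real y) = 0}"

lemma rzeros_iff: "y \<in> rzeros x \<longleftrightarrow> of_real y \<in> zeros (of_real x)"
  by (auto simp: rzeros_def zeros_def dist_norm norm_minus_commute simp flip: of_real_diff)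

lemma cnj_zeros:
  assumes "\<bar>x - a0\<bar> < R" "y \<in> zeros (of_real x)"
  shows "cnj y \<in> zeros (of_real x)"
proof -
  have x: "of_real x \<in> ball (of_real a0 :: complex) R" using assms(1) by (simp add: dist_norm norm_minus_commute flip: of_real_diff)
  have y: "y \<in> ball (of_real b0) r" "f (of_real x) y = 0" using assms(2) by (auto simp: zeros_def)
  have "f (of_real x) (cnj y) = cnj (f (of_real x) y)" using sym[OF x, of y] y r by auto
  moreover have "cnj y \<in> ball (of_real b0) r"
    using y(1) complex_mod_cnj[of "y - of_real b0"] by (simp add: dist_norm norm_minus_commute)
  ultimately show ?thesis using y by (simp add: zeros_def)
qed

lemma zeros_near_centre:
  assumes e: "e > 0"
  obtains \<eta> where "\<eta> > 0" "\<And>x y. \<bar>x - a0\<bar> < \<eta> \<Longrightarrow> y \<in> rzeros x \<Longrightarrow> \<bar>y - b0\<bar> < e"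
proof -
  define K where "K = cball (complex_of_real b0) r - ball (of_real b0) e"
  have cK: "compact K" unfolding K_def by (intro compact_diff compact_cball open_ball)
  have "continuous_on (cball (of_real a0) (R/2) \<times> K) (\<lambda>(x, y). f x y)"
    by (rule continuous_on_subset[OF cont]) (use R r in \<open>auto simp: K_def\<close>)
  note c = this
  have nz: "f (of_real a0) y \<noteq> 0" if "y \<in> K" for y using centre[of y] that e by (auto simp: K_def)
  obtain d where d: "d > 0" "\<And>x y. x \<in> ball (of_real a0) d \<Longrightarrow> y \<in> K \<Longrightarrow> f x y \<noteq> 0"
    using nonzero_tube[OF cK _ c nz] R by auto
  show ?thesis
  proof (rule that[OF d(1)])
    fix x y assume x: "\<bar>x - a0\<bar> < d" and y: "y \<in> rzeros x"
    have xb: "complex_of_real x \<in> ball (of_real a0) d"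
      using x by (auto simp: dist_of_real dist_real_def abs_minus_commute)
    show "\<bar>y - b0\<bar> < e"
    proof (rule ccontr)
      assume "\<not> ?thesis"
      then have "complex_of_real y \<in> K" using y by (auto simp: K_def rzeros_def dist_norm norm_minus_commute simp flip: of_real_diff)
      then show False using d(2)[OF xb] y by (auto simp: rzeros_def)
    qed
  qed
qed

text \<open>Off the centre the number of complex zeros is constant and each zero persists, so nearby
  zero sets are matched bijectively with small displacement. The symmetry under conjugation makes
  the matching respect real zeros, and small displacements of real numbers preserve their
  order.\<close>

lemma rzeros_locally_ordered:
  obtains \<delta> where "0 < \<delta>" "\<delta> < R" "locally_ordered_on {a0<..<a0 + \<delta>} rzeros" "locally_ordered_on {a0 - \<delta><..<a0} rzeros"
proof -
  obtain k \<delta> where \<delta>: "0 < \<delta>" "\<delta> < R" "\<And>x. x \<in> ball (of_real a0) \<delta> - {of_real a0} \<Longrightarrow> card (zeros x) = k"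
  proof (rule card_zeros_constant)
    fix k \<delta> assume "0 < \<delta>" "\<delta> < R" "\<And>x. x \<in> ball (of_real a0) \<delta> - {of_real a0} \<Longrightarrow> card (zeros x) = k"
    then show thesis by (rule that)
  qed
  have inb: "complex_of_real x \<in> ball (of_real a0) \<delta> - {of_real a0}" if "x \<noteq> a0" "\<bar>x - a0\<bar> < \<delta>" for x
    using that by (auto simp: dist_norm norm_minus_commute simp flip: of_real_diff)
  have lo: "locally_ordered_on I rzeros" if I: "\<And>x. x \<in> I \<Longrightarrow> x \<noteq> a0 \<and> \<bar>x - a0\<bar> < \<delta>" for I
    unfolding locally_ordered_on_def
  proof (intro conjI ballI allI impI)
    have xR: "complex_of_real x \<in> ball (of_real a0) R" if "x \<in> I" for x using inb[of x] I[OF that] \<delta>(2) by auto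
    have fin: "finite (zeros (of_real x))" if "x \<in> I" for x by (rule finite_zeros[OF xR[OF that]])
    show finr: "finite (rzeros x)" if "x \<in> I" for x
    proof -
      have "of_real ` rzeros x \<subseteq> zeros (of_real x)" by (auto simp: rzeros_iff)
      then have "finite (complex_of_real ` rzeros x)" using fin[OF that] finite_subset by blast
      then show ?thesis by (rule finite_imageD) (simp add: inj_on_def)
    qed
    fix x1 e :: real assume x1: "x1 \<in> I" and e: "e > 0"
    let ?Z = "zeros (of_real x1)"
    \<comment> \<open>The positive quantities that a displacement has to beat: mutual distances of
      the zeros, distances of the nonreal ones from the real line, and the given e. The last also
      makes the set nonempty, so that its minimum exists.\<close>
    define W where "W = (\<lambda>(y, z). dist y z) ` {(y, z) \<in> ?Z \<times> ?Z. y \<noteq> z} \<union> (\<lambda>y. \<bar>Im y\<bar>) ` {y \<in> ?Z. Im y \<noteq> 0} \<union> {e}"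
    have finW: "finite W"
    proof -
      have "finite {(y, z) \<in> ?Z \<times> ?Z. y \<noteq> z}"
        by (rule finite_subset[OF _ finite_cartesian_product[OF fin[OF x1] fin[OF x1]]]) auto
      moreover have "finite {y \<in> ?Z. Im y \<noteq> 0}" using fin[OF x1] by simp
      ultimately show ?thesis unfolding W_def by (intro finite_UnI finite_imageI) auto
    qed
    define g where "g = Min W / 2"
    have Wpos: "w > 0" if "w \<in> W" for w using that e by (auto simp: W_def)
    have g: "g > 0" unfolding g_def using finW Wpos by (subst half_gt_zero_iff, subst Min_gr_iff) (auto simp: W_def)
    have gW: "2 * g \<le> w" if "w \<in> W" for w unfolding g_def using Min_le[OF finW that] by simp
    have "\<exists>\<eta>. \<forall>y\<in>?Z. \<eta> y > 0 \<and> (\<forall>x\<in>ball (of_real x1) (\<eta> y). \<exists>y'\<in>zeros x. dist y' y < g)"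
    proof (rule bchoice, rule ballI)
      fix y assume "y \<in> ?Z"
      from zero_persists[OF xR[OF x1] this g]
      obtain \<eta> where "\<eta> > 0" "\<And>x. x \<in> ball (of_real x1) \<eta> \<Longrightarrow> \<exists>y'\<in>zeros x. dist y' y < g" by blast
      then show "\<exists>\<eta>>0. \<forall>x\<in>ball (of_real x1) \<eta>. \<exists>y'\<in>zeros x. dist y' y < g" by blast
    qed
    then obtain \<eta> where \<eta>: "\<And>y. y \<in> ?Z \<Longrightarrow> \<eta> y > 0"
      "\<And>y x. y \<in> ?Z \<Longrightarrow> x \<in> ball (of_real x1) (\<eta> y) \<Longrightarrow> \<exists>y'\<in>zeros x. dist y' y < g" by blast
    define \<eta>0 where "\<eta>0 = Min (insert 1 (\<eta> ` ?Z))"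
    have \<eta>0: "\<eta>0 > 0" unfolding \<eta>0_def using fin[OF x1] \<eta>(1) by (subst Min_gr_iff) auto
    show "\<exists>\<eta>>0. \<forall>x\<in>I. \<bar>x - x1\<bar> < \<eta> \<longrightarrow> (\<exists>h. bij_betw h (rzeros x1) (rzeros x) \<and> strict_mono_on (rzeros x1) h \<and> (\<forall>y\<in>rzeros x1. \<bar>h y - y\<bar> < e))"
    proof (intro exI[of _ \<eta>0] conjI ballI impI \<eta>0)
      fix x assume x: "x \<in> I" "\<bar>x - x1\<bar> < \<eta>0"
      let ?X = "zeros (of_real x)"
      have "\<exists>y'\<in>?X. dist y' y < g" if y: "y \<in> ?Z" for y
      proof (rule \<eta>(2)[OF y])
        have "\<eta>0 \<le> \<eta> y" unfolding \<eta>0_def using fin[OF x1] y by (intro Min_le) auto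
        then show "of_real x \<in> ball (complex_of_real x1) (\<eta> y)" using x by (simp add: dist_norm norm_minus_commute flip: of_real_diff)
      qed
      then have "\<forall>y\<in>?Z. \<exists>y'. y' \<in> ?X \<and> dist y' y < g" by blast
      from bchoice[OF this] obtain h where h: "\<And>y. y \<in> ?Z \<Longrightarrow> h y \<in> ?X \<and> dist (h y) y < g" by blast
      have sep: "y = z" if "y \<in> ?Z" "z \<in> ?Z" "dist y z < 2 * g" for y z
        using gW[of "dist y z"] that by (force simp: W_def)
      have injh: "inj_on h ?Z"
      proof (rule inj_onI)
        fix y z assume yz: "y \<in> ?Z" "z \<in> ?Z" "h y = h z"
        have "dist y z \<le> dist (h y) y + dist (h z) z" using yz(3) dist_triangle3[of y z "h y"] by simp
        then show "y = z" using h[OF yz(1)] h[OF yz(2)] by (intro sep[OF yz(1,2)]) linarith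
      qed
      have "card ?X = card ?Z" using \<delta>(3)[OF inb, of x] \<delta>(3)[OF inb, of x1] I[OF x(1)] I[OF x1] by simp
      then have imh: "h ` ?Z = ?X"
        using h injh fin[OF x(1)] by (intro card_subset_eq) (auto simp: card_image)
      \<comment> \<open>The conjugate of h y is a zero as near to the real y as h y itself, so both
        are the match of y and coincide.\<close>
      have real_h: "Im (h y) = 0" if y: "y \<in> ?Z" "Im y = 0" for y
      proof -
        have "cnj (h y) \<in> ?X" by (rule cnj_zeros) (use h[OF y(1)] I[OF x(1)] \<delta> in auto)
        then have "cnj (h y) \<in> h ` ?Z" using imh by simp
        then obtain z where z: "z \<in> ?Z" "h z = cnj (h y)" by (elim imageE) simp
        have cy: "cnj y = y" using y(2) by (simp add: complex_eq_iff)
        have "dist (cnj (h y)) y = dist (h y) y" 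
          using complex_mod_cnj[of "h y - y"] cy by (simp add: dist_norm)
        moreover have "dist y z \<le> dist (cnj (h y)) y + dist (cnj (h y)) z" using dist_triangle3[of y z "cnj (h y)"] .
        ultimately have "y = z" using h[OF y(1)] h[OF z(1)] z(2) by (intro sep[OF y(1) z(1)]) simp
        then have "cnj (h y) = h y" using z by simp
        then show ?thesis by (simp add: complex_eq_iff)
      qed
      \<comment> \<open>Conversely, a nonreal zero is too far from the real line to be moved onto
        it.\<close>
      have real_h': "Im y = 0" if y: "y \<in> ?Z" "Im (h y) = 0" for y
      proof (rule ccontr)
        assume "Im y \<noteq> 0"
        then have "2 * g \<le> \<bar>Im y\<bar>" using y by (intro gW) (auto simp: W_def)
        moreover have "\<bar>Im (h y - y)\<bar> \<le> dist (h y) y" unfolding dist_norm by (rule abs_Im_le_cmod)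
        ultimately show False using h[OF y(1)] y(2) g by simp
      qed
      define k where "k y = Re (h (of_real y))" for y
      have kh: "of_real (k y) = h (of_real y)" if "y \<in> rzeros x1" for y
        using real_h[of "of_real y"] that by (auto simp: k_def rzeros_iff complex_eq_iff)
      have kd: "\<bar>k y - y\<bar> < g" if "y \<in> rzeros x1" for y
      proof -
        have "dist (h (of_real y)) (of_real y) = \<bar>k y - y\<bar>" unfolding kh[OF that, symmetric] by (simp add: dist_of_real dist_real_def)
        then show ?thesis using h[of "of_real y"] that by (simp add: rzeros_iff)
      qed
      have "bij_betw k (rzeros x1) (rzeros x)"
        unfolding bij_betw_def
      proof
        show "inj_on k (rzeros x1)"
        proof (rule inj_onI)
          fix y z assume yz: "y \<in> rzeros x1" "z \<in> rzeros x1" "k y = k z"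
          then have "h (of_real y) = h (of_real z)" using kh[OF yz(1)] kh[OF yz(2)] by simp
          from inj_onD[OF injh this] have "complex_of_real y = of_real z" using yz by (simp add: rzeros_iff)
          then show "y = z" by simp
        qed
        show "k ` rzeros x1 = rzeros x"
        proof (rule equalityI; rule subsetI)
          fix z assume "z \<in> k ` rzeros x1"
          then show "z \<in> rzeros x" using kh h by (auto simp: rzeros_iff)
        next
          fix z assume "z \<in> rzeros x"
          then have "of_real z \<in> h ` ?Z" using imh by (simp add: rzeros_iff)
          then obtain y where y: "y \<in> ?Z" "h y = of_real z" by (elim imageE) simp
          then have "Im y = 0" using real_h'[OF y(1)] by simp
          then have yr: "of_real (Re y) = y" by (simp add: complex_eq_iff)
          then have "Re y \<in> rzeros x1" using y(1) by (simp add: rzeros_iff)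
          moreover have "k (Re y) = z" using y(2) yr by (simp add: k_def)
          ultimately show "z \<in> k ` rzeros x1" by blast
        qed
      qed
      moreover have "strict_mono_on (rzeros x1) k"
      proof (rule strict_mono_onI)
        fix y z assume yz: "y \<in> rzeros x1" "z \<in> rzeros x1" "y < z"
        have "2 * g \<le> dist (complex_of_real y) (of_real z)"
        proof (rule gW)
          have "(complex_of_real y, complex_of_real z) \<in> {(y, z) \<in> ?Z \<times> ?Z. y \<noteq> z}" using yz by (simp add: rzeros_iff)
          from imageI[OF this, of "\<lambda>(y, z). dist y z"]
          show "dist (complex_of_real y) (of_real z) \<in> W" unfolding W_def by simp
        qed
        then have "2 * g \<le> z - y" using yz by (simp add: dist_of_real dist_real_def)
        then show "k y < k z" using kd[OF yz(1)] kd[OF yz(2)] by linarith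
      qed
      moreover have "\<bar>k y - y\<bar> < e" if "y \<in> rzeros x1" for y using kd[OF that] gW[of e] g by (auto simp: W_def)
      ultimately show "\<exists>h. bij_betw h (rzeros x1) (rzeros x) \<and> strict_mono_on (rzeros x1) h \<and> (\<forall>y\<in>rzeros x1. \<bar>h y - y\<bar> < e)" by blast
    qed
  qed
  have "locally_ordered_on {a0<..<a0 + \<delta>} rzeros" "locally_ordered_on {a0 - \<delta><..<a0} rzeros"
    by (rule lo; force)+
  then show ?thesis by (rule that[OF \<delta>(1,2)])
qed

end

section \<open>The complexified shooting function\<close>

definition nl :: "'a::{real_normed_field,banach} \<Rightarrow> 'a \<Rightarrow> 'a" where
  "nl l y = y + l * y\<^sup>2 - y ^ 4"

lemma continuous_nl: "continuous_on UNIV (nl l)"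
  unfolding nl_def by (intro continuous_intros)

lemma nl_lipschitz:
  fixes l y z :: "'a::{real_normed_field,banach}"
  assumes "norm y \<le> M" "norm z \<le> M" "norm l \<le> A"
  shows "norm (nl l y - nl l z) \<le> (1 + 2 * A * M + 4 * M ^ 3) * norm (y - z)"
proof -
  have M: "0 \<le> M" using assms(1) norm_ge_zero order_trans by blast
  have A: "0 \<le> A" using assms(3) norm_ge_zero order_trans by blast
  have eq: "nl l y - nl l z = (1 + l * (y + z) - (y + z) * (y\<^sup>2 + z\<^sup>2)) * (y - z)"
    by (simp add: nl_def power2_eq_square power4_eq_xxxx algebra_simps)
  have yz: "norm (y + z) \<le> 2 * M" using norm_triangle_le[of y z "2 * M"] assms by simp
  have yz2: "norm (y\<^sup>2 + z\<^sup>2) \<le> 2 * M\<^sup>2"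
  proof (rule norm_triangle_le)
    have "norm y ^ 2 \<le> M\<^sup>2" "norm z ^ 2 \<le> M\<^sup>2" using assms by (auto intro!: power_mono)
    then show "norm (y\<^sup>2) + norm (z\<^sup>2) \<le> 2 * M\<^sup>2" by (simp add: norm_power)
  qed
  have "norm (1 + l * (y + z) - (y + z) * (y\<^sup>2 + z\<^sup>2)) \<le> norm (1 + l * (y + z)) + norm ((y + z) * (y\<^sup>2 + z\<^sup>2))"
    by (rule norm_triangle_ineq4)
  also have "norm (1 + l * (y + z)) \<le> 1 + norm (l * (y + z))" by (rule order_trans[OF norm_triangle_ineq]) simp
  also have "norm (l * (y + z)) \<le> A * (2 * M)" unfolding norm_mult using assms yz A by (intro mult_mono) auto
  also have "norm ((y + z) * (y\<^sup>2 + z\<^sup>2)) \<le> (2 * M) * (2 * M\<^sup>2)" unfolding norm_mult using yz yz2 M by (intro mult_mono) auto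
  finally have "norm (1 + l * (y + z) - (y + z) * (y\<^sup>2 + z\<^sup>2)) \<le> 1 + 2 * A * M + 4 * M ^ 3"
    by (simp add: power2_eq_square power3_eq_cube)
  then show ?thesis unfolding eq norm_mult by (intro mult_right_mono) auto
qed

lemma bounded_on_Icc:
  fixes u :: "real \<Rightarrow> 'a::real_normed_vector"
  assumes "continuous_on {0..b} u"
  obtains M where "M \<ge> 0" "\<And>x. x \<in> {0..b} \<Longrightarrow> norm (u x) \<le> M"
proof -
  have "compact (u ` {0..b})" by (intro compact_continuous_image assms) auto
  then obtain M where M: "\<forall>y\<in>u ` {0..b}. norm y \<le> M" by (auto dest!: compact_imp_bounded simp: bounded_iff)
  show ?thesis by (rule that[of "max M 0"]) (use M in force)+
qed

lemma nl_sol_unique: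
  fixes y z :: "real \<Rightarrow> 'a::{real_normed_field,banach}"
  assumes "volterra_sol b (nl l) l p y" "volterra_sol b (nl l) l p z" "x \<in> {0..b}"
  shows "y x = z x"
proof -
  obtain M1 where M1: "M1 \<ge> 0" "\<And>x. x \<in> {0..b} \<Longrightarrow> norm (y x) \<le> M1"
    using bounded_on_Icc[of b y] assms(1) unfolding volterra_sol_def by blast
  obtain M2 where M2: "M2 \<ge> 0" "\<And>x. x \<in> {0..b} \<Longrightarrow> norm (z x) \<le> M2"
    using bounded_on_Icc[of b z] assms(2) unfolding volterra_sol_def by blast
  define M where "M = max M1 M2"
  show ?thesis
  proof (rule volterra_sol_unique[OF assms(1,2) continuous_nl _ _ assms(3)])
    show "norm (nl l (y t) - nl l (z t)) \<le> (1 + 2 * norm l * M + 4 * M ^ 3) * norm (y t - z t)" if "t \<in> {0..b}" for t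
      by (rule nl_lipschitz) (use M1(2)[OF that] M2(2)[OF that] in \<open>auto simp: M_def\<close>)
    show "0 \<le> 1 + 2 * norm l * M + 4 * M ^ 3" using M1(1) M2(1) by (simp add: M_def)
  qed
qed

text \<open>The variable upper limit is moved into the integrand, so that the integral runs over a
  fixed path and the lemmas on contour integrals with parameters apply.\<close>

lemma integral_rescale:
  fixes f :: "real \<Rightarrow> complex"
  assumes "continuous_on {0..x} f" "x \<ge> 0"
  shows "integral {0..x} f = contour_integral (linepath 0 1) (\<lambda>z. of_real x * f (x * Re z))"
proof (cases "x = 0")
  case True then show ?thesis by simp
next
  case False
  then have x: "x > 0" using assms by simp
  have "(f has_integral integral {0..x} f) {0..x}"
    using assms by (intro integrable_integral integrable_continuous_interval)
  then have "((\<lambda>z. f (Re z)) has_contour_integral integral {0..x} f) (linepath 0 (of_real x))"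
    using has_contour_integral_linepath_Reals_iff[of 0 "of_real x" "\<lambda>z. f (Re z)"] x by simp
  then have "((\<lambda>s. f (Re (linepath 0 (of_real x) s)) * of_real x) has_integral integral {0..x} f) {0..1}"
    by (simp add: has_contour_integral_linepath)
  then have "((\<lambda>s. f (x * s) * of_real x) has_integral integral {0..x} f) {0..1}"
    by (simp add: linepath_def mult.commute)
  then have "((\<lambda>z. of_real x * f (x * Re z)) has_contour_integral integral {0..x} f) (linepath 0 1)"
    unfolding has_contour_integral_linepath by (simp add: linepath_def mult.commute)
  then show ?thesis by (simp add: contour_integral_unique)
qed

text \<open>Joint continuity belongs to the induction because the holomorphy of the next iterate, an
  integral with parameters, is derived from it.\<close>

lemma picard_param:
  fixes w :: "real \<Rightarrow> complex"
  assumes cw: "continuous_on {0..pi} w"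
  shows "continuous_on (UNIV \<times> {0..pi}) (\<lambda>z. picard (nl (fst (fst z))) (fst (fst z)) (snd (fst z)) w n (snd z))
     \<and> (\<forall>x\<in>{0..pi}. \<forall>p. (\<lambda>l. picard (nl l) l p w n x) holomorphic_on UNIV)
     \<and> (\<forall>x\<in>{0..pi}. \<forall>l. (\<lambda>p. picard (nl l) l p w n x) holomorphic_on UNIV)"
proof (induction n)
  case 0
  have "continuous_on (UNIV \<times> {0..pi}) (\<lambda>z :: (complex \<times> complex) \<times> real. w (snd z))"
    by (rule continuous_on_compose2[OF cw]) (auto intro!: continuous_intros)
  then show ?case by simp
next
  case (Suc n)
  define u where "u l p = picard (nl l) l p w n" for l p
  have cu: "continuous_on (UNIV \<times> {0..pi}) (\<lambda>z. u (fst (fst z)) (snd (fst z)) (snd z))" using Suc by (simp add: u_def)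
  have hl: "(\<lambda>l. u l p x) holomorphic_on UNIV" and hp: "(\<lambda>p. u l p x) holomorphic_on UNIV" if "x \<in> {0..pi}" for x l p
    using Suc that by (auto simp: u_def)
  define H where "H l p x z = of_real x * (l * u l p (x * Re z) + of_real (x - x * Re z) * nl l (u l p (x * Re z)))" for l p z and x :: real
  have cux: "continuous_on {0..x} (u l p)" if "x \<in> {0..pi}" for l p x
  proof -
    have "continuous_on {0..x} (\<lambda>t. (\<lambda>z. u (fst (fst z)) (snd (fst z)) (snd z)) ((l, p), t))"
      by (rule continuous_on_compose2[OF cu]) (use that in \<open>auto intro!: continuous_intros\<close>)
    then show ?thesis by simp
  qed
  have step: "picard (nl l) l p w (Suc n) x = p * of_real x - contour_integral (linepath 0 1) (H l p x)" if x: "x \<in> {0..pi}" for l p x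
  proof -
    have "continuous_on {0..x} (\<lambda>t. l * u l p t + of_real (x - t) * nl l (u l p t))"
      by (rule continuous_volterra_integrand[OF cux[OF x] continuous_nl]) simp
    from integral_rescale[OF this] show ?thesis using x by (simp add: volterra_def u_def H_def[abs_def])
  qed
  have cH: "continuous_on S (\<lambda>z. H (a z) (b z) (c z) (d z))"
    if abcd: "continuous_on S a" "continuous_on S b" "continuous_on S c" "continuous_on S d"
      "\<And>z. z \<in> S \<Longrightarrow> c z \<in> {0..pi} \<and> Re (d z) \<in> {0..1}" for S :: "'z::topological_space set" and a b c d
  proof -
    have "continuous_on S (\<lambda>z. (\<lambda>z. u (fst (fst z)) (snd (fst z)) (snd z)) ((a z, b z), c z * Re (d z)))"
    proof (rule continuous_on_compose2[OF cu])
      show "continuous_on S (\<lambda>z. ((a z, b z), c z * Re (d z)))" using abcd by (intro continuous_intros)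
      show "(\<lambda>z. ((a z, b z), c z * Re (d z))) ` S \<subseteq> UNIV \<times> {0..pi}"
      proof -
        have "c z * Re (d z) \<in> {0..pi}" if "z \<in> S" for z
          using abcd(5)[OF that] mult_mono[of "c z" pi "Re (d z)" 1] by auto
        then show ?thesis by blast
      qed
    qed
    then have 1: "continuous_on S (\<lambda>z. u (a z) (b z) (c z * Re (d z)))" by simp
    show ?thesis unfolding H_def nl_def using abcd(1-4) by (intro continuous_intros 1)
  qed
  have pim: "Re z \<in> {0..1}" if z: "z \<in> path_image (linepath (0::complex) 1)" for z
  proof -
    obtain t where "t \<in> {0..1}" "z = linepath 0 1 t" using z unfolding path_image_def by blast
    then show ?thesis by (simp add: linepath_def)
  qed
  have vd: "continuous_on {0..1} (\<lambda>t. vector_derivative (linepath (0::complex) 1) (at t))"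
    unfolding vector_derivative_linepath_at by (intro continuous_intros)
  have vp: "valid_path (linepath (0::complex) 1)" by simp
  have xr: "x * Re z \<in> {0..pi}" if "x \<in> {0..pi}" "z \<in> path_image (linepath (0::complex) 1)" for x z
    using that pim[OF that(2)] mult_mono[of x pi "Re z" 1] by auto
  have "continuous_on (UNIV \<times> {0..pi}) (\<lambda>z. snd (fst z) * of_real (snd z) - contour_integral (linepath 0 1) (H (fst (fst z)) (snd (fst z)) (snd z)))"
  proof (intro continuous_on_diff contour_integral_continuous_param[OF vp vd])
    show "continuous_on (UNIV \<times> {0..pi}) (\<lambda>z :: (complex \<times> complex) \<times> real. snd (fst z) * of_real (snd z))" by (intro continuous_intros)
    show "continuous_on ((UNIV \<times> {0..pi}) \<times> path_image (linepath 0 1)) (\<lambda>(z, y). H (fst (fst z)) (snd (fst z)) (snd z) y)"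
      unfolding split_def using pim by (intro cH continuous_intros) auto
  qed
  then have 1: "continuous_on (UNIV \<times> {0..pi}) (\<lambda>z. picard (nl (fst (fst z))) (fst (fst z)) (snd (fst z)) w (Suc n) (snd z))"
    by (rule continuous_on_eq) (use step in auto)
  have "(\<lambda>l. p * of_real x - contour_integral (linepath 0 1) (H l p x)) holomorphic_on UNIV" if x: "x \<in> {0..pi}" for x p
  proof (intro holomorphic_intros contour_integral_holomorphic_param[OF _ vp vd])
    show "continuous_on (UNIV \<times> path_image (linepath 0 1)) (\<lambda>(l, y). H l p x y)"
      unfolding split_def using pim x by (intro cH continuous_intros) auto
    show "(\<lambda>l. H l p x z) holomorphic_on UNIV" if "z \<in> path_image (linepath 0 1)" for z
      unfolding H_def nl_def by (intro holomorphic_intros hl xr x that)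
  qed simp
  then have 2: "(\<lambda>l. picard (nl l) l p w (Suc n) x) holomorphic_on UNIV" if "x \<in> {0..pi}" for x p
    using that step by simp
  have "(\<lambda>p. p * of_real x - contour_integral (linepath 0 1) (H l p x)) holomorphic_on UNIV" if x: "x \<in> {0..pi}" for x l
  proof (intro holomorphic_intros contour_integral_holomorphic_param[OF _ vp vd])
    show "continuous_on (UNIV \<times> path_image (linepath 0 1)) (\<lambda>(p, y). H l p x y)"
      unfolding split_def using pim x by (intro cH continuous_intros) auto
    show "(\<lambda>p. H l p x z) holomorphic_on UNIV" if "z \<in> path_image (linepath 0 1)" for z
      unfolding H_def nl_def by (intro holomorphic_intros hp xr x that)
  qed simp
  then have 3: "(\<lambda>p. picard (nl l) l p w (Suc n) x) holomorphic_on UNIV" if "x \<in> {0..pi}" for x l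
    using that step by simp
  show ?case using 1 2 3 by blast
qed

section \<open>Solutions of the polynomial equation with complex data\<close>

definition csol :: "complex \<Rightarrow> complex \<Rightarrow> real \<Rightarrow> complex" where
  "csol l p = (SOME y. volterra_sol pi (nl l) l p y)"

definition cdom :: "(complex \<times> complex) set" where
  "cdom = {(l, p). \<exists>y. volterra_sol pi (nl l) l p y}"

definition cshoot :: "complex \<Rightarrow> complex \<Rightarrow> complex" where
  "cshoot l p = csol l p pi"

lemma csol_sol: "(l, p) \<in> cdom \<Longrightarrow> volterra_sol pi (nl l) l p (csol l p)"
proof -
  assume "(l, p) \<in> cdom"
  then have "\<exists>y. volterra_sol pi (nl l) l p y" by (simp add: cdom_def)
  then show ?thesis unfolding csol_def by (rule someI_ex)
qed

lemma csol_eq: "volterra_sol pi (nl l) l p y \<Longrightarrow> x \<in> {0..pi} \<Longrightarrow> csol l p x = y x"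
  by (rule nl_sol_unique[of pi l p]) (auto intro!: csol_sol simp: cdom_def)

text \<open>Picard iteration is started at the base solution itself, whose defect for nearby data is
  small, in a tube of radius 1. As the starting function does not depend on the new data, all
  iterates depend holomorphically on them.\<close>

lemma csol_near:
  assumes base: "(l0, p0) \<in> cdom"
  obtains \<eta> C where "0 < \<eta>" "\<eta> \<le> 1" "C \<ge> 0"
    "\<And>l p. l \<in> ball l0 \<eta> \<Longrightarrow> p \<in> ball p0 \<eta> \<Longrightarrow> (l, p) \<in> cdom"
    "\<And>l p x n. l \<in> ball l0 \<eta> \<Longrightarrow> p \<in> ball p0 \<eta> \<Longrightarrow> x \<in> {0..pi} \<Longrightarrow>
       norm (csol l p x - picard (nl l) l p (csol l0 p0) n x) \<le> (1/2) ^ n"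
    "\<And>l p x. l \<in> ball l0 \<eta> \<Longrightarrow> p \<in> ball p0 \<eta> \<Longrightarrow> x \<in> {0..pi} \<Longrightarrow>
       norm (csol l p x - csol l0 p0 x) \<le> C * (norm (l - l0) + norm (p - p0))"
proof -
  let ?w = "csol l0 p0"
  have w: "volterra_sol pi (nl l0) l0 p0 ?w" by (rule csol_sol[OF base])
  then have cw: "continuous_on {0..pi} ?w" by (simp add: volterra_sol_def)
  obtain M where M: "M \<ge> 0" "\<And>x. x \<in> {0..pi} \<Longrightarrow> norm (?w x) \<le> M" using bounded_on_Icc[OF cw] by blast
  define L where "L = 1 + 2 * (norm l0 + 1) * (M + 1) + 4 * (M + 1) ^ 3"
  have L0: "L \<ge> 0" using M by (simp add: L_def)
  define E where "E = exp ((2 * ((norm l0 + 1) + pi * L) + 1) * pi)"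
  define B where "B = pi + M * pi + pi\<^sup>2 * M\<^sup>2"
  have B: "B > 0" unfolding B_def using M by (intro add_pos_nonneg) auto
  have E: "E > 0" by (simp add: E_def)
  \<comment> \<open>Within distance \<eta> of the base point the defect is at most 2 B \<eta>, and 4
    B \<eta> E \<le> 1 is the smallness condition for the tube of radius 1.\<close>
  define \<eta> where "\<eta> = min 1 (1 / (4 * B * E))"
  have \<eta>: "0 < \<eta>" "\<eta> \<le> 1" "2 * (2 * B * \<eta>) * E \<le> 1"
  proof -
    show "0 < \<eta>" "\<eta> \<le> 1" using B E by (auto simp: \<eta>_def)
    have "\<eta> \<le> 1 / (4 * B * E)" by (simp add: \<eta>_def)
    then show "2 * (2 * B * \<eta>) * E \<le> 1" using B E by (simp add: field_simps)
  qed
  have ldiff: "norm (nl l (?w t) - nl l0 (?w t)) \<le> norm (l - l0) * M\<^sup>2" if "t \<in> {0..pi}" for l t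
  proof -
    have "nl l (?w t) - nl l0 (?w t) = (l - l0) * (?w t)\<^sup>2" by (simp add: nl_def algebra_simps)
    moreover have "norm (?w t) ^ 2 \<le> M\<^sup>2" using M(2)[OF that] by (intro power_mono) auto
    ultimately show ?thesis by (simp add: norm_mult norm_power mult_left_mono)
  qed
  have dB: "norm (p - p0) * pi + norm (l - l0) * M * pi + pi\<^sup>2 * (norm (l - l0) * M\<^sup>2) \<le> B * (norm (l - l0) + norm (p - p0))" for l p
  proof -
    have "norm (p - p0) * pi + norm (l - l0) * M * pi + pi\<^sup>2 * (norm (l - l0) * M\<^sup>2)
       \<le> (norm (p - p0) * pi + norm (l - l0) * M * pi + pi\<^sup>2 * (norm (l - l0) * M\<^sup>2))
        + (norm (l - l0) * pi + norm (p - p0) * (M * pi + pi\<^sup>2 * M\<^sup>2))" using M by simp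
    also have "\<dots> = B * (norm (l - l0) + norm (p - p0))" by (simp add: B_def algebra_simps)
    finally show ?thesis .
  qed
  have tube: "picard_tube (nl l) l p ?w pi L (2 * B * \<eta>) 1" if l: "l \<in> ball l0 \<eta>" and p: "p \<in> ball p0 \<eta>" for l p
  proof
    have nl': "norm (l - l0) \<le> \<eta>" "norm (p - p0) \<le> \<eta>" using l p by (auto simp: dist_norm norm_minus_commute)
    have ll: "norm l \<le> norm l0 + 1" using nl'(1) \<eta>(2) norm_triangle_sub[of l l0] by simp
    show "norm (nl l y - nl l z) \<le> L * norm (y - z)"
      if x: "x \<in> {0..pi}" and "norm (y - ?w x) \<le> 1" "norm (z - ?w x) \<le> 1" for x y z
      unfolding L_def
      by (rule nl_lipschitz[OF _ _ ll]) (use that M(2)[OF x] norm_triangle_sub[of y "?w x"] norm_triangle_sub[of z "?w x"] in linarith)+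
    fix x assume x: "x \<in> {0..pi}"
    have "norm (volterra (nl l) l p ?w x - volterra (nl l0) l0 p0 ?w x)
      \<le> (norm (p - p0) * pi + norm (l - l0) * M * pi + pi\<^sup>2 * (norm (l - l0) * M\<^sup>2))
       + integral {0..x} (\<lambda>t. (norm l + pi * L) * norm (?w t - ?w t))"
      by (rule volterra_diff_le[OF cw cw continuous_nl continuous_nl _ L0 ldiff M(2) x]) auto
    also have "\<dots> \<le> B * (norm (l - l0) + norm (p - p0))" using dB by simp
    also have "\<dots> \<le> B * (2 * \<eta>)" using nl' B by (intro mult_left_mono) auto
    finally show "norm (volterra (nl l) l p ?w x - ?w x) \<le> 2 * B * \<eta>"
      using w x by (simp add: volterra_sol_def mult_ac)
  next
    have nl': "norm (l - l0) \<le> \<eta>" using l by (auto simp: dist_norm norm_minus_commute)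
    have ll: "norm l \<le> norm l0 + 1" using nl' \<eta>(2) norm_triangle_sub[of l l0] by simp
    then have "exp ((2 * (norm l + pi * L) + 1) * pi) \<le> E" by (simp add: E_def)
    then have "2 * (2 * B * \<eta>) * exp ((2 * (norm l + pi * L) + 1) * pi) \<le> 2 * (2 * B * \<eta>) * E"
      using B \<eta> by (intro mult_left_mono) auto
    then show "2 * (2 * B * \<eta>) * exp ((2 * (norm l + pi * L) + 1) * pi) \<le> 1" using \<eta>(3) by linarith
  qed (use cw continuous_nl L0 in auto)
  have ex: "\<exists>u. volterra_sol pi (nl l) l p u \<and> (\<forall>x\<in>{0..pi}. norm (u x - ?w x) \<le> 1) \<and> (\<forall>x\<in>{0..pi}. \<forall>n. norm (u x - picard (nl l) l p ?w n x) \<le> (1/2) ^ n)"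
    if lp: "l \<in> ball l0 \<eta>" "p \<in> ball p0 \<eta>" for l p
  proof -
    interpret picard_tube "nl l" l p ?w pi L "2 * B * \<eta>" 1 by (rule tube[OF lp])
    show ?thesis using picard_ex unfolding mult_1 .
  qed
  have dom: "(l, p) \<in> cdom" if "l \<in> ball l0 \<eta>" "p \<in> ball p0 \<eta>" for l p using ex[OF that] by (auto simp: cdom_def)
  have near1: "norm (csol l p x - ?w x) \<le> 1" if "l \<in> ball l0 \<eta>" "p \<in> ball p0 \<eta>" "x \<in> {0..pi}" for l p x
    using ex[OF that(1,2)] csol_eq[OF _ that(3)] that(3) by fastforce
  have it: "norm (csol l p x - picard (nl l) l p ?w n x) \<le> (1/2) ^ n" if "l \<in> ball l0 \<eta>" "p \<in> ball p0 \<eta>" "x \<in> {0..pi}" for l p x n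
    using ex[OF that(1,2)] csol_eq[OF _ that(3)] that(3) by fastforce
  have lip: "norm (csol l p x - ?w x) \<le> 2 * B * E * (norm (l - l0) + norm (p - p0))"
    if l: "l \<in> ball l0 \<eta>" and p: "p \<in> ball p0 \<eta>" and x: "x \<in> {0..pi}" for l p x
  proof -
    have nl': "norm (l - l0) \<le> \<eta>" using l by (auto simp: dist_norm norm_minus_commute)
    have ll: "norm l \<le> norm l0 + 1" using nl' \<eta>(2) norm_triangle_sub[of l l0] by simp
    have "norm (csol l p x - ?w x) \<le> 2 * (norm (p - p0) * pi + norm (l - l0) * M * pi + pi\<^sup>2 * (norm (l - l0) * M\<^sup>2))
       * exp ((2 * (norm l + pi * L) + 1) * x)"
    proof (rule volterra_sol_dist[OF csol_sol[OF dom[OF l p]] w continuous_nl continuous_nl _ L0 ldiff M(2) x])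
      fix t assume t: "t \<in> {0..pi}"
      show "norm (nl l (csol l p t) - nl l (?w t)) \<le> L * norm (csol l p t - ?w t)" unfolding L_def
        by (rule nl_lipschitz[OF _ _ ll]) (use M(2)[OF t] norm_triangle_sub[of "csol l p t" "?w t"] near1[OF l p t] in linarith)+
    qed
    also have "\<dots> \<le> 2 * (B * (norm (l - l0) + norm (p - p0))) * E"
    proof (rule mult_mono)
      have "norm l + pi * L \<le> norm l0 + 1 + pi * L" using ll by simp
      then have "(2 * (norm l + pi * L) + 1) * x \<le> (2 * ((norm l0 + 1) + pi * L) + 1) * pi"
        using x L0 by (intro mult_mono) auto
      then show "exp ((2 * (norm l + pi * L) + 1) * x) \<le> E" by (simp add: E_def)
      show "2 * (norm (p - p0) * pi + norm (l - l0) * M * pi + pi\<^sup>2 * (norm (l - l0) * M\<^sup>2))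
          \<le> 2 * (B * (norm (l - l0) + norm (p - p0)))" by (rule mult_left_mono[OF dB]) simp
    qed (use B in auto)
    finally show ?thesis by (simp add: mult_ac)
  qed
  show ?thesis
    by (rule that[OF \<eta>(1,2) _ dom it lip]) (use B E in auto)
qed

text \<open>The iterates are entire in each variable and converge at the rate (1/2)^n independently
  of the data, so continuity and holomorphy pass to the limit.\<close>

lemma cshoot_near:
  assumes base: "(l0, p0) \<in> cdom"
  obtains \<eta> where "0 < \<eta>" "ball l0 \<eta> \<times> ball p0 \<eta> \<subseteq> cdom"
    "continuous_on (ball l0 \<eta> \<times> ball p0 \<eta>) (\<lambda>(l, p). cshoot l p)"
    "\<And>p. p \<in> ball p0 \<eta> \<Longrightarrow> (\<lambda>l. cshoot l p) holomorphic_on ball l0 \<eta>"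
    "\<And>l. l \<in> ball l0 \<eta> \<Longrightarrow> cshoot l holomorphic_on ball p0 \<eta>"
proof -
  obtain \<eta> C where \<eta>: "0 < \<eta>" "\<And>l p. l \<in> ball l0 \<eta> \<Longrightarrow> p \<in> ball p0 \<eta> \<Longrightarrow> (l, p) \<in> cdom"
    "\<And>l p x n. l \<in> ball l0 \<eta> \<Longrightarrow> p \<in> ball p0 \<eta> \<Longrightarrow> x \<in> {0..pi} \<Longrightarrow>
       norm (csol l p x - picard (nl l) l p (csol l0 p0) n x) \<le> (1/2) ^ n"
    by (rule csol_near[OF base]) blast
  have cw: "continuous_on {0..pi} (csol l0 p0)" using csol_sol[OF base] by (simp add: volterra_sol_def)
  let ?P = "\<lambda>n l p. picard (nl l) l p (csol l0 p0) n pi"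
  have est: "norm (cshoot l p - ?P n l p) \<le> (1/2) ^ n" if "l \<in> ball l0 \<eta>" "p \<in> ball p0 \<eta>" for l p n
    using \<eta>(3)[OF that, of pi n] by (simp add: cshoot_def)
  have lim0: "(\<lambda>n. (1/2::real) ^ n) \<longlonglongrightarrow> 0" by (rule LIMSEQ_power_zero) simp
  have ul: "uniform_limit S (\<lambda>n z. ?P n (a z) (b z)) (\<lambda>z. cshoot (a z) (b z)) sequentially"
    if ab: "\<And>z. z \<in> S \<Longrightarrow> a z \<in> ball l0 \<eta> \<and> b z \<in> ball p0 \<eta>" for S :: "'z set" and a b
  proof (rule uniform_limitI)
    fix e :: real assume "e > 0"
    have "\<forall>\<^sub>F n in sequentially. (1/2::real) ^ n < e" by (rule order_tendstoD(2)[OF lim0 \<open>e > 0\<close>])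
    then show "\<forall>\<^sub>F n in sequentially. \<forall>z\<in>S. dist (?P n (a z) (b z)) (cshoot (a z) (b z)) < e"
    proof eventually_elim
      case (elim n)
      show ?case
      proof
        fix z assume "z \<in> S"
        then have "norm (cshoot (a z) (b z) - ?P n (a z) (b z)) \<le> (1/2) ^ n" using ab est by blast
        then show "dist (?P n (a z) (b z)) (cshoot (a z) (b z)) < e" using elim by (simp add: dist_norm norm_minus_commute)
      qed
    qed
  qed
  show ?thesis
  proof (rule that[OF \<eta>(1)])
    show "ball l0 \<eta> \<times> ball p0 \<eta> \<subseteq> cdom" using \<eta>(2) by auto
    have "continuous_on (ball l0 \<eta> \<times> ball p0 \<eta>) (\<lambda>z. cshoot (fst z) (snd z))"
    proof (rule uniform_limit_theorem[OF _ ul])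
      show "\<forall>\<^sub>F n in sequentially. continuous_on (ball l0 \<eta> \<times> ball p0 \<eta>) (\<lambda>z. ?P n (fst z) (snd z))"
      proof (intro always_eventually allI)
        fix n
        have "continuous_on (ball l0 \<eta> \<times> ball p0 \<eta>) (\<lambda>z. (\<lambda>z. picard (nl (fst (fst z))) (fst (fst z)) (snd (fst z)) (csol l0 p0) n (snd z)) (z, pi))"
          by (rule continuous_on_compose2[OF conjunct1[OF picard_param[OF cw, of n]]]) (auto intro!: continuous_intros)
        then show "continuous_on (ball l0 \<eta> \<times> ball p0 \<eta>) (\<lambda>z. ?P n (fst z) (snd z))" by simp
      qed
    qed auto
    then show "continuous_on (ball l0 \<eta> \<times> ball p0 \<eta>) (\<lambda>(l, p). cshoot l p)" by (simp add: split_def)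
    show "(\<lambda>l. cshoot l p) holomorphic_on ball l0 \<eta>" if p: "p \<in> ball p0 \<eta>" for p
    proof (rule holomorphic_uniform_sequence[where f = "\<lambda>n l. ?P n l p"])
      show "(\<lambda>l. ?P n l p) holomorphic_on ball l0 \<eta>" for n
      proof -
        have "(\<lambda>l. ?P n l p) holomorphic_on UNIV" using picard_param[OF cw, of n] by simp
        then show ?thesis by (rule holomorphic_on_subset) simp
      qed
      fix x assume "x \<in> ball l0 \<eta>"
      then obtain d where d: "d > 0" "cball x d \<subseteq> ball l0 \<eta>" using open_contains_cball[of "ball l0 \<eta>"] open_ball by blast
      have "uniform_limit (cball x d) (\<lambda>n l. ?P n l p) (\<lambda>l. cshoot l p) sequentially" by (rule ul) (use d p in auto)
      then show "\<exists>d>0. cball x d \<subseteq> ball l0 \<eta> \<and> uniform_limit (cball x d) (\<lambda>n l. ?P n l p) (\<lambda>l. cshoot l p) sequentially" using d by blast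
    qed simp
    show "cshoot l holomorphic_on ball p0 \<eta>" if l: "l \<in> ball l0 \<eta>" for l
    proof (rule holomorphic_uniform_sequence[where f = "\<lambda>n p. ?P n l p"])
      show "(\<lambda>p. ?P n l p) holomorphic_on ball p0 \<eta>" for n
      proof -
        have "(\<lambda>p. ?P n l p) holomorphic_on UNIV" using picard_param[OF cw, of n] by simp
        then show ?thesis by (rule holomorphic_on_subset) simp
      qed
      fix x assume "x \<in> ball p0 \<eta>"
      then obtain d where d: "d > 0" "cball x d \<subseteq> ball p0 \<eta>" using open_contains_cball[of "ball p0 \<eta>"] open_ball by blast
      have "uniform_limit (cball x d) (\<lambda>n p. ?P n l p) (cshoot l) sequentially" by (rule ul) (use d l in auto)
      then show "\<exists>d>0. cball x d \<subseteq> ball p0 \<eta> \<and> uniform_limit (cball x d) (\<lambda>n p. ?P n l p) (cshoot l) sequentially" using d by blast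
    qed simp
  qed
qed

lemma cnj_volterra_sol:
  assumes "volterra_sol pi (nl l) l p y"
  shows "volterra_sol pi (nl (cnj l)) (cnj l) (cnj p) (\<lambda>x. cnj (y x))"
  unfolding volterra_sol_def
proof (intro conjI ballI)
  have cy: "continuous_on {0..pi} y" using assms by (simp add: volterra_sol_def)
  show "continuous_on {0..pi} (\<lambda>x. cnj (y x))" by (intro continuous_intros cy)
  fix x assume x: "x \<in> {0..pi}"
  have "y x = volterra (nl l) l p y x" using assms x by (simp add: volterra_sol_def)
  then have "cnj (y x) = cnj p * of_real x - cnj (integral {0..x} (\<lambda>t. l * y t + of_real (x - t) * nl l (y t)))"
    by (simp add: volterra_def)
  also have "cnj (integral {0..x} (\<lambda>t. l * y t + of_real (x - t) * nl l (y t)))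
      = integral {0..x} (\<lambda>t. cnj (l * y t + of_real (x - t) * nl l (y t)))"
    by (rule integral_cnj)
  finally show "cnj (y x) = volterra (nl (cnj l)) (cnj l) (cnj p) (\<lambda>x. cnj (y x)) x"
    by (simp add: volterra_def nl_def)
qed

lemma cshoot_cnj: "(l, p) \<in> cdom \<Longrightarrow> cshoot (cnj l) (cnj p) = cnj (cshoot l p)"
  unfolding cshoot_def using csol_eq[OF cnj_volterra_sol[OF csol_sol]] by simp

lemma of_real_volterra_sol:
  fixes u :: "real \<Rightarrow> real"
  assumes "volterra_sol pi (nl l) l p u"
  shows "volterra_sol pi (nl (complex_of_real l)) (of_real l) (of_real p) (\<lambda>x. of_real (u x))"
  unfolding volterra_sol_def
proof (intro conjI ballI)
  have cu: "continuous_on {0..pi} u" using assms by (simp add: volterra_sol_def)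
  show "continuous_on {0..pi} (\<lambda>x. complex_of_real (u x))" by (intro continuous_intros cu)
  fix x assume x: "x \<in> {0..pi}"
  have i: "(\<lambda>t. l * u t + (x - t) * nl l (u t)) integrable_on {0..x}"
    using continuous_volterra_integrand[OF cu continuous_nl, of x l x l] x by (intro integrable_continuous_interval) auto
  have "u x = p * x - integral {0..x} (\<lambda>t. l * u t + (x - t) * nl l (u t))" using assms x by (simp add: volterra_sol_def volterra_def)
  then have "complex_of_real (u x) = of_real p * of_real x - of_real (integral {0..x} (\<lambda>t. l * u t + (x - t) * nl l (u t)))"
    by simp
  also have "complex_of_real (integral {0..x} (\<lambda>t. l * u t + (x - t) * nl l (u t)))
     = integral {0..x} (\<lambda>t. of_real (l * u t + (x - t) * nl l (u t)))"
    using has_integral_of_real[OF integrable_integral[OF i], where 'b = complex] by (simp add: integral_unique)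
  finally show "complex_of_real (u x) = volterra (nl (of_real l)) (of_real l) (of_real p) (\<lambda>x. of_real (u x)) x"
    by (simp add: volterra_def nl_def)
qed

text \<open>For real data the conjugate of a solution solves the same problem, so uniqueness makes
  the solution real.\<close>

lemma Re_volterra_sol:
  assumes "volterra_sol pi (nl (complex_of_real l)) (of_real l) (of_real p) y"
  shows "volterra_sol pi (nl l) l p (\<lambda>x. Re (y x))" "\<And>x. x \<in> {0..pi} \<Longrightarrow> y x = of_real (Re (y x))"
proof -
  have "cnj (y x) = y x" if "x \<in> {0..pi}" for x
    by (rule nl_sol_unique[OF _ assms that]) (use cnj_volterra_sol[OF assms] in simp)
  then show R: "y x = of_real (Re (y x))" if "x \<in> {0..pi}" for x using that by (simp add: complex_eq_iff)
  have cy: "continuous_on {0..pi} y" using assms by (simp add: volterra_sol_def)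
  show "volterra_sol pi (nl l) l p (\<lambda>x. Re (y x))"
    unfolding volterra_sol_def
  proof (intro conjI ballI)
    show "continuous_on {0..pi} (\<lambda>x. Re (y x))" by (intro continuous_intros cy)
    fix x assume x: "x \<in> {0..pi}"
    have i: "(\<lambda>t. of_real l * y t + of_real (x - t) * nl (of_real l) (y t)) integrable_on {0..x}"
      using continuous_volterra_integrand[OF cy continuous_nl, of x "of_real l" x] x by (intro integrable_continuous_interval) auto
    have "Re (y x) = Re (volterra (nl (of_real l)) (of_real l) (of_real p) y x)" using assms x by (simp add: volterra_sol_def)
    also have "\<dots> = p * x - integral {0..x} (\<lambda>t. Re (of_real l * y t + of_real (x - t) * nl (of_real l) (y t)))"
      using integral_linear[OF i bounded_linear_Re] by (simp add: volterra_def o_def)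
    also have "integral {0..x} (\<lambda>t. Re (of_real l * y t + of_real (x - t) * nl (of_real l) (y t)))
       = integral {0..x} (\<lambda>t. l * Re (y t) + (x - t) * nl l (Re (y t)))"
    proof (rule integral_cong)
      fix t assume "t \<in> {0..x}"
      then have "y t = of_real (Re (y t))" using R x by auto
      then have "nl (of_real l) (y t) = of_real (nl l (Re (y t)))" by (metis nl_def of_real_add of_real_diff of_real_mult of_real_power)
      then show "Re (of_real l * y t + of_real (x - t) * nl (of_real l) (y t)) = l * Re (y t) + (x - t) * nl l (Re (y t))" by simp
    qed
    finally show "Re (y x) = volterra (nl l) l p (\<lambda>x. Re (y x)) x" by (simp add: volterra_def)
  qed
qed

section \<open>Comparison with the truncated equation\<close>

lemma volterra_sol_cong:
  assumes "volterra_sol b g a p u" "\<And>x. x \<in> {0..b} \<Longrightarrow> g (u x) = g' (u x)"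
  shows "volterra_sol b g' a p u"
proof -
  have "volterra g a p u x = volterra g' a p u x" if "x \<in> {0..b}" for x
    unfolding volterra_def using assms(2) that by (intro arg_cong2[where f = "(-)"] integral_cong refl) auto
  then show ?thesis using assms(1) by (simp add: volterra_sol_def)
qed

lemma vdot_dist:
  assumes cu: "continuous_on {0..b} u" and cw: "continuous_on {0..b} w"
    and cg: "continuous_on UNIV g" and cg': "continuous_on UNIV g'"
    and d: "\<And>t. t \<in> {0..b} \<Longrightarrow> \<bar>g (u t) - g' (w t)\<bar> \<le> d" and x: "x \<in> {0..b}"
  shows "\<bar>vdot g a p u x - vdot g' a' p' w x\<bar> \<le> \<bar>p - p'\<bar> + \<bar>a * u x - a' * w x\<bar> + b * d"
proof -
  have c: "continuous_on {0..x} (\<lambda>t. g (u t))" "continuous_on {0..x} (\<lambda>t. g' (w t))"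
    using x by (auto intro!: continuous_on_compose2[OF cg] continuous_on_compose2[OF cg'] continuous_on_subset[OF cu] continuous_on_subset[OF cw])
  have "norm (integral {0..x} (\<lambda>t. g (u t) - g' (w t))) \<le> integral {0..x} (\<lambda>t. d)"
    by (rule integral_norm_bound_integral) (use c d x in \<open>auto intro!: integrable_continuous_interval continuous_intros\<close>)
  also have "\<dots> \<le> b * d"
  proof -
    have "0 \<le> d" using order_trans[OF abs_ge_zero d[OF x]] .
    then show ?thesis using x by (simp add: mult_right_mono)
  qed
  finally have "\<bar>integral {0..x} (\<lambda>t. g (u t)) - integral {0..x} (\<lambda>t. g' (w t))\<bar> \<le> b * d"
    using c by (simp add: integral_diff integrable_continuous_interval)
  then show ?thesis unfolding vdot_def by linarith
qed

text \<open>For l < 4 the nonlinearity is negative already above 5/2. The margin below the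
  truncation level 3 leaves room for perturbations: solutions for nearby data stay where the
  truncation from above is inactive.\<close>

lemma flow_bound:
  assumes p: "p > 0" and s: "shoot l p = 0" and x: "x \<in> {0..pi}"
  shows "0 \<le> flow l p x" "flow l p x \<le> 5 / 2"
proof -
  have l: "0 < l" "l < 4" using shoot_nonpos(1,2)[OF p] s by auto
  have pos: "flow l p x > 0" if "x \<in> {0<..<pi}" for x using shoot_nonneg_pos[OF p _ that] s by simp
  have z: "flow l p pi = 0" using s by (simp add: shoot_def)
  show "0 \<le> flow l p x" using pos[of x] z x by (cases "x = 0"; cases "x = pi") auto
  have neg: "trunc l y < 0" if y: "y > 5 / 2" for y
  proof (cases "y \<le> 3")
    case True
    have "y * y > (5 / 2) * (5 / 2)" using y by (intro mult_strict_mono) auto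
    then have "y * (y * y) > y * (25 / 4)" using y by (intro mult_strict_left_mono) auto
    moreover have "l * y \<le> 4 * y" using l y by (intro mult_right_mono) auto
    ultimately have "1 + l * y - y * (y * y) < 0" using y by linarith
    then have "y * (1 + l * y - y * (y * y)) < 0" using y by (intro mult_pos_neg) auto
    then show ?thesis using True y by (simp add: trunc_eq power2_eq_square power4_eq_xxxx algebra_simps)
  next
    case False then show ?thesis using l by (simp add: trunc_large)
  qed
  obtain m where "m \<in> {0<..<pi}" "vdot (trunc l) l p (flow l p) m = 0"
    "\<And>x. x \<in> {0..pi} \<Longrightarrow> flow l p x \<le> flow l p m" "flow l p m \<le> 5 / 2"
    using volterra_max_le[OF flow_sol continuous_trunc pi_gt_zero order_refl pos z neg] by blast
  then show "flow l p x \<le> 5 / 2" using x by fastforce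
qed

lemma flow_nl_sol:
  assumes "p > 0" "shoot l p \<ge> 0" "\<And>x. x \<in> {0..pi} \<Longrightarrow> flow l p x \<le> 3"
  shows "volterra_sol pi (nl l) l p (flow l p)"
proof (rule volterra_sol_cong[OF flow_sol])
  fix x assume x: "x \<in> {0..pi}"
  have "flow l p x \<ge> 0"
    using shoot_nonneg_pos[OF assms(1,2), of x] assms(2) x by (cases "x = 0"; cases "x = pi") (auto simp: shoot_def)
  then show "trunc l (flow l p x) = nl l (flow l p x)" using assms(3)[OF x] by (simp add: trunc_eq nl_def)
qed

lemma nl_sol_flow:
  fixes u :: "real \<Rightarrow> real"
  assumes "volterra_sol pi (nl l) l p u" "\<And>x. x \<in> {0..pi} \<Longrightarrow> 0 \<le> u x \<and> u x \<le> 3" "x \<in> {0..pi}"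
  shows "u x = flow l p x"
proof (rule flow_unique[OF _ order_refl assms(3)])
  show "volterra_sol pi (trunc l) l p u"
    by (rule volterra_sol_cong[OF assms(1)]) (use assms(2) in \<open>simp add: trunc_eq nl_def\<close>)
qed

text \<open>Near 0 and pi positivity is inherited through the slope, starting from w 0 = 0 and w pi
  \<ge> 0; in between it follows from the positive minimum of u.\<close>

lemma positive_near:
  fixes u v :: "real \<Rightarrow> real"
  assumes du: "\<And>x. x \<in> {0..pi} \<Longrightarrow> (u has_real_derivative v x) (at x within {0..pi})"
    and cv: "continuous_on {0..pi} v" and u0: "u 0 = 0" "u pi = 0" and v: "v 0 > 0" "v pi < 0"
    and pos: "\<And>x. x \<in> {0<..<pi} \<Longrightarrow> u x > 0"
  obtains e where "e > 0" "\<And>w w' x. (\<And>x. x \<in> {0..pi} \<Longrightarrow> (w has_real_derivative w' x) (at x within {0..pi})) \<Longrightarrow> w 0 = 0 \<Longrightarrow> w pi \<ge> 0 \<Longrightarrow>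
      (\<And>x. x \<in> {0..pi} \<Longrightarrow> \<bar>w x - u x\<bar> < e \<and> \<bar>w' x - v x\<bar> < e) \<Longrightarrow> x \<in> {0<..<pi} \<Longrightarrow> w x > 0"
proof -
  obtain a where a: "0 < a" "a < pi / 2" "\<And>x. x \<in> {0..a} \<Longrightarrow> v x > v 0 / 2"
  proof -
    have "0 \<in> {0..pi}" "v 0 / 2 > 0" using v by auto
    then obtain d where d: "d > 0" "\<And>x. x \<in> {0..pi} \<Longrightarrow> dist x 0 < d \<Longrightarrow> dist (v x) (v 0) < v 0 / 2"
      using cv unfolding continuous_on_iff by blast
    define a where "a = min d pi / 3"
    have a: "0 < a" "a < d" "a < pi / 2" using d(1) pi_gt_zero unfolding a_def by linarith+
    have "v x > v 0 / 2" if x: "x \<in> {0..a}" for x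
    proof -
      have "x \<in> {0..pi}" "dist x 0 < d" using x a by (auto simp: dist_real_def)
      from d(2)[OF this] show ?thesis unfolding dist_real_def by linarith
    qed
    then show ?thesis using a by (intro that[of a]) auto
  qed
  obtain b where b: "pi / 2 < b" "b < pi" "\<And>x. x \<in> {b..pi} \<Longrightarrow> v x < v pi / 2"
  proof -
    have "pi \<in> {0..pi}" "- v pi / 2 > 0" using v by auto
    then obtain d where d: "d > 0" "\<And>x. x \<in> {0..pi} \<Longrightarrow> dist x pi < d \<Longrightarrow> dist (v x) (v pi) < - v pi / 2"
      using cv unfolding continuous_on_iff by blast
    define b where "b = pi - min d pi / 3"
    have b: "b < pi" "pi - b < d" "pi / 2 < b" using d(1) pi_gt_zero unfolding b_def by linarith+
    have "v x < v pi / 2" if x: "x \<in> {b..pi}" for x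
    proof -
      have "x \<in> {0..pi}" "dist x pi < d" using x b pi_gt_zero by (auto simp: dist_real_def)
      from d(2)[OF this] show ?thesis unfolding dist_real_def by linarith
    qed
    then show ?thesis using b by (intro that[of b]) auto
  qed
  have "continuous_on {a..b} u"
    by (rule continuous_on_subset[OF DERIV_continuous_on[OF du]]) (use a b in auto)
  then obtain m where m: "m \<in> {a..b}" "\<And>x. x \<in> {a..b} \<Longrightarrow> u m \<le> u x"
    using continuous_attains_inf[of "{a..b}" u] a b by auto
  have um: "u m > 0" using pos[of m] m a b by auto
  define e where "e = min (u m) (min (v 0 / 2) (- v pi / 2))"
  have e: "e > 0" "e \<le> u m" "e \<le> v 0 / 2" "e \<le> - v pi / 2" using um v by (auto simp: e_def)
  show ?thesis
  proof (rule that[OF e(1)])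
    fix w w' :: "real \<Rightarrow> real" and x :: real
    assume dw: "\<And>x. x \<in> {0..pi} \<Longrightarrow> (w has_real_derivative w' x) (at x within {0..pi})"
      and w0: "w 0 = 0" and wp: "w pi \<ge> 0"
      and cl: "\<And>x. x \<in> {0..pi} \<Longrightarrow> \<bar>w x - u x\<bar> < e \<and> \<bar>w' x - v x\<bar> < e" and x: "x \<in> {0<..<pi}"
    have cw: "continuous_on {0..pi} w" by (rule DERIV_continuous_on[OF dw])
    have dwx: "(w has_real_derivative w' y) (at y)" if "0 < y" "y < pi" for y using dw[of y] that by (simp add: at_within_Icc_at)
    consider "x \<le> a" | "x \<in> {a..b}" | "b \<le> x" by fastforce
    then show "w x > 0"
    proof cases
      case 1
      have "w 0 < w x"
      proof (rule DERIV_pos_imp_increasing_open[where f = w])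
        show "0 < x" using x by simp
        fix y assume y: "0 < y" "y < x"
        then show "\<exists>z. (w has_real_derivative z) (at y) \<and> z > 0"
          using dwx[of y] cl[of y] a(3)[of y] e x 1 by (intro exI[of _ "w' y"]) auto
      next
        show "continuous_on {0..x} w" by (rule continuous_on_subset[OF cw]) (use x in auto)
      qed
      then show ?thesis using w0 by simp
    next
      case 2
      then show ?thesis using cl[of x] m(2)[of x] e x by auto
    next
      case 3
      have "w x > w pi"
      proof (rule DERIV_neg_imp_decreasing_open[where f = w])
        show "x < pi" using x by simp
        fix y assume y: "x < y" "y < pi"
        then show "\<exists>z. (w has_real_derivative z) (at y) \<and> z < 0"
          using dwx[of y] cl[of y] b(3)[of y] e x 3 by (intro exI[of _ "w' y"]) auto
      next
        show "continuous_on {x..pi} w" by (rule continuous_on_subset[OF cw]) (use x in auto)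
      qed
      then show ?thesis using wp by simp
    qed
  qed
qed

text \<open>If either end value is nonnegative, the corresponding solution is positive on (0, pi)
  and stays below 3, so it solves the other equation as well and uniqueness identifies the two. When
  both end values are negative no equality is claimed, as the equations differ below zero.\<close>

lemma cshoot_real_near:
  assumes p0: "p0 > 0" and z: "shoot l0 p0 = 0"
  obtains \<eta> where "\<eta> > 0" "\<And>l p. \<bar>l - l0\<bar> < \<eta> \<Longrightarrow> \<bar>p - p0\<bar> < \<eta> \<Longrightarrow> p > 0 \<and> Im (cshoot (of_real l) (of_real p)) = 0 \<and>
     (shoot l p \<ge> 0 \<or> Re (cshoot (of_real l) (of_real p)) \<ge> 0 \<longrightarrow> cshoot (of_real l) (of_real p) = of_real (shoot l p))"
    "(complex_of_real l0, complex_of_real p0) \<in> cdom"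
proof -
  let ?u = "flow l0 p0"
  let ?v = "vdot (nl l0) l0 p0 ?u"
  have ub: "0 \<le> ?u x" "?u x \<le> 5/2" if "x \<in> {0..pi}" for x using flow_bound[OF p0 z that] by auto
  have ub3: "?u x \<le> 3" if "x \<in> {0..pi}" for x using ub(2)[OF that] by linarith
  have l0: "0 < l0" "l0 < 4" using shoot_nonpos(1,2)[OF p0] z by auto
  have us: "volterra_sol pi (nl l0) l0 p0 ?u"
    by (rule flow_nl_sol) (use p0 z ub3 in auto)
  then have cus: "volterra_sol pi (nl (complex_of_real l0)) (of_real l0) (of_real p0) (\<lambda>x. of_real (?u x))"
    by (rule of_real_volterra_sol)
  then have dom: "(complex_of_real l0, complex_of_real p0) \<in> cdom" by (auto simp: cdom_def)
  have cu: "csol (of_real l0) (of_real p0) x = of_real (?u x)" if "x \<in> {0..pi}" for x by (rule csol_eq[OF cus that])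
  obtain \<eta>1 C where \<eta>1: "0 < \<eta>1" "\<eta>1 \<le> 1" "C \<ge> 0"
    "\<And>l p. l \<in> ball (of_real l0) \<eta>1 \<Longrightarrow> p \<in> ball (of_real p0) \<eta>1 \<Longrightarrow> (l, p) \<in> cdom"
    "\<And>l p x. l \<in> ball (of_real l0) \<eta>1 \<Longrightarrow> p \<in> ball (of_real p0) \<eta>1 \<Longrightarrow> x \<in> {0..pi} \<Longrightarrow>
       norm (csol l p x - csol (of_real l0) (of_real p0) x) \<le> C * (norm (l - of_real l0) + norm (p - of_real p0))"
    by (rule csol_near[OF dom]) blast
  obtain C' where C': "C' \<ge> 0"
    "\<And>l p x. \<bar>l - l0\<bar> \<le> 1 \<Longrightarrow> x \<in> {0..pi} \<Longrightarrow> \<bar>flow l p x - flow l0 p0 x\<bar> \<le> C' * (\<bar>l - l0\<bar> + \<bar>p - p0\<bar>)"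
    using flow_lipschitz[of l0 p0] by blast
  note ode = volterra_ode[OF us continuous_nl]
  have vpi: "?v pi = dflow l0 p0 pi"
    unfolding dflow_def vdot_def
  proof (intro arg_cong2[where f = "(-)"] integral_cong refl)
    fix x assume x: "x \<in> {0..pi}"
    show "nl l0 (?u x) = trunc l0 (?u x)" using trunc_eq[OF ub(1)[OF x] ub3[OF x]] by (simp add: nl_def)
  qed
  obtain e where e: "e > 0" "\<And>w w' x. (\<And>x. x \<in> {0..pi} \<Longrightarrow> (w has_real_derivative w' x) (at x within {0..pi})) \<Longrightarrow> w 0 = 0 \<Longrightarrow> w pi \<ge> 0 \<Longrightarrow>
      (\<And>x. x \<in> {0..pi} \<Longrightarrow> \<bar>w x - ?u x\<bar> < e \<and> \<bar>w' x - ?v x\<bar> < e) \<Longrightarrow> x \<in> {0<..<pi} \<Longrightarrow> w x > 0"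
  proof (rule positive_near[of ?u ?v])
    show "continuous_on {0..pi} ?v" by (rule DERIV_continuous_on[OF ode(2)])
    show "?v 0 > 0" using ode(4)[of 0] p0 by simp
    show "?v pi < 0" using vpi shoot_zero_slope[OF p0 z] by simp
    show "?u pi = 0" using z by (simp add: shoot_def)
    show "?u x > 0" if "x \<in> {0<..<pi}" for x using shoot_nonneg_pos[OF p0 _ that, of l0] z by simp
  qed (use ode in auto)
  \<comment> \<open>A Lipschitz constant for u': the change of p, then of l u with |l| \<le> 5 and u
    \<le> 3, then of the integrated nonlinearity, whose Lipschitz constant is taken for |l| \<le> 5
    and values up to 4, with 9 for the change of l.\<close>
  define B where "B = 1 + (5 * C + 3) + pi * ((1 + 2 * 5 * 4 + 4 * 4 ^ 3) * C + 9)"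
  have B: "B \<ge> 1" using \<eta>1(3) by (simp add: B_def)
  \<comment> \<open>The first two bounds stay inside the domain and the half plane p > 0, the next
    two keep the polynomial and the truncated solution below 3, and the last one makes the
    polynomial solution e-close to u together with its derivative.\<close>
  define \<eta> where "\<eta> = min (min \<eta>1 p0) (min (1 / (4 * (C + 1))) (min (1 / (8 * (C' + 1))) (e / (4 * (B + C)))))"
  have \<eta>: "\<eta> > 0" using \<eta>1 p0 C' e B by (auto simp: \<eta>_def)
  have main: "p > 0 \<and> Im (cshoot (of_real l) (of_real p)) = 0 \<and>
     (shoot l p \<ge> 0 \<or> Re (cshoot (of_real l) (of_real p)) \<ge> 0 \<longrightarrow> cshoot (of_real l) (of_real p) = of_real (shoot l p))"
    if l: "\<bar>l - l0\<bar> < \<eta>" and p: "\<bar>p - p0\<bar> < \<eta>" for l p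
  proof -
    define D where "D = \<bar>l - l0\<bar> + \<bar>p - p0\<bar>"
    have "\<eta> \<le> p0" by (simp add: \<eta>_def)
    then have pp: "p > 0" using p by linarith
    have "\<bar>l - l0\<bar> < \<eta>1" "\<bar>p - p0\<bar> < \<eta>1" using l p by (auto simp: \<eta>_def)
    then have lb: "complex_of_real l \<in> ball (of_real l0) \<eta>1" and pb: "complex_of_real p \<in> ball (of_real p0) \<eta>1"
      by (auto simp: dist_of_real dist_real_def abs_minus_commute)
    have l1: "\<bar>l - l0\<bar> \<le> 1" using \<open>\<bar>l - l0\<bar> < \<eta>1\<close> \<eta>1(2) by simp
    have D0: "0 \<le> D" "D < 2 * \<eta>" using l p by (auto simp: D_def)
    have CD: "C * D \<le> 1/2"
    proof -
      have "D \<le> 2 * (1 / (4 * (C + 1)))" using D0(2) by (simp add: \<eta>_def)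
      then have "C * D \<le> C * (2 * (1 / (4 * (C + 1))))" using \<eta>1(3) by (rule mult_left_mono)
      also have "\<dots> \<le> 1/2" using \<eta>1(3) by (simp add: field_simps)
      finally show ?thesis .
    qed
    have CD': "C' * D \<le> 1/4"
    proof -
      have "D \<le> 2 * (1 / (8 * (C' + 1)))" using D0(2) by (simp add: \<eta>_def)
      then have "C' * D \<le> C' * (2 * (1 / (8 * (C' + 1))))" using C'(1) by (rule mult_left_mono)
      also have "\<dots> \<le> 1/4" using C'(1) by (simp add: field_simps)
      finally show ?thesis .
    qed
    have BD: "(B + C) * D < e"
    proof -
      have "D < 2 * (e / (4 * (B + C)))" using D0(2) by (simp add: \<eta>_def)
      then have "(B + C) * D < (B + C) * (2 * (e / (4 * (B + C))))" using \<eta>1(3) B by (intro mult_strict_left_mono) auto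
      also have "\<dots> \<le> e" using \<eta>1(3) B e(1) by (simp add: field_simps)
      finally show ?thesis .
    qed
    have ys: "volterra_sol pi (nl (complex_of_real l)) (of_real l) (of_real p) (csol (of_real l) (of_real p))"
      by (rule csol_sol[OF \<eta>1(4)[OF lb pb]])
    define w where "w x = Re (csol (of_real l) (of_real p) x)" for x
    have ws: "volterra_sol pi (nl l) l p w" unfolding w_def by (rule Re_volterra_sol(1)[OF ys])
    have wc: "csol (of_real l) (of_real p) x = of_real (w x)" if "x \<in> {0..pi}" for x unfolding w_def by (rule Re_volterra_sol(2)[OF ys that])
    have G: "cshoot (of_real l) (of_real p) = of_real (w pi)" using wc[of pi] by (simp add: cshoot_def)
    have wu: "\<bar>w x - ?u x\<bar> \<le> C * D" if x: "x \<in> {0..pi}" for x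
    proof -
      have "norm (csol (of_real l) (of_real p) x - csol (of_real l0) (of_real p0) x) = \<bar>w x - ?u x\<bar>"
        unfolding wc[OF x] cu[OF x] by (simp flip: of_real_diff)
      moreover have "norm (complex_of_real l - of_real l0) + norm (complex_of_real p - of_real p0) = D"
        by (simp add: D_def flip: of_real_diff)
      ultimately show ?thesis using \<eta>1(5)[OF lb pb x] by simp
    qed
    have w3: "\<bar>w x\<bar> \<le> 3" if x: "x \<in> {0..pi}" for x using wu[OF x] CD ub[OF x] by linarith
    have cw: "continuous_on {0..pi} w" using ws by (simp add: volterra_sol_def)
    have DL: "\<bar>l - l0\<bar> \<le> D" "\<bar>p - p0\<bar> \<le> D" by (auto simp: D_def)
    have nld: "\<bar>nl l (w t) - nl l0 (?u t)\<bar> \<le> ((1 + 2 * 5 * 4 + 4 * 4 ^ 3) * C + 9) * D" if t: "t \<in> {0..pi}" for t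
    proof -
      have "norm (nl l (w t) - nl l (?u t)) \<le> (1 + 2 * 5 * 4 + 4 * 4 ^ 3) * norm (w t - ?u t)"
        by (rule nl_lipschitz) (use w3[OF t] ub[OF t] l0 l1 in auto)
      also have "\<dots> \<le> (1 + 2 * 5 * 4 + 4 * 4 ^ 3) * (C * D)" using wu[OF t] by (intro mult_left_mono) auto
      finally have 1: "\<bar>nl l (w t) - nl l (?u t)\<bar> \<le> (1 + 2 * 5 * 4 + 4 * 4 ^ 3) * (C * D)" by simp
      have "nl l (?u t) - nl l0 (?u t) = (l - l0) * (?u t)\<^sup>2" by (simp add: nl_def algebra_simps)
      moreover have "(?u t)\<^sup>2 \<le> 3\<^sup>2" using ub[OF t] by (intro power_mono) auto
      ultimately have "\<bar>nl l (?u t) - nl l0 (?u t)\<bar> \<le> D * 9" using DL(1) D0 by (simp add: abs_mult) (intro mult_mono; simp)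
      then show ?thesis using 1 by (simp add: algebra_simps)
    qed
    have vd: "\<bar>vdot (nl l) l p w x - ?v x\<bar> \<le> B * D" if x: "x \<in> {0..pi}" for x
    proof -
      have "\<bar>vdot (nl l) l p w x - ?v x\<bar> \<le> \<bar>p - p0\<bar> + \<bar>l * w x - l0 * ?u x\<bar> + pi * (((1 + 2 * 5 * 4 + 4 * 4 ^ 3) * C + 9) * D)"
        by (rule vdot_dist[OF cw continuous_flow(1) continuous_nl continuous_nl nld x])
      moreover have "\<bar>l * w x - l0 * ?u x\<bar> \<le> 5 * (C * D) + D * 3"
      proof -
        have "l * w x - l0 * ?u x = l * (w x - ?u x) + (l - l0) * ?u x" by (simp add: algebra_simps)
        moreover have "\<bar>l * (w x - ?u x)\<bar> \<le> 5 * (C * D)" unfolding abs_mult using wu[OF x] l0 l1 by (intro mult_mono) auto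
        moreover have "\<bar>(l - l0) * ?u x\<bar> \<le> D * 3" unfolding abs_mult using DL(1) D0 ub[OF x] by (intro mult_mono) auto
        ultimately show ?thesis by linarith
      qed
      ultimately have "\<bar>vdot (nl l) l p w x - ?v x\<bar> \<le> D + (5 * (C * D) + D * 3) + pi * (((1 + 2 * 5 * 4 + 4 * 4 ^ 3) * C + 9) * D)"
        using DL(2) by linarith
      also have "\<dots> = B * D" by (simp add: B_def algebra_simps)
      finally show ?thesis .
    qed
    \<comment> \<open>Here positivity comes from closeness to the positive base solution in value
      and slope.\<close>
    have c1: "w pi = shoot l p" if wp: "w pi \<ge> 0"
    proof -
      have wpos: "w x > 0" if y: "x \<in> {0<..<pi}" for x
      proof (rule e(2)[where w = w and w' = "vdot (nl l) l p w"])
        show "x \<in> {0<..<pi}" "w pi \<ge> 0" by fact+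
        show "(w has_real_derivative vdot (nl l) l p w x) (at x within {0..pi})" if "x \<in> {0..pi}" for x
          by (rule volterra_ode(1)[OF ws continuous_nl that])
        show "w 0 = 0" using volterra_ode(3)[OF ws continuous_nl, of 0] by simp
        fix x assume x: "x \<in> {0..pi}"
        have "0 \<le> B * D" "0 \<le> C * D" using B \<eta>1(3) D0 by auto
        then show "\<bar>w x - ?u x\<bar> < e \<and> \<bar>vdot (nl l) l p w x - ?v x\<bar> < e"
          using wu[OF x] vd[OF x] BD by (simp add: distrib_right)
      qed
      have "0 \<le> w x \<and> w x \<le> 3" if x: "x \<in> {0..pi}" for x
        using wpos[of x] w3[OF x] wp volterra_ode(3)[OF ws continuous_nl, of 0] x by (cases "x = 0"; cases "x = pi") auto
      then show ?thesis unfolding shoot_def by (intro nl_sol_flow[OF ws]) auto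
    qed
    \<comment> \<open>Here positivity comes from \<open>shoot_nonneg_pos\<close>, and only the bound
      3 needs closeness.\<close>
    have c2: "w pi = shoot l p" if sp: "shoot l p \<ge> 0"
    proof -
      have "flow l p x \<le> 3" if x: "x \<in> {0..pi}" for x
        using C'(2)[OF l1 x, of p] CD' ub[OF x] by (simp add: D_def[symmetric])
      then have "volterra_sol pi (nl l) l p (flow l p)" using flow_nl_sol[OF pp sp] by blast
      then show ?thesis unfolding shoot_def by (intro nl_sol_unique[OF ws]) auto
    qed
    have "w pi = shoot l p" if "shoot l p \<ge> 0 \<or> w pi \<ge> 0" using that c1 c2 by blast
    then show ?thesis using pp unfolding G by (simp only: Im_complex_of_real Re_complex_of_real of_real_eq_iff) blast
  qed
  show ?thesis by (rule that[OF \<eta> main dom])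
qed

text \<open>Where one end value is nonnegative the two agree; hence zeros correspond to zeros,
  positive to positive, and the remaining negative values to each other.\<close>

lemma cshoot_eq_0_iff_near:
  assumes p0: "p0 > 0" and z: "shoot l0 p0 = 0"
  obtains \<eta> where "\<eta> > 0" "(complex_of_real l0, complex_of_real p0) \<in> cdom"
    "\<And>l p. \<bar>l - l0\<bar> < \<eta> \<Longrightarrow> \<bar>p - p0\<bar> < \<eta> \<Longrightarrow> p > 0"
    "\<And>l p. \<bar>l - l0\<bar> < \<eta> \<Longrightarrow> \<bar>p - p0\<bar> < \<eta> \<Longrightarrow> cshoot (of_real l) (of_real p) = of_real (Re (cshoot (of_real l) (of_real p)))"
    "\<And>l p. \<bar>l - l0\<bar> < \<eta> \<Longrightarrow> \<bar>p - p0\<bar> < \<eta> \<Longrightarrow> cshoot (of_real l) (of_real p) = 0 \<longleftrightarrow> shoot l p = 0"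
    "\<And>l p. \<bar>l - l0\<bar> < \<eta> \<Longrightarrow> \<bar>p - p0\<bar> < \<eta> \<Longrightarrow> Re (cshoot (of_real l) (of_real p)) > 0 \<longleftrightarrow> shoot l p > 0"
proof -
  obtain \<eta> where \<eta>: "\<eta> > 0" "\<And>l p. \<bar>l - l0\<bar> < \<eta> \<Longrightarrow> \<bar>p - p0\<bar> < \<eta> \<Longrightarrow> p > 0 \<and> Im (cshoot (of_real l) (of_real p)) = 0 \<and>
     (shoot l p \<ge> 0 \<or> Re (cshoot (of_real l) (of_real p)) \<ge> 0 \<longrightarrow> cshoot (of_real l) (of_real p) = of_real (shoot l p))"
    "(complex_of_real l0, complex_of_real p0) \<in> cdom"
    by (rule cshoot_real_near[OF p0 z]) (rule that)
  show ?thesis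
  proof (rule that[OF \<eta>(1,3)])
    fix l p assume lp: "\<bar>l - l0\<bar> < \<eta>" "\<bar>p - p0\<bar> < \<eta>"
    have h: "p > 0" "Im (cshoot (of_real l) (of_real p)) = 0"
      "shoot l p \<ge> 0 \<or> Re (cshoot (of_real l) (of_real p)) \<ge> 0 \<Longrightarrow> cshoot (of_real l) (of_real p) = of_real (shoot l p)"
      using \<eta>(2)[OF lp] by blast+
    have h1: "cshoot (of_real l) (of_real p) = of_real (shoot l p)" if "shoot l p \<ge> 0" using h(3) that by blast
    have h2: "Re (cshoot (of_real l) (of_real p)) = shoot l p" if "Re (cshoot (of_real l) (of_real p)) \<ge> 0"
      using arg_cong[OF h(3), of Re] that by simp
    show "p > 0" by (rule h)
    show "cshoot (of_real l) (of_real p) = of_real (Re (cshoot (of_real l) (of_real p)))" using h(2) by (simp add: complex_eq_iff)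
    show "cshoot (of_real l) (of_real p) = 0 \<longleftrightarrow> shoot l p = 0"
    proof
      assume "cshoot (of_real l) (of_real p) = 0" then show "shoot l p = 0" using h2 by simp
    next
      assume "shoot l p = 0" then show "cshoot (of_real l) (of_real p) = 0" using h1 by simp
    qed
    show "Re (cshoot (of_real l) (of_real p)) > 0 \<longleftrightarrow> shoot l p > 0"
    proof
      assume "Re (cshoot (of_real l) (of_real p)) > 0" then show "shoot l p > 0" using h2 by linarith
    next
      assume "shoot l p > 0" then show "Re (cshoot (of_real l) (of_real p)) > 0" using h1 by simp
    qed
  qed
qed

lemma zero_in_cdom:
  assumes "p > 0" "shoot l p = 0"
  shows "(complex_of_real l, complex_of_real p) \<in> cdom" "cshoot (of_real l) (of_real p) = 0"
proof -
  obtain \<eta> where \<eta>: "\<eta> > 0" "(complex_of_real l, complex_of_real p) \<in> cdom"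
    "\<And>l' p'. \<bar>l' - l\<bar> < \<eta> \<Longrightarrow> \<bar>p' - p\<bar> < \<eta> \<Longrightarrow> cshoot (of_real l') (of_real p') = 0 \<longleftrightarrow> shoot l' p' = 0"
    by (rule cshoot_eq_0_iff_near[OF assms]) (rule that)
  show "(complex_of_real l, complex_of_real p) \<in> cdom" by (rule \<eta>)
  show "cshoot (of_real l) (of_real p) = 0" using \<eta>(3)[of l p] \<eta>(1) assms by simp
qed

text \<open>If the slice vanished identically near p0, its real zeros would fill an interval
  reaching down from p0. By the slope bound its infimum is positive, so it is itself a zero; there
  \<open>cshoot\<close> is holomorphic and vanishes near it by analytic continuation, and the
  interval reaches further down. The continuation runs along real zeros because
  \<open>cshoot\<close> is under control only near these.\<close>

lemma cshoot_slice_nontrivial: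
  assumes p0: "p0 > 0" and z: "shoot l0 p0 = 0" and d: "d > 0"
  shows "\<exists>p\<in>ball (of_real p0) d. cshoot (of_real l0) p \<noteq> 0"
proof (rule ccontr)
  assume "\<not> ?thesis"
  then have all0: "cshoot (of_real l0) p = 0" if "p \<in> ball (of_real p0) d" for p using that by blast
  obtain c where c: "c > 0" "\<And>l p. p > 0 \<Longrightarrow> shoot l p \<le> 0 \<Longrightarrow> l \<le> c * p" using shoot_nonpos_slope by blast
  have l0: "l0 > 0" using shoot_nonpos(1)[OF p0] z by simp
  define B where "B = {q. q \<le> p0 \<and> (\<forall>p\<in>{q..p0}. p > 0 \<and> shoot l0 p = 0)}"
  have p0B: "p0 \<in> B" using p0 z by (simp add: B_def)
  have lowb: "l0 / c \<le> q" if "q \<in> B" for q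
  proof -
    have "q > 0" "shoot l0 q = 0" using that by (auto simp: B_def)
    then show ?thesis using c(2)[of q l0] c(1) by (simp add: field_simps)
  qed
  then have bdd: "bdd_below B" by (rule bdd_belowI)
  define m where "m = Inf B"
  have m: "l0 / c \<le> m" "m \<le> p0" unfolding m_def using p0B lowb bdd by (auto intro: cInf_greatest cInf_lower)
  then have m0: "m > 0" using l0 c(1) by (smt (verit) divide_pos_pos)
  have above: "shoot l0 p = 0" if p: "m < p" "p \<le> p0" for p
  proof -
    obtain q where "q \<in> B" "q < p" using p(1) cInf_lessD[of B p] p0B unfolding m_def by blast
    then show ?thesis using p(2) by (auto simp: B_def)
  qed
  have cs: "continuous_on UNIV (shoot l0)"
  proof -
    have "continuous_on UNIV (\<lambda>p. (\<lambda>z. shoot (fst z) (snd z)) (l0, p))"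
      by (rule continuous_on_compose2[OF continuous_shoot]) (auto intro!: continuous_intros)
    then show ?thesis by simp
  qed
  have zm: "shoot l0 m = 0"
  proof (cases "m = p0")
    case False
    then have mp: "m < p0" using m by simp
    have "closed {p. shoot l0 p = 0}" using cs by (intro closed_Collect_eq) (auto intro: continuous_on_const)
    moreover have "{m<..<p0} \<subseteq> {p. shoot l0 p = 0}" using above by auto
    ultimately have "closure {m<..<p0} \<subseteq> {p. shoot l0 p = 0}" by (rule closure_minimal[rotated])
    then show ?thesis using mp m by (auto simp: subset_iff)
  qed (use z in simp)
  obtain \<eta> where \<eta>: "\<eta> > 0" "(complex_of_real l0, complex_of_real m) \<in> cdom"
    "\<And>l p. \<bar>l - l0\<bar> < \<eta> \<Longrightarrow> \<bar>p - m\<bar> < \<eta> \<Longrightarrow> p > 0"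
    "\<And>l p. \<bar>l - l0\<bar> < \<eta> \<Longrightarrow> \<bar>p - m\<bar> < \<eta> \<Longrightarrow> cshoot (of_real l) (of_real p) = 0 \<longleftrightarrow> shoot l p = 0"
    by (rule cshoot_eq_0_iff_near[OF m0 zm]) (rule that)
  obtain \<eta>' where \<eta>': "\<eta>' > 0" "\<And>l. l \<in> ball (of_real l0) \<eta>' \<Longrightarrow> cshoot l holomorphic_on ball (of_real m) \<eta>'"
    by (rule cshoot_near[OF \<eta>(2)]) (rule that)
  have hol: "cshoot (of_real l0) holomorphic_on ball (of_real m) \<eta>'" using \<eta>' by simp
  \<comment> \<open>If the interval is still the single point p0, the vanishing is the assumption;
    otherwise the real zeros just above m accumulate at m.\<close>
  have vanish: "cshoot (of_real l0) p = 0" if pb: "p \<in> ball (of_real m) \<eta>'" for p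
  proof (cases "m = p0")
    case True
    define U where "U = ball (complex_of_real m) (min d \<eta>')"
    show ?thesis
      by (rule analytic_continuation_open[of U "ball (of_real m) \<eta>'" "cshoot (of_real l0)" "\<lambda>_. 0"])
        (use True all0 hol pb d \<eta>'(1) in \<open>auto simp: U_def\<close>)
  next
    case False
    then have mp: "m < p0" using m by simp
    define U where "U = complex_of_real ` {m<..<m + min (p0 - m) (min \<eta> \<eta>')}"
    have "complex_of_real m islimpt U"
    proof (unfold islimpt_approachable, intro allI impI)
      fix e :: real assume "e > 0"
      define h where "h = min e (min (p0 - m) (min \<eta> \<eta>')) / 2"
      have h: "0 < h" "h < e" "h < min (p0 - m) (min \<eta> \<eta>')" using \<open>e > 0\<close> mp \<eta>(1) \<eta>'(1) by (auto simp: h_def)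
      have "complex_of_real (m + h) \<in> U" unfolding U_def using h by (intro imageI) auto
      moreover have "complex_of_real (m + h) \<noteq> of_real m" using h by simp
      moreover have "dist (complex_of_real (m + h)) (of_real m) < e" using h by (simp add: dist_of_real dist_real_def del: of_real_add)
      ultimately show "\<exists>x'\<in>U. x' \<noteq> complex_of_real m \<and> dist x' (complex_of_real m) < e" by blast
    qed
    moreover have "cshoot (of_real l0) u = 0" if u: "u \<in> U" for u
    proof -
      obtain p where p: "u = of_real p" "m < p" "p < m + min (p0 - m) (min \<eta> \<eta>')" using u by (auto simp: U_def)
      then show ?thesis using above[of p] \<eta>(4)[of l0 p] \<eta>(1) by auto
    qed
    moreover have "U \<subseteq> ball (of_real m) \<eta>'"
      by (auto simp: U_def dist_of_real dist_real_def)
    ultimately show ?thesis using analytic_continuation[OF hol _ _ _ _ _ _ pb, of U "of_real m"] \<eta>'(1) by simp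
  qed
  define h where "h = min \<eta> \<eta>' / 2"
  have h: "0 < h" "h < \<eta>" "h < \<eta>'" using \<eta>(1) \<eta>'(1) by (auto simp: h_def)
  have "m - h \<in> B"
    unfolding B_def
  proof (intro CollectI conjI ballI)
    show "m - h \<le> p0" using m h by simp
    fix p assume p: "p \<in> {m - h..p0}"
    show "p > 0" using p m0 \<eta>(3)[of l0 p] h \<eta>(1) by (cases "p \<le> m") auto
    show "shoot l0 p = 0"
    proof (cases "p \<le> m")
      case True
      then have "cshoot (of_real l0) (of_real p) = 0" using p h by (intro vanish) (auto simp: dist_of_real dist_real_def)
      then show ?thesis using \<eta>(4)[of l0 p] True p h \<eta>(1) by auto
    next
      case False then show ?thesis using above[of p] p by auto
    qed
  qed
  then have "m \<le> m - h" unfolding m_def using bdd by (rule cInf_lower)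
  then show False using h by simp
qed

definition zslice :: "real \<Rightarrow> real \<Rightarrow> real \<Rightarrow> real set" where
  "zslice p0 r x = {y. \<bar>y - p0\<bar> < r \<and> shoot x y = 0}"

text \<open>The complexified shooting function is put into a \<open>real_zero_family\<close> centred
  at the zero. Its only zero in the central disc is p0, so all branches run into that point. The
  arbitrary e allows the box to be shrunk on demand.\<close>

theorem zero_branches:
  assumes p0: "p0 > 0" and z: "shoot l0 p0 = 0" and e: "e > 0"
  obtains \<delta> r where "0 < \<delta>" "\<delta> < e" "0 < r" "r < e" "r < p0"
    "locally_ordered_on {l0<..<l0 + \<delta>} (zslice p0 r)" "locally_ordered_on {l0 - \<delta><..<l0} (zslice p0 r)"
    "\<And>y. \<bar>y - p0\<bar> \<le> r \<Longrightarrow> shoot l0 y = 0 \<Longrightarrow> y = p0"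
    "\<And>e'. e' > 0 \<Longrightarrow> \<exists>\<eta>>0. \<forall>x y. \<bar>x - l0\<bar> < \<eta> \<longrightarrow> y \<in> zslice p0 r x \<longrightarrow> \<bar>y - p0\<bar> < e'"
proof -
  let ?l = "complex_of_real l0" and ?p = "complex_of_real p0"
  obtain \<eta>1 where \<eta>1: "\<eta>1 > 0" "(?l, ?p) \<in> cdom"
    "\<And>l p. \<bar>l - l0\<bar> < \<eta>1 \<Longrightarrow> \<bar>p - p0\<bar> < \<eta>1 \<Longrightarrow> cshoot (of_real l) (of_real p) = 0 \<longleftrightarrow> shoot l p = 0"
    by (rule cshoot_eq_0_iff_near[OF p0 z]) (rule that)
  obtain \<eta>2 where \<eta>2: "0 < \<eta>2" "ball ?l \<eta>2 \<times> ball ?p \<eta>2 \<subseteq> cdom"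
    "continuous_on (ball ?l \<eta>2 \<times> ball ?p \<eta>2) (\<lambda>(l, p). cshoot l p)"
    "\<And>p. p \<in> ball ?p \<eta>2 \<Longrightarrow> (\<lambda>l. cshoot l p) holomorphic_on ball ?l \<eta>2"
    "\<And>l. l \<in> ball ?l \<eta>2 \<Longrightarrow> cshoot l holomorphic_on ball ?p \<eta>2"
    by (rule cshoot_near[OF \<eta>1(2)]) (rule that)
  have z0: "cshoot ?l ?p = 0" using \<eta>1(3)[of l0 p0] \<eta>1(1) z by simp
  have hol: "cshoot ?l holomorphic_on ball ?p \<eta>2" using \<eta>2 by simp
  obtain q where q: "q \<in> ball ?p \<eta>2" "cshoot ?l q \<noteq> 0" using cshoot_slice_nontrivial[OF p0 z \<eta>2(1)] by blast
  obtain \<rho> where \<rho>: "\<rho> > 0" "ball ?p \<rho> \<subseteq> ball ?p \<eta>2" "\<And>y. y \<in> ball ?p \<rho> - {?p} \<Longrightarrow> cshoot ?l y \<noteq> 0"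
    by (rule isolated_zeros[OF hol _ _ _ z0 q]) (use \<eta>2(1) in auto)
  \<comment> \<open>Small enough that p0 is the only zero of the central slice in the closed disc,
    that \<open>cshoot\<close> is holomorphic beyond it, and that its real zeros there are those of
    \<open>shoot\<close>, all with p > 0.\<close>
  define r where "r = min (min \<rho> \<eta>2) (min (min e p0) \<eta>1) / 2"
  have r: "0 < r" "r < \<rho>" "r < \<eta>2" "r < e" "r < p0" "r < \<eta>1" using \<rho>(1) \<eta>2(1) e p0 \<eta>1(1) by (auto simp: r_def)
  have nzs: "cshoot ?l y \<noteq> 0" if "y \<in> sphere ?p r" for y using \<rho>(3)[of y] that r by auto
  have ct: "continuous_on (cball ?l (\<eta>2/2) \<times> sphere ?p r) (\<lambda>(l, p). cshoot l p)"
    by (rule continuous_on_subset[OF \<eta>2(3)]) (use r \<eta>2(1) in auto)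
  have "\<exists>d>0. d \<le> \<eta>2/2 \<and> (\<forall>x\<in>ball ?l d. \<forall>y\<in>sphere ?p r. cshoot x y \<noteq> 0)"
    by (rule nonzero_tube[OF compact_sphere _ ct nzs]) (use \<eta>2(1) in auto)
  then obtain R0 where R0: "R0 > 0" "R0 \<le> \<eta>2/2" "\<And>x y. x \<in> ball ?l R0 \<Longrightarrow> y \<in> sphere ?p r \<Longrightarrow> cshoot x y \<noteq> 0"
    by blast
  define R where "R = min R0 (min \<eta>1 e)"
  have R: "R > 0" "R \<le> R0" "R \<le> \<eta>1" "R \<le> e" "R < \<eta>2" using R0 \<eta>1(1) e \<eta>2(1) by (auto simp: R_def min_def)
  interpret F: real_zero_family cshoot l0 p0 R r \<eta>2
  proof
    show "continuous_on (ball ?l R \<times> ball ?p \<eta>2) (\<lambda>(x, y). cshoot x y)" by (rule continuous_on_subset[OF \<eta>2(3)]) (use R in auto)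
    show "cshoot x holomorphic_on ball ?p \<eta>2" if "x \<in> ball ?l R" for x using \<eta>2(5)[of x] that R by auto
    show "(\<lambda>x. cshoot x y) holomorphic_on ball ?l R" if "y \<in> ball ?p \<eta>2" for y
      by (rule holomorphic_on_subset[OF \<eta>2(4)[OF that]]) (use R in auto)
    show "cshoot x y \<noteq> 0" if "x \<in> ball ?l R" "y \<in> sphere ?p r" for x y using R0(3)[of x y] that R by auto
    show "cshoot (cnj x) (cnj y) = cnj (cshoot x y)" if "x \<in> ball ?l R" "y \<in> ball ?p \<eta>2" for x y
      by (rule cshoot_cnj) (use \<eta>2(2) that R in auto)
    show "y = ?p" if "y \<in> cball ?p r" "cshoot ?l y = 0" for y using \<rho>(3)[of y] that r by auto
  qed (use R r in auto)
  have same: "F.rzeros x = zslice p0 r x" if "\<bar>x - l0\<bar> < R" for x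
    unfolding F.rzeros_def zslice_def using \<eta>1(3)[of x] that R r by auto
  have lo: "locally_ordered_on I (zslice p0 r)" if "locally_ordered_on I F.rzeros" "\<And>x. x \<in> I \<Longrightarrow> \<bar>x - l0\<bar> < R" for I
    using that(1) unfolding locally_ordered_on_def by (simp add: same[OF that(2)] cong: ball_cong)
  obtain \<delta> where \<delta>: "0 < \<delta>" "\<delta> < R" "locally_ordered_on {l0<..<l0 + \<delta>} F.rzeros" "locally_ordered_on {l0 - \<delta><..<l0} F.rzeros"
    using F.rzeros_locally_ordered by blast
  show ?thesis
  proof (rule that[OF \<delta>(1) _ r(1,4,5)])
    show "\<delta> < e" using \<delta> R by simp
    show "locally_ordered_on {l0<..<l0 + \<delta>} (zslice p0 r)" by (rule lo[OF \<delta>(3)]) (use \<delta> in auto)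
    show "locally_ordered_on {l0 - \<delta><..<l0} (zslice p0 r)" by (rule lo[OF \<delta>(4)]) (use \<delta> in auto)
    show "y = p0" if "\<bar>y - p0\<bar> \<le> r" "shoot l0 y = 0" for y
    proof -
      have "cshoot ?l (of_real y) = 0" using \<eta>1(3)[of l0 y] that r \<eta>1(1) by auto
      moreover have "complex_of_real y \<in> cball ?p r" using that by (simp add: dist_of_real dist_real_def abs_minus_commute)
      ultimately show ?thesis using F.centre[of "of_real y"] by simp
    qed
    show "\<exists>\<eta>>0. \<forall>x y. \<bar>x - l0\<bar> < \<eta> \<longrightarrow> y \<in> zslice p0 r x \<longrightarrow> \<bar>y - p0\<bar> < e'" if e': "e' > 0" for e'
    proof -
      obtain \<eta> where \<eta>: "\<eta> > 0" "\<And>x y. \<bar>x - l0\<bar> < \<eta> \<Longrightarrow> y \<in> F.rzeros x \<Longrightarrow> \<bar>y - p0\<bar> < e'" using F.zeros_near_centre[OF e'] by blast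
      show ?thesis by (rule exI[of _ "min \<eta> R"]) (use \<eta> same R in auto)
    qed
  qed
qed

section \<open>The order of vanishing along an analytic arc\<close>

definition analytic_real :: "(real \<Rightarrow> real) \<Rightarrow> real set \<Rightarrow> bool" where
  "analytic_real f S \<longleftrightarrow> (\<forall>t0\<in>S. \<exists>r>0. \<exists>c. \<forall>t. \<bar>t - t0\<bar> < r \<longrightarrow> (\<lambda>n. c n * (t - t0) ^ n) sums f t)"

lemma analytic_real_extension:
  assumes "analytic_real f S" "t0 \<in> S"
  obtains r g where "r > 0" "g holomorphic_on ball (of_real t0) r"
    "\<And>t. \<bar>t - t0\<bar> < r \<Longrightarrow> g (of_real t) = complex_of_real (f t)"
proof -
  obtain r c where r: "r > 0" "\<And>t. \<bar>t - t0\<bar> < r \<Longrightarrow> (\<lambda>n. c n * (t - t0) ^ n) sums f t"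
    using assms unfolding analytic_real_def by blast
  define g where "g w = (\<Sum>n. complex_of_real (c n) * (w - of_real t0) ^ n)" for w
  have sm: "(\<lambda>n. complex_of_real (c n) * (w - of_real t0) ^ n) sums g w" if w: "w \<in> ball (of_real t0) r" for w
  proof -
    define s where "s = (norm (w - of_real t0) + r) / 2"
    have s: "norm (w - of_real t0) < s" "0 \<le> s" "s < r"
    proof -
      have "norm (w - of_real t0) < r" using w by (simp add: dist_norm norm_minus_commute)
      then show "norm (w - of_real t0) < s" "s < r" by (simp_all add: s_def)
      show "0 \<le> s" using r(1) by (simp add: s_def add_nonneg_nonneg)
    qed
    have "summable (\<lambda>n. c n * s ^ n)" using r(2)[of "t0 + s"] s by (auto simp: sums_iff)
    then have "summable (\<lambda>n. complex_of_real (c n * s ^ n))" by (simp only: summable_of_real)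
    then have "summable (\<lambda>n. complex_of_real (c n) * of_real s ^ n)" by simp
    then have "summable (\<lambda>n. complex_of_real (c n) * (w - of_real t0) ^ n)"
      by (rule powser_inside) (use s in simp)
    then show ?thesis unfolding g_def by (rule summable_sums)
  qed
  show ?thesis
  proof (rule that[OF r(1)])
    show "g holomorphic_on ball (of_real t0) r" by (rule power_series_holomorphic[OF sm])
    fix t assume t: "\<bar>t - t0\<bar> < r"
    then have "complex_of_real t \<in> ball (of_real t0) r" by (simp add: dist_of_real dist_real_def abs_minus_commute)
    from sm[OF this] have "(\<lambda>n. complex_of_real (c n * (t - t0) ^ n)) sums g (of_real t)" by simp
    moreover have "(\<lambda>n. complex_of_real (c n * (t - t0) ^ n)) sums of_real (f t)"
      using r(2)[OF t] by (simp only: sums_of_real_iff)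
    ultimately show "g (of_real t) = of_real (f t)" by (rule sums_unique2)
  qed
qed

definition locally_holomorphic :: "(real \<Rightarrow> complex) \<Rightarrow> real set \<Rightarrow> bool" where
  "locally_holomorphic H S \<longleftrightarrow> (\<forall>t0\<in>S. \<exists>r>0. \<exists>g. g holomorphic_on ball (of_real t0) r \<and> (\<forall>t. \<bar>t - t0\<bar> < r \<longrightarrow> g (of_real t) = H t))"

text \<open>The points around which H vanishes form an open subset of the interval. It is also
  closed: if such points come arbitrarily near t0, the identity theorem for the local extension at
  t0 gives vanishing around t0.\<close>

lemma locally_holomorphic_identity:
  assumes lh: "locally_holomorphic H {a<..<b}" and cd: "a \<le> c" "c < d" "d \<le> b"
    and z: "\<And>t. t \<in> {c<..<d} \<Longrightarrow> H t = 0" and t: "t \<in> {a<..<b}"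
  shows "H t = 0"
proof -
  let ?I = "{a<..<b}"
  define E where "E = {t \<in> ?I. \<exists>r>0. \<forall>s. \<bar>s - t\<bar> < r \<longrightarrow> H s = 0}"
  have ext: "t0 \<in> E" if t0: "t0 \<in> ?I" and near: "\<And>e. e > 0 \<Longrightarrow> \<exists>t\<in>E. \<bar>t - t0\<bar> < e" for t0
  proof -
    obtain r g where r: "r > 0" and g: "g holomorphic_on ball (of_real t0) r" "\<And>t. \<bar>t - t0\<bar> < r \<Longrightarrow> g (of_real t) = H t"
      using lh t0 unfolding locally_holomorphic_def by blast
    obtain t where tE: "t \<in> E" "\<bar>t - t0\<bar> < r" using near[OF r] by blast
    obtain q where q: "q > 0" "\<And>s. \<bar>s - t\<bar> < q \<Longrightarrow> H s = 0" using tE by (auto simp: E_def)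
    define m where "m = min q (r - \<bar>t - t0\<bar>)"
    have m: "m > 0" using q tE by (simp add: m_def)
    define U where "U = complex_of_real ` {t - m<..<t + m}"
    have sub: "U \<subseteq> ball (of_real t0) r"
      by (auto simp: U_def m_def dist_of_real dist_real_def)
    have "complex_of_real t islimpt U"
    proof (unfold islimpt_approachable, intro allI impI)
      fix e :: real assume "e > 0"
      define h where "h = min e m / 2"
      have h: "0 < h" "h < e" "h < m" using \<open>e > 0\<close> m by (auto simp: h_def)
      have "complex_of_real (t + h) \<in> U" unfolding U_def using h by (intro imageI) auto
      moreover have "complex_of_real (t + h) \<noteq> of_real t" using h by simp
      moreover have "dist (complex_of_real (t + h)) (of_real t) < e" using h by (simp add: dist_of_real dist_real_def del: of_real_add)
      ultimately show "\<exists>x'\<in>U. x' \<noteq> complex_of_real t \<and> dist x' (complex_of_real t) < e" by blast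
    qed
    moreover have "g u = 0" if "u \<in> U" for u
    proof -
      have "\<exists>s. u = of_real s \<and> \<bar>s - t\<bar> < m" using that by (auto simp: U_def)
      then obtain s where s: "u = of_real s" "\<bar>s - t\<bar> < m" by blast
      have "\<bar>s - t0\<bar> < r" "\<bar>s - t\<bar> < q" using s(2) by (auto simp: m_def)
      then show ?thesis using g(2) q(2) s(1) by simp
    qed
    moreover have "complex_of_real t \<in> ball (of_real t0) r" using tE by (simp add: dist_of_real dist_real_def abs_minus_commute)
    ultimately have "g w = 0" if "w \<in> ball (of_real t0) r" for w
      using analytic_continuation[OF g(1) _ _ sub, of "of_real t" w] that by simp
    then have "H s = 0" if "\<bar>s - t0\<bar> < r" for s
      using g(2)[OF that] that by (metis abs_minus_commute dist_of_real dist_real_def mem_ball)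
    then show ?thesis using t0 r by (auto simp: E_def)
  qed
  have "openin (top_of_set ?I) E"
    unfolding openin_euclidean_subtopology_iff
  proof (intro conjI ballI)
    fix x assume "x \<in> E"
    then obtain r where r: "r > 0" "\<And>s. \<bar>s - x\<bar> < r \<Longrightarrow> H s = 0" by (auto simp: E_def)
    show "\<exists>e>0. \<forall>x'\<in>?I. dist x' x < e \<longrightarrow> x' \<in> E"
    proof (intro exI[of _ "r/2"] conjI ballI impI)
      fix x' assume x': "x' \<in> ?I" "dist x' x < r/2"
      have "H s = 0" if "\<bar>s - x'\<bar> < r/2" for s by (rule r(2)) (use that x'(2) in \<open>unfold dist_real_def, linarith\<close>)
      then show "x' \<in> E" using x'(1) r(1) unfolding E_def by (auto intro!: exI[of _ "r/2"])
    qed (use r in simp)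
  qed (auto simp: E_def)
  moreover have "openin (top_of_set ?I) (?I - E)"
    unfolding openin_euclidean_subtopology_iff
  proof (intro conjI ballI)
    fix x assume x: "x \<in> ?I - E"
    then obtain e where "e > 0" "\<And>t. t \<in> E \<Longrightarrow> \<not> \<bar>t - x\<bar> < e" using ext[of x] by blast
    then show "\<exists>e>0. \<forall>x'\<in>?I. dist x' x < e \<longrightarrow> x' \<in> ?I - E" by (auto simp: dist_real_def)
  qed auto
  moreover have "E \<subseteq> ?I" by (auto simp: E_def)
  ultimately have "openin (top_of_set ?I) E" "closedin (top_of_set ?I) E" by (simp_all add: closedin_def)
  moreover have "(c + d) / 2 \<in> E"
  proof -
    have "H s = 0" if "\<bar>s - (c + d) / 2\<bar> < (d - c) / 2" for s by (rule z) (use that in \<open>auto simp: abs_less_iff field_simps\<close>)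
    then show ?thesis unfolding E_def using cd by (auto intro!: exI[of _ "(d - c) / 2"])
  qed
  ultimately have "E = ?I" using connected_Ioo[of a b] unfolding connected_clopen by blast
  then have "t \<in> E" using t by simp
  then obtain r where "r > 0" "\<forall>s. \<bar>s - t\<bar> < r \<longrightarrow> H s = 0" by (auto simp: E_def)
  then show ?thesis by simp
qed

definition sign_change :: "real \<Rightarrow> real \<Rightarrow> bool" where
  "sign_change l p \<longleftrightarrow> (\<exists>e>0. \<exists>s\<in>{1,-1}. \<forall>y. 0 < \<bar>y - p\<bar> \<and> \<bar>y - p\<bar> < e \<longrightarrow> s * (y - p) * shoot l y > 0)"

text \<open>Factor out (w - p)^k. The remaining holomorphic factor has no zeros near p and is real
  on the real line, hence of constant sign there. Only \<open>cshoot\<close> is differentiated, but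
  \<open>shoot\<close> has the same sign.\<close>

lemma sign_at_zero_of_order:
  assumes p: "p > 0" and z: "shoot l p = 0" and k: "k > 0"
    and dk: "(deriv ^^ k) (cshoot (of_real l)) (of_real p) \<noteq> 0"
    and dj: "\<And>j. 0 < j \<Longrightarrow> j < k \<Longrightarrow> (deriv ^^ j) (cshoot (of_real l)) (of_real p) = 0"
  obtains e s where "e > 0" "s \<in> {1,-1::real}" "\<And>y. 0 < \<bar>y - p\<bar> \<Longrightarrow> \<bar>y - p\<bar> < e \<Longrightarrow> s * (y - p) ^ k * shoot l y > 0"
proof -
  obtain \<eta> where \<eta>: "\<eta> > 0" "(complex_of_real l, complex_of_real p) \<in> cdom"
    "\<And>l' p'. \<bar>l' - l\<bar> < \<eta> \<Longrightarrow> \<bar>p' - p\<bar> < \<eta> \<Longrightarrow> cshoot (of_real l') (of_real p') = of_real (Re (cshoot (of_real l') (of_real p')))"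
    "\<And>l' p'. \<bar>l' - l\<bar> < \<eta> \<Longrightarrow> \<bar>p' - p\<bar> < \<eta> \<Longrightarrow> cshoot (of_real l') (of_real p') = 0 \<longleftrightarrow> shoot l' p' = 0"
    "\<And>l' p'. \<bar>l' - l\<bar> < \<eta> \<Longrightarrow> \<bar>p' - p\<bar> < \<eta> \<Longrightarrow> Re (cshoot (of_real l') (of_real p')) > 0 \<longleftrightarrow> shoot l' p' > 0"
    by (rule cshoot_eq_0_iff_near[OF p z]) (rule that)
  obtain \<eta>' where \<eta>': "\<eta>' > 0" "\<And>l'. l' \<in> ball (of_real l) \<eta>' \<Longrightarrow> cshoot l' holomorphic_on ball (of_real p) \<eta>'"
    by (rule cshoot_near[OF \<eta>(2)]) (rule that)
  let ?f = "cshoot (of_real l)"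
  have hol: "?f holomorphic_on ball (of_real p) \<eta>'" using \<eta>' by simp
  have f0: "?f (of_real p) = 0" using \<eta>(4)[of l p] \<eta>(1) z by simp
  have pin: "complex_of_real p \<in> ball (of_real p) \<eta>'" using \<eta>' by simp
  obtain g r where r: "r > 0" and g: "g holomorphic_on ball (of_real p) r"
    "\<And>w. w \<in> ball (of_real p) r \<Longrightarrow> ?f w - ?f (of_real p) = (w - of_real p) ^ k * g w" "\<And>w. w \<in> ball (of_real p) r \<Longrightarrow> g w \<noteq> 0"
  proof (rule holomorphic_factor_order_of_zero[OF hol open_ball pin k dk])
    show "(deriv ^^ i) ?f (of_real p) = 0" if "0 < i" "i < k" for i using dj[OF that] .
  qed (rule that)
  define e where "e = min \<eta> r"
  have e: "e > 0" using \<eta>(1) r by (simp add: e_def)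
  define G where "G y = Re (g (of_real y))" for y
  have inb: "complex_of_real y \<in> ball (of_real p) r" if "\<bar>y - p\<bar> < e" for y
    using that by (simp add: e_def dist_of_real dist_real_def abs_minus_commute)
  have fG: "Re (?f (of_real y)) = (y - p) ^ k * G y" and gG: "g (of_real y) = of_real (G y)" if y: "0 < \<bar>y - p\<bar>" "\<bar>y - p\<bar> < e" for y
  proof -
    have eq: "?f (of_real y) = of_real ((y - p) ^ k) * g (of_real y)" using g(2)[OF inb[OF y(2)]] f0 by simp
    then show "Re (?f (of_real y)) = (y - p) ^ k * G y" by (simp add: G_def)
    have nz: "complex_of_real ((y - p) ^ k) \<noteq> 0" using y by simp
    have "?f (of_real y) = of_real (Re (?f (of_real y)))" by (rule \<eta>(3)) (use y \<eta>(1) in \<open>auto simp: e_def\<close>)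
    then have "of_real ((y - p) ^ k) * g (of_real y) = of_real ((y - p) ^ k) * of_real (G y)"
      using eq \<open>Re (?f (of_real y)) = _\<close> by (metis of_real_mult)
    then show "g (of_real y) = of_real (G y)" by (simp only: mult_left_cancel[OF nz])
  qed
  have cG: "continuous_on {p - e<..<p + e} G"
  proof -
    have "continuous_on {p - e<..<p + e} (\<lambda>y. g (complex_of_real y))"
      by (rule continuous_on_compose2[OF holomorphic_on_imp_continuous_on[OF g(1)]])
        (use inb in \<open>auto intro!: continuous_intros simp: abs_less_iff\<close>)
    then show ?thesis unfolding G_def by (intro continuous_intros)
  qed
  have cI: "continuous_on {p - e<..<p + e} (\<lambda>y. Im (g (of_real y)))"
  proof -
    have "continuous_on {p - e<..<p + e} (\<lambda>y. g (complex_of_real y))"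
      by (rule continuous_on_compose2[OF holomorphic_on_imp_continuous_on[OF g(1)]])
        (use inb in \<open>auto intro!: continuous_intros simp: abs_less_iff\<close>)
    then show ?thesis by (intro continuous_intros)
  qed
  \<comment> \<open>Off p the factor is a quotient of real numbers; at p its imaginary part vanishes
    by continuity.\<close>
  have Ip: "Im (g (of_real p)) = 0"
  proof (rule ccontr)
    assume nz: "Im (g (of_real p)) \<noteq> 0"
    have "isCont (\<lambda>y. Im (g (of_real y))) p" using cI e by (simp add: continuous_on_eq_continuous_at)
    then obtain d where d: "d > 0" "\<And>y. dist y p < d \<Longrightarrow> dist (Im (g (of_real y))) (Im (g (of_real p))) < \<bar>Im (g (of_real p))\<bar>"
      using nz unfolding continuous_at_eps_delta by (metis zero_less_abs_iff)
    define y where "y = p + min d e / 2"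
    have y: "0 < \<bar>y - p\<bar>" "\<bar>y - p\<bar> < e" "dist y p < d" using d(1) e by (auto simp: y_def dist_real_def)
    have "Im (g (of_real y)) = 0" using gG[OF y(1,2)] by simp
    then show False using d(2)[OF y(3)] by (simp add: dist_real_def)
  qed
  have Gnz: "G y \<noteq> 0" if y: "y \<in> {p - e<..<p + e}" for y
  proof
    assume G0: "G y = 0"
    have ye: "\<bar>y - p\<bar> < e" using y by auto
    have "Im (g (of_real y)) = 0" using gG[of y] ye Ip by (cases "y = p") auto
    then have "g (of_real y) = 0" using G0 by (simp add: G_def complex_eq_iff)
    then show False using g(3)[OF inb[OF ye]] by simp
  qed
  have same: "sgn (G y) = sgn (G p)" if y: "y \<in> {p - e<..<p + e}" for y
  proof (rule ccontr)
    assume ne: "sgn (G y) \<noteq> sgn (G p)"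
    have pI: "p \<in> {p - e<..<p + e}" using e by auto
    have con: "connected (G ` {p - e<..<p + e})" by (intro connected_continuous_image cG) simp
    have "0 \<in> G ` {p - e<..<p + e}"
    proof (cases "G y < 0")
      case True
      then have "G p > 0" using ne Gnz[OF pI] by (auto simp: sgn_if split: if_splits)
      then show ?thesis using connectedD_interval[OF con, of "G y" "G p" 0] True y pI by auto
    next
      case False
      then have "G y > 0" "G p < 0" using ne Gnz[OF pI] Gnz[OF y] by (auto simp: sgn_if split: if_splits)
      then show ?thesis using connectedD_interval[OF con, of "G p" "G y" 0] y pI by auto
    qed
    then show False using Gnz by auto
  qed
  define s where "s = sgn (G p)"
  have s: "s \<in> {1, -1}" using Gnz[of p] e by (auto simp: s_def sgn_if)
  show ?thesis
  proof (rule that[OF e s])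
    fix y assume y: "0 < \<bar>y - p\<bar>" "\<bar>y - p\<bar> < e"
    have yI: "y \<in> {p - e<..<p + e}" using y by auto
    have "s * G y = \<bar>G y\<bar>" unfolding s_def same[OF yI, symmetric] by (simp add: abs_sgn mult.commute)
    then have sG: "s * G y > 0" using Gnz[OF yI] by simp
    have ye: "\<bar>y - p\<bar> < \<eta>" "\<bar>l - l\<bar> < \<eta>" using y \<eta>(1) by (auto simp: e_def)
    have nz: "(y - p) ^ k \<noteq> 0" using y by simp
    have sg: "sgn (shoot l y) = sgn (Re (?f (of_real y)))"
      using \<eta>(5)[OF ye(2,1)] \<eta>(4)[OF ye(2,1)] \<eta>(3)[OF ye(2,1)] by (auto simp: sgn_if)
    have "sgn (s * (y - p) ^ k * shoot l y) = sgn (s * (y - p) ^ k) * sgn (shoot l y)" by (simp add: sgn_mult)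
    also have "\<dots> = sgn (s * (y - p) ^ k * ((y - p) ^ k * G y))" unfolding sg fG[OF y] by (simp add: sgn_mult)
    also have "s * (y - p) ^ k * ((y - p) ^ k * G y) = ((y - p) ^ k)\<^sup>2 * (s * G y)" by (simp add: power2_eq_square)
    also have "sgn \<dots> = 1"
    proof (rule sgn_pos, rule mult_pos_pos[OF _ sG])
      show "((y - p) ^ k)\<^sup>2 > 0" using nz by (simp only: zero_less_power2 not_False_eq_True)
    qed
    finally show "s * (y - p) ^ k * shoot l y > 0" by (simp add: sgn_1_pos)
  qed
qed

text \<open>Let k be the least order for which the k-th derivative in p is not identically zero
  along the arc. It vanishes on no subinterval of the arc, so generic points have order exactly k.
  The sign changes near the left end force k to be odd, and then there are sign changes arbitrarily
  close to the right end as well.\<close>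

theorem sign_change_persists:
  assumes an: "analytic_real q {0<..<\<epsilon>}" and Z: "\<And>l. l \<in> {0<..<\<epsilon>} \<Longrightarrow> q l > 0 \<and> shoot l (q l) = 0"
    and d0: "0 < d0" "d0 \<le> \<epsilon>" "\<And>l. l \<in> {0<..<d0} \<Longrightarrow> sign_change l (q l)"
    and l': "0 \<le> l'" "l' < \<epsilon>"
  shows "\<exists>l\<in>{l'<..<\<epsilon>}. sign_change l (q l)"
proof -
  \<comment> \<open>The j-th derivative in the slope, taken at the zero and followed along the
    arc.\<close>
  define H where "H j l = (deriv ^^ j) (cshoot (of_real l)) (complex_of_real (q l))" for j l
  have lh: "locally_holomorphic (H j) {0<..<\<epsilon>}" for j
    unfolding locally_holomorphic_def
  proof
    fix l0 assume l0: "l0 \<in> {0<..<\<epsilon>}"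
    let ?l = "complex_of_real l0" and ?p = "complex_of_real (q l0)"
    have \<eta>1: "(?l, ?p) \<in> cdom" using zero_in_cdom(1)[of "q l0" l0] Z[OF l0] by simp
    obtain \<eta> where \<eta>: "0 < \<eta>"
      "continuous_on (ball ?l \<eta> \<times> ball ?p \<eta>) (\<lambda>(l, p). cshoot l p)"
      "\<And>p. p \<in> ball ?p \<eta> \<Longrightarrow> (\<lambda>l. cshoot l p) holomorphic_on ball ?l \<eta>"
      "\<And>l. l \<in> ball ?l \<eta> \<Longrightarrow> cshoot l holomorphic_on ball ?p \<eta>"
      by (rule cshoot_near[OF \<eta>1]) (rule that)
    obtain r a where r: "r > 0" and a: "a holomorphic_on ball ?l r" "\<And>t. \<bar>t - l0\<bar> < r \<Longrightarrow> a (of_real t) = complex_of_real (q t)"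
      using analytic_real_extension[OF an l0] by blast
    have al0: "a ?l = ?p" using a(2)[of l0] r by simp
    define \<rho> where "\<rho> = \<eta> / 2"
    have \<rho>: "0 < \<rho>" "\<rho> < \<eta>" using \<eta>(1) by (auto simp: \<rho>_def)
    have "isCont a ?l" using holomorphic_on_imp_continuous_on[OF a(1)] r by (simp add: continuous_on_eq_continuous_at)
    then obtain s0 where s0: "s0 > 0" "\<And>w. dist w ?l < s0 \<Longrightarrow> dist (a w) (a ?l) < \<rho>"
      using \<rho>(1) unfolding continuous_at_eps_delta by blast
    define s where "s = min s0 (min r \<eta>)"
    have s: "s > 0" "s \<le> s0" "s \<le> r" "s \<le> \<eta>" using s0 r \<eta>(1) by (auto simp: s_def)
    have ain: "a w \<in> ball ?p \<rho>" if "w \<in> ball ?l s" for w using s0(2)[of w] that s al0 by (auto simp: dist_commute)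
    have ca: "continuous_on (ball ?l s) a" by (rule continuous_on_subset[OF holomorphic_on_imp_continuous_on[OF a(1)]]) (use s in auto)
    \<comment> \<open>Cauchy's formula over a fixed circle around q l0 exhibits the derivative at
      the moving point a w as a holomorphic function of w, where a is the extension of q to complex
      arguments.\<close>
    define g where "g w = fact j / (2 * pi * \<i>) * contour_integral (circlepath ?p \<rho>) (\<lambda>u. cshoot w u / (u - a w) ^ Suc j)" for w
    have gd: "g w = (deriv ^^ j) (cshoot w) (a w)" if w: "w \<in> ball ?l s" for w
    proof -
      have h: "cshoot w holomorphic_on cball ?p \<rho>" by (rule holomorphic_on_subset[OF \<eta>(4)]) (use w s \<rho> in auto)
      have "cshoot w holomorphic_on ball ?p \<rho>" by (rule holomorphic_on_subset[OF h]) auto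
      from Cauchy_higher_derivative_integral_circlepath(2)[OF holomorphic_on_imp_continuous_on[OF h] this ain[OF w], of j]
      show ?thesis by (simp add: g_def)
    qed
    have "g holomorphic_on ball ?l s"
      unfolding g_def
    proof (intro holomorphic_on_mult holomorphic_on_const contour_integral_holomorphic_param)
      show "continuous_on {0..1} (\<lambda>t. vector_derivative (circlepath ?p \<rho>) (at t))"
        unfolding vector_derivative_circlepath by (intro continuous_intros)
      have sp: "path_image (circlepath ?p \<rho>) = sphere ?p \<rho>" using \<rho> by simp
      have ne: "u \<noteq> a w" if "w \<in> ball ?l s" "u \<in> sphere ?p \<rho>" for w u using ain[OF that(1)] that(2) by auto
      show "continuous_on (ball ?l s \<times> path_image (circlepath ?p \<rho>)) (\<lambda>(x, u). cshoot x u / (u - a x) ^ Suc j)"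
        unfolding sp split_def
      proof (intro continuous_on_divide continuous_on_power continuous_on_diff continuous_on_snd continuous_on_id)
        have "continuous_on (ball ?l s \<times> sphere ?p \<rho>) (\<lambda>(l, p). cshoot l p)"
          by (rule continuous_on_subset[OF \<eta>(2)]) (use s \<rho> in auto)
        then show "continuous_on (ball ?l s \<times> sphere ?p \<rho>) (\<lambda>x. cshoot (fst x) (snd x))" by (simp add: split_def)
        show "continuous_on (ball ?l s \<times> sphere ?p \<rho>) (\<lambda>x. a (fst x))"
          by (rule continuous_on_compose2[OF ca]) (auto intro!: continuous_intros)
        show "\<forall>x\<in>ball ?l s \<times> sphere ?p \<rho>. (snd x - a (fst x)) ^ Suc j \<noteq> 0" using ne by auto
      qed
      show "(\<lambda>x. cshoot x u / (u - a x) ^ Suc j) holomorphic_on ball ?l s" if u: "u \<in> path_image (circlepath ?p \<rho>)" for u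
      proof (intro holomorphic_on_divide holomorphic_on_power holomorphic_on_diff holomorphic_on_const)
        have "u \<in> ball ?p \<eta>" using u \<rho> by auto
        from \<eta>(3)[OF this] show "(\<lambda>x. cshoot x u) holomorphic_on ball ?l s" by (rule holomorphic_on_subset) (use s in auto)
        show "a holomorphic_on ball ?l s" by (rule holomorphic_on_subset[OF a(1)]) (use s in auto)
        show "(u - a x) ^ Suc j \<noteq> 0" if "x \<in> ball ?l s" for x using ne[OF that, of u] u unfolding sp by simp
      qed
    qed auto
    moreover have "g (of_real t) = H j t" if t: "\<bar>t - l0\<bar> < s" for t
    proof -
      have "complex_of_real t \<in> ball ?l s" using t by (simp add: dist_of_real dist_real_def abs_minus_commute)
      from gd[OF this] show ?thesis using a(2)[of t] t s by (simp add: H_def)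
    qed
    ultimately show "\<exists>r>0. \<exists>g. g holomorphic_on ball ?l r \<and> (\<forall>t. \<bar>t - l0\<bar> < r \<longrightarrow> g (of_real t) = H j t)" using s(1) by blast
  qed
  have H0: "H 0 l = 0" if l: "l \<in> {0<..<\<epsilon>}" for l using zero_in_cdom(2)[of "q l" l] Z[OF l] by (simp add: H_def)
  \<comment> \<open>If all derivatives vanished at one point of the arc, the slice there would be
    identically zero.\<close>
  have ex: "\<exists>j. \<exists>l\<in>{0<..<\<epsilon>}. H j l \<noteq> 0"
  proof (rule ccontr)
    assume no: "\<not> ?thesis"
    define l where "l = d0 / 2"
    have l: "l \<in> {0<..<\<epsilon>}" using d0 by (auto simp: l_def)
    have \<eta>1: "(complex_of_real l, complex_of_real (q l)) \<in> cdom" using zero_in_cdom(1)[of "q l" l] Z[OF l] by simp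
    obtain \<eta> where \<eta>: "0 < \<eta>" "\<And>l'. l' \<in> ball (of_real l) \<eta> \<Longrightarrow> cshoot l' holomorphic_on ball (of_real (q l)) \<eta>"
      by (rule cshoot_near[OF \<eta>1]) (rule that)
    have hol: "cshoot (of_real l) holomorphic_on ball (of_real (q l)) \<eta>" using \<eta> by simp
    obtain w where w: "w \<in> ball (of_real (q l)) \<eta>" "cshoot (of_real l) w \<noteq> 0"
      using cshoot_slice_nontrivial[of "q l" l \<eta>] Z[OF l] \<eta>(1) by blast
    have "cshoot (of_real l) w = 0"
      by (rule holomorphic_fun_eq_0_on_ball[OF hol w(1)]) (use no l in \<open>auto simp: H_def\<close>)
    then show False using w(2) by simp
  qed
  define k where "k = (LEAST j. \<exists>l\<in>{0<..<\<epsilon>}. H j l \<noteq> 0)"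
  have k: "\<exists>l\<in>{0<..<\<epsilon>}. H k l \<noteq> 0" unfolding k_def by (rule LeastI_ex[OF ex])
  have klow: "H j l = 0" if "j < k" "l \<in> {0<..<\<epsilon>}" for j l using not_less_Least[OF that(1)[unfolded k_def]] that(2) by blast
  have k0: "k > 0" using k H0 by (cases k) auto
  have dense: "\<exists>l\<in>{c<..<d}. H k l \<noteq> 0" if "0 \<le> c" "c < d" "d \<le> \<epsilon>" for c d
    using locally_holomorphic_identity[OF lh[of k] that] k by blast
  have order: "\<exists>e>0. \<exists>s\<in>{1,-1::real}. \<forall>y. 0 < \<bar>y - q l\<bar> \<longrightarrow> \<bar>y - q l\<bar> < e \<longrightarrow> s * (y - q l) ^ k * shoot l y > 0"
    if l: "l \<in> {0<..<\<epsilon>}" "H k l \<noteq> 0" for l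
  proof -
    have "\<And>j. 0 < j \<Longrightarrow> j < k \<Longrightarrow> (deriv ^^ j) (cshoot (of_real l)) (of_real (q l)) = 0" using klow l(1) by (simp add: H_def)
    from sign_at_zero_of_order[OF _ _ k0 l(2)[unfolded H_def] this] Z[OF l(1)]
    obtain e s where "e > 0" "s \<in> {1,-1::real}" "\<And>y. 0 < \<bar>y - q l\<bar> \<Longrightarrow> \<bar>y - q l\<bar> < e \<Longrightarrow> s * (y - q l) ^ k * shoot l y > 0" by blast
    then show ?thesis by blast
  qed
  \<comment> \<open>An even order gives \<open>shoot\<close> the same sign on both sides of the arc,
    against the sign change at generic points left of d0.\<close>
  have "odd k"
  proof (rule ccontr)
    assume "\<not> odd k"
    then have ev: "even k" by simp
    obtain l where l: "l \<in> {0<..<d0}" "H k l \<noteq> 0" using dense[of 0 d0] d0 by auto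
    have le: "l \<in> {0<..<\<epsilon>}" using l d0 by auto
    obtain e s where e: "e > 0" "s \<in> {1,-1::real}" "\<And>y. 0 < \<bar>y - q l\<bar> \<Longrightarrow> \<bar>y - q l\<bar> < e \<Longrightarrow> s * (y - q l) ^ k * shoot l y > 0"
      using order[OF le l(2)] by blast
    obtain e' s' where e': "e' > 0" "s' \<in> {1,-1::real}" "\<And>y. 0 < \<bar>y - q l\<bar> \<and> \<bar>y - q l\<bar> < e' \<Longrightarrow> s' * (y - q l) * shoot l y > 0"
      using d0(3)[OF l(1)] unfolding sign_change_def by blast
    define h where "h = min e e' / 2"
    have h: "0 < h" "h < e" "h < e'" using e(1) e'(1) by (auto simp: h_def)
    have 1: "s * h ^ k * shoot l (q l + h) > 0" "s * h ^ k * shoot l (q l - h) > 0"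
      using e(3)[of "q l + h"] e(3)[of "q l - h"] h ev by auto
    have 2: "s' * h * shoot l (q l + h) > 0" "s' * (- h) * shoot l (q l - h) > 0"
      using e'(3)[of "q l + h"] e'(3)[of "q l - h"] h by auto
    have hk: "h ^ k > 0" using h by simp
    show False using 1 2 e(2) e'(2) h hk by (auto simp: zero_less_mult_iff mult_less_0_iff)
  qed
  then obtain m where m: "k = Suc (2 * m)" using oddE by (metis Suc_eq_plus1)
  obtain l where l: "l \<in> {l'<..<\<epsilon>}" "H k l \<noteq> 0" using dense[of l' \<epsilon>] l' by auto
  have le: "l \<in> {0<..<\<epsilon>}" using l l' by auto
  obtain e s where e: "e > 0" "s \<in> {1,-1::real}" "\<And>y. 0 < \<bar>y - q l\<bar> \<Longrightarrow> \<bar>y - q l\<bar> < e \<Longrightarrow> s * (y - q l) ^ k * shoot l y > 0"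
    using order[OF le l(2)] by blast
  have "s * (y - q l) * shoot l y > 0" if y: "0 < \<bar>y - q l\<bar>" "\<bar>y - q l\<bar> < e" for y
  proof -
    have "s * (y - q l) ^ k * shoot l y = ((y - q l) ^ m)\<^sup>2 * (s * (y - q l) * shoot l y)"
      by (simp add: m power_mult power2_eq_square power_mult_distrib mult_ac)
    moreover have "((y - q l) ^ m)\<^sup>2 > 0" using y by simp
    ultimately show ?thesis using e(3)[OF y] zero_less_mult_pos[of "((y - q l) ^ m)\<^sup>2"] by metis
  qed
  then have "sign_change l (q l)" unfolding sign_change_def using e by blast
  then show ?thesis using l by blast
qed

section \<open>Positive solutions and zeros of the shooting function\<close>

lemma dom_integral:
  fixes f :: "real \<Rightarrow> real"
  assumes "continuous_on {0..pi} f"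
  shows "integrable dom_measure f" "(LINT x|dom_measure. f x) = integral {0..pi} f"
proof -
  have "set_integrable lborel {0..pi} f" by (rule borel_integrable_atLeastAtMost'[OF assms])
  then have s: "set_integrable lborel {0<..<pi} f" by (rule set_integrable_subset) auto
  then show "integrable dom_measure f"
    by (subst integrable_restrict_space) (auto simp: set_integrable_def)
  have "(LINT x|dom_measure. f x) = (LINT x:{0<..<pi}|lborel. f x)"
    by (subst integral_restrict_space) (auto simp: set_lebesgue_integral_def)
  also have "\<dots> = integral {0<..<pi} f" by (rule set_borel_integral_eq_integral(2)[OF s])
  finally show "(LINT x|dom_measure. f x) = integral {0..pi} f" by (simp add: integral_open_interval_real)
qed

lemma continuous_L2:
  assumes "continuous_on {0..pi} f" shows "f \<in> L2"
proof -
  have "continuous_on {0<..<pi} f" by (rule continuous_on_subset[OF assms]) auto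
  then have "f \<in> borel_measurable (restrict_space borel {0<..<pi})" by (rule borel_measurable_continuous_on_restrict)
  then have "f \<in> borel_measurable dom_measure" by (simp cong: measurable_cong_sets add: sets_restrict_space)
  moreover have "integrable dom_measure (\<lambda>x. (f x)\<^sup>2)" by (intro dom_integral continuous_intros assms)
  ultimately show ?thesis by (simp add: L2_def)
qed

lemma test_fun_deriv: "test_fun \<phi> \<Longrightarrow> (\<phi> has_real_derivative deriv \<phi> x) (at x)"
  by (simp add: test_fun_def DERIV_deriv_iff_real_differentiable)

lemma test_fun_continuous: "test_fun \<phi> \<Longrightarrow> continuous_on S \<phi>" "test_fun \<phi> \<Longrightarrow> continuous_on S (deriv \<phi>)"
  by (meson DERIV_isCont continuous_at_imp_continuous_on test_fun_deriv)
    (auto simp: test_fun_def intro: continuous_on_subset)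

lemma test_fun_ends: "test_fun \<phi> \<Longrightarrow> \<phi> 0 = 0 \<and> \<phi> pi = 0"
  unfolding test_fun_def by force

lemma classical_weak_deriv:
  assumes du: "\<And>x. x \<in> {0..pi} \<Longrightarrow> (u has_real_derivative v x) (at x within {0..pi})"
    and cv: "continuous_on {0..pi} v"
  shows "has_weak_deriv u v"
  unfolding has_weak_deriv_def
proof (intro allI impI)
  fix \<phi> assume t: "test_fun \<phi>"
  have cu: "continuous_on {0..pi} u" by (rule DERIV_continuous_on[OF du])
  note ct = test_fun_continuous[OF t]
  have "((\<lambda>x. v x * \<phi> x + deriv \<phi> x * u x) has_integral u pi * \<phi> pi - u 0 * \<phi> 0) {0..pi}"
  proof (rule fundamental_theorem_of_calculus)
    fix x assume x: "x \<in> {0..pi}"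
    show "((\<lambda>x. u x * \<phi> x) has_vector_derivative v x * \<phi> x + deriv \<phi> x * u x) (at x within {0..pi})"
      unfolding has_real_derivative_iff_has_vector_derivative[symmetric]
      by (rule DERIV_mult[OF du[OF x] has_field_derivative_at_within[OF test_fun_deriv[OF t]]])
  qed simp
  then have "integral {0..pi} (\<lambda>x. v x * \<phi> x + deriv \<phi> x * u x) = 0" using test_fun_ends[OF t] by (simp add: integral_unique)
  moreover have "integral {0..pi} (\<lambda>x. v x * \<phi> x + deriv \<phi> x * u x)
     = integral {0..pi} (\<lambda>x. v x * \<phi> x) + integral {0..pi} (\<lambda>x. deriv \<phi> x * u x)"
    by (intro integral_add integrable_continuous_interval continuous_intros cu cv ct)
  moreover have "(LINT x|dom_measure. u x * deriv \<phi> x) = integral {0..pi} (\<lambda>x. deriv \<phi> x * u x)"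
    by (subst dom_integral(2)) (auto intro!: continuous_intros cu ct simp: mult.commute)
  moreover have "(LINT x|dom_measure. v x * \<phi> x) = integral {0..pi} (\<lambda>x. v x * \<phi> x)"
    by (intro dom_integral(2) continuous_intros cv ct)
  ultimately show "(LINT x|dom_measure. u x * deriv \<phi> x) = - (LINT x|dom_measure. v x * \<phi> x)" by simp
qed

text \<open>Zero mean is what makes the primitive vanish to the right of the support, so that it is
  again a test function.\<close>

lemma test_fun_primitive:
  assumes \<psi>: "continuous_on UNIV \<psi>" "0 < a" "a \<le> b" "b < pi" "\<And>x. x \<notin> {a..b} \<Longrightarrow> \<psi> x = 0" and int: "integral {0..pi} \<psi> = 0"
  shows "\<exists>\<phi>. test_fun \<phi> \<and> deriv \<phi> = \<psi>"
proof -
  define \<phi> where "\<phi> x = integral {0..x} \<psi>" for x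
  have ii: "\<psi> integrable_on {c..d}" for c d by (intro integrable_continuous_interval continuous_on_subset[OF \<psi>(1)]) auto
  have low: "\<phi> x = 0" if "x < a" for x
  proof (cases "x \<ge> 0")
    case True
    have "integral {0..x} \<psi> = integral {0..x} (\<lambda>_. 0)" by (rule integral_cong) (use \<psi>(5) that in auto)
    then show ?thesis by (simp add: \<phi>_def)
  qed (simp add: \<phi>_def)
  have zero: "integral {c..d} \<psi> = 0" if "b < c" for c d
  proof -
    have "integral {c..d} \<psi> = integral {c..d} (\<lambda>_. 0)" by (rule integral_cong) (use \<psi>(5) that in auto)
    then show ?thesis by simp
  qed
  have high: "\<phi> x = 0" if x: "b < x" for x
  proof (cases "x \<le> pi")
    case True
    have "integral {0..x} \<psi> + integral {x..pi} \<psi> = integral {0..pi} \<psi>"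
      by (rule Henstock_Kurzweil_Integration.integral_combine) (use True x \<psi>(2,3) ii in auto)
    then show ?thesis using int zero[OF x] by (simp add: \<phi>_def)
  next
    case False
    have "integral {0..pi} \<psi> + integral {pi..x} \<psi> = integral {0..x} \<psi>"
      by (rule Henstock_Kurzweil_Integration.integral_combine) (use False x \<psi>(2,3) ii in auto)
    then show ?thesis using int zero[OF \<psi>(4)] by (simp add: \<phi>_def)
  qed
  have D: "(\<phi> has_real_derivative \<psi> x) (at x)" for x
  proof (cases "x < a")
    case True
    have "((\<lambda>_. 0) has_real_derivative 0) (at x)" by simp
    then have "(\<phi> has_real_derivative 0) (at x)"
      by (rule has_field_derivative_transform_within_open[where S = "{..<a}"]) (use True low in auto)
    then show ?thesis using \<psi>(5)[of x] True by simp
  next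
    case False
    then have x: "0 < x" using \<psi>(2) by simp
    have "(\<phi> has_vector_derivative \<psi> x) (at x within {0..x + 1})"
      unfolding \<phi>_def by (rule integral_has_vector_derivative) (use x continuous_on_subset[OF \<psi>(1)] in auto)
    then show ?thesis using x by (simp add: has_real_derivative_iff_has_vector_derivative at_within_Icc_at)
  qed
  then have der: "deriv \<phi> = \<psi>" by (auto intro!: DERIV_imp_deriv)
  have "test_fun \<phi>"
    unfolding test_fun_def der
  proof (intro conjI allI)
    show "\<phi> differentiable at x" for x using D real_differentiable_def by blast
    have "\<forall>x. x \<notin> {a..b} \<longrightarrow> \<phi> x = 0" using low high by force
    then show "\<exists>a b. 0 < a \<and> b < pi \<and> (\<forall>x. x \<notin> {a..b} \<longrightarrow> \<phi> x = 0)" using \<psi>(2,4) by blast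
  qed (use \<psi> in auto)
  then show ?thesis using der by blast
qed

text \<open>Du Bois-Reymond: subtracting from a test function \<psi> its mean times a fixed \<rho>
  of mean 1 leaves the derivative of a test function. Hence f pairs with \<psi> like the constant
  that is the integral of f \<rho>.\<close>

lemma weak_deriv_zero_const:
  assumes f: "f \<in> L2" and z: "\<And>\<phi>. test_fun \<phi> \<Longrightarrow> (LINT x|dom_measure. f x * deriv \<phi> x) = 0"
  shows "\<exists>c. AE x in dom_measure. f x = c"
proof -
  \<comment> \<open>Any bump supported in (0, pi) would do; [1, 2] fits because pi > 3.\<close>
  define \<rho>0 where "\<rho>0 = bump 1 1 2"
  have t0: "test_fun \<rho>0" unfolding \<rho>0_def by (rule test_fun_bump) (use pi_gt3 in auto)
  define I where "I = integral {0..pi} \<rho>0"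
  have I: "I > 0"
  proof -
    have nn: "\<rho>0 x \<ge> 0" for x using bump_bounds[of 1 1 2 x] by (simp add: \<rho>0_def)
    have "I \<ge> 0" unfolding I_def
      by (rule integral_nonneg) (use nn test_fun_continuous(1)[OF t0] in \<open>auto intro!: integrable_continuous_interval\<close>)
    moreover have "I \<noteq> 0"
    proof
      assume "I = 0"
      then have "\<forall>x\<in>{0..pi}. \<rho>0 x = 0"
        unfolding I_def using integral_eq_0_iff[OF test_fun_continuous(1)[OF t0], of 0 pi] nn by simp
      moreover have "\<rho>0 (3/2) > 0" by (simp add: \<rho>0_def bump_def power4_eq_xxxx)
      ultimately show False using pi_gt3 by force
    qed
    ultimately show ?thesis by simp
  qed
  define \<rho> where "\<rho> x = \<rho>0 x / I" for x
  have c\<rho>: "continuous_on S \<rho>" for S unfolding \<rho>_def using I by (intro continuous_intros test_fun_continuous(1)[OF t0]) auto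
  have \<rho>1: "integral {0..pi} \<rho> = 1" unfolding \<rho>_def using I by (simp add: I_def)
  have \<rho>L: "\<rho> \<in> L2" by (rule continuous_L2[OF c\<rho>])
  define c where "c = (LINT x|dom_measure. f x * \<rho> x)"
  have fc: "(\<lambda>x. f x + (-1) * c) \<in> L2" by (intro L2_add f continuous_L2 continuous_intros)
  have "AE x in dom_measure. f x + (-1) * c = 0"
  proof (rule fundamental_lemma[OF fc])
    fix \<psi> assume t: "test_fun \<psi>"
    define m where "m = integral {0..pi} \<psi>"
    obtain a b where ab: "0 < a" "b < pi" "\<And>x. x \<notin> {a..b} \<Longrightarrow> \<psi> x = 0" using t unfolding test_fun_def by blast
    have cc: "continuous_on S (\<lambda>x. \<psi> x - m * \<rho> x)" for S by (intro continuous_intros test_fun_continuous(1)[OF t] c\<rho>)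
    have "\<exists>\<phi>. test_fun \<phi> \<and> deriv \<phi> = (\<lambda>x. \<psi> x - m * \<rho> x)"
    proof (rule test_fun_primitive[OF cc, of "min a 1" "max b 2"])
      show "\<psi> x - m * \<rho> x = 0" if "x \<notin> {min a 1..max b 2}" for x
      proof -
        have "x \<notin> {a..b}" "x \<notin> {1..2}" using that by auto
        then show ?thesis using ab(3)[of x] bump_zero[of x 1 2 1] by (simp add: \<rho>_def \<rho>0_def)
      qed
      have "integral {0..pi} (\<lambda>x. \<psi> x - m * \<rho> x) = integral {0..pi} \<psi> - integral {0..pi} (\<lambda>x. m * \<rho> x)"
        by (intro integral_diff integrable_continuous_interval continuous_intros test_fun_continuous(1)[OF t] c\<rho>)
      then show "integral {0..pi} (\<lambda>x. \<psi> x - m * \<rho> x) = 0" by (simp add: m_def \<rho>1)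
    qed (use ab pi_gt3 in auto)
    then obtain \<phi> where \<phi>: "test_fun \<phi>" "deriv \<phi> = (\<lambda>x. \<psi> x - m * \<rho> x)" by blast
    have \<psi>L: "\<psi> \<in> L2" by (rule test_fun_L2(1)[OF t])
    have "0 = (LINT x|dom_measure. f x * \<psi> x - m * (f x * \<rho> x))"
      using z[OF \<phi>(1)] by (simp add: \<phi>(2) algebra_simps)
    also have "\<dots> = (LINT x|dom_measure. f x * \<psi> x) - m * c"
      by (subst Bochner_Integration.integral_diff) (auto simp: c_def intro: L2_mult_integrable f \<rho>L \<psi>L)
    also have "m * c = (LINT x|dom_measure. c * \<psi> x)"
      by (simp add: m_def dom_integral(2)[OF test_fun_continuous(1)[OF t]])
    finally have e: "(LINT x|dom_measure. f x * \<psi> x) = (LINT x|dom_measure. c * \<psi> x)" by simp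
    have "(LINT x|dom_measure. (f x + (-1) * c) * \<psi> x) = (LINT x|dom_measure. f x * \<psi> x - c * \<psi> x)" by (simp add: algebra_simps)
    also have "\<dots> = (LINT x|dom_measure. f x * \<psi> x) - (LINT x|dom_measure. c * \<psi> x)"
      by (intro Bochner_Integration.integral_diff L2_mult_integrable[OF f \<psi>L] integrable_mult_right L2_integrable[OF \<psi>L])
    finally show "(LINT x|dom_measure. (f x + (-1) * c) * \<psi> x) = 0" using e by simp
  qed
  then have "AE x in dom_measure. f x = c" by eventually_elim simp
  then show ?thesis by blast
qed

lemma AE_dom_continuous_eq:
  fixes f g :: "real \<Rightarrow> real"
  assumes "AE x in dom_measure. f x = g x" "continuous_on {0..pi} f" "continuous_on {0..pi} g" and x: "x \<in> {0..pi}"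
  shows "f x = g x"
proof -
  have op: "f y = g y" if y: "y \<in> {0<..<pi}" for y
  proof (rule ccontr)
    assume ne: "f y \<noteq> g y"
    have c: "continuous_on {0<..<pi} (\<lambda>x. f x - g x)"
      by (intro continuous_intros continuous_on_subset[OF assms(2)] continuous_on_subset[OF assms(3)]) auto
    have "open ({0<..<pi} \<inter> (\<lambda>x. f x - g x) -` (- {0}))" by (rule continuous_open_preimage[OF c]) auto
    moreover have "y \<in> {0<..<pi} \<inter> (\<lambda>x. f x - g x) -` (- {0})" using y ne by simp
    ultimately obtain e where e: "e > 0" "ball y e \<subseteq> {0<..<pi} \<inter> (\<lambda>x. f x - g x) -` (- {0})" by (rule openE)
    have "AE x in lborel. x \<in> {0<..<pi} \<longrightarrow> f x = g x" using assms(1) by (subst (asm) AE_restrict_space_iff) auto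
    then have "AE z in lborel. z \<notin> ball y e" by eventually_elim (use e(2) in auto)
    then have "emeasure lborel (ball y e) = 0" by (subst (asm) AE_iff_measurable[OF _ refl]) (auto simp: ball_def)
    then show False using e(1) by (simp add: ball_eq_greaterThanLessThan)
  qed
  have "closure {0<..<pi} \<subseteq> {x \<in> {0..pi}. f x = g x}"
  proof (rule closure_minimal)
    show "{0<..<pi} \<subseteq> {x \<in> {0..pi}. f x = g x}" using op by auto
    have "closed ({0..pi} \<inter> (\<lambda>x. f x - g x) -` {0})"
      by (rule continuous_closed_preimage) (auto intro!: continuous_intros assms)
    then show "closed {x \<in> {0..pi}. f x = g x}" by (rule back_subst) auto
  qed
  then show ?thesis using x by auto
qed

lemma fun_of_props: "fun_of u \<in> H2" "continuous_on S (fun_of u)" "x \<notin> {0<..<pi} \<Longrightarrow> fun_of u x = 0"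
  using fun_of[of u] by (auto intro: continuous_on_subset)

text \<open>The lemma of du Bois-Reymond is used twice: first for u' + l u plus the integral of
  \<open>nl l u\<close>, which makes u' almost everywhere equal to a continuous q, then for the
  difference of u and a primitive of q. So u solves the equation classically, with slope p at
  0.\<close>

lemma bvp_regularity:
  assumes "(l, u) \<in> bvp_solutions"
  obtains p where "volterra_sol pi (nl l) l p (fun_of u)"
    "AE x in dom_measure. wderiv (fun_of u) x = vdot (nl l) l p (fun_of u) x"
    "AE x in dom_measure. wderiv (wderiv (fun_of u)) x = - l * vdot (nl l) l p (fun_of u) x - nl l (fun_of u x)"
proof -
  define U where "U = fun_of u"
  define v where "v = wderiv U"
  define w where "w = wderiv v"
  have UH: "U \<in> H2" and cU: "continuous_on S U" for S using fun_of_props by (auto simp: U_def)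
  note L = H2_L2[OF UH, folded v_def w_def]
  have U0: "U 0 = 0" "U pi = 0" using fun_of_props(3) by (auto simp: U_def)
  define h where "h x = nl l (U x)" for x
  have ch: "continuous_on S h" for S unfolding h_def by (intro continuous_on_compose2[OF continuous_nl cU]) auto
  have hL: "h \<in> L2" by (rule continuous_L2[OF ch])
  have "AE x in dom_measure. bvp_op l u x = 0" using assms by (simp add: bvp_solutions_def)
  then have weq: "AE x in dom_measure. w x = - l * v x - h x"
    by eventually_elim (simp add: bvp_op_def U_def v_def w_def h_def nl_def algebra_simps power2_eq_square power4_eq_xxxx)
  define H where "H x = integral {0..x} h" for x
  have dH: "(H has_real_derivative h x) (at x within {0..pi})" if "x \<in> {0..pi}" for x
    unfolding H_def has_real_derivative_iff_has_vector_derivative by (rule integral_has_vector_derivative[OF ch that])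
  have cH: "continuous_on {0..pi} H" by (rule DERIV_continuous_on[OF dH])
  have HL: "H \<in> L2" by (rule continuous_L2[OF cH])
  have wH: "has_weak_deriv H h" by (rule classical_weak_deriv[OF dH ch])
  \<comment> \<open>The weak derivative of F is the left side of the equation; the constant F turns
    out to be is the slope at 0.\<close>
  define F where "F x = v x + (l * U x + H x)" for x
  have FL: "F \<in> L2" unfolding F_def by (intro L2_add L2_scale L HL)
  have wF: "has_weak_deriv F (\<lambda>x. w x + (l * v x + h x))"
    unfolding F_def by (intro has_weak_deriv_add has_weak_deriv_scale L2_add L2_scale L HL hL wH)
  have "\<exists>p. AE x in dom_measure. F x = p"
  proof (rule weak_deriv_zero_const[OF FL])
    fix \<phi> assume t: "test_fun \<phi>"
    have "(LINT x|dom_measure. (w x + (l * v x + h x)) * \<phi> x) = (LINT x|dom_measure. 0)"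
    proof (rule integral_cong_AE)
      show "AE x in dom_measure. (w x + (l * v x + h x)) * \<phi> x = 0" using weq by eventually_elim simp
      have "(\<lambda>x. w x + (l * v x + h x)) \<in> L2" by (intro L2_add L2_scale L hL)
      then show "(\<lambda>x. (w x + (l * v x + h x)) * \<phi> x) \<in> borel_measurable dom_measure"
        using test_fun_L2(1)[OF t] by (auto simp: L2_def)
    qed simp
    then show "(LINT x|dom_measure. F x * deriv \<phi> x) = 0" using wF t by (simp add: has_weak_deriv_def)
  qed
  then obtain p where p: "AE x in dom_measure. F x = p" by blast
  define q where "q x = p - l * U x - H x" for x
  have cq: "continuous_on {0..pi} q" unfolding q_def by (intro continuous_intros cU cH)
  have vq: "AE x in dom_measure. v x = q x" using p by eventually_elim (simp add: F_def q_def)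
  \<comment> \<open>Q vanishes at 0 like u, so the constant in u = Q + c is zero.\<close>
  define Q where "Q x = integral {0..x} q" for x
  have dQ: "(Q has_real_derivative q x) (at x within {0..pi})" if "x \<in> {0..pi}" for x
    unfolding Q_def has_real_derivative_iff_has_vector_derivative by (rule integral_has_vector_derivative[OF cq that])
  have cQ: "continuous_on {0..pi} Q" by (rule DERIV_continuous_on[OF dQ])
  have QL: "Q \<in> L2" "q \<in> L2" by (rule continuous_L2[OF cQ], rule continuous_L2[OF cq])
  have wQ: "has_weak_deriv Q q" by (rule classical_weak_deriv[OF dQ cq])
  have "\<exists>c. AE x in dom_measure. U x + (-1) * Q x = c"
  proof (rule weak_deriv_zero_const)
    show "(\<lambda>x. U x + (-1) * Q x) \<in> L2" by (intro L2_add L2_scale L QL)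
    fix \<phi> assume t: "test_fun \<phi>"
    have "has_weak_deriv (\<lambda>x. U x + (-1) * Q x) (\<lambda>x. v x + (-1) * q x)"
      by (intro has_weak_deriv_add has_weak_deriv_scale L2_scale L QL wQ)
    moreover have "(LINT x|dom_measure. (v x + (-1) * q x) * \<phi> x) = (LINT x|dom_measure. 0)"
    proof (rule integral_cong_AE)
      show "AE x in dom_measure. (v x + (-1) * q x) * \<phi> x = 0" using vq by eventually_elim simp
      have "(\<lambda>x. v x + (-1) * q x) \<in> L2" by (intro L2_add L2_scale L QL)
      then show "(\<lambda>x. (v x + (-1) * q x) * \<phi> x) \<in> borel_measurable dom_measure"
        using test_fun_L2(1)[OF t] by (auto simp: L2_def)
    qed simp
    ultimately show "(LINT x|dom_measure. (U x + (-1) * Q x) * deriv \<phi> x) = 0" using t by (simp add: has_weak_deriv_def)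
  qed
  then obtain c where "AE x in dom_measure. U x + (-1) * Q x = c" by blast
  then have "AE x in dom_measure. U x = Q x + c" by eventually_elim simp
  then have UQc: "U x = Q x + c" if "x \<in> {0..pi}" for x
    by (rule AE_dom_continuous_eq) (use that cU cQ in \<open>auto intro!: continuous_intros\<close>)
  have "c = 0" using UQc[of 0] U0 by (simp add: Q_def)
  then have UQ: "U x = Q x" if "x \<in> {0..pi}" for x using UQc[OF that] by simp
  have dU: "(U has_real_derivative q x) (at x within {0..pi})" if x: "x \<in> {0..pi}" for x
    by (rule has_field_derivative_transform_within[OF dQ[OF x], where d = 1]) (use x UQ in auto)
  have dq: "(q has_real_derivative - l * q x - nl l (U x)) (at x within {0..pi})" if x: "x \<in> {0..pi}" for x
  proof -
    have "(q has_real_derivative 0 - l * q x - h x) (at x within {0..pi})"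
      unfolding q_def[abs_def] by (intro DERIV_diff DERIV_const DERIV_cmult dH[OF x] dU[OF x, unfolded q_def])
    then show ?thesis by (simp add: h_def)
  qed
  have q0: "q 0 = p" by (simp add: q_def U0 H_def)
  have vs: "volterra_sol pi (nl l) l p U" and qv: "\<And>x. x \<in> {0..pi} \<Longrightarrow> q x = vdot (nl l) l p U x"
    using ode_volterra[OF pi_ge_zero continuous_nl dU dq U0(1)] q0 by auto
  have sp: "AE x in dom_measure. x \<in> {0<..<pi}" by (rule AE_I2) simp
  show ?thesis
  proof (rule that[of p])
    show "volterra_sol pi (nl l) l p (fun_of u)" using vs by (simp add: U_def)
    show "AE x in dom_measure. wderiv (fun_of u) x = vdot (nl l) l p (fun_of u) x"
      using vq sp by eventually_elim (use qv in \<open>simp add: U_def v_def\<close>)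
    show "AE x in dom_measure. wderiv (wderiv (fun_of u)) x = - l * vdot (nl l) l p (fun_of u) x - nl l (fun_of u x)"
      using weq vq sp by eventually_elim (use qv in \<open>simp add: U_def v_def w_def h_def\<close>)
  qed
qed

text \<open>By partial integration this is \<open>u'(0)\<close>. The integral makes it visibly a bounded linear functional.\<close>

definition init_slope :: "sobU \<Rightarrow> real" where
  "init_slope u = - (LINT x|dom_measure. (pi - x) * wderiv (wderiv (fun_of u)) x) / pi"

lemma wderiv2_L2: "wderiv (wderiv (fun_of u)) \<in> L2" "wderiv (fun_of u) \<in> L2" "fun_of u \<in> L2"
  using H2_L2[OF fun_of_props(1)] by auto

lemma linear_weight_L2: "(\<lambda>x. pi - x) \<in> L2" by (rule continuous_L2) (intro continuous_intros)

lemma linear_weight_measurable: "f \<in> L2 \<Longrightarrow> (\<lambda>x. (pi - x) * f x) \<in> borel_measurable dom_measure"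
  by (rule borel_measurable_integrable[OF L2_mult_integrable[OF linear_weight_L2]])

lemma init_slope_add: "init_slope (u + v) = init_slope u + init_slope v"
proof -
  have "AE x in dom_measure. wderiv (wderiv (fun_of (u + v))) x = wderiv (wderiv (fun_of u)) x + wderiv (wderiv (fun_of v)) x"
    using H2_add(3)[OF fun_of_props(1) fun_of_props(1)] by (simp add: plus_sobU.rep_eq)
  then have "(LINT x|dom_measure. (pi - x) * wderiv (wderiv (fun_of (u + v))) x)
     = (LINT x|dom_measure. (pi - x) * wderiv (wderiv (fun_of u)) x + (pi - x) * wderiv (wderiv (fun_of v)) x)"
    by (intro integral_cong_AE borel_measurable_add linear_weight_measurable wderiv2_L2)
      (erule eventually_mono, simp add: distrib_left)
  also have "\<dots> = (LINT x|dom_measure. (pi - x) * wderiv (wderiv (fun_of u)) x) + (LINT x|dom_measure. (pi - x) * wderiv (wderiv (fun_of v)) x)"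
    by (intro Bochner_Integration.integral_add L2_mult_integrable linear_weight_L2 wderiv2_L2)
  finally show ?thesis by (simp add: init_slope_def field_simps)
qed

lemma init_slope_scale: "init_slope (c *\<^sub>R u) = c * init_slope u"
proof -
  have "AE x in dom_measure. wderiv (wderiv (fun_of (c *\<^sub>R u))) x = c * wderiv (wderiv (fun_of u)) x"
    using H2_scale(3)[OF fun_of_props(1)] by (simp add: scaleR_sobU.rep_eq)
  then have "(LINT x|dom_measure. (pi - x) * wderiv (wderiv (fun_of (c *\<^sub>R u))) x)
     = (LINT x|dom_measure. c * ((pi - x) * wderiv (wderiv (fun_of u)) x))"
    by (intro integral_cong_AE linear_weight_measurable wderiv2_L2
        borel_measurable_times[OF borel_measurable_const linear_weight_measurable])
      (erule eventually_mono, simp)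
  then show ?thesis by (simp add: init_slope_def)
qed

lemma norm_sobU_sq: "(norm u)\<^sup>2 = (LINT x|dom_measure. (fun_of u x)\<^sup>2) + (LINT x|dom_measure. (wderiv (fun_of u) x)\<^sup>2)
    + (LINT x|dom_measure. (wderiv (wderiv (fun_of u)) x)\<^sup>2)"
  unfolding power2_norm_eq_inner inner_sobU_def by (simp add: power2_eq_square)

lemma bounded_linear_init_slope: "bounded_linear init_slope"
proof -
  define A where "A = (LINT x|dom_measure. (pi - x)\<^sup>2) / pi"
  have A: "A \<ge> 0" by (simp add: A_def)
  \<comment> \<open>The inequality 2 a b \<le> a^2 + b^2 gives a bound that is quadratic in the
    norm; applied to unit vectors it becomes the linear one by homogeneity.\<close>
  have quad: "\<bar>init_slope u\<bar> \<le> A + (norm u)\<^sup>2" for u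
  proof -
    let ?w = "wderiv (wderiv (fun_of u))"
    have iw: "integrable dom_measure (\<lambda>x. (?w x)\<^sup>2)" and il: "integrable dom_measure (\<lambda>x. (pi - x)\<^sup>2)"
      using wderiv2_L2 linear_weight_L2 by (auto simp: L2_def)
    have "\<bar>LINT x|dom_measure. (pi - x) * ?w x\<bar> \<le> (LINT x|dom_measure. (pi - x)\<^sup>2 + (?w x)\<^sup>2)"
    proof -
      have "\<bar>LINT x|dom_measure. (pi - x) * ?w x\<bar> \<le> (LINT x|dom_measure. \<bar>(pi - x) * ?w x\<bar>)"
        using integral_abs_bound by blast
      also have "\<dots> \<le> (LINT x|dom_measure. (pi - x)\<^sup>2 + (?w x)\<^sup>2)"
      proof (rule integral_mono)
        show "integrable dom_measure (\<lambda>x. \<bar>(pi - x) * ?w x\<bar>)"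
          by (intro integrable_abs L2_mult_integrable linear_weight_L2 wderiv2_L2)
        show "integrable dom_measure (\<lambda>x. (pi - x)\<^sup>2 + (?w x)\<^sup>2)" by (intro Bochner_Integration.integrable_add iw il)
        fix x
        have "0 \<le> (\<bar>pi - x\<bar> - \<bar>?w x\<bar>)\<^sup>2" by simp
        then have "2 * (\<bar>pi - x\<bar> * \<bar>?w x\<bar>) \<le> (pi - x)\<^sup>2 + (?w x)\<^sup>2" by (simp add: power2_diff mult.assoc)
        moreover have "0 \<le> \<bar>pi - x\<bar> * \<bar>?w x\<bar>" by simp
        ultimately show "\<bar>(pi - x) * ?w x\<bar> \<le> (pi - x)\<^sup>2 + (?w x)\<^sup>2" unfolding abs_mult by linarith
      qed
      finally show ?thesis .
    qed
    also have "\<dots> = (LINT x|dom_measure. (pi - x)\<^sup>2) + (LINT x|dom_measure. (?w x)\<^sup>2)" by (rule Bochner_Integration.integral_add[OF il iw])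
    also have "(LINT x|dom_measure. (?w x)\<^sup>2) \<le> (norm u)\<^sup>2" unfolding norm_sobU_sq by simp
    finally have "\<bar>LINT x|dom_measure. (pi - x) * ?w x\<bar> / pi \<le> ((LINT x|dom_measure. (pi - x)\<^sup>2) + (norm u)\<^sup>2) / pi"
      by (intro divide_right_mono) auto
    also have "\<dots> \<le> A + (norm u)\<^sup>2"
    proof -
      have "(norm u)\<^sup>2 / pi \<le> (norm u)\<^sup>2 / 1" using pi_gt3 by (intro divide_left_mono) auto
      then show ?thesis by (simp add: A_def add_divide_distrib)
    qed
    finally show ?thesis by (simp add: init_slope_def)
  qed
  show ?thesis
  proof (rule bounded_linear_intro[where K = "A + 1"])
    show "init_slope (u + v) = init_slope u + init_slope v" for u v by (rule init_slope_add)
    show "init_slope (c *\<^sub>R u) = c *\<^sub>R init_slope u" for c u by (simp add: init_slope_scale)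
    fix u :: sobU
    show "norm (init_slope u) \<le> norm u * (A + 1)"
    proof (cases "u = 0")
      case True
      then show ?thesis using init_slope_scale[of 0 0] by simp
    next
      case False
      then have n: "norm u > 0" by simp
      have "\<bar>init_slope ((1 / norm u) *\<^sub>R u)\<bar> \<le> A + (norm ((1 / norm u) *\<^sub>R u))\<^sup>2" by (rule quad)
      also have "norm ((1 / norm u) *\<^sub>R u) = 1" using n by simp
      finally have "\<bar>init_slope u\<bar> / norm u \<le> A + 1" using n by (simp add: init_slope_scale abs_mult)
      then show ?thesis using n by (simp add: field_simps)
    qed
  qed
qed

text \<open>The function (pi - x) u' + u is an antiderivative of (pi - x) u''. It equals pi * p at 0
  and vanishes at pi.\<close>

lemma init_slope_eq:
  assumes vs: "volterra_sol pi (nl l) l p (fun_of u)"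
    and w: "AE x in dom_measure. wderiv (wderiv (fun_of u)) x = - l * vdot (nl l) l p (fun_of u) x - nl l (fun_of u x)"
  shows "init_slope u = p"
proof -
  let ?U = "fun_of u" and ?v = "vdot (nl l) l p (fun_of u)"
  note ode = volterra_ode[OF vs continuous_nl]
  have cv: "continuous_on {0..pi} ?v" by (rule DERIV_continuous_on[OF ode(2)])
  have cg: "continuous_on {0..pi} (\<lambda>x. (pi - x) * (- l * ?v x - nl l (?U x)))"
    by (intro continuous_intros cv continuous_on_compose2[OF continuous_nl fun_of_props(2)]) auto
  have "(LINT x|dom_measure. (pi - x) * wderiv (wderiv ?U) x) = (LINT x|dom_measure. (pi - x) * (- l * ?v x - nl l (?U x)))"
  proof (rule integral_cong_AE)
    show "AE x in dom_measure. (pi - x) * wderiv (wderiv ?U) x = (pi - x) * (- l * ?v x - nl l (?U x))" using w by eventually_elim simp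
    show "(\<lambda>x. (pi - x) * wderiv (wderiv ?U) x) \<in> borel_measurable dom_measure" by (intro linear_weight_measurable wderiv2_L2)
    show "(\<lambda>x. (pi - x) * (- l * ?v x - nl l (?U x))) \<in> borel_measurable dom_measure" using continuous_L2[OF cg] by (simp add: L2_def)
  qed
  also have "\<dots> = integral {0..pi} (\<lambda>x. (pi - x) * (- l * ?v x - nl l (?U x)))" by (rule dom_integral(2)[OF cg])
  also have "\<dots> = ((pi - pi) * ?v pi + ?U pi) - ((pi - 0) * ?v 0 + ?U 0)"
  proof (rule integral_unique, rule fundamental_theorem_of_calculus)
    fix x assume x: "x \<in> {0..pi}"
    have d: "((\<lambda>x. pi - x) has_real_derivative - 1) (at x within {0..pi})" by (auto intro!: derivative_eq_intros)
    show "((\<lambda>x. (pi - x) * ?v x + ?U x) has_vector_derivative (pi - x) * (- l * ?v x - nl l (?U x))) (at x within {0..pi})"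
      unfolding has_real_derivative_iff_has_vector_derivative[symmetric]
      by (rule DERIV_cong[OF DERIV_add[OF DERIV_mult[OF d ode(2)[OF x]] ode(1)[OF x]]]) (simp add: algebra_simps)
  qed simp
  also have "\<dots> = - pi * p" using ode(3)[of 0] ode(4)[of 0] fun_of_props(3)[of pi u] by simp
  finally show ?thesis by (simp add: init_slope_def)
qed

section \<open>Positive solutions correspond to zeros of the shooting function\<close>

lemma positive_solution_shoot:
  assumes "(l, u) \<in> positive_solutions"
  shows "init_slope u > 0" "shoot l (init_slope u) = 0" "\<And>x. x \<in> {0..pi} \<Longrightarrow> fun_of u x = flow l (init_slope u) x"
proof -
  have bs: "(l, u) \<in> bvp_solutions" and sp: "strongly_positive (fun_of u)" using assms by (auto simp: positive_solutions_def)
  obtain p where p: "volterra_sol pi (nl l) l p (fun_of u)"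
    "AE x in dom_measure. wderiv (wderiv (fun_of u)) x = - l * vdot (nl l) l p (fun_of u) x - nl l (fun_of u x)"
    by (rule bvp_regularity[OF bs]) (rule that)
  have pe: "init_slope u = p" by (rule init_slope_eq[OF p])
  note ode = volterra_ode[OF p(1) continuous_nl]
  have pos: "fun_of u x > 0" if "x \<in> {0<..<pi}" for x using sp that by (auto simp: strongly_positive_def)
  have upi: "fun_of u pi = 0" by (rule fun_of_props(3)) simp
  obtain d0 d1 where d0: "d0 > 0" "(fun_of u has_real_derivative d0) (at 0 within {0..pi})"
    and d1: "d1 < 0" "(fun_of u has_real_derivative d1) (at pi within {0..pi})"
    using sp unfolding strongly_positive_def by blast
  have nt: "at 0 within {0..pi} \<noteq> bot" "at pi within {0..pi} \<noteq> bot" using pi_gt_zero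
    by (auto simp: trivial_limit_within islimpt_Icc)
  have "d0 = p" using has_field_derivative_unique[OF d0(2) ode(1)[of 0]] nt(1) ode(4)[of 0] by simp
  then have p0: "p > 0" using d0 by simp
  have "d1 = vdot (nl l) l p (fun_of u) pi" using has_field_derivative_unique[OF d1(2) ode(1)[of pi]] nt(2) by simp
  then have vpi: "vdot (nl l) l p (fun_of u) pi \<le> 0" using d1 by simp
  \<comment> \<open>The Wronskian argument is repeated for the polynomial equation, since the
    truncation may be introduced only after the bound u \<le> 3, which itself rests on l <
    4.\<close>
  have l4: "l < 4"
  proof (rule ccontr)
    assume "\<not> l < 4"
    then have "l\<^sup>2 / 4 * fun_of u x + fun_of u x - nl l (fun_of u x) > 0" if "x \<in> {0<..<pi}" for x
      using nonlinearity_sub_pos[OF pos[OF that], of l] by (simp add: nl_def)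
    then show False
      using volterra_no_early_zero[OF p(1) continuous_nl pi_gt_zero order_refl order_refl pos upi vpi] by blast
  qed
  have neg: "nl l y < 0" if y: "y > 3" for y
  proof -
    have "y * y > 3 * 3" using y by (intro mult_strict_mono) auto
    then have "y * (y * y) > y * 9" using y by (intro mult_strict_left_mono) auto
    moreover have "l * y \<le> 4 * y" using l4 y by (intro mult_right_mono) auto
    ultimately have "1 + l * y - y * (y * y) < 0" using y by linarith
    then have "y * (1 + l * y - y * (y * y)) < 0" using y by (intro mult_pos_neg) auto
    then show ?thesis by (simp add: nl_def power2_eq_square power4_eq_xxxx algebra_simps)
  qed
  obtain m where m: "\<And>x. x \<in> {0..pi} \<Longrightarrow> fun_of u x \<le> fun_of u m" "fun_of u m \<le> 3"
  proof (rule volterra_max_le[OF p(1) continuous_nl pi_gt_zero order_refl _ upi, where R = 3])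
    show "fun_of u x > 0" if "x \<in> {0<..<pi}" for x by (rule pos[OF that])
    show "nl l y < 0" if "y > 3" for y by (rule neg[OF that])
  qed (rule that)
  have "0 \<le> fun_of u x \<and> fun_of u x \<le> 3" if x: "x \<in> {0..pi}" for x
    using m(1)[OF x] m(2) pos[of x] upi fun_of_props(3)[of 0 u] x by (cases "x = 0"; cases "x = pi") auto
  then have fl: "fun_of u x = flow l p x" if "x \<in> {0..pi}" for x using nl_sol_flow[OF p(1) _ that] by blast
  show "init_slope u > 0" using p0 pe by simp
  show "shoot l (init_slope u) = 0" unfolding shoot_def pe using fl[of pi] upi by simp
  show "fun_of u x = flow l (init_slope u) x" if "x \<in> {0..pi}" for x using fl[OF that] pe by simp
qed

lemma sobU_classical_wderiv:
  assumes du: "\<And>x. x \<in> {0..pi} \<Longrightarrow> (fun_of u has_real_derivative v x) (at x within {0..pi})"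
    and dv: "\<And>x. x \<in> {0..pi} \<Longrightarrow> (v has_real_derivative w x) (at x within {0..pi})"
    and cw: "continuous_on {0..pi} w"
  shows "AE x in dom_measure. wderiv (fun_of u) x = v x" "AE x in dom_measure. wderiv (wderiv (fun_of u)) x = w x"
proof -
  have cv: "continuous_on {0..pi} v" by (rule DERIV_continuous_on[OF dv])
  note * = H2_wderivI[OF wderiv2_L2(3) continuous_L2[OF cv] continuous_L2[OF cw]
      classical_weak_deriv[OF du cv] classical_weak_deriv[OF dv cw]]
  show "AE x in dom_measure. wderiv (fun_of u) x = v x" by (rule *(2)) auto
  show "AE x in dom_measure. wderiv (wderiv (fun_of u)) x = w x" by (rule *(3)) auto
qed

text \<open>Each of the three square integrals is at most pi B^2, and 3 pi < 16.\<close>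

lemma norm_sobU_classical_le:
  assumes du: "\<And>x. x \<in> {0..pi} \<Longrightarrow> (fun_of u has_real_derivative v x) (at x within {0..pi})"
    and dv: "\<And>x. x \<in> {0..pi} \<Longrightarrow> (v has_real_derivative w x) (at x within {0..pi})"
    and cw: "continuous_on {0..pi} w"
    and B: "\<And>x. x \<in> {0..pi} \<Longrightarrow> \<bar>fun_of u x\<bar> \<le> B" "\<And>x. x \<in> {0..pi} \<Longrightarrow> \<bar>v x\<bar> \<le> B" "\<And>x. x \<in> {0..pi} \<Longrightarrow> \<bar>w x\<bar> \<le> B"
  shows "norm u \<le> 4 * B"
proof -
  interpret finite_measure dom_measure by (rule finite_measure_dom)
  have B0: "B \<ge> 0" using B(1)[of 0] by auto
  have sp: "AE x in dom_measure. x \<in> {0<..<pi}" by (rule AE_I2) simp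
  have m: "measure dom_measure {0<..<pi} = pi"
    by (simp add: measure_restrict_space)
  have bound: "(LINT x|dom_measure. (f x)\<^sup>2) \<le> pi * B\<^sup>2" if f: "f \<in> L2" and fg: "AE x in dom_measure. \<bar>f x\<bar> \<le> B" for f
  proof -
    have "(LINT x|dom_measure. (f x)\<^sup>2) \<le> (LINT x|dom_measure. B\<^sup>2)"
    proof (rule integral_mono_AE)
      show "integrable dom_measure (\<lambda>x. (f x)\<^sup>2)" using f by (simp add: L2_def)
      show "AE x in dom_measure. (f x)\<^sup>2 \<le> B\<^sup>2" using fg
        by eventually_elim (metis B0 abs_le_square_iff abs_of_nonneg)
    qed simp
    also have "\<dots> = pi * B\<^sup>2" using m by simp
    finally show ?thesis .
  qed
  have ae: "AE x in dom_measure. wderiv (fun_of u) x = v x" "AE x in dom_measure. wderiv (wderiv (fun_of u)) x = w x"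
    by (rule sobU_classical_wderiv[OF du dv cw]; assumption)+
  have "(LINT x|dom_measure. (fun_of u x)\<^sup>2) \<le> pi * B\<^sup>2"
    by (rule bound[OF wderiv2_L2(3)], use sp in eventually_elim) (use B(1) in auto)
  moreover have "AE x in dom_measure. \<bar>wderiv (fun_of u) x\<bar> \<le> B"
    using ae(1) sp by eventually_elim (use B(2) in auto)
  then have "(LINT x|dom_measure. (wderiv (fun_of u) x)\<^sup>2) \<le> pi * B\<^sup>2" by (rule bound[OF wderiv2_L2(2)])
  moreover have "AE x in dom_measure. \<bar>wderiv (wderiv (fun_of u)) x\<bar> \<le> B"
    using ae(2) sp by eventually_elim (use B(3) in auto)
  then have "(LINT x|dom_measure. (wderiv (wderiv (fun_of u)) x)\<^sup>2) \<le> pi * B\<^sup>2" by (rule bound[OF wderiv2_L2(1)])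
  ultimately have "(norm u)\<^sup>2 \<le> 3 * (pi * B\<^sup>2)" unfolding norm_sobU_sq by linarith
  also have "\<dots> \<le> 3 * (4 * B\<^sup>2)" using pi_less_4 by (intro mult_left_mono mult_right_mono) auto
  also have "\<dots> \<le> (4 * B)\<^sup>2" by (simp add: power_mult_distrib)
  finally show ?thesis using B0 by (auto intro: power2_le_imp_le[of "norm u" "4 * B"])
qed

text \<open>Clamping the argument to [0, pi] continues the flow by its two end values; this is the
  extension by zero, and thus an element of the type, when \<open>shoot l p = 0\<close>.\<close>

definition sol :: "real \<Rightarrow> real \<Rightarrow> sobU" where
  "sol l p = Abs_sobU (\<lambda>x. flow l p (max 0 (min pi x)))"

lemma fun_of_sol:
  assumes s: "shoot l p = 0"
  shows "fun_of (sol l p) x = flow l p (max 0 (min pi x))"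
proof -
  let ?f = "\<lambda>x. flow l p (max 0 (min pi x))"
  have c: "continuous_on UNIV ?f"
    by (rule continuous_on_compose2[OF continuous_flow(1)]) (auto intro!: continuous_intros)
  have d: "(?f has_real_derivative dflow l p x) (at x within {0..pi})" if x: "x \<in> {0..pi}" for x
    by (rule has_field_derivative_transform_within[OF flow_deriv(1)[OF x], where d = 1]) (use x in auto)
  have cw: "continuous_on {0..pi} (\<lambda>x. - l * dflow l p x - trunc l (flow l p x))"
    by (intro continuous_intros continuous_flow continuous_on_compose2[OF continuous_trunc continuous_flow(1)]) auto
  have "?f \<in> H2"
    by (rule H2_wderivI(1)[OF continuous_L2 continuous_L2[OF continuous_flow(2)] continuous_L2[OF cw]
          classical_weak_deriv[OF d continuous_flow(2)] classical_weak_deriv[OF flow_deriv(2) cw]])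
      (auto intro: continuous_on_subset[OF c])
  moreover have "?f x = 0" if "x \<notin> {0<..<pi}" for x
    using that s by (cases "x \<le> 0") (auto simp: shoot_def min_def max_def)
  ultimately show ?thesis unfolding sol_def using c by (subst Abs_sobU_inverse) auto
qed

lemma fun_of_sol_deriv:
  assumes s: "shoot l p = 0" and x: "x \<in> {0..pi}"
  shows "(fun_of (sol l p) has_real_derivative dflow l p x) (at x within {0..pi})"
  by (rule has_field_derivative_transform_within[OF flow_deriv(1)[OF x], where d = 1]) (use x fun_of_sol[OF s] in auto)

lemma sol_positive_solution:
  assumes p: "p > 0" and s: "shoot l p = 0"
  shows "(l, sol l p) \<in> positive_solutions" "init_slope (sol l p) = p"
proof -
  have cw: "continuous_on {0..pi} (\<lambda>x. - l * dflow l p x - trunc l (flow l p x))"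
    by (intro continuous_intros continuous_flow continuous_on_compose2[OF continuous_trunc continuous_flow(1)]) auto
  have ae: "AE x in dom_measure. wderiv (fun_of (sol l p)) x = dflow l p x"
    "AE x in dom_measure. wderiv (wderiv (fun_of (sol l p))) x = - l * dflow l p x - trunc l (flow l p x)"
    by (rule sobU_classical_wderiv[OF fun_of_sol_deriv[OF s] flow_deriv(2) cw]; assumption)+
  have ft: "trunc l (flow l p x) = nl l (flow l p x)" if "x \<in> {0..pi}" for x
    using flow_bound[OF p s that] by (simp add: trunc_eq nl_def)
  have fe: "fun_of (sol l p) x = flow l p x" if "x \<in> {0..pi}" for x using that by (simp add: fun_of_sol[OF s])
  have sp: "AE x in dom_measure. x \<in> {0<..<pi}" by (rule AE_I2) simp
  have ae': "AE x in dom_measure. bvp_op l (sol l p) x = 0"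
    using ae sp
  proof eventually_elim
    case (elim x)
    then have x: "x \<in> {0..pi}" by auto
    show ?case unfolding bvp_op_def elim fe[OF x] ft[OF x] nl_def by (simp add: algebra_simps power2_eq_square power4_eq_xxxx)
  qed
  then have bs: "(l, sol l p) \<in> bvp_solutions" by (simp add: bvp_solutions_def)
  have "strongly_positive (fun_of (sol l p))"
    unfolding strongly_positive_def
  proof (intro conjI ballI)
    show "fun_of (sol l p) x > 0" if "x \<in> {0<..<pi}" for x
      using shoot_nonneg_pos[OF p _ that, of l] s fe[of x] that by auto
    show "\<exists>d>0. (fun_of (sol l p) has_real_derivative d) (at 0 within {0..pi})"
      using fun_of_sol_deriv[OF s, of 0] p by auto
    show "\<exists>d<0. (fun_of (sol l p) has_real_derivative d) (at pi within {0..pi})"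
      using fun_of_sol_deriv[OF s, of pi] shoot_zero_slope[OF p s] by auto
  qed
  then show "(l, sol l p) \<in> positive_solutions" using bs by (simp add: positive_solutions_def)
  obtain p' where p': "volterra_sol pi (nl l) l p' (fun_of (sol l p))"
    "AE x in dom_measure. wderiv (wderiv (fun_of (sol l p))) x = - l * vdot (nl l) l p' (fun_of (sol l p)) x - nl l (fun_of (sol l p) x)"
    by (rule bvp_regularity[OF bs]) (rule that)
  note ode = volterra_ode[OF p'(1) continuous_nl]
  have nt: "at 0 within {0..pi} \<noteq> bot" using pi_gt_zero
    by (auto simp: trivial_limit_within islimpt_Icc)
  have "p = p'" using has_field_derivative_unique[OF fun_of_sol_deriv[OF s, of 0] ode(1)[of 0]] nt ode(4)[of 0] by simp
  then show "init_slope (sol l p) = p" using init_slope_eq[OF p'] by simp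
qed

lemma positive_solution_eq_sol:
  assumes "(l, u) \<in> positive_solutions" shows "u = sol l (init_slope u)"
proof -
  note * = positive_solution_shoot[OF assms]
  have "fun_of u x = fun_of (sol l (init_slope u)) x" for x
  proof (cases "x \<in> {0..pi}")
    case True
    then show ?thesis using *(3)[OF True] by (simp add: fun_of_sol[OF *(2)])
  next
    case False
    then have "x \<notin> {0<..<pi}" by auto
    then show ?thesis using fun_of_props(3)[of x u] fun_of_props(3)[of x "sol l (init_slope u)"] by simp
  qed
  then show ?thesis by (simp add: fun_of_inject[symmetric] fun_eq_iff)
qed

lemma trunc_param_lipschitz: "\<bar>trunc l z - trunc l0 z\<bar> \<le> 9 * \<bar>l - l0\<bar>"
proof -
  define c where "c = max 0 (min 3 z)"
  have c: "0 \<le> c" "c \<le> 3" by (auto simp: c_def)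
  have "c\<^sup>2 \<le> 3\<^sup>2" by (rule power_mono) (use c in auto)
  moreover have "trunc l z - trunc l0 z = c\<^sup>2 * (l - l0)" unfolding trunc_def c_def[symmetric] Let_def by (simp add: algebra_simps)
  ultimately show ?thesis by (simp add: abs_mult mult_right_mono)
qed

text \<open>The topology of H^2 asks for closeness of u, u' and u''. The flow estimate yields the
  first, the once integrated equation the second, and the equation itself the third.\<close>

lemma sol_lipschitz:
  assumes s0: "shoot l0 p0 = 0"
  obtains K where "K \<ge> 0" "\<And>l p. \<bar>l - l0\<bar> \<le> 1 \<Longrightarrow> shoot l p = 0 \<Longrightarrow>
     norm (sol l p - sol l0 p0) \<le> K * (\<bar>l - l0\<bar> + \<bar>p - p0\<bar>)"
proof -
  obtain C where C: "C \<ge> 0"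
    "\<And>l p x. \<bar>l - l0\<bar> \<le> 1 \<Longrightarrow> x \<in> {0..pi} \<Longrightarrow> \<bar>flow l p x - flow l0 p0 x\<bar> \<le> C * (\<bar>l - l0\<bar> + \<bar>p - p0\<bar>)"
    by (rule flow_lipschitz[of l0 p0]) (rule that)
  have bnd: "\<exists>M\<ge>0. \<forall>x\<in>{0..pi}. \<bar>f x\<bar> \<le> M" if c: "continuous_on {0..pi} f" for f :: "real \<Rightarrow> real"
  proof -
    have "bounded (f ` {0..pi})" by (intro compact_imp_bounded compact_continuous_image c) auto
    then obtain M where "M > 0" "\<And>x. x \<in> f ` {0..pi} \<Longrightarrow> norm x \<le> M" unfolding bounded_pos by blast
    then show ?thesis by (intro exI[of _ M]) auto
  qed
  obtain M1 where M1: "M1 \<ge> 0" "\<And>x. x \<in> {0..pi} \<Longrightarrow> \<bar>flow l0 p0 x\<bar> \<le> M1" using bnd[OF continuous_flow(1)] by blast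
  obtain M2 where M2: "M2 \<ge> 0" "\<And>x. x \<in> {0..pi} \<Longrightarrow> \<bar>dflow l0 p0 x\<bar> \<le> M2" using bnd[OF continuous_flow(2)] by blast
  \<comment> \<open>K1, K2 and K3 are Lipschitz constants for the nonlinearity along the flow, for
    u' and for u''.\<close>
  define K1 where "K1 = (109 + 6 * (\<bar>l0\<bar> + 1)) * C + 9"
  define K2 where "K2 = 1 + ((\<bar>l0\<bar> + 1) * C + M1) + pi * K1"
  define K3 where "K3 = ((\<bar>l0\<bar> + 1) * K2 + M2) + K1"
  have K1: "K1 \<ge> 0" using C by (simp add: K1_def)
  have K2: "K2 \<ge> 0" using C K1 M1 by (simp add: K2_def)
  have K3: "K3 \<ge> 0" using K2 K1 M2 by (simp add: K3_def)
  define K where "K = C + K2 + K3"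
  have "norm (sol l p - sol l0 p0) \<le> 4 * K * (\<bar>l - l0\<bar> + \<bar>p - p0\<bar>)" if h: "\<bar>l - l0\<bar> \<le> 1" "shoot l p = 0" for l p
  proof -
    define s where "s = \<bar>l - l0\<bar> + \<bar>p - p0\<bar>"
    have s: "s \<ge> 0" "\<bar>l - l0\<bar> \<le> s" "\<bar>p - p0\<bar> \<le> s" by (auto simp: s_def)
    have la: "\<bar>l\<bar> \<le> \<bar>l0\<bar> + 1" using h(1) by linarith
    have fl: "\<bar>flow l p x - flow l0 p0 x\<bar> \<le> C * s" if "x \<in> {0..pi}" for x using C(2)[OF h(1) that] by (simp add: s_def)
    have prod: "\<bar>l * y - l0 * z\<bar> \<le> ((\<bar>l0\<bar> + 1) * A + M) * s" if "\<bar>y - z\<bar> \<le> A * s" "\<bar>z\<bar> \<le> M" for y z A M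
    proof -
      have "l * y - l0 * z = l * (y - z) + (l - l0) * z" by (simp add: algebra_simps)
      then have "\<bar>l * y - l0 * z\<bar> \<le> \<bar>l\<bar> * \<bar>y - z\<bar> + \<bar>l - l0\<bar> * \<bar>z\<bar>" by (metis abs_mult abs_triangle_ineq)
      also have "\<dots> \<le> (\<bar>l0\<bar> + 1) * (A * s) + s * M" using that la s by (intro add_mono mult_mono) auto
      finally show ?thesis by (simp add: algebra_simps)
    qed
    have tr: "\<bar>trunc l (flow l p x) - trunc l0 (flow l0 p0 x)\<bar> \<le> K1 * s" if x: "x \<in> {0..pi}" for x
    proof -
      have "\<bar>trunc l (flow l p x) - trunc l (flow l0 p0 x)\<bar> \<le> (109 + 6 * \<bar>l\<bar>) * \<bar>flow l p x - flow l0 p0 x\<bar>"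
        using trunc_lipschitz[of l "flow l p x" "flow l0 p0 x"] by simp
      also have "\<dots> \<le> (109 + 6 * (\<bar>l0\<bar> + 1)) * (C * s)" using la fl[OF x] by (intro mult_mono) auto
      finally have "\<bar>trunc l (flow l p x) - trunc l (flow l0 p0 x)\<bar> \<le> (109 + 6 * (\<bar>l0\<bar> + 1)) * (C * s)" .
      moreover have "\<bar>trunc l (flow l0 p0 x) - trunc l0 (flow l0 p0 x)\<bar> \<le> 9 * s"
      proof -
        have "9 * \<bar>l - l0\<bar> \<le> 9 * s" using s(2) by simp
        then show ?thesis using trunc_param_lipschitz[of l "flow l0 p0 x" l0] by (rule order_trans[rotated])
      qed
      moreover have "K1 * s = (109 + 6 * (\<bar>l0\<bar> + 1)) * (C * s) + 9 * s" by (simp add: K1_def algebra_simps)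
      ultimately show ?thesis by linarith
    qed
    have df: "\<bar>dflow l p x - dflow l0 p0 x\<bar> \<le> K2 * s" if x: "x \<in> {0..pi}" for x
    proof -
      have "\<bar>dflow l p x - dflow l0 p0 x\<bar> \<le> \<bar>p - p0\<bar> + \<bar>l * flow l p x - l0 * flow l0 p0 x\<bar> + pi * (K1 * s)"
        unfolding dflow_def by (rule vdot_dist[OF continuous_flow(1) continuous_flow(1) continuous_trunc continuous_trunc tr x])
      also have "\<dots> \<le> s + ((\<bar>l0\<bar> + 1) * C + M1) * s + pi * (K1 * s)"
        using s prod[OF fl[OF x] M1(2)[OF x]] by linarith
      finally show ?thesis by (simp add: K2_def algebra_simps)
    qed
    let ?w = "\<lambda>l p x. - l * dflow l p x - trunc l (flow l p x)"
    have dw: "\<bar>?w l p x - ?w l0 p0 x\<bar> \<le> K3 * s" if x: "x \<in> {0..pi}" for x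
    proof -
      have "\<bar>?w l p x - ?w l0 p0 x\<bar> \<le> \<bar>l * dflow l p x - l0 * dflow l0 p0 x\<bar> + \<bar>trunc l (flow l p x) - trunc l0 (flow l0 p0 x)\<bar>" by linarith
      also have "\<dots> \<le> ((\<bar>l0\<bar> + 1) * K2 + M2) * s + K1 * s" using prod[OF df[OF x] M2(2)[OF x]] tr[OF x] by linarith
      finally show ?thesis by (simp add: K3_def algebra_simps)
    qed
    have cw: "continuous_on {0..pi} (?w l p)" for l p
      by (intro continuous_intros continuous_flow continuous_on_compose2[OF continuous_trunc continuous_flow(1)]) auto
    have feq: "fun_of (sol l p - sol l0 p0) = (\<lambda>x. fun_of (sol l p) x - fun_of (sol l0 p0) x)" by (simp add: minus_sobU.rep_eq)
    have le: "a \<le> K * s" if "a \<le> A * s" "A = C \<or> A = K2 \<or> A = K3" for a A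
    proof -
      have "A * s \<le> K * s" using that(2) C(1) K2 K3 s(1) by (intro mult_right_mono) (auto simp: K_def)
      then show ?thesis using that(1) by linarith
    qed
    have "norm (sol l p - sol l0 p0) \<le> 4 * (K * s)"
    proof (rule norm_sobU_classical_le)
      fix x assume x: "x \<in> {0..pi}"
      show "(fun_of (sol l p - sol l0 p0) has_real_derivative dflow l p x - dflow l0 p0 x) (at x within {0..pi})"
        unfolding feq by (intro DERIV_diff fun_of_sol_deriv h s0 x)
      show "((\<lambda>x. dflow l p x - dflow l0 p0 x) has_real_derivative ?w l p x - ?w l0 p0 x) (at x within {0..pi})"
        by (intro DERIV_diff flow_deriv(2) x)
      have "fun_of (sol l p - sol l0 p0) x = flow l p x - flow l0 p0 x"
        unfolding feq fun_of_sol[OF h(2)] fun_of_sol[OF s0] using x by simp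
      then show "\<bar>fun_of (sol l p - sol l0 p0) x\<bar> \<le> K * s" using le[OF fl[OF x]] by simp
      show "\<bar>dflow l p x - dflow l0 p0 x\<bar> \<le> K * s" using le[OF df[OF x]] by simp
      show "\<bar>?w l p x - ?w l0 p0 x\<bar> \<le> K * s" using le[OF dw[OF x]] by simp
    next
      show "continuous_on {0..pi} (\<lambda>x. ?w l p x - ?w l0 p0 x)" by (intro continuous_on_diff cw)
    qed
    then show ?thesis by (simp add: s_def mult.assoc)
  qed
  then show ?thesis using that[of "4 * K"] C(1) K2 K3 by (simp add: K_def)
qed

lemma continuous_on_sol: "continuous_on {z. shoot (Re z) (Im z) = 0} (\<lambda>z. sol (Re z) (Im z))"
proof (rule continuous_onI)
  fix z0 :: complex and e :: real assume z0: "z0 \<in> {z. shoot (Re z) (Im z) = 0}" and e: "e > 0"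
  obtain K where K: "K \<ge> 0" "\<And>l p. \<bar>l - Re z0\<bar> \<le> 1 \<Longrightarrow> shoot l p = 0 \<Longrightarrow>
     norm (sol l p - sol (Re z0) (Im z0)) \<le> K * (\<bar>l - Re z0\<bar> + \<bar>p - Im z0\<bar>)"
    by (rule sol_lipschitz[of "Re z0" "Im z0"]) (use z0 in simp, rule that)
  define d where "d = min 1 (e / (2 * (K + 1)))"
  have d: "d > 0" using e K by (simp add: d_def)
  have "dist (sol (Re z) (Im z)) (sol (Re z0) (Im z0)) \<le> e" if z: "shoot (Re z) (Im z) = 0" "dist z z0 < d" for z
  proof -
    have a: "\<bar>Re z - Re z0\<bar> \<le> dist z z0" "\<bar>Im z - Im z0\<bar> \<le> dist z z0"
      using abs_Re_le_cmod[of "z - z0"] abs_Im_le_cmod[of "z - z0"] by (auto simp: dist_norm)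
    have "norm (sol (Re z) (Im z) - sol (Re z0) (Im z0)) \<le> K * (\<bar>Re z - Re z0\<bar> + \<bar>Im z - Im z0\<bar>)"
      by (rule K(2)) (use z a in \<open>auto simp: d_def\<close>)
    also have "\<dots> \<le> (K + 1) * (2 * (e / (2 * (K + 1))))"
      using K(1) a z(2) by (intro mult_mono) (auto simp: d_def)
    also have "\<dots> = e" using K(1) by (simp add: field_simps)
    finally show ?thesis by (simp add: dist_norm)
  qed
  then show "\<exists>d>0. \<forall>z\<in>{z. shoot (Re z) (Im z) = 0}. dist z z0 < d \<longrightarrow> dist (sol (Re z) (Im z)) (sol (Re z0) (Im z0)) \<le> e"
    using d by blast
qed

lemma flow_zero_slope: "x \<in> {0..pi} \<Longrightarrow> flow l 0 x = 0"
proof -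
  assume x: "x \<in> {0..pi}"
  have "volterra_sol pi (nl l) l 0 (\<lambda>x. 0)"
    by (rule ode_volterra(1)[where v = "\<lambda>x. 0", OF _ continuous_nl]) (auto simp: nl_def)
  then show ?thesis using nl_sol_flow[of l 0 "\<lambda>x. 0" x] x by simp
qed

lemma sol_zero_slope: "sol l 0 = 0"
proof -
  have "flow l 0 (max 0 (min pi x)) = 0" for x by (rule flow_zero_slope) auto
  then show ?thesis by (simp add: sol_def zero_sobU_def)
qed

section \<open>The zero set in the plane of the points l + i p\<close>

definition zeros :: "complex set" where
  "zeros = {z. Im z > 0 \<and> shoot (Re z) (Im z) = 0}"

text \<open>The lower half plane, where solutions are not positive, belongs to the positive side in order to make the
  complement of \<open>zeros \<union> {0}\<close> the union of the two sides.\<close>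

definition pos_side :: "complex set" where
  "pos_side = {z. Im z > 0 \<and> shoot (Re z) (Im z) > 0} \<union> {z. Im z \<le> 0 \<and> z \<noteq> 0}"

definition neg_side :: "complex set" where
  "neg_side = {z. Im z > 0 \<and> shoot (Re z) (Im z) < 0}"

lemma continuous_shoot_complex: "continuous_on S (\<lambda>z. shoot (Re z) (Im z))"
proof -
  have "continuous_on UNIV (\<lambda>z. shoot (fst (Re z, Im z)) (snd (Re z, Im z)))"
    by (rule continuous_on_compose2[OF continuous_shoot]) (auto intro!: continuous_intros)
  then show ?thesis by (auto intro: continuous_on_subset)
qed

lemma shoot_0 [simp]: "shoot l 0 = 0" by (simp add: shoot_def flow_zero_slope)

text \<open>Above the axis openness is continuity of \<open>shoot\<close>. At points of the axis
  other than the origin it needs the slope bound: they lie off a closed sector outside of which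
  \<open>shoot\<close> is positive for all p > 0.\<close>

lemma open_sides: "open pos_side" "open neg_side"
proof -
  have G: "open {z. shoot (Re z) (Im z) > 0}" "open {z. shoot (Re z) (Im z) < 0}"
    by (intro open_Collect_less continuous_shoot_complex continuous_intros)+
  have I: "open {z. Im z > 0}" by (intro open_Collect_less continuous_intros)
  have "neg_side = {z. Im z > 0} \<inter> {z. shoot (Re z) (Im z) < 0}" by (auto simp: neg_side_def)
  then show "open neg_side" using open_Int[OF I G(2)] by simp
  obtain c where c: "c > 0" "\<And>l p. p > 0 \<Longrightarrow> shoot l p \<le> 0 \<Longrightarrow> l \<le> c * p"
    by (rule shoot_nonpos_slope) (rule that)
  define Q where "Q = {z. 0 \<le> Re z} \<inter> {z. Re z \<le> c * Im z}"
  have "closed Q" unfolding Q_def by (intro closed_Int closed_Collect_le continuous_intros)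
  then have oQ: "open (- Q)" by (simp add: open_Compl)
  have "pos_side = - Q \<union> ({z. Im z > 0} \<inter> {z. shoot (Re z) (Im z) > 0})"
  proof (intro equalityI subsetI)
    fix z assume z: "z \<in> pos_side"
    show "z \<in> - Q \<union> ({z. Im z > 0} \<inter> {z. shoot (Re z) (Im z) > 0})"
    proof (cases "Im z > 0")
      case True
      then show ?thesis using z by (auto simp: pos_side_def)
    next
      case False
      then have nz: "z \<noteq> 0" using z by (auto simp: pos_side_def)
      have "z \<notin> Q"
      proof
        assume "z \<in> Q"
        then have q: "0 \<le> Re z" "Re z \<le> c * Im z" by (auto simp: Q_def)
        have "c * Im z \<le> 0" using False c(1) by (simp add: mult_nonneg_nonpos)
        then have "Re z = 0" using q by linarith
        moreover have "Im z = 0" using q c(1) False \<open>Re z = 0\<close> by (simp add: zero_le_mult_iff)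
        ultimately show False using nz by (simp add: complex_eq_iff)
      qed
      then show ?thesis by blast
    qed
  next
    fix z assume z: "z \<in> - Q \<union> ({z. Im z > 0} \<inter> {z. shoot (Re z) (Im z) > 0})"
    show "z \<in> pos_side"
    proof (cases "Im z > 0")
      case True
      have "shoot (Re z) (Im z) > 0"
      proof (rule ccontr)
        assume n: "\<not> ?thesis"
        then have "z \<in> Q" using c(2)[OF True, of "Re z"] shoot_nonpos(1)[OF True, of "Re z"] by (auto simp: Q_def)
        then show False using z n by auto
      qed
      then show ?thesis using True by (simp add: pos_side_def)
    next
      case False
      then show ?thesis using z by (auto simp: pos_side_def Q_def)
    qed
  qed
  then show "open pos_side" using open_Un[OF oQ open_Int[OF I G(1)]] by simp
qed

lemma sides_cover: "- insert 0 zeros = pos_side \<union> neg_side" "pos_side \<inter> neg_side = {}"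
  by (auto simp: zeros_def pos_side_def neg_side_def)

text \<open>The complement of the zero set with the vertex is a disjoint union of two open sets, so
  no connected subset of it meets both. Janiszewski's theorem will be played off against
  this.\<close>

lemma sides_separated:
  assumes "connected_component (- insert 0 zeros) a b" "a \<in> pos_side" "b \<in> neg_side"
  shows False
proof -
  obtain S where S: "connected S" "S \<subseteq> - insert 0 zeros" "a \<in> S" "b \<in> S"
    using assms(1) unfolding connected_component_def by blast
  have "pos_side \<inter> S = {} \<or> neg_side \<inter> S = {}"
    by (rule connectedD[OF S(1) open_sides]) (use S(2) sides_cover in auto)
  then show False using S assms by auto
qed

text \<open>Closedness is openness of the two sides, and this is where the vertex has to be added;
  boundedness is 0 < l < 4 and p \<le> 200.\<close>

lemma compact_zeros: "compact (insert 0 zeros)"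
proof -
  obtain c where c: "c > 0" "\<And>l p. p > 0 \<Longrightarrow> shoot l p \<le> 0 \<Longrightarrow> l \<le> c * p"
    by (rule shoot_nonpos_slope) (rule that)
  have "insert 0 zeros = - (pos_side \<union> neg_side)" using sides_cover by auto
  then have cl: "closed (insert 0 zeros)" using open_sides by auto
  have "norm z \<le> 4 + 200" if "z \<in> insert 0 zeros" for z
  proof (cases "z = 0")
    case False
    then have "Im z > 0" "shoot (Re z) (Im z) \<le> 0" using that by (auto simp: zeros_def)
    note s = shoot_nonpos[OF this]
    show ?thesis using cmod_le[of z] s(1,2,4) \<open>Im z > 0\<close> by linarith
  qed simp
  then have "bounded (insert 0 zeros)" unfolding bounded_iff by blast
  then show ?thesis using cl by (simp add: compact_eq_bounded_closed)
qed

definition solution_at :: "complex \<Rightarrow> real \<times> sobU" where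
  "solution_at z = (Re z, sol (Re z) (Im z))"

lemma solution_at_zeros: "z \<in> zeros \<Longrightarrow> solution_at z \<in> positive_solutions"
  unfolding zeros_def solution_at_def using sol_positive_solution(1) by auto

lemma continuous_on_solution_at: "continuous_on {z. shoot (Re z) (Im z) = 0} solution_at"
  unfolding solution_at_def by (intro continuous_intros continuous_on_sol)

lemma inj_on_solution_at: "inj_on solution_at zeros"
proof (rule inj_onI)
  fix z w assume z: "z \<in> zeros" and w: "w \<in> zeros" and eq: "solution_at z = solution_at w"
  have "init_slope (snd (solution_at z)) = Im z" if "z \<in> zeros" for z
    using that sol_positive_solution(2) by (auto simp: zeros_def solution_at_def)
  then have "Im z = Im w" using z w eq by metis
  moreover have "Re z = Re w" using eq by (simp add: solution_at_def)
  ultimately show "z = w" by (simp add: complex_eq_iff)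
qed

lemma positive_solution_zero:
  assumes "(l, u) \<in> positive_solutions"
  shows "Complex l (init_slope u) \<in> zeros" "solution_at (Complex l (init_slope u)) = (l, u)"
  using positive_solution_shoot[OF assms] positive_solution_eq_sol[OF assms] by (auto simp: zeros_def solution_at_def)

section \<open>The planar topology of the zero set\<close>

lemma continuous_shoot_line: "continuous_on S (shoot l)" "continuous_on S (\<lambda>x. shoot x p)"
proof -
  have "continuous_on S (\<lambda>y. shoot (Re (Complex l y)) (Im (Complex l y)))"
    by (rule continuous_on_compose2[OF continuous_shoot_complex[of UNIV]])
      (auto simp: Complex_eq intro!: continuous_intros)
  then show "continuous_on S (shoot l)" by simp
  have "continuous_on S (\<lambda>x. shoot (Re (Complex x p)) (Im (Complex x p)))"
    by (rule continuous_on_compose2[OF continuous_shoot_complex[of UNIV]])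
      (auto simp: Complex_eq intro!: continuous_intros)
  then show "continuous_on S (\<lambda>x. shoot x p)" by simp
qed

lemma sign_change_between:
  assumes q: "a < q" "q < b" and nz: "\<And>y. a \<le> y \<Longrightarrow> y \<le> b \<Longrightarrow> y \<noteq> q \<Longrightarrow> shoot l y \<noteq> 0"
    and s: "shoot l a * shoot l b < 0"
  shows "sign_change l q"
proof -
  note c = continuous_shoot_line(1)
  have no_change: "shoot l x * shoot l y > 0" if xy: "x \<le> y" and n: "\<And>w. x \<le> w \<Longrightarrow> w \<le> y \<Longrightarrow> shoot l w \<noteq> 0" for x y
  proof (rule ccontr)
    assume "\<not> ?thesis"
    then consider "shoot l x \<le> 0" "0 \<le> shoot l y" | "shoot l y \<le> 0" "0 \<le> shoot l x"
      using n[of x] n[of y] xy by (auto simp: zero_less_mult_iff not_less)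
    then show False
    proof cases
      case 1
      then obtain w where "x \<le> w" "w \<le> y" "shoot l w = 0" using IVT'[of "shoot l" x 0 y] xy c by blast
      then show False using n by blast
    next
      case 2
      then obtain w where "x \<le> w" "w \<le> y" "shoot l w = 0" using IVT2'[of "shoot l" y 0 x] xy c by blast
      then show False using n by blast
    qed
  qed
  define \<sigma> where "\<sigma> = sgn (shoot l b)"
  have sb: "shoot l b \<noteq> 0" "shoot l a \<noteq> 0" using s by auto
  have left: "shoot l a * shoot l y > 0" if "a \<le> y" "y < q" for y
    by (rule no_change) (use that nz q in auto)
  have right: "shoot l y * shoot l b > 0" if "q < y" "y \<le> b" for y
    by (rule no_change) (use that nz q in auto)
  show ?thesis unfolding sign_change_def
  proof (intro exI[of _ "min (q - a) (b - q)"] conjI bexI[of _ \<sigma>] allI impI)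
    show "0 < min (q - a) (b - q)" using q by simp
    show "\<sigma> \<in> {1, -1}" using sb by (auto simp: \<sigma>_def sgn_if)
    fix y assume y: "0 < \<bar>y - q\<bar> \<and> \<bar>y - q\<bar> < min (q - a) (b - q)"
    show "\<sigma> * (y - q) * shoot l y > 0"
    proof (cases "y < q")
      case True
      then have "shoot l a * shoot l y > 0" using left y by auto
      then have "\<sigma> * shoot l y < 0" using s by (auto simp: \<sigma>_def sgn_if zero_less_mult_iff mult_less_0_iff)
      then have "(y - q) * (\<sigma> * shoot l y) > 0" using True by (intro mult_neg_neg) auto
      then show ?thesis by (simp add: mult_ac)
    next
      case False
      then have "q < y" "shoot l y * shoot l b > 0" using right y by auto
      then have "\<sigma> * shoot l y > 0" by (auto simp: \<sigma>_def sgn_if zero_less_mult_iff)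
      then have "(y - q) * (\<sigma> * shoot l y) > 0" using \<open>q < y\<close> by simp
      then show ?thesis by (simp add: mult_ac)
    qed
  qed
qed

section \<open>The two arcs at the vertex and their far ends\<close>

locale two_arcs =
  fixes \<epsilon> :: real and q q' :: "real \<Rightarrow> real" and W :: "complex set"
  assumes eps: "\<epsilon> > 0"
    and an: "analytic_real q {0<..<\<epsilon>}" "analytic_real q' {0<..<\<epsilon>}"
    and cont: "continuous_on {0<..<\<epsilon>} q" "continuous_on {0<..<\<epsilon>} q'"
    and in_zeros: "\<And>l. l \<in> {0<..<\<epsilon>} \<Longrightarrow> Complex l (q l) \<in> zeros" "\<And>l. l \<in> {0<..<\<epsilon>} \<Longrightarrow> Complex l (q' l) \<in> zeros"
    and lim0: "(q \<longlongrightarrow> 0) (at_right 0)" "(q' \<longlongrightarrow> 0) (at_right 0)"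
    and W: "open W" "0 \<in> W" "zeros \<inter> W = (\<lambda>l. Complex l (q l)) ` {0<..<\<epsilon>} \<union> (\<lambda>l. Complex l (q' l)) ` {0<..<\<epsilon>}"
begin

text \<open>The assumptions are symmetric, so what is proved for q is available for q' as
  well.\<close>

lemma swap: "two_arcs \<epsilon> q' q W"
  using eps an cont in_zeros lim0 W by unfold_locales auto

lemma zero_props:
  assumes "l \<in> {0<..<\<epsilon>}"
  shows "q l > 0" "shoot l (q l) = 0" "q' l > 0" "shoot l (q' l) = 0"
  using in_zeros[OF assms] by (auto simp: zeros_def)

lemma zeros_near_origin: "z \<in> zeros \<Longrightarrow> z \<in> W \<Longrightarrow> Re z \<in> {0<..<\<epsilon>} \<and> (Im z = q (Re z) \<or> Im z = q' (Re z))"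
proof -
  assume "z \<in> zeros" "z \<in> W"
  then have "z \<in> (\<lambda>l. Complex l (q l)) ` {0<..<\<epsilon>} \<union> (\<lambda>l. Complex l (q' l)) ` {0<..<\<epsilon>}" using W(3) by auto
  then show ?thesis by auto
qed

text \<open>On a vertical line close to the origin the shooting function is positive near the axis, negative on the
  diagonal, and positive further up, so that each of the two zeros on that line is a sign change.\<close>

lemma sign_change_near_origin:
  obtains d where "0 < d" "d \<le> \<epsilon>" "\<And>l. l \<in> {0<..<d} \<Longrightarrow> sign_change l (q l)" "\<And>l. l \<in> {0<..<d} \<Longrightarrow> q l \<noteq> q' l"
proof -
  obtain r0 where r0: "r0 > 0" "ball 0 r0 \<subseteq> W" using W(1,2) open_contains_ball by blast
  \<comment> \<open>Half the radius, so that the box |l| < r, |p| \<le> r lies in the ball of radius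
    r0 and hence in W.\<close>
  define r where "r = r0 / 2"
  have r: "r > 0" using r0 by (simp add: r_def)
  have inW: "Complex l p \<in> W" if "\<bar>l\<bar> < r" "\<bar>p\<bar> \<le> r" for l p
  proof -
    have "norm (Complex l p) \<le> \<bar>l\<bar> + \<bar>p\<bar>" using cmod_le[of "Complex l p"] by simp
    also have "\<dots> < r0" using that by (simp add: r_def)
    finally show ?thesis using r0(2) by auto
  qed
  obtain c where c: "c > 0" "\<And>l p. p > 0 \<Longrightarrow> shoot l p \<le> 0 \<Longrightarrow> l \<le> c * p"
    by (rule shoot_nonpos_slope) (rule that)
  obtain d1 where d1: "d1 > 0" "\<And>l. 0 < l \<Longrightarrow> l < d1 \<Longrightarrow> shoot l l < 0" using shoot_diag_neg by blast
  have "\<forall>\<^sub>F l in at_right 0. q l < r \<and> q' l < r"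
    using order_tendstoD(2)[OF lim0(1) r] order_tendstoD(2)[OF lim0(2) r] by eventually_elim simp
  then obtain d2 where d2: "d2 > 0" "\<And>l. 0 < l \<Longrightarrow> l < d2 \<Longrightarrow> q l < r \<and> q' l < r"
    unfolding eventually_at_right_field by auto
  define d where "d = min (min d1 d2) (min r \<epsilon>)"
  have d: "0 < d" "d \<le> \<epsilon>" "d \<le> d1" "d \<le> d2" "d \<le> r" using d1 d2 r eps by (auto simp: d_def)
  have main: "\<exists>a. 0 < a \<and> a < l \<and> shoot l a > 0 \<and> shoot l l < 0 \<and> shoot l r > 0 \<and>
     ((a < q l \<and> q l < l \<and> l < q' l \<and> q' l < r) \<or> (a < q' l \<and> q' l < l \<and> l < q l \<and> q l < r))"
    if l: "l \<in> {0<..<d}" for l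
  proof -
    have l': "0 < l" "l < d1" "l < d2" "l < r" "l \<in> {0<..<\<epsilon>}" using l d by auto
    \<comment> \<open>Up to height l / (2 c) the slope bound excludes nonpositive values; a < l
      keeps the point below the diagonal.\<close>
    define a where "a = min (l / (2 * c)) (l / 2)"
    have a: "0 < a" "a < l" using l'(1) c(1) by (auto simp: a_def)
    have ap: "shoot l y > 0" if "0 < y" "y \<le> a" for y
    proof (rule ccontr)
      assume "\<not> ?thesis"
      then have "l \<le> c * y" using c(2) that by auto
      also have "\<dots> \<le> c * (l / (2 * c))" using that c(1) by (intro mult_left_mono) (auto simp: a_def)
      also have "\<dots> = l / 2" using c(1) by simp
      finally show False using l'(1) by simp
    qed
    have zero: "y = q l \<or> y = q' l" if "0 < y" "y \<le> r" "shoot l y = 0" for y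
      using zeros_near_origin[of "Complex l y"] inW[of l y] that l' by (auto simp: zeros_def)
    \<comment> \<open>At l = 0 the value is positive, as nonpositive values need l > 0. Moving right
      at height r a zero would lie in W and hence on one of the arcs, which are still below
      r.\<close>
    have top: "shoot l r > 0"
    proof -
      note cs = continuous_shoot_line(2)
      have p0: "shoot 0 r > 0" using shoot_nonpos(1)[OF r, of 0] by (meson less_irrefl not_less)
      show ?thesis
      proof (rule ccontr)
        assume "\<not> ?thesis"
        then obtain x where x: "0 \<le> x" "x \<le> l" "shoot x r = 0"
          using IVT2'[of "\<lambda>x. shoot x r" l 0 0] p0 cs l' by auto
        have "x > 0" using x p0 by (cases "x = 0") auto
        then have "Complex x r \<in> zeros" "Complex x r \<in> W" using x r inW[of x r] l' by (auto simp: zeros_def)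
        then have "r = q x \<or> r = q' x" using zeros_near_origin by force
        then show False using d2(2)[of x] x l' \<open>x > 0\<close> by auto
      qed
    qed
    have neg: "shoot l l < 0" using d1(2) l' by auto
    note cl = continuous_shoot_line(1)
    obtain y1 where y1: "a \<le> y1" "y1 \<le> l" "shoot l y1 = 0"
      using IVT2'[of "shoot l" l 0 a] ap[of a] a neg cl by auto
    obtain y2 where y2: "l \<le> y2" "y2 \<le> r" "shoot l y2 = 0"
      using IVT'[of "shoot l" l 0 r] top neg cl l' by auto
    have "y1 \<noteq> l" "y2 \<noteq> l" "y1 \<noteq> a" "y2 \<noteq> r" using y1 y2 neg ap[of a] a top by auto
    then have s: "a < y1" "y1 < l" "l < y2" "y2 < r" using y1 y2 by auto
    have "y1 = q l \<or> y1 = q' l" by (rule zero) (use s a l' y1 in auto)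
    moreover have "y2 = q l \<or> y2 = q' l" by (rule zero) (use s a l' y2 in auto)
    ultimately show ?thesis using s a ap[of a] neg top by (intro exI[of _ a]) auto
  qed
  have zero: "y = q l \<or> y = q' l" if "l \<in> {0<..<d}" "0 < y" "y \<le> r" "shoot l y = 0" for y l
  proof -
    have "Complex l y \<in> W" using that d by (intro inW) auto
    moreover have "Complex l y \<in> zeros" using that by (simp add: zeros_def)
    ultimately show ?thesis using zeros_near_origin[of "Complex l y"] by simp
  qed
  have ne: "q l \<noteq> q' l" if "l \<in> {0<..<d}" for l using main[OF that] by auto
  have "sign_change l (q l)" if l: "l \<in> {0<..<d}" for l
  proof -
    obtain a where a: "0 < a" "a < l" "shoot l a > 0" "shoot l l < 0" "shoot l r > 0"
     "(a < q l \<and> q l < l \<and> l < q' l \<and> q' l < r) \<or> (a < q' l \<and> q' l < l \<and> l < q l \<and> q l < r)" using main[OF l] by (elim exE conjE) (rule that)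
    have lr: "l < r" using l d by auto
    from a(6) show ?thesis
    proof
      assume h: "a < q l \<and> q l < l \<and> l < q' l \<and> q' l < r"
      show ?thesis
      proof (rule sign_change_between[of a "q l" l])
        show "shoot l y \<noteq> 0" if "a \<le> y" "y \<le> l" "y \<noteq> q l" for y
          using zero[OF l, of y] that h a lr by auto
        show "shoot l a * shoot l l < 0" using a by (simp add: mult_pos_neg)
      qed (use h in auto)
    next
      assume h: "a < q' l \<and> q' l < l \<and> l < q l \<and> q l < r"
      show ?thesis
      proof (rule sign_change_between[of l "q l" r])
        show "shoot l y \<noteq> 0" if "l \<le> y" "y \<le> r" "y \<noteq> q l" for y
          using zero[OF l, of y] that h a lr by auto
        show "shoot l l * shoot l r < 0" using a by (simp add: mult_neg_pos)
      qed (use h in auto)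
    qed
  qed
  then show ?thesis using that[of d] d ne by blast
qed

text \<open>By the identity theorem arcs agreeing on a subinterval would agree everywhere, but near
  the vertex they lie on different sides of the diagonal.\<close>

lemma arcs_not_eventually_equal:
  assumes "0 \<le> a" "a < b" "b \<le> \<epsilon>" "\<And>l. l \<in> {a<..<b} \<Longrightarrow> q l = q' l"
  shows False
proof -
  obtain d where d: "0 < d" "d \<le> \<epsilon>" "\<And>l. l \<in> {0<..<d} \<Longrightarrow> q l \<noteq> q' l"
    by (rule sign_change_near_origin) (rule that)
  have lh: "locally_holomorphic (\<lambda>t. complex_of_real (q t - q' t)) {0<..<\<epsilon>}"
    unfolding locally_holomorphic_def
  proof
    fix t0 assume t0: "t0 \<in> {0<..<\<epsilon>}"
    obtain r1 g1 where 1: "r1 > 0" "g1 holomorphic_on ball (of_real t0) r1"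
      "\<And>t. \<bar>t - t0\<bar> < r1 \<Longrightarrow> g1 (of_real t) = complex_of_real (q t)"
      by (rule analytic_real_extension[OF an(1) t0]) (rule that)
    obtain r2 g2 where 2: "r2 > 0" "g2 holomorphic_on ball (of_real t0) r2"
      "\<And>t. \<bar>t - t0\<bar> < r2 \<Longrightarrow> g2 (of_real t) = complex_of_real (q' t)"
      by (rule analytic_real_extension[OF an(2) t0]) (rule that)
    show "\<exists>r>0. \<exists>g. g holomorphic_on ball (of_real t0) r \<and> (\<forall>t. \<bar>t - t0\<bar> < r \<longrightarrow> g (of_real t) = complex_of_real (q t - q' t))"
    proof (intro exI[of _ "min r1 r2"] conjI exI[of _ "\<lambda>w. g1 w - g2 w"])
      show "(\<lambda>w. g1 w - g2 w) holomorphic_on ball (of_real t0) (min r1 r2)"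
        by (intro holomorphic_on_diff holomorphic_on_subset[OF 1(2)] holomorphic_on_subset[OF 2(2)]) auto
    qed (use 1 2 in auto)
  qed
  have "complex_of_real (q (d / 2) - q' (d / 2)) = 0"
    by (rule locally_holomorphic_identity[OF lh assms(1-3)]) (use assms(4) d in auto)
  then show False using d(3)[of "d / 2"] d(1) by simp
qed

text \<open>Compactness yields an accumulation point (\<epsilon>, p), which is not the vertex. On
  the line l = \<epsilon> the zero p is isolated, so close to this line q cannot cross the levels p
  + e' and p - e'; being continuous it is trapped between them and converges.\<close>

lemma endpoint_limit:
  obtains p where "p > 0" "shoot \<epsilon> p = 0" "(q \<longlongrightarrow> p) (at_left \<epsilon>)"
proof -
  \<comment> \<open>The shift by 2 keeps all members of the sequence inside (0, \<epsilon>), also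
    for n = 0.\<close>
  define t where "t n = \<epsilon> - \<epsilon> / (n + 2)" for n :: nat
  have t: "t n \<in> {0<..<\<epsilon>}" for n using eps by (simp add: t_def field_simps add_pos_nonneg)
  have tl: "t \<longlonglongrightarrow> \<epsilon>"
  proof -
    have "(\<lambda>n. \<epsilon> - \<epsilon> / real (n + 2)) \<longlonglongrightarrow> \<epsilon> - 0"
      by (intro tendsto_diff tendsto_const LIMSEQ_ignore_initial_segment[OF lim_const_over_n])
    then show ?thesis by (simp add: t_def[abs_def] add.commute)
  qed
  have "\<forall>n. Complex (t n) (q (t n)) \<in> insert 0 zeros" using in_zeros(1)[OF t] by blast
  then obtain z s where s: "z \<in> insert 0 zeros" "strict_mono s" "((\<lambda>n. Complex (t n) (q (t n))) \<circ> s) \<longlonglongrightarrow> z"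
    by (rule seq_compactE[OF compact_imp_seq_compact[OF compact_zeros]]) (rule that)
  have R: "(\<lambda>n. t (s n)) \<longlonglongrightarrow> Re z" and I: "(\<lambda>n. q (t (s n))) \<longlonglongrightarrow> Im z"
    using tendsto_Re[OF s(3)] tendsto_Im[OF s(3)] by (simp_all add: o_def)
  have ts: "(\<lambda>n. t (s n)) \<longlonglongrightarrow> \<epsilon>" using LIMSEQ_subseq_LIMSEQ[OF tl s(2)] by (simp add: o_def)
  have Rz: "Re z = \<epsilon>" by (rule LIMSEQ_unique[OF R ts])
  then have "z \<noteq> 0" using eps by auto
  then have p: "Im z > 0" "shoot \<epsilon> (Im z) = 0" using s(1) Rz by (auto simp: zeros_def)
  obtain r where r: "0 < r" "\<And>y. \<bar>y - Im z\<bar> \<le> r \<Longrightarrow> shoot \<epsilon> y = 0 \<Longrightarrow> y = Im z"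
    by (rule zero_branches[of "Im z" \<epsilon> 1]) (use p in simp, use p in simp, simp, rule that)
  have "(q \<longlongrightarrow> Im z) (at_left \<epsilon>)"
  proof (rule tendstoI)
    fix e :: real assume e: "e > 0"
    define e' where "e' = min e r"
    have e': "0 < e'" "e' \<le> e" "e' \<le> r" using e r by (auto simp: e'_def)
    have near: "\<forall>\<^sub>F x in at_left \<epsilon>. shoot x y \<noteq> 0" if "\<bar>y - Im z\<bar> = e'" for y
    proof -
      have "shoot \<epsilon> y \<noteq> 0" using r(2)[of y] that e' by auto
      moreover have "isCont (\<lambda>x. shoot x y) \<epsilon>"
        using continuous_shoot_line(2)[of UNIV] by (simp add: continuous_on_eq_continuous_at)
      ultimately have "\<forall>\<^sub>F x in at \<epsilon>. shoot x y \<noteq> 0" unfolding isCont_def by (rule tendsto_imp_eventually_ne[rotated])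
      then show ?thesis by (rule eventually_at_filter[THEN iffD2, OF eventually_mono[OF eventually_at_filter[THEN iffD1]]]) auto
    qed
    have "\<forall>\<^sub>F x in at_left \<epsilon>. shoot x (Im z + e') \<noteq> 0 \<and> shoot x (Im z - e') \<noteq> 0"
      using near[of "Im z + e'"] near[of "Im z - e'"] e' by (auto intro: eventually_conj)
    then obtain b where b: "b < \<epsilon>" "\<And>x. b < x \<Longrightarrow> x < \<epsilon> \<Longrightarrow> shoot x (Im z + e') \<noteq> 0 \<and> shoot x (Im z - e') \<noteq> 0"
      unfolding eventually_at_left_field by blast
    define b' where "b' = max b 0"
    have b': "b' < \<epsilon>" "0 \<le> b'" "b \<le> b'" using b eps by (auto simp: b'_def)
    have ne: "\<bar>q x - Im z\<bar> \<noteq> e'" if "x \<in> {b'<..<\<epsilon>}" for x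
    proof
      assume "\<bar>q x - Im z\<bar> = e'"
      then have "q x = Im z + e' \<or> q x = Im z - e'" by linarith
      then show False using b(2)[of x] zero_props(2)[of x] that b' by auto
    qed
    have "\<forall>\<^sub>F n in sequentially. dist (q (t (s n))) (Im z) < e' \<and> b' < t (s n)"
      using tendstoD[OF I e'(1)] order_tendstoD(1)[OF ts b'(1)] by eventually_elim simp
    then obtain n where n: "dist (q (t (s n))) (Im z) < e'" "b' < t (s n)" using eventually_happens'[OF sequentially_bot] by blast
    have con: "connected ((\<lambda>x. \<bar>q x - Im z\<bar>) ` {b'<..<\<epsilon>})"
      by (intro connected_continuous_image continuous_intros continuous_on_subset[OF cont(1)]) (use b' in auto)
    have "\<bar>q x - Im z\<bar> < e'" if x: "x \<in> {b'<..<\<epsilon>}" for x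
    proof (rule ccontr)
      assume "\<not> ?thesis"
      then have "e' \<in> (\<lambda>x. \<bar>q x - Im z\<bar>) ` {b'<..<\<epsilon>}"
        using connectedD_interval[OF con, of "\<bar>q (t (s n)) - Im z\<bar>" "\<bar>q x - Im z\<bar>" e'] n x t[of "s n"] by (auto simp: dist_real_def)
      then obtain x' where "x' \<in> {b'<..<\<epsilon>}" "e' = \<bar>q x' - Im z\<bar>" by blast
      then show False using ne by metis
    qed
    then have "\<bar>q x - Im z\<bar> < e" if "b' < x" "x < \<epsilon>" for x using e' that by fastforce
    then show "\<forall>\<^sub>F x in at_left \<epsilon>. dist (q x) (Im z) < e"
      unfolding eventually_at_left_field dist_real_def using b'(1) by blast
  qed
  then show ?thesis using that p by blast
qed

end

lemma continuous_on_insert_limit: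
  fixes q :: "real \<Rightarrow> real"
  assumes I: "open I" "l0 \<notin> I" "continuous_on I q"
    and lim: "\<And>e. e > 0 \<Longrightarrow> \<exists>\<eta>>0. \<forall>t\<in>I. \<bar>t - l0\<bar> < \<eta> \<longrightarrow> \<bar>q t - p0\<bar> < e"
  shows "continuous_on (insert l0 I) (\<lambda>t. if t = l0 then p0 else q t)"
  unfolding continuous_on_eq_continuous_within
proof
  let ?f = "\<lambda>t. if t = l0 then p0 else q t"
  fix x assume x: "x \<in> insert l0 I"
  show "continuous (at x within insert l0 I) ?f"
  proof (cases "x = l0")
    case True
    show ?thesis unfolding continuous_within_eps_delta
    proof (intro allI impI)
      fix e :: real assume "e > 0"
      with lim obtain \<eta> where "\<eta> > 0" "\<And>t. t \<in> I \<Longrightarrow> \<bar>t - l0\<bar> < \<eta> \<Longrightarrow> \<bar>q t - p0\<bar> < e" by blast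
      then show "\<exists>d>0. \<forall>x'\<in>insert l0 I. dist x' x < d \<longrightarrow> dist (?f x') (?f x) < e"
        using True \<open>e > 0\<close> by (intro exI[of _ \<eta>]) (auto simp: dist_real_def)
    qed
  next
    case False
    then have xI: "x \<in> I" using x by simp
    have "continuous_on I ?f" using I(2,3) by (subst continuous_on_cong[OF refl, of _ _ q]) auto
    then have "isCont ?f x" using I(1) xI by (simp add: continuous_on_eq_continuous_at)
    then show ?thesis by (rule continuous_at_imp_continuous_within)
  qed
qed

text \<open>Vertex and far end are added to the arc. Its real part is always the parameter, which
  makes it injective and lets intersections be compared at equal parameters.\<close>

definition closed_arc :: "real \<Rightarrow> (real \<Rightarrow> real) \<Rightarrow> real \<Rightarrow> complex" where
  "closed_arc e q l = Complex l (if l \<le> 0 then 0 else if l < e then q l else Lim (at_left e) q)"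

lemma Re_closed_arc [simp]: "Re (closed_arc e q l) = l" by (simp add: closed_arc_def)

lemma closed_arc_0 [simp]: "closed_arc e q 0 = 0" by (simp add: closed_arc_def complex_eq_iff)

context two_arcs begin

lemma continuous_on_closed_arc: "continuous_on {0..\<epsilon>} (closed_arc \<epsilon> q)"
proof -
  let ?g = "\<lambda>l. if l \<le> 0 then 0 else if l < \<epsilon> then q l else Lim (at_left \<epsilon>) q"
  obtain p where p: "(q \<longlongrightarrow> p) (at_left \<epsilon>)" by (rule endpoint_limit) (rule that)
  have L: "Lim (at_left \<epsilon>) q = p" by (rule tendsto_Lim[OF _ p]) simp
  have "continuous_on {0..\<epsilon>} ?g"
  proof (rule continuous_on_IccI)
    have "\<forall>\<^sub>F l in at_right 0. q l = ?g l" unfolding eventually_at_right_field using eps by (intro exI[of _ \<epsilon>]) auto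
    then show "(?g \<longlongrightarrow> ?g 0) (at_right 0)" using lim0(1) by (auto intro: Lim_transform_eventually)
    have "\<forall>\<^sub>F l in at_left \<epsilon>. q l = ?g l" unfolding eventually_at_left_field using eps by (intro exI[of _ 0]) auto
    then show "(?g \<longlongrightarrow> ?g \<epsilon>) (at_left \<epsilon>)" using p eps L by (auto intro: Lim_transform_eventually)
    fix x assume x: "0 < x" "x < \<epsilon>"
    have "continuous_on {0<..<\<epsilon>} ?g" using cont(1) by (subst continuous_on_cong[OF refl, of _ _ q]) auto
    then have "isCont ?g x" using x by (simp add: continuous_on_eq_continuous_at)
    then show "?g \<midarrow>x\<rightarrow> ?g x" by (simp only: isCont_def)
  qed (rule eps)
  then show ?thesis unfolding closed_arc_def[abs_def] Complex_eq by (intro continuous_intros)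
qed

lemma closed_arc_in_zeros: "l \<in> {0<..\<epsilon>} \<Longrightarrow> closed_arc \<epsilon> q l \<in> zeros"
proof -
  assume l: "l \<in> {0<..\<epsilon>}"
  obtain p where p: "p > 0" "shoot \<epsilon> p = 0" "(q \<longlongrightarrow> p) (at_left \<epsilon>)" by (rule endpoint_limit) (rule that)
  have "Lim (at_left \<epsilon>) q = p" by (rule tendsto_Lim[OF _ p(3)]) simp
  then show ?thesis using l p in_zeros(1)[of l] by (cases "l < \<epsilon>") (auto simp: closed_arc_def zeros_def)
qed

lemma closed_arc_in_W: "l \<in> {0<..<\<epsilon>} \<Longrightarrow> closed_arc \<epsilon> q l \<in> W"
  using W(3) by (auto simp: closed_arc_def)

text \<open>All zeros in W have real part below \<epsilon>.\<close>

lemma closed_arc_end_notin_W: "closed_arc \<epsilon> q \<epsilon> \<notin> W"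
  using zeros_near_origin[of "closed_arc \<epsilon> q \<epsilon>"] closed_arc_in_zeros[of \<epsilon>] eps by auto

lemma zeros_Int_W: "zeros \<inter> W = closed_arc \<epsilon> q ` {0<..<\<epsilon>} \<union> closed_arc \<epsilon> q' ` {0<..<\<epsilon>}"
  unfolding W(3) by (intro arg_cong2[where f = "(\<union>)"] image_cong refl) (auto simp: closed_arc_def)

section \<open>The zero set outside the arcs\<close>

abbreviation K where "K \<equiv> zeros - W"
abbreviation z1 where "z1 \<equiv> closed_arc \<epsilon> q \<epsilon>"
abbreviation z2 where "z2 \<equiv> closed_arc \<epsilon> q' \<epsilon>"

lemma compact_K: "compact K"
proof -
  have "K = insert 0 zeros \<inter> - W" using W(2) by auto
  moreover have "compact (insert 0 zeros \<inter> - W)"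
    by (rule compact_Int_closed[OF compact_zeros]) (simp add: closed_Compl W(1))
  ultimately show ?thesis by simp
qed

lemma z1_in_K: "z1 \<in> K" using closed_arc_in_zeros[of \<epsilon>] closed_arc_end_notin_W eps by auto

lemma z2_in_K: "z2 \<in> K" by (rule two_arcs.z1_in_K[OF swap])

text \<open>In the zero set without z1 and z2, the part inside W is the part on the closed arcs, so
  it is open and closed. A connected set containing a point of K therefore cannot enter W.\<close>

lemma connected_in_K:
  assumes S: "connected S" "S \<subseteq> zeros - {z1, z2}" and y: "y \<in> S" "y \<in> K"
  shows "S \<subseteq> K"
proof -
  let ?C = "closed_arc \<epsilon> q ` {0..\<epsilon>} \<union> closed_arc \<epsilon> q' ` {0..\<epsilon>}"
  have "compact ?C"
    by (intro compact_Un compact_continuous_image continuous_on_closed_arc two_arcs.continuous_on_closed_arc[OF swap]) auto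
  then have o: "open (- ?C)" by (rule open_Compl[OF compact_imp_closed])
  have split: "{0..\<epsilon>} = insert 0 (insert \<epsilon> {0<..<\<epsilon>})" using eps by auto
  have 0: "0 \<notin> zeros" by (simp add: zeros_def)
  have C: "?C = {0, z1, z2} \<union> (zeros \<inter> W)" unfolding zeros_Int_W split by auto
  have "W \<inter> S = {} \<or> - ?C \<inter> S = {}"
  proof (rule connectedD[OF S(1) W(1) o])
    show "W \<inter> - ?C \<inter> S = {}" using C S(2) by auto
    show "S \<subseteq> W \<union> - ?C" using C S(2) 0 by auto
  qed
  moreover have "y \<in> - ?C" using C y S(2) 0 by auto
  ultimately have "W \<inter> S = {}" using y by auto
  then show ?thesis using S(2) by auto
qed

text \<open>A point y of K close to x lies on a continuous branch of zeros over an interval to one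
  side of x, and this branch runs into x. It remains in K because it is connected, contains y and
  avoids z1 and z2.\<close>

lemma locally_path_connected_K: "locally path_connected K"
  unfolding locally_path_connected_im_kleinen
proof (intro allI impI)
  fix v x assume vx: "openin (top_of_set K) v \<and> x \<in> v"
  then obtain T where T: "open T" "v = K \<inter> T" by (auto simp: openin_open)
  define l0 where "l0 = Re x" define p0 where "p0 = Im x"
  have xe: "x = Complex l0 p0" by (simp add: l0_def p0_def)
  have xK: "x \<in> K" "x \<in> T" using vx T by auto
  then have p0: "p0 > 0" "shoot l0 p0 = 0" by (auto simp: zeros_def l0_def p0_def)
  \<comment> \<open>The far ends other than x are kept out of the neighbourhood; if x is itself a
    far end, the branch avoids it because l0 does not belong to I.\<close>
  have "open (T - ({z1, z2} - {x}))" using T(1) by (intro open_Diff finite_imp_closed) auto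
  then obtain e0 where e0: "e0 > 0" "ball x e0 \<subseteq> T - ({z1, z2} - {x})" using xK(2) open_contains_ball by blast
  have box: "Complex a b \<in> T - ({z1, z2} - {x})" if "\<bar>a - l0\<bar> < e0 / 2" "\<bar>b - p0\<bar> < e0 / 2" for a b
  proof -
    have "dist x (Complex a b) \<le> \<bar>a - l0\<bar> + \<bar>b - p0\<bar>"
      unfolding xe dist_norm using cmod_le[of "Complex l0 p0 - Complex a b"] by simp
    then have "Complex a b \<in> ball x e0" using that by simp
    then show ?thesis using e0(2) by blast
  qed
  obtain \<delta> r where \<delta>: "0 < \<delta>" "\<delta> < e0 / 2" "0 < r" "r < e0 / 2" "r < p0"
    "locally_ordered_on {l0<..<l0 + \<delta>} (zslice p0 r)" "locally_ordered_on {l0 - \<delta><..<l0} (zslice p0 r)"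
    "\<And>y. \<bar>y - p0\<bar> \<le> r \<Longrightarrow> shoot l0 y = 0 \<Longrightarrow> y = p0"
    "\<And>e'. e' > 0 \<Longrightarrow> \<exists>\<eta>>0. \<forall>x y. \<bar>x - l0\<bar> < \<eta> \<longrightarrow> y \<in> zslice p0 r x \<longrightarrow> \<bar>y - p0\<bar> < e'"
    by (rule zero_branches[of p0 l0 "e0 / 2"]) (use p0 e0(1) in simp, use p0 in simp, use e0(1) in simp, rule that)
  define B where "B = {z. \<bar>Re z - l0\<bar> < \<delta>} \<inter> {z. \<bar>Im z - p0\<bar> < r}"
  have oB: "open B" unfolding B_def by (intro open_Int open_Collect_less continuous_intros)
  have BT: "B \<subseteq> T"
  proof
    fix z assume "z \<in> B"
    then have "Complex (Re z) (Im z) \<in> T - ({z1, z2} - {x})" using \<delta> by (intro box) (auto simp: B_def)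
    then show "z \<in> T" by simp
  qed
  have branch: "\<exists>p. path p \<and> path_image p \<subseteq> v \<and> pathstart p = x \<and> pathfinish p = y"
    if y: "y \<in> K \<inter> B" and I: "connected I" "open I" "l0 \<notin> I" "\<And>t. t \<in> I \<Longrightarrow> \<bar>t - l0\<bar> < \<delta>"
      "locally_ordered_on I (zslice p0 r)" "closed_segment l0 (Re y) \<subseteq> insert l0 I" "Re y \<in> I" for y I
  proof -
    have "Im y \<in> zslice p0 r (Re y)" using y by (auto simp: zslice_def B_def zeros_def)
    then obtain s where s: "continuous_on I s" "s (Re y) = Im y" "\<And>t. t \<in> I \<Longrightarrow> s t \<in> zslice p0 r t"
      by (rule continuous_section_through[OF I(1,5,7)]) (rule that)
    define h where "h t = Complex t (if t = l0 then p0 else s t)" for t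
    have "continuous_on (insert l0 I) (\<lambda>t. if t = l0 then p0 else s t)"
    proof (rule continuous_on_insert_limit[OF I(2,3) s(1)])
      fix e' :: real assume "e' > 0"
      from \<delta>(9)[OF this] show "\<exists>\<eta>>0. \<forall>t\<in>I. \<bar>t - l0\<bar> < \<eta> \<longrightarrow> \<bar>s t - p0\<bar> < e'" using s(3) by blast
    qed
    then have ch: "continuous_on (insert l0 I) h" unfolding h_def[abs_def] Complex_eq by (intro continuous_intros)
    have hI: "h ` I \<subseteq> zeros - {z1, z2}"
    proof
      fix w assume "w \<in> h ` I"
      then obtain t where t: "t \<in> I" "w = h t" by blast
      then have w: "w = Complex t (s t)" "t \<noteq> l0" using I(3) by (auto simp: h_def)
      have st: "\<bar>s t - p0\<bar> < r" "shoot t (s t) = 0" using s(3)[OF t(1)] by (auto simp: zslice_def)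
      have "w \<in> T - ({z1, z2} - {x})" unfolding w using I(4)[OF t(1)] st \<delta> by (intro box) auto
      moreover have "w \<noteq> x" using w by (simp add: xe)
      moreover have "w \<in> zeros" using st \<delta>(5) by (auto simp: zeros_def w)
      ultimately show "w \<in> zeros - {z1, z2}" by blast
    qed
    have "connected (h ` I)" by (intro connected_continuous_image continuous_on_subset[OF ch] I(1)) auto
    moreover have hy: "h (Re y) = y" using I(3,7) s(2) by (auto simp: h_def complex_eq_iff)
    then have "y \<in> h ` I" using I(7) by force
    ultimately have hK: "h ` I \<subseteq> K" using connected_in_K[OF _ hI] y by blast
    have hT: "h ` I \<subseteq> T"
    proof
      fix w assume "w \<in> h ` I"
      then obtain t where t: "t \<in> I" "w = h t" by blast
      then have w: "w = Complex t (s t)" using I(3) by (auto simp: h_def)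
      have "w \<in> T - ({z1, z2} - {x})" unfolding w using I(4)[OF t(1)] s(3)[OF t(1)] \<delta>
        by (intro box) (auto simp: zslice_def)
      then show "w \<in> T" by simp
    qed
    have hl: "h l0 = x" by (simp add: h_def xe)
    let ?p = "\<lambda>t. h (linepath l0 (Re y) t)"
    have li: "linepath l0 (Re y) ` {0..1} \<subseteq> insert l0 I" using I(6) by (simp add: linepath_image_01)
    have "path ?p" unfolding path_def by (rule continuous_on_compose2[OF ch continuous_on_linepath li])
    moreover have "path_image ?p \<subseteq> v"
    proof
      fix w assume "w \<in> path_image ?p"
      then obtain t where "t \<in> insert l0 I" "w = h t" using li by (auto simp: path_image_def)
      then show "w \<in> v" using hK hT hl xK T(2) by auto
    qed
    moreover have "pathstart ?p = x" "pathfinish ?p = y" by (auto simp: pathstart_def pathfinish_def linepath_def hl hy)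
    ultimately show ?thesis by blast
  qed
  show "\<exists>u. openin (top_of_set K) u \<and> x \<in> u \<and> u \<subseteq> v \<and>
      (\<forall>y. y \<in> u \<longrightarrow> (\<exists>p. path p \<and> path_image p \<subseteq> v \<and> pathstart p = x \<and> pathfinish p = y))"
  proof (intro exI[of _ "K \<inter> B"] conjI allI impI)
    show "openin (top_of_set K) (K \<inter> B)" using oB by (auto simp: openin_open)
    show "x \<in> K \<inter> B" using xK \<delta> by (auto simp: B_def xe)
    show "K \<inter> B \<subseteq> v" using BT T(2) by auto
    fix y assume y: "y \<in> K \<inter> B"
    then have yB: "\<bar>Re y - l0\<bar> < \<delta>" "\<bar>Im y - p0\<bar> < r" "shoot (Re y) (Im y) = 0" by (auto simp: B_def zeros_def)
    consider "Re y = l0" | "Re y > l0" | "Re y < l0" by linarith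
    then show "\<exists>p. path p \<and> path_image p \<subseteq> v \<and> pathstart p = x \<and> pathfinish p = y"
    proof cases
      case 1
      then have "y = x" using \<delta>(8)[of "Im y"] yB by (simp add: xe complex_eq_iff)
      then show ?thesis using vx by (intro exI[of _ "linepath x x"]) auto
    next
      case 2
      show ?thesis
        by (rule branch[OF y, of "{l0<..<l0 + \<delta>}"]) (use 2 yB \<delta>(6) in \<open>auto simp: closed_segment_eq_real_ivl\<close>)
    next
      case 3
      show ?thesis
        by (rule branch[OF y, of "{l0 - \<delta><..<l0}"]) (use 3 yB \<delta>(7) in \<open>auto simp: closed_segment_eq_real_ivl\<close>)
    qed
  qed
qed

end

text \<open>Points directly above and below the centre belong to the closure of either half disc, so
  they can be joined while passing the centre on the left or on the right.\<close>

lemma connected_half_disc: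
  fixes x :: complex
  assumes \<eta>: "0 < \<eta>" "\<eta> < \<rho> / 2" and \<sigma>: "\<sigma> = 1 \<or> \<sigma> = -1"
  shows "connected ({w \<in> ball x \<rho>. \<sigma> * Re w < \<sigma> * Re x} \<union> {x + Complex 0 \<eta>, x - Complex 0 \<eta>})"
proof -
  let ?H = "{w \<in> ball x \<rho>. \<sigma> * Re w < \<sigma> * Re x}"
  have "?H = ball x \<rho> \<inter> {w. inner (complex_of_real \<sigma>) w < \<sigma> * Re x}" by (auto simp: inner_complex_def)
  then have cv: "convex ?H" by (simp add: convex_Int convex_halfspace_lt)
  have cl: "x + Complex 0 \<tau> \<in> closure ?H" if \<tau>: "\<bar>\<tau>\<bar> = \<eta>" for \<tau>
    unfolding closure_approachable
  proof (intro allI impI)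
    fix e :: real assume e: "e > 0"
    define t where "t = min e \<rho> / 2"
    have t: "0 < t" "t < e" "t \<le> \<rho> / 2" using e \<eta> by (auto simp: t_def)
    let ?y = "x + Complex (- \<sigma> * t) \<tau>"
    have "dist x ?y = cmod (Complex (- \<sigma> * t) \<tau>)" by (simp add: dist_norm norm_minus_commute)
    also have "\<dots> \<le> t + \<eta>" using cmod_le[of "Complex (- \<sigma> * t) \<tau>"] \<sigma> t \<tau> by (auto simp: abs_mult)
    finally have "?y \<in> ball x \<rho>" using t \<eta> by simp
    moreover have "\<sigma> * Re ?y < \<sigma> * Re x" using \<sigma> t by (auto simp: algebra_simps)
    moreover have "dist ?y (x + Complex 0 \<tau>) < e"
    proof -
      have "?y - (x + Complex 0 \<tau>) = Complex (- \<sigma> * t) 0" by (simp add: complex_eq_iff)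
      then have "dist ?y (x + Complex 0 \<tau>) = \<bar>- \<sigma> * t\<bar>" unfolding dist_norm by (simp add: complex_norm)
      then show ?thesis using \<sigma> t by (auto simp: abs_mult)
    qed
    ultimately show "\<exists>y\<in>?H. dist y (x + Complex 0 \<tau>) < e" by blast
  qed
  have "x - Complex 0 \<eta> = x + Complex 0 (- \<eta>)" by (simp add: complex_eq_iff)
  then have "x - Complex 0 \<eta> \<in> closure ?H" by (simp only:) (rule cl, use \<eta> in simp)
  moreover have "x + Complex 0 \<eta> \<in> closure ?H" using cl[of \<eta>] \<eta> by simp
  ultimately show ?thesis
    by (intro connected_intermediate_closure[OF convex_connected[OF cv]]) (auto intro: closure_subset[THEN subsetD])
qed

context two_arcs begin

text \<open>If the end points of the two arcs lay in different components of \<open>K\<close>, then cutting the first arc at a sign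
  change would write the zero set as a union of two compact sets meeting in a single point only. By Janiszewski's
  theorem the points just above and just below the cut could then be joined off the zero set.\<close>

lemma endpoints_joined:
  assumes ne: "z1 \<noteq> z2"
  shows "connected_component K z1 z2"
proof (rule ccontr)
  assume nc: "\<not> connected_component K z1 z2"
  let ?c1 = "closed_arc \<epsilon> q" and ?c2 = "closed_arc \<epsilon> q'"
  note c1 = continuous_on_closed_arc and c2 = two_arcs.continuous_on_closed_arc[OF swap]
  define A where "A = connected_component_set K z1"
  define B where "B = K - A"
  have lc: "locally connected K" by (rule locally_path_connected_imp_locally_connected[OF locally_path_connected_K])
  have AK: "A \<subseteq> K" unfolding A_def by (rule connected_component_subset)
  have cA: "compact A" unfolding A_def by (rule closedin_compact[OF compact_K closedin_connected_component])
  \<comment> \<open>Local connectedness makes the component open in K, so that its complement B is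
    compact as well.\<close>
  have "openin (top_of_set K) A" unfolding A_def by (rule openin_connected_component_locally_connected[OF lc])
  then have "closedin (top_of_set K) B" using AK by (auto simp: B_def closedin_def double_diff)
  then have cB: "compact B" by (rule closedin_compact[OF compact_K])
  have zA: "z1 \<in> A" "z2 \<notin> A" "z2 \<in> B" "z1 \<notin> B" using z1_in_K z2_in_K nc by (auto simp: A_def B_def)
  have AB: "A \<inter> B = {}" "A \<union> B = K" using AK by (auto simp: B_def)
  have "continuous_on {0..\<epsilon>} (\<lambda>l. ?c1 l - ?c2 l)" by (intro continuous_intros c1 c2)
  moreover have "norm (z1 - z2) > 0" using ne by simp
  moreover have "\<epsilon> \<in> {0..\<epsilon>}" using eps by simp
  ultimately obtain d where d: "d > 0" "\<And>l. l \<in> {0..\<epsilon>} \<Longrightarrow> dist l \<epsilon> < d \<Longrightarrow> dist (?c1 l - ?c2 l) (z1 - z2) < norm (z1 - z2)"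
    unfolding continuous_on_iff by blast
  have apart: "?c1 l \<noteq> ?c2 l" if "l \<in> {0..\<epsilon>}" "dist l \<epsilon> < d" for l
    using d(2)[OF that] by (auto simp: dist_norm norm_minus_commute)
  \<comment> \<open>Beyond this parameter the arcs do not meet at equal real parts, because their
    far ends differ.\<close>
  define l' where "l' = max 0 (\<epsilon> - d)"
  have l': "0 \<le> l'" "l' < \<epsilon>" using d eps by (auto simp: l'_def)
  obtain d0 where d0: "0 < d0" "d0 \<le> \<epsilon>" "\<And>l. l \<in> {0<..<d0} \<Longrightarrow> sign_change l (q l)"
    by (rule sign_change_near_origin) (rule that)
  have "\<exists>l\<in>{l'<..<\<epsilon>}. sign_change l (q l)"
    by (rule sign_change_persists[OF an(1)]) (use zero_props d0 l' in auto)
  then obtain l0 where l0: "l0 \<in> {l'<..<\<epsilon>}" "sign_change l0 (q l0)" by blast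
  have l0': "0 < l0" "l0 < \<epsilon>" using l0 l' by auto
  define x where "x = ?c1 l0"
  have xe: "x = Complex l0 (q l0)" using l0' by (simp add: x_def closed_arc_def)
  have xW: "x \<in> W" "x \<in> zeros" using closed_arc_in_W[of l0] closed_arc_in_zeros[of l0] l0' by (auto simp: x_def)
  have apart': "?c1 l \<noteq> ?c2 l" if "l \<in> {l0..\<epsilon>}" for l
    by (rule apart) (use that l0 l' in \<open>auto simp: l'_def dist_real_def\<close>)
  \<comment> \<open>A1 takes the first arc from the cut to its far end together with the component
    of that end, E takes everything else. The arcs may meet before the cut, where both belong to E,
    but not after it, so x is the only common point.\<close>
  define A1 where "A1 = A \<union> ?c1 ` {l0..\<epsilon>}"
  define E where "E = B \<union> ?c2 ` {0..\<epsilon>} \<union> ?c1 ` {0..l0}"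
  have cA1: "compact A1" unfolding A1_def
    by (intro compact_Un cA compact_continuous_image continuous_on_subset[OF c1]) (use l0' in auto)
  have cE: "compact E" unfolding E_def
    by (intro compact_Un cB compact_continuous_image continuous_on_subset[OF c1] c2) (use l0' in auto)
  have c1W: "?c1 l \<in> W" if "0 \<le> l" "l < \<epsilon>" for l using closed_arc_in_W[of l] that W(2) by (cases "l = 0") auto
  have c2W: "?c2 l \<in> W" if "0 \<le> l" "l < \<epsilon>" for l
    using two_arcs.closed_arc_in_W[OF swap, of l] that W(2) by (cases "l = 0") auto
  have inter: "A1 \<inter> E = {x}"
  proof (intro equalityI subsetI)
    fix w assume w: "w \<in> A1 \<inter> E"
    show "w \<in> {x}"
    proof (cases "w \<in> A")
      case True
      then have wK: "w \<notin> W" using AK by auto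
      have "w \<notin> B" using True AB by auto
      moreover have "w \<notin> ?c2 ` {0..\<epsilon>}"
      proof
        assume "w \<in> ?c2 ` {0..\<epsilon>}"
        then obtain l where l: "0 \<le> l" "l \<le> \<epsilon>" "w = ?c2 l" by auto
        then show False using c2W[of l] wK True zA(2) by (cases "l < \<epsilon>") auto
      qed
      moreover have "w \<notin> ?c1 ` {0..l0}" using c1W wK l0' by auto
      ultimately show ?thesis using w by (auto simp: E_def)
    next
      case False
      then obtain l where l: "l0 \<le> l" "l \<le> \<epsilon>" "w = ?c1 l" using w by (auto simp: A1_def)
      have "w \<notin> B"
      proof
        assume "w \<in> B"
        then have "w \<notin> W" using AB by auto
        then show False using c1W[of l] l l0' zA(4) \<open>w \<in> B\<close> by (cases "l < \<epsilon>") auto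
      qed
      moreover have "w \<notin> ?c2 ` {0..\<epsilon>}"
      proof
        assume "w \<in> ?c2 ` {0..\<epsilon>}"
        then obtain m where "w = ?c2 m" by auto
        moreover have "Re w = l" using l by simp
        ultimately have "?c1 l = ?c2 l" using l by simp
        then show False using apart'[of l] l by auto
      qed
      ultimately obtain m where m: "0 \<le> m" "m \<le> l0" "w = ?c1 m" using w by (auto simp: E_def)
      then have "m = l" using l by (metis Re_closed_arc)
      then show ?thesis using m l by (simp add: x_def)
    qed
  next
    fix w assume "w \<in> {x}"
    then show "w \<in> A1 \<inter> E" using l0' by (auto simp: A1_def E_def x_def)
  qed
  have split: "{0..\<epsilon>} = insert 0 (insert \<epsilon> {0<..<\<epsilon>})" using eps by auto
  have "A1 \<union> E = K \<union> ?c2 ` {0..\<epsilon>} \<union> ?c1 ` ({0..l0} \<union> {l0..\<epsilon>})" using AB by (auto simp: A1_def E_def)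
  also have "{0..l0} \<union> {l0..\<epsilon>} = {0..\<epsilon>}" using l0' by auto
  also have "K \<union> ?c2 ` {0..\<epsilon>} \<union> ?c1 ` {0..\<epsilon>} = insert 0 (K \<union> (zeros \<inter> W))"
    unfolding split zeros_Int_W using z1_in_K z2_in_K by auto
  also have "\<dots> = insert 0 zeros" by auto
  finally have un: "A1 \<union> E = insert 0 zeros" .
  have "compact (A \<union> (B \<union> ?c2 ` {0..\<epsilon>}))" by (intro compact_Un cA cB compact_continuous_image c2) auto
  then have o: "open (- (A \<union> (B \<union> ?c2 ` {0..\<epsilon>})))" by (rule open_Compl[OF compact_imp_closed])
  have "x \<notin> ?c2 ` {0..\<epsilon>}"
  proof
    assume "x \<in> ?c2 ` {0..\<epsilon>}"
    then obtain m where m: "x = ?c2 m" by auto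
    then have "m = l0" by (metis Re_closed_arc x_def)
    then show False using apart'[of l0] m l0' by (auto simp: x_def)
  qed
  then have "x \<in> - (A \<union> (B \<union> ?c2 ` {0..\<epsilon>}))" using xW AB by auto
  with o obtain \<rho> where \<rho>: "\<rho> > 0" "ball x \<rho> \<subseteq> - (A \<union> (B \<union> ?c2 ` {0..\<epsilon>}))" using open_contains_ball by blast
  obtain e s where e: "e > 0" "s = 1 \<or> s = (-1::real)" "\<And>y. 0 < \<bar>y - q l0\<bar> \<Longrightarrow> \<bar>y - q l0\<bar> < e \<Longrightarrow> s * (y - q l0) * shoot l0 y > 0"
    using l0(2) unfolding sign_change_def by blast
  have q0: "q l0 > 0" using zero_props(1)[of l0] l0' by auto
  \<comment> \<open>The points above and below the cut must lie in the half discs, within the range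
    of the sign change, and in the upper half plane.\<close>
  define \<eta> where "\<eta> = min (min \<rho> e) (q l0) / 3"
  have \<eta>: "0 < \<eta>" "\<eta> < \<rho> / 2" "\<eta> < e" "\<eta> < q l0" using \<rho> e q0 by (auto simp: \<eta>_def min_def)
  define a where "a = x + Complex 0 \<eta>" define b where "b = x - Complex 0 \<eta>"
  have ab: "Re a = l0" "Im a = q l0 + \<eta>" "Re b = l0" "Im b = q l0 - \<eta>" by (simp_all add: a_def b_def xe)
  have nx: "a \<noteq> x" "b \<noteq> x" using ab \<eta> by (auto simp: xe complex_eq_iff)
  have na: "a \<in> ball x \<rho>" "b \<in> ball x \<rho>" using \<eta> by (auto simp: a_def b_def dist_norm complex_norm)
  \<comment> \<open>Close to x the set A1 continues only to the right and E only to the left,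
    because the arcs are graphs over l. So a and b are joined through the left half disc off A1 and
    through the right one off E.\<close>
  have ccA: "connected_component (- A1) a b"
    unfolding connected_component_def
  proof (intro exI conjI)
    show "connected ({w \<in> ball x \<rho>. 1 * Re w < 1 * Re x} \<union> {a, b})"
      unfolding a_def b_def by (rule connected_half_disc[OF \<eta>(1,2)]) simp
    show "{w \<in> ball x \<rho>. 1 * Re w < 1 * Re x} \<union> {a, b} \<subseteq> - A1"
    proof
      fix w assume w: "w \<in> {w \<in> ball x \<rho>. 1 * Re w < 1 * Re x} \<union> {a, b}"
      then have "w \<in> ball x \<rho>" "Re w \<le> l0" "w \<noteq> x" using na ab nx by (auto simp: xe)
      moreover have "w \<notin> ?c1 ` {l0..\<epsilon>}"
      proof
        assume "w \<in> ?c1 ` {l0..\<epsilon>}"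
        then obtain m where m: "l0 \<le> m" "w = ?c1 m" by auto
        then have "m = l0" using \<open>Re w \<le> l0\<close> by simp
        then show False using m \<open>w \<noteq> x\<close> by (simp add: x_def)
      qed
      ultimately show "w \<in> - A1" using \<rho>(2) by (auto simp: A1_def)
    qed
  qed auto
  have ccE: "connected_component (- E) a b"
    unfolding connected_component_def
  proof (intro exI conjI)
    show "connected ({w \<in> ball x \<rho>. - 1 * Re w < - 1 * Re x} \<union> {a, b})"
      unfolding a_def b_def by (rule connected_half_disc[OF \<eta>(1,2)]) simp
    show "{w \<in> ball x \<rho>. - 1 * Re w < - 1 * Re x} \<union> {a, b} \<subseteq> - E"
    proof
      fix w assume w: "w \<in> {w \<in> ball x \<rho>. - 1 * Re w < - 1 * Re x} \<union> {a, b}"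
      then have "w \<in> ball x \<rho>" "Re w \<ge> l0" "w \<noteq> x" using na ab nx by (auto simp: xe)
      moreover have "w \<notin> ?c1 ` {0..l0}"
      proof
        assume "w \<in> ?c1 ` {0..l0}"
        then obtain m where m: "m \<le> l0" "w = ?c1 m" by auto
        then have "m = l0" using \<open>Re w \<ge> l0\<close> by simp
        then show False using m \<open>w \<noteq> x\<close> by (simp add: x_def)
      qed
      ultimately show "w \<in> - E" using \<rho>(2) by (auto simp: E_def)
    qed
  qed auto
  have cc: "connected_component (- insert 0 zeros) a b"
    unfolding un[symmetric]
    by (rule Janiszewski[OF cA1 compact_imp_closed[OF cE] _ ccA ccE]) (simp add: inter)
  have sg: "s * \<eta> * shoot l0 (q l0 + \<eta>) > 0" "s * (- \<eta>) * shoot l0 (q l0 - \<eta>) > 0"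
    using e(3)[of "q l0 + \<eta>"] e(3)[of "q l0 - \<eta>"] \<eta> by auto
  from e(2) show False
  proof
    assume "s = 1"
    then have "a \<in> pos_side" "b \<in> neg_side" using sg \<eta> q0 ab
      by (auto simp: pos_side_def neg_side_def zero_less_mult_iff mult_less_0_iff)
    then show False by (rule sides_separated[OF cc])
  next
    assume "s = -1"
    then have "b \<in> pos_side" "a \<in> neg_side" using sg \<eta> q0 ab
      by (auto simp: pos_side_def neg_side_def zero_less_mult_iff mult_less_0_iff)
    then show False by (rule sides_separated[OF connected_component_sym[OF cc]])
  qed
qed

end

section \<open>Closing the loop\<close>

lemma locally_inj_onI:
  assumes "\<And>t. t \<in> S \<Longrightarrow> \<exists>U. open U \<and> t \<in> U \<and> inj_on f (S \<inter> U)"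
  shows "locally_inj_on f S"
  unfolding locally_inj_on_def
proof
  fix t assume "t \<in> S"
  from assms[OF this] obtain U where U: "open U" "t \<in> U" "inj_on f (S \<inter> U)" by blast
  then obtain r where "r > 0" "ball t r \<subseteq> U" using open_contains_ball by blast
  then show "\<exists>r>0. inj_on f (S \<inter> ball t r)" using inj_on_subset[OF U(3), of "S \<inter> ball t r"] by blast
qed

lemma locally_ordered_on_subset:
  assumes lo: "locally_ordered_on I Z" and JI: "J \<subseteq> I"
  shows "locally_ordered_on J Z"
proof -
  have "\<exists>\<eta>>0. \<forall>x\<in>J. \<bar>x - x1\<bar> < \<eta> \<longrightarrow>
    (\<exists>h. bij_betw h (Z x1) (Z x) \<and> strict_mono_on (Z x1) h \<and> (\<forall>y\<in>Z x1. \<bar>h y - y\<bar> < e))" if "x1 \<in> J" "e > 0" for x1 e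
  proof -
    have "x1 \<in> I" using that JI by blast
    then have "\<exists>\<eta>>0. \<forall>x\<in>I. \<bar>x - x1\<bar> < \<eta> \<longrightarrow>
      (\<exists>h. bij_betw h (Z x1) (Z x) \<and> strict_mono_on (Z x1) h \<and> (\<forall>y\<in>Z x1. \<bar>h y - y\<bar> < e))"
      using lo that(2) unfolding locally_ordered_on_def by simp
    then show ?thesis using JI by (elim exE conjE) (rule exI, erule conjI, blast)
  qed
  then show ?thesis using lo JI unfolding locally_ordered_on_def by blast
qed

context two_arcs begin

text \<open>Close to the common far end both arcs are sections of the same ordered family, so
  meeting at one point makes them equal up to the end. This gives local injectivity where the curve
  turns from one arc into the other.\<close>

lemma arcs_distinct_near_common_end:
  assumes eq: "z1 = z2"
  obtains b where "0 \<le> b" "b < \<epsilon>" "\<And>l. l \<in> {b<..<\<epsilon>} \<Longrightarrow> q l \<noteq> q' l"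
proof -
  obtain p where p: "p > 0" "shoot \<epsilon> p = 0" "(q \<longlongrightarrow> p) (at_left \<epsilon>)" by (rule endpoint_limit) (rule that)
  obtain p' where p': "(q' \<longlongrightarrow> p') (at_left \<epsilon>)" by (rule two_arcs.endpoint_limit[OF swap]) (rule that)
  have "Lim (at_left \<epsilon>) q = p" "Lim (at_left \<epsilon>) q' = p'" by (rule tendsto_Lim[OF _ p(3)], simp, rule tendsto_Lim[OF _ p'], simp)
  then have pp: "p' = p" using eq eps by (simp add: closed_arc_def)
  obtain \<delta> r where \<delta>: "0 < \<delta>" "0 < r" "locally_ordered_on {\<epsilon> - \<delta><..<\<epsilon>} (zslice p r)"
    by (rule zero_branches[of p \<epsilon> 1]) (use p in simp, use p in simp, simp, rule that)
  have "\<forall>\<^sub>F l in at_left \<epsilon>. dist (q l) p < r \<and> dist (q' l) p < r"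
    using tendstoD[OF p(3) \<delta>(2)] tendstoD[OF p'[unfolded pp] \<delta>(2)] by eventually_elim simp
  then obtain b0 where b0: "b0 < \<epsilon>" "\<And>l. b0 < l \<Longrightarrow> l < \<epsilon> \<Longrightarrow> dist (q l) p < r \<and> dist (q' l) p < r"
    unfolding eventually_at_left_field by blast
  define b where "b = max (max 0 b0) (\<epsilon> - \<delta>)"
  have b: "0 \<le> b" "b < \<epsilon>" "b0 \<le> b" "\<epsilon> - \<delta> \<le> b" using b0 eps \<delta> by (auto simp: b_def)
  have lo: "locally_ordered_on {b<..<\<epsilon>} (zslice p r)" by (rule locally_ordered_on_subset[OF \<delta>(3)]) (use b in auto)
  have qz: "q l \<in> zslice p r l" "q' l \<in> zslice p r l" if "l \<in> {b<..<\<epsilon>}" for l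
    using b0(2)[of l] zero_props(2,4)[of l] that b by (auto simp: zslice_def dist_real_def)
  have cq: "continuous_on {b<..<\<epsilon>} q" "continuous_on {b<..<\<epsilon>} q'"
    by (rule continuous_on_subset[OF cont(1)], use b in auto, rule continuous_on_subset[OF cont(2)], use b in auto)
  have "q l \<noteq> q' l" if l: "l \<in> {b<..<\<epsilon>}" for l
  proof
    assume e: "q l = q' l"
    have "q x = q' x" if "x \<in> {b<..<\<epsilon>}" for x
      by (rule continuous_sections_unique[OF _ lo cq(1) qz(1) cq(2) qz(2) l e that]) auto
    then show False using arcs_not_eventually_equal[OF b(1,2) order_refl] by blast
  qed
  then show ?thesis using that b by blast
qed

lemma global_curve:
  obtains T g where "\<epsilon> < T" "continuous_on {0<..<T} g" "g ` {0<..<T} \<subseteq> zeros" "locally_inj_on g {0<..<T}"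
    "\<And>t. t \<in> {0<..<\<epsilon>} \<Longrightarrow> g t = Complex t (q t)" "\<And>t. t \<in> {0<..<\<epsilon>} \<Longrightarrow> g (T - t) = Complex t (q' t)"
proof (cases "z1 = z2")
  case True
  let ?c1 = "closed_arc \<epsilon> q" and ?c2 = "closed_arc \<epsilon> q'"
  note c1 = continuous_on_closed_arc and c2 = two_arcs.continuous_on_closed_arc[OF swap]
  obtain b where b: "0 \<le> b" "b < \<epsilon>" "\<And>l. l \<in> {b<..<\<epsilon>} \<Longrightarrow> q l \<noteq> q' l"
    by (rule arcs_distinct_near_common_end[OF True]) (rule that)
  \<comment> \<open>The far ends coincide: the curve runs along the first arc and returns at once
    along the second.\<close>
  define T where "T = 2 * \<epsilon>"
  define g where "g t = (if t \<le> \<epsilon> then ?c1 t else ?c2 (T - t))" for t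
  have gl: "g t = ?c1 t" if "t \<le> \<epsilon>" for t using that by (simp add: g_def)
  have gr: "g t = ?c2 (T - t)" if "t \<ge> \<epsilon>" for t using that True by (cases "t = \<epsilon>") (auto simp: g_def T_def)
  have "continuous_on {0..\<epsilon>} g" using c1 by (rule continuous_on_eq) (simp add: gl)
  moreover have "continuous_on {\<epsilon>..T} (\<lambda>t. ?c2 (T - t))"
    by (rule continuous_on_compose2[OF c2]) (auto simp: T_def intro!: continuous_intros)
  then have "continuous_on {\<epsilon>..T} g" by (rule continuous_on_eq) (simp add: gr)
  ultimately have "continuous_on ({0..\<epsilon>} \<union> {\<epsilon>..T}) g" by (intro continuous_on_closed_Un) auto
  then have cg: "continuous_on {0<..<T} g" by (rule continuous_on_subset) auto
  have gz: "g ` {0<..<T} \<subseteq> zeros"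
  proof
    fix w assume "w \<in> g ` {0<..<T}"
    then obtain t where t: "0 < t" "t < T" "w = g t" by auto
    then show "w \<in> zeros"
      using closed_arc_in_zeros[of t] two_arcs.closed_arc_in_zeros[OF swap, of "T - t"] by (auto simp: g_def T_def)
  qed
  have injl: "inj_on g {..\<epsilon>}" by (rule inj_onI) (metis Re_closed_arc atMost_iff gl)
  have injr: "inj_on g {\<epsilon>..}" by (rule inj_onI) (metis Re_closed_arc atLeast_iff gr diff_left_imp_eq)
  have "locally_inj_on g {0<..<T}"
  proof (rule locally_inj_onI)
    fix t assume t: "t \<in> {0<..<T}"
    consider "t < \<epsilon>" | "t > \<epsilon>" | "t = \<epsilon>" by linarith
    then show "\<exists>U. open U \<and> t \<in> U \<and> inj_on g ({0<..<T} \<inter> U)"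
    proof cases
      case 1
      moreover have "inj_on g ({0<..<T} \<inter> {..<\<epsilon>})" by (rule inj_on_subset[OF injl]) auto
      ultimately show ?thesis by (intro exI[of _ "{..<\<epsilon>}"]) auto
    next
      case 2
      moreover have "inj_on g ({0<..<T} \<inter> {\<epsilon><..})" by (rule inj_on_subset[OF injr]) auto
      ultimately show ?thesis by (intro exI[of _ "{\<epsilon><..}"]) auto
    next
      case 3
      \<comment> \<open>A common value on the two sides of the turning point would have a single
        real part t and be a meeting point of the arcs with t > b.\<close>
      have ne: "g t \<noteq> g s" if "b < t" "t < \<epsilon>" "\<epsilon> < s" "s < T - b" for t s
      proof
        assume h: "g t = g s"
        have "Re (g t) = t" "Re (g s) = T - s" using that by (auto simp: gl gr)
        then have "t = T - s" using h by simp
        then have "?c1 t = ?c2 t" using h that by (simp add: gl gr)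
        then have "q t = q' t" using that b(1) by (simp add: closed_arc_def)
        then show False using b(3)[of t] that by auto
      qed
      have "inj_on g ({b<..\<epsilon>} \<union> {\<epsilon>..<T - b})"
        unfolding inj_on_Un
      proof (intro conjI)
        show "inj_on g {b<..\<epsilon>}" by (rule inj_on_subset[OF injl]) auto
        show "inj_on g {\<epsilon>..<T - b}" by (rule inj_on_subset[OF injr]) auto
        show "g ` ({b<..\<epsilon>} - {\<epsilon>..<T - b}) \<inter> g ` ({\<epsilon>..<T - b} - {b<..\<epsilon>}) = {}"
        proof (rule equals0I)
          fix w assume "w \<in> g ` ({b<..\<epsilon>} - {\<epsilon>..<T - b}) \<inter> g ` ({\<epsilon>..<T - b} - {b<..\<epsilon>})"
          then obtain t s where ts: "t \<in> {b<..\<epsilon>} - {\<epsilon>..<T - b}" "s \<in> {\<epsilon>..<T - b} - {b<..\<epsilon>}" "w = g t" "w = g s" by blast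
          then have "b < t" "t < \<epsilon>" "\<epsilon> < s" "s < T - b" using b by (auto simp: T_def)
          then show False using ne ts by metis
        qed
      qed
      moreover have "{0<..<T} \<inter> {b<..<T - b} \<subseteq> {b<..\<epsilon>} \<union> {\<epsilon>..<T - b}" by auto
      ultimately have "inj_on g ({0<..<T} \<inter> {b<..<T - b})" by (rule inj_on_subset)
      then show ?thesis using 3 b by (intro exI[of _ "{b<..<T - b}"]) (auto simp: T_def)
    qed
  qed
  moreover have "g t = Complex t (q t)" if "t \<in> {0<..<\<epsilon>}" for t using that by (simp add: gl closed_arc_def)
  moreover have "g (T - t) = Complex t (q' t)" if "t \<in> {0<..<\<epsilon>}" for t
  proof -
    have "g (T - t) = ?c2 (T - (T - t))" by (rule gr) (use that in \<open>simp add: T_def\<close>)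
    then show ?thesis using that by (simp add: closed_arc_def)
  qed
  moreover have "\<epsilon> < T" using eps by (simp add: T_def)
  ultimately show ?thesis using that cg gz by blast
next
  case False
  let ?c1 = "closed_arc \<epsilon> q" and ?c2 = "closed_arc \<epsilon> q'"
  note c1 = continuous_on_closed_arc and c2 = two_arcs.continuous_on_closed_arc[OF swap]
  have "path_component K z1 z2"
    using endpoints_joined[OF False] by (simp add: path_component_eq_connected_component[OF locally_path_connected_K])
  then obtain p where p: "path p" "path_image p \<subseteq> K" "pathstart p = z1" "pathfinish p = z2"
    unfolding path_component_def by blast
  \<comment> \<open>The path in K is thinned out to an injective one.\<close>
  obtain h where h: "arc h" "path_image h \<subseteq> path_image p" "pathstart h = z1" "pathfinish h = z2"
    by (rule path_contains_arc[OF p(1,3,4) False]) (rule that)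
  have h01: "h 0 = z1" "h 1 = z2" using h by (auto simp: pathstart_def pathfinish_def)
  have hK: "h s \<in> K" if "s \<in> {0..1}" for s using subset_trans[OF h(2) p(2)] that unfolding path_image_def by blast
  have hi: "inj_on h {0..1}" and hc: "continuous_on {0..1} h" using h(1) by (auto simp: arc_def path_def)
  \<comment> \<open>The additional unit of time is spent on the connecting arc h.\<close>
  define T where "T = 2 * \<epsilon> + 1"
  define g where "g t = (if t < \<epsilon> then ?c1 t else if t \<le> \<epsilon> + 1 then h (t - \<epsilon>) else ?c2 (T - t))" for t
  have gl: "g t = ?c1 t" if "t \<le> \<epsilon>" for t using that h01 by (cases "t = \<epsilon>") (auto simp: g_def)
  have gm: "g t = h (t - \<epsilon>)" if "t \<in> {\<epsilon>..\<epsilon> + 1}" for t using that by (simp add: g_def)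
  have gr: "g t = ?c2 (T - t)" if "t \<ge> \<epsilon> + 1" for t using that h01 eps by (cases "t = \<epsilon> + 1") (auto simp: g_def T_def)
  have "continuous_on {0..\<epsilon>} g" using c1 by (rule continuous_on_eq) (simp add: gl)
  moreover have "continuous_on {\<epsilon>..\<epsilon> + 1} (\<lambda>t. h (t - \<epsilon>))"
    by (rule continuous_on_compose2[OF hc]) (auto intro!: continuous_intros)
  then have "continuous_on {\<epsilon>..\<epsilon> + 1} g" by (rule continuous_on_eq) (simp add: gm)
  moreover have "continuous_on {\<epsilon> + 1..T} (\<lambda>t. ?c2 (T - t))"
    by (rule continuous_on_compose2[OF c2]) (auto simp: T_def intro!: continuous_intros)
  then have "continuous_on {\<epsilon> + 1..T} g" by (rule continuous_on_eq) (simp add: gr)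
  ultimately have "continuous_on ({0..\<epsilon>} \<union> ({\<epsilon>..\<epsilon> + 1} \<union> {\<epsilon> + 1..T})) g" by (intro continuous_on_closed_Un closed_Un) auto
  then have cg: "continuous_on {0<..<T} g" by (rule continuous_on_subset) auto
  have gW: "g t \<in> zeros \<inter> W" if "0 < t" "t < T" "t \<notin> {\<epsilon>..\<epsilon> + 1}" for t
  proof (cases "t < \<epsilon>")
    case True
    then show ?thesis using that closed_arc_in_W[of t] closed_arc_in_zeros[of t] by (auto simp: gl)
  next
    case False
    then have "T - t \<in> {0<..<\<epsilon>}" "g t = ?c2 (T - t)" using that gr by (auto simp: T_def)
    then show ?thesis using two_arcs.closed_arc_in_W[OF swap, of "T - t"] two_arcs.closed_arc_in_zeros[OF swap, of "T - t"] by auto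
  qed
  have gK: "g t \<in> K" if "t \<in> {\<epsilon>..\<epsilon> + 1}" for t using gm[OF that] hK[of "t - \<epsilon>"] that by auto
  have "g t \<in> zeros" if "t \<in> {0<..<T}" for t
    using gW[of t] gK[of t] that by (cases "t \<in> {\<epsilon>..\<epsilon> + 1}") auto
  then have gz: "g ` {0<..<T} \<subseteq> zeros" by blast
  have injm: "inj_on g {\<epsilon>..\<epsilon> + 1}"
  proof (rule inj_onI)
    fix x y assume xy: "x \<in> {\<epsilon>..\<epsilon> + 1}" "y \<in> {\<epsilon>..\<epsilon> + 1}" "g x = g y"
    have "x - \<epsilon> = y - \<epsilon>" by (rule inj_onD[OF hi]) (use xy gm in auto)
    then show "x = y" by simp
  qed
  have injl: "inj_on g {0<..<\<epsilon>}" by (rule inj_onI) (metis Re_closed_arc greaterThanLessThan_iff gl less_imp_le)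
  have injr: "inj_on g {\<epsilon> + 1<..<T}" by (rule inj_onI) (metis Re_closed_arc greaterThanLessThan_iff gr diff_left_imp_eq less_imp_le)
  have disj: "g x \<noteq> g y" if "x \<in> {0<..<T} - {\<epsilon>..\<epsilon> + 1}" "y \<in> {\<epsilon>..\<epsilon> + 1}" for x y
    using gW[of x] gK[of y] that by auto
  have "inj_on g ({0<..<\<epsilon>} \<union> {\<epsilon>..\<epsilon> + 1})"
    unfolding inj_on_Un
  proof (intro conjI injl injm equals0I)
    fix w assume "w \<in> g ` ({0<..<\<epsilon>} - {\<epsilon>..\<epsilon> + 1}) \<inter> g ` ({\<epsilon>..\<epsilon> + 1} - {0<..<\<epsilon>})"
    then obtain x y where "x \<in> {0<..<\<epsilon>}" "y \<in> {\<epsilon>..\<epsilon> + 1}" "g x = g y" by fastforce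
    then show False using disj[of x y] eps by (auto simp: T_def)
  qed
  \<comment> \<open>The arcs may cross each other, so injectivity is shown separately up to the
    beginning of the second arc and from the end of the first. These two domains cover (0, T), and
    on each of them arc and connecting piece are disjoint, one lying in W and the other in
    K.\<close>
  then have inj1: "inj_on g ({0<..<T} \<inter> {..<\<epsilon> + 1})" by (rule inj_on_subset) auto
  have "inj_on g ({\<epsilon>..\<epsilon> + 1} \<union> {\<epsilon> + 1<..<T})"
    unfolding inj_on_Un
  proof (intro conjI injr injm equals0I)
    fix w assume "w \<in> g ` ({\<epsilon>..\<epsilon> + 1} - {\<epsilon> + 1<..<T}) \<inter> g ` ({\<epsilon> + 1<..<T} - {\<epsilon>..\<epsilon> + 1})"
    then obtain x y where "x \<in> {\<epsilon> + 1<..<T}" "y \<in> {\<epsilon>..\<epsilon> + 1}" "g x = g y" by fastforce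
    then show False using disj[of x y] eps by (auto simp: T_def)
  qed
  then have inj2: "inj_on g ({0<..<T} \<inter> {\<epsilon><..})" by (rule inj_on_subset) auto
  note inj = inj1 inj2
  have "locally_inj_on g {0<..<T}"
  proof (rule locally_inj_onI)
    fix t assume t: "t \<in> {0<..<T}"
    show "\<exists>U. open U \<and> t \<in> U \<and> inj_on g ({0<..<T} \<inter> U)"
    proof (cases "t < \<epsilon> + 1")
      case True
      then show ?thesis using inj(1) by (intro exI[of _ "{..<\<epsilon> + 1}"]) auto
    next
      case False
      then show ?thesis using inj(2) by (intro exI[of _ "{\<epsilon><..}"]) auto
    qed
  qed
  moreover have "g t = Complex t (q t)" if "t \<in> {0<..<\<epsilon>}" for t using that by (simp add: gl closed_arc_def)
  moreover have "g (T - t) = Complex t (q' t)" if "t \<in> {0<..<\<epsilon>}" for t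
  proof -
    have "g (T - t) = ?c2 (T - (T - t))" by (rule gr) (use that in \<open>simp add: T_def\<close>)
    then show ?thesis using that by (simp add: closed_arc_def)
  qed
  moreover have "\<epsilon> < T" using eps by (simp add: T_def)
  ultimately show ?thesis using that cg gz by blast
qed

end

section \<open>Transfer between the plane and the solution set\<close>

lemma arc_data:
  assumes eps: "\<epsilon> > 0"
    and an: "\<And>i::nat. i \<in> {1, 2} \<Longrightarrow> real_analytic_on (arc_of (u i)) {0<..<\<epsilon>}"
    and ps: "\<And>i. i \<in> {1, 2} \<Longrightarrow> arc_of (u i) ` {0<..<\<epsilon>} \<subseteq> positive_solutions"
    and l0: "\<And>i. i \<in> {1, 2} \<Longrightarrow> (u i \<longlongrightarrow> 0) (at_right 0)"
    and N: "open N" "(0, 0) \<in> N" "positive_solutions \<inter> N = arc_of (u 1) ` {0<..<\<epsilon>} \<union> arc_of (u 2) ` {0<..<\<epsilon>}"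
  obtains W where "two_arcs \<epsilon> (\<lambda>l. init_slope (u 1 l)) (\<lambda>l. init_slope (u 2 l)) W"
proof -
  interpret init: bounded_linear init_slope by (rule bounded_linear_init_slope)
  define q where "q i l = init_slope (u i l)" for i l
  have sol: "(l, u i l) \<in> positive_solutions" if "i \<in> {1, 2}" "l \<in> {0<..<\<epsilon>}" for i l
    using ps[OF that(1)] that(2) by (auto simp: arc_of_def)
  have z: "Complex l (q i l) \<in> zeros" "solution_at (Complex l (q i l)) = arc_of (u i) l" if "i \<in> {1, 2}" "l \<in> {0<..<\<epsilon>}" for i l
    using positive_solution_zero[OF sol[OF that]] by (auto simp: q_def arc_of_def)
  have ana: "analytic_real (q i) {0<..<\<epsilon>}" if i: "i \<in> {1, 2}" for i
    unfolding analytic_real_def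
  proof
    fix t0 assume "t0 \<in> {0<..<\<epsilon>}"
    then obtain r a where r: "r > 0" "\<And>t. \<bar>t - t0\<bar> < r \<Longrightarrow> (\<lambda>n. (t - t0) ^ n *\<^sub>R a n) sums arc_of (u i) t"
      using an[OF i] unfolding real_analytic_on_def by blast
    have "(\<lambda>n. init_slope (snd (a n)) * (t - t0) ^ n) sums q i t" if "\<bar>t - t0\<bar> < r" for t
    proof -
      have "(\<lambda>n. snd ((t - t0) ^ n *\<^sub>R a n)) sums snd (arc_of (u i) t)" by (rule bounded_linear.sums[OF bounded_linear_snd r(2)[OF that]])
      from init.sums[OF this] show ?thesis by (simp add: arc_of_def q_def init.scaleR mult.commute)
    qed
    then show "\<exists>r>0. \<exists>c. \<forall>t. \<bar>t - t0\<bar> < r \<longrightarrow> (\<lambda>n. c n * (t - t0) ^ n) sums q i t"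
      using r(1) by (intro exI[of _ r] conjI exI[of _ "\<lambda>n. init_slope (snd (a n))"]) auto
  qed
  have con: "continuous_on {0<..<\<epsilon>} (q i)" if i: "i \<in> {1, 2}" for i
  proof (rule continuous_at_imp_continuous_on, rule ballI)
    fix t0 assume t0: "t0 \<in> {0<..<\<epsilon>}"
    obtain r g where r: "r > 0" "g holomorphic_on ball (of_real t0) r" "\<And>t. \<bar>t - t0\<bar> < r \<Longrightarrow> g (of_real t) = complex_of_real (q i t)"
      by (rule analytic_real_extension[OF ana[OF i] t0]) (rule that)
    have "continuous_on (ball t0 r) (\<lambda>t. Re (g (of_real t)))"
      by (intro continuous_intros continuous_on_compose2[OF holomorphic_on_imp_continuous_on[OF r(2)]])
        (auto simp: dist_norm simp flip: of_real_diff)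
    then have "continuous_on (ball t0 r) (q i)"
      by (rule continuous_on_eq) (auto simp: r(3) dist_real_def abs_minus_commute)
    then show "isCont (q i) t0" using r(1) by (simp add: continuous_on_eq_continuous_at)
  qed
  have lim: "(q i \<longlongrightarrow> 0) (at_right 0)" if "i \<in> {1, 2}" for i
    using init.tendsto[OF l0[OF that]] by (simp add: q_def[abs_def] init.zero)
  let ?G = "{z. shoot (Re z) (Im z) = 0}"
  have "openin (top_of_set ?G) (?G \<inter> solution_at -` N)"
    by (rule continuous_openin_preimage_gen[OF continuous_on_solution_at N(1)])
  \<comment> \<open>The map \<open>solution_at\<close> is continuous also at the vertex, where slope
    0 gives the zero solution. The neighbourhood N thus pulls back to a relatively open set
    containing 0, and W is a planar open set inducing it.\<close>
  then obtain W where W: "open W" "?G \<inter> solution_at -` N = ?G \<inter> W" by (auto simp: openin_open)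
  have "0 \<in> ?G \<inter> solution_at -` N" using N(2) by (simp add: solution_at_def sol_zero_slope)
  then have W0: "0 \<in> W" using W(2) by auto
  have zG: "zeros \<subseteq> ?G" by (auto simp: zeros_def)
  have "zeros \<inter> W = (\<lambda>l. Complex l (q 1 l)) ` {0<..<\<epsilon>} \<union> (\<lambda>l. Complex l (q 2 l)) ` {0<..<\<epsilon>}"
  proof (intro equalityI subsetI)
    fix w assume w: "w \<in> zeros \<inter> W"
    then have "solution_at w \<in> N" using W(2) zG by blast
    then have "solution_at w \<in> arc_of (u 1) ` {0<..<\<epsilon>} \<union> arc_of (u 2) ` {0<..<\<epsilon>}"
      using solution_at_zeros[of w] w N(3) by blast
    then obtain i l where il: "i \<in> {1, 2}" "l \<in> {0<..<\<epsilon>}" "solution_at w = arc_of (u i) l" by blast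
    \<comment> \<open>Injectivity of \<open>solution_at\<close> brings the description of the
      solutions in N back to the plane.\<close>
    then have "w = Complex l (q i l)" using inj_onD[OF inj_on_solution_at, of w "Complex l (q i l)"] z[OF il(1,2)] w by auto
    then show "w \<in> (\<lambda>l. Complex l (q 1 l)) ` {0<..<\<epsilon>} \<union> (\<lambda>l. Complex l (q 2 l)) ` {0<..<\<epsilon>}" using il by blast
  next
    fix w assume "w \<in> (\<lambda>l. Complex l (q 1 l)) ` {0<..<\<epsilon>} \<union> (\<lambda>l. Complex l (q 2 l)) ` {0<..<\<epsilon>}"
    then obtain i l where il: "i \<in> {1, 2}" "l \<in> {0<..<\<epsilon>}" "w = Complex l (q i l)" by blast
    have "arc_of (u i) l \<in> N" using N(3) il by blast
    then have "w \<in> ?G \<inter> solution_at -` N" using z[OF il(1,2)] il(3) zG by auto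
    then show "w \<in> zeros \<inter> W" using W(2) z(1)[OF il(1,2)] il(3) by auto
  qed
  then have "two_arcs \<epsilon> (q 1) (q 2) W" using eps ana con z(1) lim W(1) W0 by unfold_locales auto
  then show ?thesis using that by (simp add: q_def[abs_def])
qed

lemma homeomorphism_reflection: "homeomorphism {T - \<eta>..<T} {0<..\<eta>} (\<lambda>t. T - t) (\<lambda>t. T - t)" for T \<eta> :: real
  unfolding homeomorphism_def by (auto intro!: continuous_intros image_eqI[where x = "T - _"])

lemma global_continuation_exists:
  assumes ta: "two_arcs \<epsilon> (\<lambda>l. init_slope (w l)) (\<lambda>l. init_slope (w' l)) W"
    and ps: "\<And>l. l \<in> {0<..<\<epsilon>} \<Longrightarrow> (l, w l) \<in> positive_solutions" "\<And>l. l \<in> {0<..<\<epsilon>} \<Longrightarrow> (l, w' l) \<in> positive_solutions"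
    and C: "C \<in> components positive_solutions" "\<eta>0 \<in> {0<..\<epsilon>}" "arc_of w ` {0<..<\<eta>0} \<subseteq> C"
  obtains T \<Gamma> where "global_continuation \<epsilon> w w' C T \<Gamma>" "\<And>t. t \<in> {0<..<\<epsilon>} \<Longrightarrow> \<Gamma> (T - t) = arc_of w' t"
proof -
  have eps: "\<epsilon> > 0" using C(2) by auto
  obtain T g where g: "\<epsilon> < T" "continuous_on {0<..<T} g" "g ` {0<..<T} \<subseteq> zeros" "locally_inj_on g {0<..<T}"
    "\<And>t. t \<in> {0<..<\<epsilon>} \<Longrightarrow> g t = Complex t (init_slope (w t))" "\<And>t. t \<in> {0<..<\<epsilon>} \<Longrightarrow> g (T - t) = Complex t (init_slope (w' t))"
    by (rule two_arcs.global_curve[OF ta]) (rule that)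
  define \<Gamma> where "\<Gamma> t = solution_at (g t)" for t
  have cs: "continuous_on zeros solution_at"
    by (rule continuous_on_subset[OF continuous_on_solution_at]) (auto simp: zeros_def)
  have c: "continuous_on {0<..<T} \<Gamma>" unfolding \<Gamma>_def by (rule continuous_on_compose2[OF cs g(2,3)])
  have img: "\<Gamma> ` {0<..<T} \<subseteq> positive_solutions" using g(3) solution_at_zeros by (auto simp: \<Gamma>_def)
  have inj: "locally_inj_on \<Gamma> {0<..<T}"
    unfolding locally_inj_on_def
  proof
    fix t assume "t \<in> {0<..<T}"
    then obtain r where r: "r > 0" "inj_on g ({0<..<T} \<inter> ball t r)" using g(4) unfolding locally_inj_on_def by blast
    have "inj_on (solution_at \<circ> g) ({0<..<T} \<inter> ball t r)"
      by (rule comp_inj_on[OF r(2) inj_on_subset[OF inj_on_solution_at]]) (use g(3) in auto)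
    then show "\<exists>r>0. inj_on \<Gamma> ({0<..<T} \<inter> ball t r)" using r(1) by (auto simp: \<Gamma>_def[abs_def] comp_def)
  qed
  have start: "\<Gamma> t = arc_of w t" if "t \<in> {0<..<\<epsilon>}" for t
    unfolding \<Gamma>_def g(5)[OF that] arc_of_def by (rule positive_solution_zero(2)[OF ps(1)[OF that]])
  have fin: "\<Gamma> (T - t) = arc_of w' t" if "t \<in> {0<..<\<epsilon>}" for t
    unfolding \<Gamma>_def g(6)[OF that] arc_of_def by (rule positive_solution_zero(2)[OF ps(2)[OF that]])
  have "connected (\<Gamma> ` {0<..<T})" by (intro connected_continuous_image c) auto
  moreover have "C \<inter> \<Gamma> ` {0<..<T} \<noteq> {}"
  proof -
    have "\<Gamma> (\<eta>0 / 2) = arc_of w (\<eta>0 / 2)" by (rule start) (use C(2) in auto)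
    then have "\<Gamma> (\<eta>0 / 2) \<in> C" using C(2,3) by auto
    moreover have "\<eta>0 / 2 \<in> {0<..<T}" using C(2) g(1) by auto
    ultimately show ?thesis by blast
  qed
  ultimately have sub: "\<Gamma> ` {0<..<T} \<subseteq> C" by (intro components_maximal[OF C(1) _ img]) auto
  have "global_continuation \<epsilon> w w' C T \<Gamma>"
    unfolding global_continuation_def
  proof (intro conjI ballI)
    fix \<eta> assume \<eta>: "\<eta> \<in> {0<..<\<epsilon>}"
    show "\<exists>\<delta>\<in>{0<..<T}. \<exists>\<theta> \<theta>'. homeomorphism {T - \<delta>..<T} {0<..\<eta>} \<theta> \<theta>' \<and> (\<forall>t\<in>{T - \<delta>..<T}. \<Gamma> t = arc_of w' (\<theta> t))"
    \<comment> \<open>The end of the curve is the second arc run backwards, so \<delta> = \<eta>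
      with the reflection t to T - t as reparametrization serves every \<eta>.\<close>
    proof (intro bexI[of _ \<eta>] exI[of _ "\<lambda>t. T - t"] conjI homeomorphism_reflection ballI)
      fix t assume "t \<in> {T - \<eta>..<T}"
      then show "\<Gamma> t = arc_of w' (T - t)" using fin[of "T - t"] \<eta> by auto
    qed (use \<eta> g(1) in auto)
  qed (use g(1) c sub inj start in auto)
  then show ?thesis using that fin by blast
qed

lemma global_continuation_subset: "global_continuation \<epsilon> w w' C T \<Gamma> \<Longrightarrow> \<Gamma> ` {0<..<T} \<subseteq> C"
  by (simp add: global_continuation_def)

lemma global_continuation_cong:
  assumes gc: "global_continuation \<epsilon> w w' C T \<Gamma>" and eq: "\<And>t. t \<in> {0<..<T} \<Longrightarrow> \<Gamma>' t = \<Gamma> t"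
  shows "global_continuation \<epsilon> w w' C T \<Gamma>'"
proof -
  have eT: "\<epsilon> < T" using gc by (simp add: global_continuation_def)
  have c: "continuous_on {0<..<T} \<Gamma>' \<longleftrightarrow> continuous_on {0<..<T} \<Gamma>" by (rule continuous_on_cong) (use eq in auto)
  have i: "\<Gamma>' ` {0<..<T} = \<Gamma> ` {0<..<T}" by (rule image_cong) (use eq in auto)
  have "inj_on \<Gamma>' ({0<..<T} \<inter> ball t r) \<longleftrightarrow> inj_on \<Gamma> ({0<..<T} \<inter> ball t r)" for t r by (rule inj_on_cong) (use eq in auto)
  then have l: "locally_inj_on \<Gamma>' {0<..<T} \<longleftrightarrow> locally_inj_on \<Gamma> {0<..<T}" by (simp add: locally_inj_on_def)
  have s: "\<forall>t\<in>{0<..<\<epsilon>}. \<Gamma>' t = arc_of w t" using gc eq eT by (auto simp: global_continuation_def)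
  have f: "\<forall>\<eta>\<in>{0<..<\<epsilon>}. \<exists>\<delta>\<in>{0<..<T}. \<exists>\<theta> \<theta>'. homeomorphism {T - \<delta>..<T} {0<..\<eta>} \<theta> \<theta>' \<and> (\<forall>t\<in>{T - \<delta>..<T}. \<Gamma>' t = arc_of w' (\<theta> t))"
  proof
    fix \<eta> assume "\<eta> \<in> {0<..<\<epsilon>}"
    then obtain \<delta> \<theta> \<theta>' where d: "\<delta> \<in> {0<..<T}" "homeomorphism {T - \<delta>..<T} {0<..\<eta>} \<theta> \<theta>'" "\<forall>t\<in>{T - \<delta>..<T}. \<Gamma> t = arc_of w' (\<theta> t)"
      using gc unfolding global_continuation_def by blast
    then have "\<forall>t\<in>{T - \<delta>..<T}. \<Gamma>' t = arc_of w' (\<theta> t)" using eq by auto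
    then show "\<exists>\<delta>\<in>{0<..<T}. \<exists>\<theta> \<theta>'. homeomorphism {T - \<delta>..<T} {0<..\<eta>} \<theta> \<theta>' \<and> (\<forall>t\<in>{T - \<delta>..<T}. \<Gamma>' t = arc_of w' (\<theta> t))" using d by blast
  qed
  show ?thesis using gc s f unfolding global_continuation_def c i l by blast
qed

theorem theorem8p6:
  fixes \<epsilon> :: real
    and u :: "nat \<Rightarrow> real \<Rightarrow> sobU"
    and C :: "nat \<Rightarrow> (real \<times> sobU) set"
  assumes "\<epsilon> > 0"
    and "\<And>i. i \<in> {1, 2} \<Longrightarrow> real_analytic_on (arc_of (u i)) {0<..<\<epsilon>}"
    and "\<And>i. i \<in> {1, 2} \<Longrightarrow> arc_of (u i) ` {0<..<\<epsilon>} \<subseteq> positive_solutions"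
    and "\<And>i. i \<in> {1, 2} \<Longrightarrow> (u i \<longlongrightarrow> 0) (at_right 0)"
    and "\<exists>N. open N \<and> (0, 0) \<in> N \<and>
           positive_solutions \<inter> N = arc_of (u 1) ` {0<..<\<epsilon>} \<union> arc_of (u 2) ` {0<..<\<epsilon>}"
    and "(\<lambda>l. (LINT x|dom_measure. fun_of (u 1 l) x * phi0 x) - 3 * pi / 32 * sqrt (pi / 2) * l)
           \<in> o[at_right 0](\<lambda>l. l)"
    and "(\<lambda>l. (LINT x|dom_measure. fun_of (u 2 l) x * phi0 x) - sqrt (5 * pi / 8) * sqrt l)
           \<in> o[at_right 0](\<lambda>l. sqrt l)"
    and "\<And>i. i \<in> {1, 2} \<Longrightarrow> C i \<in> components positive_solutions"
    and "\<And>i. i \<in> {1, 2} \<Longrightarrow> \<exists>\<eta>\<in>{0<..\<epsilon>}. arc_of (u i) ` {0<..<\<eta>} \<subseteq> C i"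
  shows "C 1 = C 2 \<and>
    (\<forall>i\<in>{1, 2}. \<forall>j\<in>{1, 2} - {i}. \<exists>T \<Gamma>. global_continuation \<epsilon> (u i) (u j) (C i) T \<Gamma>) \<and>
    (\<exists>T \<Lambda>. global_continuation \<epsilon> (u 1) (u 2) (C 1) T \<Lambda> \<and>
       continuous_on {0..T} \<Lambda> \<and> \<Lambda> 0 = (0, 0) \<and> \<Lambda> T = (0, 0))"
proof -
  obtain N where N: "open N" "(0, 0) \<in> N"
    "positive_solutions \<inter> N = arc_of (u 1) ` {0<..<\<epsilon>} \<union> arc_of (u 2) ` {0<..<\<epsilon>}" using assms(5) by blast
  obtain W where ta: "two_arcs \<epsilon> (\<lambda>l. init_slope (u 1 l)) (\<lambda>l. init_slope (u 2 l)) W"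
    by (rule arc_data[OF assms(1-4) N]) (assumption | rule that)+
  have ps: "(l, u i l) \<in> positive_solutions" if "i \<in> {1, 2}" "l \<in> {0<..<\<epsilon>}" for i l
    using assms(3)[OF that(1)] that(2) by (auto simp: arc_of_def)
  have ex: "\<exists>T \<Gamma>. global_continuation \<epsilon> (u i) (u j) (C i) T \<Gamma> \<and> (\<forall>t\<in>{0<..<\<epsilon>}. \<Gamma> (T - t) = arc_of (u j) t)"
    if i: "i \<in> {1, 2}" and j: "j \<in> {1, 2} - {i}" for i j
  proof -
    obtain \<eta> where \<eta>: "\<eta> \<in> {0<..\<epsilon>}" "arc_of (u i) ` {0<..<\<eta>} \<subseteq> C i" using assms(9)[OF i] by blast
    have "two_arcs \<epsilon> (\<lambda>l. init_slope (u i l)) (\<lambda>l. init_slope (u j l)) W"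
      using ta two_arcs.swap[OF ta] i j by auto
    then obtain T \<Gamma> where "global_continuation \<epsilon> (u i) (u j) (C i) T \<Gamma>" "\<And>t. t \<in> {0<..<\<epsilon>} \<Longrightarrow> \<Gamma> (T - t) = arc_of (u j) t"
    proof (rule global_continuation_exists[OF _ _ _ assms(8)[OF i] \<eta>])
      show "(l, u i l) \<in> positive_solutions" "(l, u j l) \<in> positive_solutions" if "l \<in> {0<..<\<epsilon>}" for l
        using ps[OF _ that] i j by auto
    qed (rule that)
    then show ?thesis by blast
  qed
  obtain T \<Gamma> where \<Gamma>: "global_continuation \<epsilon> (u 1) (u 2) (C 1) T \<Gamma>" "\<And>t. t \<in> {0<..<\<epsilon>} \<Longrightarrow> \<Gamma> (T - t) = arc_of (u 2) t"
    using ex[of 1 2] by auto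
  have eT: "\<epsilon> < T" and cG: "continuous_on {0<..<T} \<Gamma>" and st: "\<And>t. t \<in> {0<..<\<epsilon>} \<Longrightarrow> \<Gamma> t = arc_of (u 1) t"
    using \<Gamma>(1) by (auto simp: global_continuation_def)
  have "C 1 = C 2"
  proof -
    obtain \<eta> where \<eta>: "\<eta> \<in> {0<..\<epsilon>}" "arc_of (u 2) ` {0<..<\<eta>} \<subseteq> C 2" using assms(9)[of 2] by auto
    have "\<Gamma> (T - \<eta> / 2) = arc_of (u 2) (\<eta> / 2)" by (rule \<Gamma>(2)) (use \<eta>(1) in auto)
    moreover have "T - \<eta> / 2 \<in> {0<..<T}" using \<eta>(1) eT by auto
    \<comment> \<open>The curve stays in the first component and ends on the second arc; one common
      point identifies the two components.\<close>
    ultimately have "arc_of (u 2) (\<eta> / 2) \<in> C 1" using global_continuation_subset[OF \<Gamma>(1)] by (metis image_subset_iff)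
    moreover have "arc_of (u 2) (\<eta> / 2) \<in> C 2" using \<eta> by auto
    ultimately show ?thesis using components_eq[OF assms(8)[of 1] assms(8)[of 2]] by auto
  qed
  moreover have "\<forall>i\<in>{1, 2}. \<forall>j\<in>{1, 2} - {i}. \<exists>T \<Gamma>. global_continuation \<epsilon> (u i) (u j) (C i) T \<Gamma>" using ex by blast
  moreover have "\<exists>T \<Lambda>. global_continuation \<epsilon> (u 1) (u 2) (C 1) T \<Lambda> \<and>
       continuous_on {0..T} \<Lambda> \<and> \<Lambda> 0 = (0, 0) \<and> \<Lambda> T = (0, 0)"
  proof (intro exI conjI)
    \<comment> \<open>Both ends of the curve tend to the vertex, so giving it the value (0, 0) there
      closes it up continuously without touching the part on (0, T).\<close>
    let ?L = "\<lambda>t. if t \<in> {0<..<T} then \<Gamma> t else (0, 0)"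
    show "global_continuation \<epsilon> (u 1) (u 2) (C 1) T ?L" by (rule global_continuation_cong[OF \<Gamma>(1)]) simp
    have T: "T > 0" using eT assms(1) by simp
    have a0: "(arc_of (u i) \<longlongrightarrow> (0, 0)) (at_right 0)" if "i \<in> {1, 2}" for i
      unfolding arc_of_def[abs_def] by (intro tendsto_Pair assms(4)[OF that] tendsto_ident_at)
    show "continuous_on {0..T} ?L"
    proof (rule continuous_on_IccI)
      have "\<forall>\<^sub>F t in at_right 0. arc_of (u 1) t = ?L t"
        unfolding eventually_at_right_field using assms(1) eT st by (intro exI[of _ \<epsilon>]) auto
      then show "(?L \<longlongrightarrow> ?L 0) (at_right 0)" using a0[of 1] by (auto intro: Lim_transform_eventually)
      have f: "filterlim (\<lambda>t. T - t) (at_right 0) (at_left T)"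
        unfolding filterlim_at
        by (auto simp: eventually_at_filter intro!: tendsto_eq_intros)
      have "((\<lambda>t. arc_of (u 2) (T - t)) \<longlongrightarrow> (0, 0)) (at_left T)"
        by (rule filterlim_compose[OF a0[of 2] f]) simp
      moreover have "\<forall>\<^sub>F t in at_left T. arc_of (u 2) (T - t) = ?L t"
      proof -
        have "arc_of (u 2) (T - t) = ?L t" if "T - \<epsilon> < t" "t < T" for t
          using \<Gamma>(2)[of "T - t"] that eT by auto
        then show ?thesis unfolding eventually_at_left_field using assms(1) by (intro exI[of _ "T - \<epsilon>"]) auto
      qed
      ultimately show "(?L \<longlongrightarrow> ?L T) (at_left T)" by (auto intro: Lim_transform_eventually)
      fix x assume x: "0 < x" "x < T"
      have "continuous_on {0<..<T} ?L" by (rule continuous_on_eq[OF cG]) simp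
      then have "isCont ?L x" using x by (simp add: continuous_on_eq_continuous_at)
      then show "?L \<midarrow>x\<rightarrow> ?L x" by (simp only: isCont_def)
    qed (rule T)
  qed auto
  ultimately show ?thesis by blast
qed

end
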